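(* Let $\widetilde{\mathfrak g}$ be one of the following finite-dimensional primitive Lie algebras of vector fields on the real plane: 1. the Lie algebra $\widetilde{\mathfrak g}=\mathfrak{sl}_2(\mathbb R)+\mathbb R^2$ of unimodular affine infinitesimal transformations; 2. the Lie algebra $\widetilde{\mathfrak g}=\mathfrak{gl}_2(\mathbb R)+\mathbb R^2$ of affine infinitesimal transformations; 3. the Lie algebra $\widetilde{\mathfrak g}=\mathfrak{conf}(\mathbb R^2)=\mathrm{span}(\partial_x,\partial_y,E,J)$; 4. the Lie algebra $\widetilde{\mathfrak g}=\mathfrak{euc}_\alpha(\mathbb R^2)=\mathrm{span}(\partial_x,\partial_y,\alpha E-J)$, for some $\alpha\ge0$, where $E=x\partial_x+y\partial_y$ and $J=x\partial_y-y\partial_x$. Then the semidirect sum $$(\ast)\qquad\mathfrak g=\widetilde{\mathfrak g}+\xi$$ is a finite-dimensional transitive and transversally primitive subalgebra of $\mathfrak p_1^{(\infty)}$, where in the first two cases $\xi=P^k_+$, $k\ge1$, is the space of polynomials in $x,y$ of degree at most $k$ without constant term, and in the last two cases $\xi\ne 0$ is a (real form of a finite, conjugation invariant) sum of "triangle" modules $W^{k,\ell}$. The stability subalgebra $\mathfrak k$ and the isotropy algebra $\mathfrak h$ are $$\mathfrak k=\widetilde{\mathfrak k}+(\xi\cap\mathrm{span}(x^2,xy,y^2,\dots)),\qquad \mathfrak h=\widetilde{\mathfrak k}+(\xi\cap\mathrm{span}(x^2,xy,y^2)),$$ where $\widetilde{\mathfrak k}$ is the stability subalgebra of $\widetilde{\mathfrak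 g}$. Let $\widetilde G=\widetilde K\ltimes\mathbb R^2$ be the connected Lie group of affine transformations of $\mathbb R^2$ with $\mathrm{Lie}(\widetilde G)=\widetilde{\mathfrak g}$ and $\mathrm{Lie}(\widetilde K)=\widetilde{\mathfrak k}$. Then $K=\widetilde K\ltimes(\xi\cap\mathrm{span}(x^2,xy,y^2,\dots))$ is a closed subgroup of $G=\widetilde G\ltimes\xi$ and $M=(G/K,\omega)$ is a homogeneous symplectic $4$-manifold. If $k>2$, where $k$ is the maximal degree of the polynomials in $\xi$, then $M=G/K$ is not reductive and it is not a homogeneous Fedosov manifold. Conversely, any finite-dimensional transitive and transversally primitive subalgebra $\mathfrak g$ of $\mathfrak p_1^{(\infty)}$ that is splitting and polynomial in $x$ and $y$ is a subalgebra of some of the Lie algebras $(\ast)$. Actually, it coincides with one of them, unless $\widetilde{\mathfrak g}=\mathfrak{euc}_\alpha(\mathbb R^2)$ and $\alpha=0$, in which case $\xi$ may be properly contained in a sum of "triangle" modules.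
   Context: Setting. $V=\mathrm{span}(p_1,p_2,q_1,q_2)$ is the $4$-dimensional symplectic space with $\Omega(q_i,p_i)=1$ (other pairings of basis vectors zero), $P=\mathrm{span}(p_1,p_2)$, $Q=\mathrm{span}(q_1,q_2)$. The Lie algebra of formal symplectic vector fields on $V$ is $\mathfrak{sp}(V)^{(\infty)}=V+S^2(V)+S^3(V)+\cdots$ (formal power series modulo constants) with the Poisson bracket extending $\{u,v\}=\Omega(u,v)$. $\mathfrak p_1=Q\vee P+S^2(P)$ is the stabilizer of the Lagrangian plane $P$ in $\mathfrak{sp}(V)=S^2(V)$, and its full prolongation $\mathfrak p_1^{(\infty)}$ consists of the series $a_1(p_1,p_2)q_1+a_2(p_1,p_2)q_2+f(p_1,p_2)$ modulo constants. Writing $x=p_1,y=p_2,\partial_x=q_1,\partial_y=q_2$, one has the semidirect sum $$\mathfrak p_1^{(\infty)}=\mathrm{Der}(\mathbb R[[x,y]])+\mathfrak i,\qquad \mathfrak i=\mathbb R_+[[x,y]]\cong\mathbb R[[x,y]]/\mathbb R1,$$ of the Lie algebra of formal vector fields on the plane acting naturally on the abelian ideal $\mathfrak i$. The stability subalgebra is $\mathfrak p_1^{\ge0}=\mathrm{Der}^{\ge0}(\mathbb R[[x,y]])+\mathrm{span}(x^2,xy,y^2,\dots)$ (fields on $V$ vanishing at the origin; $\mathrm{Der}^{\ge0}$ denotes the fields on the plane vanishing at the origin). For $\mathfrak g\subset\mathfrak p_1^{(\infty)}$: $\mathfrak k=\mathfrak g\cap\mathfrak p_1^{\ge0}$ is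 the stability subalgebra, and the isotropy algebra $\mathfrak h\subset\mathfrak p_1=\mathfrak{gl}_2(\mathbb R)+\mathrm{span}(x^2,xy,y^2)$ is its image in $\mathfrak{sp}(V)$ (linear parts); $\mathfrak g$ is transitive if its projection (value at the origin) to $V$ is surjective; $\mathfrak g$ is splitting if $\mathfrak g=\widetilde{\mathfrak g}+\xi$ with $\widetilde{\mathfrak g}=\mathfrak g\cap\mathrm{Der}(\mathbb R[[x,y]])$, $\xi=\mathfrak g\cap\mathbb R_+[[x,y]]$. A transitive Lie algebra of vector fields on the plane is primitive if it preserves no nontrivial involutive distribution on any open subset; $\mathfrak g$ is transversally primitive if $\mathfrak g/(\mathfrak g\cap\mathfrak i)$ acts primitively on the $(x,y)$-plane (the local leaf space of the invariant Lagrangian foliation determined by $P$). Finite-dimensional primitive Lie algebras of vector fields on the plane are considered up to local change of coordinates $(x,y)$, in the polynomial normal forms of the Gonz\'alez-L\'opez--Kamran--Olver classification. "Polynomial in $x$ and $y$" means, in such normal form, that $\xi$ consists of polynomials. Triangle modules. With $z=x+iy$, let $P^{k,\ell}=\mathbb C\,z^{(k+\ell)/2}\bar z^{(k-\ell)/2}$ for $k\ge0$ and $\ell\in\{k,k-2,\dots,-k\}$ (and $P^{k,\ell}=0$ otherwise), on which $E$ acts as $k$ and $J$ as $i\ell$. For $P^{k_o,\ell_o}\ne0$, $W^{k_o,\ell_o}$ is the direct sum of all $P^{k,\ell}$ with $k>0$ reached from $P^{k_o,\ell_o}$ by iterated application (possibly zero times) of $\partial_z:P^{k,\ell}\to P^{k-1,\ell-1}$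 and $\partial_{\bar z}:P^{k,\ell}\to P^{k-1,\ell+1}$; it is a complex $\mathfrak{conf}(\mathbb R^2)$-module (modulo constants). In cases 3 and 4, the complexification of $\xi$ is a nonzero sum (not necessarily direct) of finitely many $W^{k,\ell}$, invariant under complex conjugation (i.e. including both of $W^{k,\pm\ell}$ or neither), and $\xi$ is its real form. The form $\omega$ on $G/K$ is the invariant symplectic form induced by $\Omega$ on $T_o(G/K)=\mathfrak g/\mathfrak k\cong V$. $G/K$ is reductive if $\mathfrak g=\mathfrak k+\mathfrak m$ (direct sum) with $[\mathfrak k,\mathfrak m]\subset\mathfrak m$; it is a homogeneous Fedosov manifold if it has a $G$-invariant torsion free connection preserving $\omega$. *)

theory Defs
  imports
    "HOL-Analysis.Analysis"
    "HOL-Computational_Algebra.Formal_Power_Series"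
    "HOL-Algebra.Left_Coset"
    "HOL-Algebra.Generated_Groups"
begin

section \<open>Formal power series as a real vector space\<close>

instantiation fps :: (real_vector) real_vector
begin

definition "scaleR r F = Abs_fps (\<lambda>n. r *\<^sub>R fps_nth F n)"

instance
  by standard (simp_all add: scaleR_fps_def fps_eq_iff scaleR_add_right scaleR_add_left)

end

definition fps_map :: "('a \<Rightarrow> 'b) \<Rightarrow> 'a fps \<Rightarrow> 'b fps" where
  "fps_map h F = Abs_fps (\<lambda>n. h (fps_nth F n))"

text \<open>
  A series in \<open>x, y\<close> is a series in \<open>x\<close> whose coefficients are series in \<open>y\<close>. A series on
  the four-dimensional space \<open>V\<close> is a series in \<open>q\<^sub>1\<close> over series in \<open>q\<^sub>2\<close> over series in
  \<open>x = p\<^sub>1, y = p\<^sub>2\<close>; \<open>hcoeff H a b i j\<close> is the coefficient of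
  \<open>q\<^sub>1^a q\<^sub>2^b p\<^sub>1^i p\<^sub>2^j\<close>.
  The topology that the library puts on \<open>fps\<close> is the \<open>X\<close>-adic one; it is never used here.
\<close>

type_synonym plane = "real fps fps"
type_synonym ham = "real fps fps fps fps"

definition pcoeff :: "'a fps fps \<Rightarrow> nat \<Rightarrow> nat \<Rightarrow> 'a" where
  "pcoeff F i j = fps_nth (fps_nth F i) j"

definition qcoeff :: "ham \<Rightarrow> nat \<Rightarrow> nat \<Rightarrow> plane" where
  "qcoeff H a b = fps_nth (fps_nth H a) b"

definition hcoeff :: "ham \<Rightarrow> nat \<Rightarrow> nat \<Rightarrow> nat \<Rightarrow> nat \<Rightarrow> real" where
  "hcoeff H a b i j = pcoeff (qcoeff H a b) i j"

definition px :: plane where "px = fps_X"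
definition py :: plane where "py = fps_const fps_X"

definition dx :: "plane \<Rightarrow> plane" where "dx = fps_deriv"
definition dy :: "plane \<Rightarrow> plane" where "dy = fps_map fps_deriv"

definition emb :: "plane \<Rightarrow> ham" where "emb f = fps_const (fps_const f)"

definition hq1 :: ham where "hq1 = fps_X"
definition hq2 :: ham where "hq2 = fps_const fps_X"
definition hp1 :: ham where "hp1 = emb px"
definition hp2 :: ham where "hp2 = emb py"

definition d_q1 :: "ham \<Rightarrow> ham" where "d_q1 = fps_deriv"
definition d_q2 :: "ham \<Rightarrow> ham" where "d_q2 = fps_map fps_deriv"
definition d_p1 :: "ham \<Rightarrow> ham" where "d_p1 = fps_map (fps_map dx)"
definition d_p2 :: "ham \<Rightarrow> ham" where "d_p2 = fps_map (fps_map dy)"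

definition hom_part :: "nat \<Rightarrow> ham \<Rightarrow> ham" where
  "hom_part n H = Abs_fps (\<lambda>a. Abs_fps (\<lambda>b. Abs_fps (\<lambda>i. Abs_fps (\<lambda>j.
     if a + b + i + j = n then hcoeff H a b i j else 0))))"


section \<open>Formal symplectic vector fields\<close>

text \<open>
  A class of series modulo constants is represented by its member without constant term, so the
  bracket \<open>pb\<close> is the Poisson bracket with the constant term removed.
\<close>

definition poisson :: "ham \<Rightarrow> ham \<Rightarrow> ham" where
  "poisson u v = (d_q1 u * d_p1 v - d_p1 u * d_q1 v) + (d_q2 u * d_p2 v - d_p2 u * d_q2 v)"

definition pb :: "ham \<Rightarrow> ham \<Rightarrow> ham" where
  "pb u v = poisson u v - hom_part 0 (poisson u v)"

text \<open>The form \<open>\<Omega>\<close> on \<open>V\<close>, evaluated on the linear parts of \<open>u\<close> and \<open>v\<close>.\<close>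

definition Omega :: "ham \<Rightarrow> ham \<Rightarrow> real" where
  "Omega u v =
     (hcoeff u 1 0 0 0 * hcoeff v 0 0 1 0 - hcoeff u 0 0 1 0 * hcoeff v 1 0 0 0) +
     (hcoeff u 0 1 0 0 * hcoeff v 0 0 0 1 - hcoeff u 0 0 0 1 * hcoeff v 0 1 0 0)"

definition Der :: "ham set" where
  "Der = {emb a1 * hq1 + emb a2 * hq2 | a1 a2. True}"

definition abelian_ideal :: "ham set" where
  "abelian_ideal = {emb f | f. pcoeff f 0 0 = 0}"

definition set_sum :: "ham set \<Rightarrow> ham set \<Rightarrow> ham set" (infixl "\<oplus>\<^sub>s" 65) where
  "A \<oplus>\<^sub>s B = {u + v | u v. u \<in> A \<and> v \<in> B}"

definition p1_inf :: "ham set" where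
  "p1_inf = Der \<oplus>\<^sub>s abelian_ideal"

definition lie_subalgebra :: "ham set \<Rightarrow> bool" where
  "lie_subalgebra S \<longleftrightarrow> subspace S \<and> (\<forall>u\<in>S. \<forall>v\<in>S. pb u v \<in> S)"

definition finite_dim :: "ham set \<Rightarrow> bool" where
  "finite_dim S \<longleftrightarrow> (\<exists>B. finite B \<and> S \<subseteq> span B)"

definition stability :: "ham set \<Rightarrow> ham set" where
  "stability g = {H \<in> g. hom_part 1 H = 0}"

definition isotropy :: "ham set \<Rightarrow> ham set" where
  "isotropy g = hom_part 2 ` stability g"

definition transitive :: "ham set \<Rightarrow> bool" where
  "transitive g \<longleftrightarrow> hom_part 1 ` g = span {hp1, hp2, hq1, hq2}"

definition func_part :: "ham set \<Rightarrow> plane set" where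
  "func_part g = {f. emb f \<in> g \<inter> abelian_ideal}"

definition splitting :: "ham set \<Rightarrow> bool" where
  "splitting g \<longleftrightarrow> g = (g \<inter> Der) \<oplus>\<^sub>s (g \<inter> abelian_ideal)"

definition reductive :: "ham set \<Rightarrow> bool" where
  "reductive g \<longleftrightarrow> (\<exists>m. subspace m \<and> m \<subseteq> g \<and> stability g \<inter> m = {0} \<and>
     stability g \<oplus>\<^sub>s m = g \<and> (\<forall>u\<in>stability g. \<forall>v\<in>m. pb u v \<in> m))"


section \<open>Transversal primitivity\<close>

text \<open>
  The map \<open>der_part\<close> realises \<open>g / (g \<inter> abelian_ideal)\<close> as an algebra of formal vector fields on
  the plane. Such an algebra lives on the formal neighbourhood of the origin, so its invariant
  distributions are formal as well. A distribution other than \<open>0\<close> and the full tangent bundle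
  has rank one, that is, it is generated by one field not vanishing at the origin.
\<close>

definition der_part :: "ham \<Rightarrow> ham" where
  "der_part H = emb (qcoeff H 1 0) * hq1 + emb (qcoeff H 0 1) * hq2"

definition nontrivial_distribution :: "ham set \<Rightarrow> bool" where
  "nontrivial_distribution D \<longleftrightarrow>
     (\<exists>Y\<in>Der. hom_part 1 Y \<noteq> 0 \<and> D = {emb h * Y | h. True})"

definition involutive :: "ham set \<Rightarrow> bool" where
  "involutive D \<longleftrightarrow> (\<forall>Y\<in>D. \<forall>Z\<in>D. pb Y Z \<in> D)"

definition plane_transitive :: "ham set \<Rightarrow> bool" where
  "plane_transitive L \<longleftrightarrow> hom_part 1 ` L = span {hq1, hq2}"

definition primitive :: "ham set \<Rightarrow> bool" where
  "primitive L \<longleftrightarrow> plane_transitive L \<and>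
     (\<nexists>D. nontrivial_distribution D \<and> involutive D \<and> (\<forall>X\<in>L. \<forall>Y\<in>D. pb X Y \<in> D))"

definition transversally_primitive :: "ham set \<Rightarrow> bool" where
  "transversally_primitive g \<longleftrightarrow> primitive (der_part ` g)"


section \<open>Primitive Lie algebras of vector fields on the plane\<close>

definition euler :: ham where "euler = hp1 * hq1 + hp2 * hq2"
definition rotation :: ham where "rotation = hp1 * hq2 - hp2 * hq1"

definition aff_sl2 :: "ham set" where
  "aff_sl2 = span {hq1, hq2, hp1 * hq1 - hp2 * hq2, hp2 * hq1, hp1 * hq2}"

definition aff_gl2 :: "ham set" where
  "aff_gl2 = span {hq1, hq2, hp1 * hq1, hp2 * hq1, hp1 * hq2, hp2 * hq2}"

definition conf :: "ham set" where
  "conf = span {hq1, hq2, euler, rotation}"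

definition euc :: "real \<Rightarrow> ham set" where
  "euc \<alpha> = span {hq1, hq2, \<alpha> *\<^sub>R euler - rotation}"

text \<open>
  The remaining entries in the classification, by Gonzalez-Lopez, Kamran and Olver, of the
  finite-dimensional primitive Lie algebras of vector fields on the real plane.
\<close>

definition nf_sl2 :: "ham set" where
  "nf_sl2 = span {hq1, euler, (hp1^2 - hp2^2) * hq1 + 2 * hp1 * hp2 * hq2}"

definition nf_so3 :: "ham set" where
  "nf_so3 = span {rotation, (1 + hp1^2 - hp2^2) * hq1 + 2 * hp1 * hp2 * hq2,
     2 * hp1 * hp2 * hq1 + (1 - hp1^2 + hp2^2) * hq2}"

definition nf_so31 :: "ham set" where
  "nf_so31 = span {hq1, hq2, euler, rotation, (hp1^2 - hp2^2) * hq1 + 2 * hp1 * hp2 * hq2,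
     2 * hp1 * hp2 * hq1 + (hp2^2 - hp1^2) * hq2}"

definition nf_sl3 :: "ham set" where
  "nf_sl3 = span {hq1, hq2, hp1 * hq1, hp2 * hq1, hp1 * hq2, hp2 * hq2,
     hp1 * euler, hp2 * euler}"

definition primitive_normal_forms :: "ham set set" where
  "primitive_normal_forms =
     {aff_sl2, aff_gl2, conf, nf_sl2, nf_so3, nf_so31, nf_sl3} \<union> {euc \<alpha> | \<alpha>. 0 \<le> \<alpha>}"


section \<open>Substitution and changes of coordinates\<close>

text \<open>
  \<open>F(u, w)\<close>. The sums are finite in the two situations where this is used: \<open>u, w\<close> without
  constant term, or \<open>F\<close> a polynomial.
\<close>

definition subst2 :: "plane \<Rightarrow> plane \<Rightarrow> plane \<Rightarrow> plane" where
  "subst2 F u w = Abs_fps (\<lambda>m. Abs_fps (\<lambda>n.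
     \<Sum>(i, j) \<in> {(i, j). pcoeff F i j \<noteq> 0 \<and> pcoeff (u ^ i * w ^ j) m n \<noteq> 0}.
       pcoeff F i j * pcoeff (u ^ i * w ^ j) m n))"

definition is_polynomial :: "plane \<Rightarrow> bool" where
  "is_polynomial f \<longleftrightarrow> (\<exists>N. \<forall>i j. N < i + j \<longrightarrow> pcoeff f i j = 0)"

definition coord_change :: "plane \<times> plane \<Rightarrow> bool" where
  "coord_change \<phi> \<longleftrightarrow> (case \<phi> of (u, w) \<Rightarrow>
     pcoeff u 0 0 = 0 \<and> pcoeff w 0 0 = 0 \<and>
     pcoeff u 1 0 * pcoeff w 0 1 - pcoeff u 0 1 * pcoeff w 1 0 \<noteq> 0)"

definition field_act :: "ham \<Rightarrow> plane \<Rightarrow> plane" where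
  "field_act H F = qcoeff H 1 0 * dx F + qcoeff H 0 1 * dy F"

text \<open>
  The automorphism of \<open>p1_inf\<close> induced by a change of coordinates \<open>\<phi>\<close> of the plane: the
  function \<open>f\<close> goes to \<open>f \<circ> \<phi>\<close> and the derivation \<open>X\<close> to its conjugate under
  \<open>F \<mapsto> F \<circ> \<phi>\<close>.
\<close>

definition transport :: "plane \<times> plane \<Rightarrow> ham set \<Rightarrow> ham set" where
  "transport \<phi> g = (case \<phi> of (u, w) \<Rightarrow> {H' \<in> p1_inf. \<exists>H\<in>g.
     qcoeff H' 0 0 = subst2 (qcoeff H 0 0) u w \<and>
     (\<forall>F. field_act H' (subst2 F u w) = subst2 (field_act H F) u w)})"

text \<open>
  A polynomial vector field on the plane, expanded at the point \<open>c\<close>. The base point matters: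
  \<open>nf_sl2\<close>, for instance, is not transitive at the points with \<open>y = 0\<close>.
\<close>

definition recenter :: "real \<times> real \<Rightarrow> ham \<Rightarrow> ham" where
  "recenter c H = (let u = px + fst c *\<^sub>R 1; w = py + snd c *\<^sub>R 1 in
     emb (subst2 (qcoeff H 1 0) u w) * hq1 + emb (subst2 (qcoeff H 0 1) u w) * hq2)"

definition polynomial_normal_form :: "ham set \<Rightarrow> bool" where
  "polynomial_normal_form g \<longleftrightarrow>
     (\<exists>L\<in>primitive_normal_forms. \<exists>c. g \<inter> Der = recenter c ` L) \<and>
     (\<forall>f\<in>func_part g. is_polynomial f)"


section \<open>The ideals: polynomials of bounded degree and triangle modules\<close>

definition polys_upto :: "nat \<Rightarrow> plane set" where
  "polys_upto k = {f. pcoeff f 0 0 = 0 \<and> (\<forall>i j. k < i + j \<longrightarrow> pcoeff f i j = 0)}"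

definition order_ge2 :: "plane set" where
  "order_ge2 = {f. \<forall>i j. i + j < 2 \<longrightarrow> pcoeff f i j = 0}"

definition max_degree :: "plane set \<Rightarrow> nat" where
  "max_degree \<xi> = Max {i + j | f i j. f \<in> \<xi> \<and> pcoeff f i j \<noteq> 0}"

definition cscale :: "complex \<Rightarrow> complex fps fps \<Rightarrow> complex fps fps" where
  "cscale c F = fps_const (fps_const c) * F"

definition complexify :: "plane \<Rightarrow> complex fps fps" where
  "complexify = fps_map (fps_map complex_of_real)"

definition zvar :: "complex fps fps" where
  "zvar = fps_X + cscale \<i> (fps_const fps_X)"

definition zbar :: "complex fps fps" where
  "zbar = fps_X - cscale \<i> (fps_const fps_X)"

definition P_nonzero :: "int \<Rightarrow> int \<Rightarrow> bool" where
  "P_nonzero k l \<longleftrightarrow> 0 \<le> k \<and> \<bar>l\<bar> \<le> k \<and> even (k - l)"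

definition P_mod :: "int \<Rightarrow> int \<Rightarrow> complex fps fps set" where
  "P_mod k l = (if P_nonzero k l
     then {cscale c (zvar ^ nat ((k + l) div 2) * zbar ^ nat ((k - l) div 2)) | c. True}
     else {0})"

text \<open>
  \<open>reached k0 l0 k l\<close>: iterated differentiation with respect to \<open>z\<close> and to its
  conjugate, which lowers \<open>k\<close> by one and changes \<open>l\<close> by \<open>-1\<close> and \<open>+1\<close>, leads from
  \<open>P_mod k0 l0\<close> to the nonzero space \<open>P_mod k l\<close>.
\<close>

inductive reached :: "int \<Rightarrow> int \<Rightarrow> int \<Rightarrow> int \<Rightarrow> bool" for k0 l0 where
  "P_nonzero k0 l0 \<Longrightarrow> reached k0 l0 k0 l0"
| "reached k0 l0 k l \<Longrightarrow> P_nonzero (k - 1) (l - 1) \<Longrightarrow> reached k0 l0 (k - 1) (l - 1)"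
| "reached k0 l0 k l \<Longrightarrow> P_nonzero (k - 1) (l + 1) \<Longrightarrow> reached k0 l0 (k - 1) (l + 1)"

definition W_mod :: "int \<Rightarrow> int \<Rightarrow> complex fps fps set" where
  "W_mod k0 l0 = module.span cscale (\<Union>{P_mod k l | k l. 0 < k \<and> reached k0 l0 k l})"

text \<open>The real form of a finite sum of triangle modules that is invariant under conjugation.\<close>

definition triangle_sum :: "plane set \<Rightarrow> bool" where
  "triangle_sum \<xi> \<longleftrightarrow> (\<exists>I. finite I \<and> (\<forall>(k, l)\<in>I. P_nonzero k l \<and> (k, - l) \<in> I) \<and>
     \<xi> = {f. complexify f \<in> module.span cscale (\<Union>(k, l)\<in>I. W_mod k l)})"

definition star_pair :: "ham set \<Rightarrow> plane set \<Rightarrow> bool" where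
  "star_pair gt \<xi> \<longleftrightarrow>
     gt \<in> {aff_sl2, aff_gl2} \<and> (\<exists>k\<ge>1. \<xi> = polys_upto k) \<or>
     (gt = conf \<or> (\<exists>\<alpha>\<ge>0. gt = euc \<alpha>)) \<and> triangle_sum \<xi> \<and> \<xi> \<noteq> {0}"

definition star_algebra :: "ham set \<Rightarrow> plane set \<Rightarrow> ham set" where
  "star_algebra gt \<xi> = gt \<oplus>\<^sub>s emb ` \<xi>"


section \<open>Smooth functions on finite-dimensional spaces and their subsets\<close>

text \<open>The canonical topology of a finite-dimensional subspace \<open>E\<close> of a real vector space.\<close>

definition fd_open :: "'a::real_vector set \<Rightarrow> 'a set \<Rightarrow> bool" where
  "fd_open E U \<longleftrightarrow> U \<subseteq> E \<and> (\<forall>x\<in>U. \<forall>B. finite B \<and> B \<subseteq> E \<longrightarrow>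
     (\<exists>e>0. \<forall>c. (\<forall>b\<in>B. \<bar>c b\<bar> < e) \<longrightarrow> x + (\<Sum>b\<in>B. c b *\<^sub>R b) \<in> U))"

definition fd_topology :: "'a::real_vector set \<Rightarrow> 'a topology" where
  "fd_topology E = topology (fd_open E)"

lemma istopology_fd_open: "istopology (fd_open E)"
proof -
  have "fd_open E (S \<inter> T)" if S: "fd_open E S" and T: "fd_open E T" for S T
    unfolding fd_open_def
  proof (intro conjI ballI allI impI)
    show "S \<inter> T \<subseteq> E" using S by (auto simp: fd_open_def)
    fix x B assume x: "x \<in> S \<inter> T" and B: "finite B \<and> B \<subseteq> E"
    obtain e where e: "e > 0" "\<And>c. (\<forall>b\<in>B. \<bar>c b\<bar> < e) \<Longrightarrow> x + (\<Sum>b\<in>B. c b *\<^sub>R b) \<in> S"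
      using S x B unfolding fd_open_def by (metis IntE)
    obtain d where d: "d > 0" "\<And>c. (\<forall>b\<in>B. \<bar>c b\<bar> < d) \<Longrightarrow> x + (\<Sum>b\<in>B. c b *\<^sub>R b) \<in> T"
      using T x B unfolding fd_open_def by (metis IntE)
    show "\<exists>e>0. \<forall>c. (\<forall>b\<in>B. \<bar>c b\<bar> < e) \<longrightarrow> x + (\<Sum>b\<in>B. c b *\<^sub>R b) \<in> S \<inter> T"
      by (rule exI[of _ "min e d"]) (use e d in auto)
  qed
  moreover have "fd_open E (\<Union>\<K>)" if K: "\<forall>S\<in>\<K>. fd_open E S" for \<K>
    unfolding fd_open_def
  proof (intro conjI ballI allI impI)
    show "\<Union>\<K> \<subseteq> E" using K by (auto simp: fd_open_def)
    fix x B assume x: "x \<in> \<Union>\<K>" and B: "finite B \<and> B \<subseteq> E"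
    from x obtain S where S: "S \<in> \<K>" "x \<in> S" by blast
    then obtain e where e: "e > 0" "\<And>c. (\<forall>b\<in>B. \<bar>c b\<bar> < e) \<Longrightarrow> x + (\<Sum>b\<in>B. c b *\<^sub>R b) \<in> S"
      using K B unfolding fd_open_def by meson
    with S show "\<exists>e>0. \<forall>c. (\<forall>b\<in>B. \<bar>c b\<bar> < e) \<longrightarrow> x + (\<Sum>b\<in>B. c b *\<^sub>R b) \<in> \<Union>\<K>"
      by blast
  qed
  ultimately show ?thesis unfolding istopology_def by blast
qed

lemma openin_fd_topology: "openin (fd_topology E) U \<longleftrightarrow> fd_open E U"
  by (simp add: fd_topology_def istopology_fd_open topology_inverse')

definition dir_deriv :: "('a::real_vector \<Rightarrow> real) \<Rightarrow> 'a \<Rightarrow> 'a \<Rightarrow> real" where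
  "dir_deriv f v x = deriv (\<lambda>t. f (x + t *\<^sub>R v)) 0"

fun C_k :: "nat \<Rightarrow> 'a::real_vector set \<Rightarrow> 'a set \<Rightarrow> ('a \<Rightarrow> real) \<Rightarrow> bool" where
  "C_k 0 E U f \<longleftrightarrow> continuous_map (subtopology (fd_topology E) U) euclideanreal f"
| "C_k (Suc n) E U f \<longleftrightarrow> continuous_map (subtopology (fd_topology E) U) euclideanreal f \<and>
     (\<forall>v\<in>E. (\<forall>x\<in>U. (\<lambda>t. f (x + t *\<^sub>R v)) field_differentiable (at 0)) \<and>
            C_k n E U (dir_deriv f v))"

definition smooth_on_open :: "'a::real_vector set \<Rightarrow> 'a set \<Rightarrow> ('a \<Rightarrow> real) \<Rightarrow> bool" where
  "smooth_on_open E U f \<longleftrightarrow> openin (fd_topology E) U \<and> (\<forall>n. C_k n E U f)"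

text \<open>Smoothness on an arbitrary subset: local extendability to a smooth function on \<open>E\<close>.\<close>

definition smooth_on_subset :: "'a::real_vector set \<Rightarrow> 'a set \<Rightarrow> ('a \<Rightarrow> real) \<Rightarrow> bool" where
  "smooth_on_subset E S f \<longleftrightarrow> (\<forall>x\<in>S. \<exists>N F. x \<in> N \<and> smooth_on_open E N F \<and>
     (\<forall>y\<in>N \<inter> S. F y = f y))"


section \<open>Smooth manifolds, vector fields, forms and connections\<close>

text \<open>
  A smooth structure is given by the functions \<open>\<O> W\<close> that are smooth on the open set \<open>W\<close>.
\<close>

definition smooth_4_manifold :: "'m topology \<Rightarrow> ('m set \<Rightarrow> ('m \<Rightarrow> real) set) \<Rightarrow> bool" where
  "smooth_4_manifold T \<O> \<longleftrightarrow>
     Hausdorff_space T \<and>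
     (\<exists>\<B>. countable \<B> \<and> (\<forall>U. openin T U \<longleftrightarrow> (\<exists>\<U>\<subseteq>\<B>. U = \<Union>\<U>))) \<and>
     (\<forall>m\<in>topspace T. \<exists>U (\<phi> :: 'm \<Rightarrow> real ^ 4).
        openin T U \<and> m \<in> U \<and> open (\<phi> ` U) \<and>
        homeomorphic_map (subtopology T U) (top_of_set (\<phi> ` U)) \<phi> \<and>
        (\<forall>W F. openin T W \<and> W \<subseteq> U \<longrightarrow>
           (F \<in> \<O> W \<longleftrightarrow> smooth_on_open UNIV (\<phi> ` W) (F \<circ> inv_into U \<phi>))))"

text \<open>
  In the following, \<open>A\<close> is the algebra of smooth functions on a manifold \<open>M\<close>, extended by \<open>0\<close>
  outside \<open>M\<close>, and vector fields are the derivations of \<open>A\<close>, extended by \<open>0\<close> outside \<open>A\<close>.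
\<close>

type_synonym 'm func = "'m \<Rightarrow> real"
type_synonym 'm vfield = "'m func \<Rightarrow> 'm func"

definition vector_fields :: "'m func set \<Rightarrow> 'm vfield set" where
  "vector_fields A = {X. (\<forall>F\<in>A. X F \<in> A) \<and> (\<forall>F. F \<notin> A \<longrightarrow> X F = (\<lambda>m. 0)) \<and>
     (\<forall>F\<in>A. \<forall>H\<in>A. X (\<lambda>m. F m + H m) = (\<lambda>m. X F m + X H m)) \<and>
     (\<forall>c. \<forall>F\<in>A. X (\<lambda>m. c * F m) = (\<lambda>m. c * X F m)) \<and>
     (\<forall>F\<in>A. \<forall>H\<in>A. X (\<lambda>m. F m * H m) = (\<lambda>m. X F m * H m + F m * X H m))}"

definition vf_add :: "'m vfield \<Rightarrow> 'm vfield \<Rightarrow> 'm vfield" where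
  "vf_add X Y = (\<lambda>F m. X F m + Y F m)"

definition vf_scale :: "'m func \<Rightarrow> 'm vfield \<Rightarrow> 'm vfield" where
  "vf_scale H X = (\<lambda>F m. H m * X F m)"

definition vf_bracket :: "'m vfield \<Rightarrow> 'm vfield \<Rightarrow> 'm vfield" where
  "vf_bracket X Y = (\<lambda>F m. X (Y F) m - Y (X F) m)"

definition two_form :: "'m func set \<Rightarrow> ('m vfield \<Rightarrow> 'm vfield \<Rightarrow> 'm func) \<Rightarrow> bool" where
  "two_form A \<omega> \<longleftrightarrow> (\<forall>X\<in>vector_fields A. \<forall>Y\<in>vector_fields A.
     \<omega> X Y \<in> A \<and> \<omega> X Y = (\<lambda>m. - \<omega> Y X m) \<and>
     (\<forall>Z\<in>vector_fields A. \<omega> (vf_add X Y) Z = (\<lambda>m. \<omega> X Z m + \<omega> Y Z m)) \<and>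
     (\<forall>H\<in>A. \<omega> (vf_scale H X) Y = (\<lambda>m. H m * \<omega> X Y m)))"

definition closed_form :: "'m func set \<Rightarrow> ('m vfield \<Rightarrow> 'm vfield \<Rightarrow> 'm func) \<Rightarrow> bool" where
  "closed_form A \<omega> \<longleftrightarrow>
     (\<forall>X\<in>vector_fields A. \<forall>Y\<in>vector_fields A. \<forall>Z\<in>vector_fields A. \<forall>m.
        X (\<omega> Y Z) m - Y (\<omega> X Z) m + Z (\<omega> X Y) m
        - \<omega> (vf_bracket X Y) Z m + \<omega> (vf_bracket X Z) Y m - \<omega> (vf_bracket Y Z) X m = 0)"

definition nondegenerate ::
    "'m set \<Rightarrow> 'm func set \<Rightarrow> ('m vfield \<Rightarrow> 'm vfield \<Rightarrow> 'm func) \<Rightarrow> bool" where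
  "nondegenerate M A \<omega> \<longleftrightarrow> (\<forall>m\<in>M. \<forall>X\<in>vector_fields A.
     (\<forall>Y\<in>vector_fields A. \<omega> X Y m = 0) \<longrightarrow> (\<forall>F\<in>A. X F m = 0))"

definition symplectic_form ::
    "'m set \<Rightarrow> 'm func set \<Rightarrow> ('m vfield \<Rightarrow> 'm vfield \<Rightarrow> 'm func) \<Rightarrow> bool" where
  "symplectic_form M A \<omega> \<longleftrightarrow> two_form A \<omega> \<and> closed_form A \<omega> \<and> nondegenerate M A \<omega>"

definition connection :: "'m func set \<Rightarrow> ('m vfield \<Rightarrow> 'm vfield \<Rightarrow> 'm vfield) \<Rightarrow> bool" where
  "connection A D \<longleftrightarrow> (\<forall>X\<in>vector_fields A. \<forall>Y\<in>vector_fields A.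
     D X Y \<in> vector_fields A \<and>
     (\<forall>Z\<in>vector_fields A. D (vf_add X Z) Y = vf_add (D X Y) (D Z Y) \<and>
        D X (vf_add Y Z) = vf_add (D X Y) (D X Z)) \<and>
     (\<forall>H\<in>A. D (vf_scale H X) Y = vf_scale H (D X Y) \<and>
        D X (vf_scale H Y) = vf_add (vf_scale (X H) Y) (vf_scale H (D X Y))))"

definition torsion_free :: "'m func set \<Rightarrow> ('m vfield \<Rightarrow> 'm vfield \<Rightarrow> 'm vfield) \<Rightarrow> bool" where
  "torsion_free A D \<longleftrightarrow> (\<forall>X\<in>vector_fields A. \<forall>Y\<in>vector_fields A. \<forall>F\<in>A. \<forall>m.
     D X Y F m - D Y X F m = vf_bracket X Y F m)"

definition preserves_form :: "'m func set \<Rightarrow> ('m vfield \<Rightarrow> 'm vfield \<Rightarrow> 'm vfield) \<Rightarrow>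
    ('m vfield \<Rightarrow> 'm vfield \<Rightarrow> 'm func) \<Rightarrow> bool" where
  "preserves_form A D \<omega> \<longleftrightarrow>
     (\<forall>X\<in>vector_fields A. \<forall>Y\<in>vector_fields A. \<forall>Z\<in>vector_fields A. \<forall>m.
        X (\<omega> Y Z) m = \<omega> (D X Y) Z m + \<omega> Y (D X Z) m)"

text \<open>\<open>X'\<close> is the image of \<open>X\<close> under the diffeomorphism \<open>\<sigma>\<close> of \<open>M\<close>.\<close>

definition vf_related :: "'m set \<Rightarrow> 'm func set \<Rightarrow> ('m \<Rightarrow> 'm) \<Rightarrow> 'm vfield \<Rightarrow> 'm vfield \<Rightarrow> bool" where
  "vf_related M A \<sigma> X X' \<longleftrightarrow> X \<in> vector_fields A \<and> X' \<in> vector_fields A \<and>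
     (\<forall>F\<in>A. \<forall>m\<in>M. X (\<lambda>m. if m \<in> M then F (\<sigma> m) else 0) m = X' F (\<sigma> m))"

definition form_invariant ::
    "'m set \<Rightarrow> 'm func set \<Rightarrow> ('m \<Rightarrow> 'm) set \<Rightarrow> ('m vfield \<Rightarrow> 'm vfield \<Rightarrow> 'm func) \<Rightarrow> bool" where
  "form_invariant M A \<Sigma> \<omega> \<longleftrightarrow> (\<forall>\<sigma>\<in>\<Sigma>. \<forall>X X' Y Y'.
     vf_related M A \<sigma> X X' \<and> vf_related M A \<sigma> Y Y' \<longrightarrow> (\<forall>m\<in>M. \<omega> X Y m = \<omega> X' Y' (\<sigma> m)))"

definition connection_invariant ::
    "'m set \<Rightarrow> 'm func set \<Rightarrow> ('m \<Rightarrow> 'm) set \<Rightarrow> ('m vfield \<Rightarrow> 'm vfield \<Rightarrow> 'm vfield) \<Rightarrow> bool" where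
  "connection_invariant M A \<Sigma> D \<longleftrightarrow> (\<forall>\<sigma>\<in>\<Sigma>. \<forall>X X' Y Y'.
     vf_related M A \<sigma> X X' \<and> vf_related M A \<sigma> Y Y' \<longrightarrow> vf_related M A \<sigma> (D X Y) (D X' Y'))"


section \<open>Affine groups\<close>

text \<open>The pair \<open>(A, b)\<close> stands for the transformation \<open>v \<mapsto> A v + b\<close> of the plane.\<close>

type_synonym aff = "(real ^ 2 ^ 2) \<times> (real ^ 2)"

definition aff_group :: "aff monoid" where
  "aff_group = \<lparr>carrier = {(A, b). invertible A},
     mult = (\<lambda>(A, b) (A', b'). (A ** A', A *v b' + b)), one = (mat 1, 0)\<rparr>"

text \<open>The vector field \<open>v \<mapsto> A v + b\<close>, as an element of \<open>Der\<close>.\<close>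

definition aff_field :: "aff \<Rightarrow> ham" where
  "aff_field = (\<lambda>(A, b).
     ((A $ 1 $ 1) *\<^sub>R hp1 + (A $ 1 $ 2) *\<^sub>R hp2 + (b $ 1) *\<^sub>R 1) * hq1 +
     ((A $ 2 $ 1) *\<^sub>R hp1 + (A $ 2 $ 2) *\<^sub>R hp2 + (b $ 2) *\<^sub>R 1) * hq2)"

text \<open>\<open>\<gamma>\<close> is the flow of the vector field \<open>aff_field v\<close>.\<close>

definition aff_flow :: "(real \<Rightarrow> aff) \<Rightarrow> aff \<Rightarrow> bool" where
  "aff_flow \<gamma> v \<longleftrightarrow> (\<forall>t. \<gamma> t \<in> carrier aff_group) \<and> \<gamma> 0 = \<one>\<^bsub>aff_group\<^esub> \<and>
     (\<forall>s t. \<gamma> (s + t) = \<gamma> s \<otimes>\<^bsub>aff_group\<^esub> \<gamma> t) \<and> (\<gamma> has_vector_derivative v) (at 0)"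

text \<open>The connected group of affine transformations belonging to a Lie algebra of affine fields.\<close>

definition integral_subgroup :: "ham set \<Rightarrow> aff set" where
  "integral_subgroup L =
     generate aff_group {\<gamma> t | \<gamma> t v. aff_flow \<gamma> v \<and> aff_field v \<in> L}"

definition aff_lie_algebra :: "aff set \<Rightarrow> ham set" where
  "aff_lie_algebra H = {aff_field v | v. \<exists>\<gamma>. aff_flow \<gamma> v \<and> range \<gamma> \<subseteq> H}"

definition connected_lie_group :: "aff set \<Rightarrow> ham set \<Rightarrow> bool" where
  "connected_lie_group H L \<longleftrightarrow> subgroup H aff_group \<and>
     closedin (top_of_set (carrier aff_group)) H \<and> connected H \<and> aff_lie_algebra H = L"


section \<open>The groups acting on the symplectic manifold\<close>

type_synonym gel = "aff \<times> plane"

text \<open>The action \<open>f \<mapsto> f \<circ> \<phi>\<inverse>\<close>, modulo constants, on polynomials.\<close>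

definition aff_act :: "aff \<Rightarrow> plane \<Rightarrow> plane" where
  "aff_act \<phi> f = (let (B, d) = inv\<^bsub>aff_group\<^esub> \<phi>;
       h = subst2 f
         ((B $ 1 $ 1) *\<^sub>R px + (B $ 1 $ 2) *\<^sub>R py + (d $ 1) *\<^sub>R 1)
         ((B $ 2 $ 1) *\<^sub>R px + (B $ 2 $ 2) *\<^sub>R py + (d $ 2) *\<^sub>R 1)
     in h - pcoeff h 0 0 *\<^sub>R 1)"

definition semidirect :: "aff set \<Rightarrow> plane set \<Rightarrow> gel monoid" where
  "semidirect H \<xi> = \<lparr>carrier = H \<times> \<xi>,
     mult = (\<lambda>(\<phi>, f) (\<psi>, h). (\<phi> \<otimes>\<^bsub>aff_group\<^esub> \<psi>, f + aff_act \<phi> h)),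
     one = (\<one>\<^bsub>aff_group\<^esub>, 0)\<rparr>"

definition tangent_ham :: "gel \<Rightarrow> ham" where
  "tangent_ham v = aff_field (fst v) + emb (snd v)"

text \<open>
  One-parameter subgroup of \<open>G\<close> with given velocity at the identity; in the second component the
  derivative is taken coefficientwise.
\<close>

definition one_parameter_subgroup :: "gel monoid \<Rightarrow> (real \<Rightarrow> gel) \<Rightarrow> gel \<Rightarrow> bool" where
  "one_parameter_subgroup G \<gamma> v \<longleftrightarrow> (\<forall>t. \<gamma> t \<in> carrier G) \<and> \<gamma> 0 = \<one>\<^bsub>G\<^esub> \<and>
     (\<forall>s t. \<gamma> (s + t) = \<gamma> s \<otimes>\<^bsub>G\<^esub> \<gamma> t) \<and>
     ((\<lambda>t. fst (\<gamma> t)) has_vector_derivative fst v) (at 0) \<and>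
     (\<forall>i j. ((\<lambda>t. pcoeff (snd (\<gamma> t)) i j) has_real_derivative pcoeff (snd v) i j) (at 0))"

text \<open>
  \<open>G\<close> carries the topology and the smooth functions induced from the finite-dimensional space
  \<open>ambient \<xi>\<close>; \<open>G / K\<close> carries the quotient topology, and a function on it is smooth if
  its composition with the projection from \<open>G\<close> is.
\<close>

abbreviation ambient :: "plane set \<Rightarrow> gel set" where
  "ambient \<xi> \<equiv> UNIV \<times> \<xi>"

definition group_topology :: "plane set \<Rightarrow> gel monoid \<Rightarrow> gel topology" where
  "group_topology \<xi> G = subtopology (fd_topology (ambient \<xi>)) (carrier G)"

definition quotient_topology :: "'a topology \<Rightarrow> ('a \<Rightarrow> 'b) \<Rightarrow> 'b topology" where
  "quotient_topology T \<pi> = topology (\<lambda>U. U \<subseteq> \<pi> ` topspace T \<and>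
     openin T {x \<in> topspace T. \<pi> x \<in> U})"

lemma openin_quotient_topology:
  "openin (quotient_topology T \<pi>) U \<longleftrightarrow>
     U \<subseteq> \<pi> ` topspace T \<and> openin T {x \<in> topspace T. \<pi> x \<in> U}"
proof -
  have "openin T {x \<in> topspace T. \<pi> x \<in> S \<inter> S'}"
    if "openin T {x \<in> topspace T. \<pi> x \<in> S}" "openin T {x \<in> topspace T. \<pi> x \<in> S'}" for S S'
    using openin_Int[OF that] by (rule back_subst) auto
  moreover have "openin T {x \<in> topspace T. \<pi> x \<in> \<Union>\<K>}"
    if "\<forall>S\<in>\<K>. openin T {x \<in> topspace T. \<pi> x \<in> S}" for \<K>
  proof -
    have "{x \<in> topspace T. \<pi> x \<in> \<Union>\<K>} = (\<Union>S\<in>\<K>. {x \<in> topspace T. \<pi> x \<in> S})" by auto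
    then show ?thesis using that by auto
  qed
  ultimately have "istopology (\<lambda>U. U \<subseteq> \<pi> ` topspace T \<and> openin T {x \<in> topspace T. \<pi> x \<in> U})"
    unfolding istopology_def by blast
  then show ?thesis by (simp add: quotient_topology_def topology_inverse')
qed

definition coset_topology :: "plane set \<Rightarrow> gel monoid \<Rightarrow> gel set \<Rightarrow> gel set topology" where
  "coset_topology \<xi> G K = quotient_topology (group_topology \<xi> G) (\<lambda>a. a <#\<^bsub>G\<^esub> K)"

definition coset_smooth ::
    "plane set \<Rightarrow> gel monoid \<Rightarrow> gel set \<Rightarrow> gel set set \<Rightarrow> gel set func set" where
  "coset_smooth \<xi> G K W = {F. smooth_on_subset (ambient \<xi>) {a \<in> carrier G. a <#\<^bsub>G\<^esub> K \<in> W}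
     (\<lambda>a. F (a <#\<^bsub>G\<^esub> K))}"

definition coset_functions :: "plane set \<Rightarrow> gel monoid \<Rightarrow> gel set \<Rightarrow> gel set func set" where
  "coset_functions \<xi> G K = {F \<in> coset_smooth \<xi> G K (lcosets\<^bsub>G\<^esub> K). \<forall>m. m \<notin> lcosets\<^bsub>G\<^esub> K \<longrightarrow> F m = 0}"

definition translations_on :: "gel monoid \<Rightarrow> (gel set \<Rightarrow> gel set) set" where
  "translations_on G = {(\<lambda>m. a <#\<^bsub>G\<^esub> m) | a. a \<in> carrier G}"

definition smooth_action :: "plane set \<Rightarrow> gel monoid \<Rightarrow> gel set \<Rightarrow> bool" where
  "smooth_action \<xi> G K \<longleftrightarrow> (\<forall>F\<in>coset_functions \<xi> G K.
     smooth_on_subset (ambient \<xi> \<times> ambient \<xi>) (carrier G \<times> carrier G)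
       (\<lambda>(a, b). F (a <#\<^bsub>G\<^esub> (b <#\<^bsub>G\<^esub> K))))"

text \<open>
  The value of the vector field \<open>Y\<close> at the base point \<open>K\<close> of \<open>G / K\<close> is the velocity of the orbit of
  the one-parameter subgroup generated by \<open>v\<close>.
\<close>

definition value_at_base ::
    "plane set \<Rightarrow> gel monoid \<Rightarrow> gel set \<Rightarrow> gel set vfield \<Rightarrow> gel \<Rightarrow> bool" where
  "value_at_base \<xi> G K Y v \<longleftrightarrow> (\<exists>\<gamma>. one_parameter_subgroup G \<gamma> v \<and>
     (\<forall>F\<in>coset_functions \<xi> G K.
        ((\<lambda>t. F (\<gamma> t <#\<^bsub>G\<^esub> K)) has_real_derivative Y F K) (at 0)))"

text \<open>The invariant form on \<open>G / K\<close> induced by \<open>\<Omega>\<close> on the tangent space \<open>g / k = V\<close>.\<close>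

definition induced_form :: "plane set \<Rightarrow> gel monoid \<Rightarrow> gel set \<Rightarrow>
    (gel set vfield \<Rightarrow> gel set vfield \<Rightarrow> gel set func) \<Rightarrow> bool" where
  "induced_form \<xi> G K \<omega> \<longleftrightarrow>
     two_form (coset_functions \<xi> G K) \<omega> \<and>
     form_invariant (lcosets\<^bsub>G\<^esub> K) (coset_functions \<xi> G K) (translations_on G) \<omega> \<and>
     (\<forall>Y\<in>vector_fields (coset_functions \<xi> G K). \<forall>Z\<in>vector_fields (coset_functions \<xi> G K). \<forall>v w.
        value_at_base \<xi> G K Y v \<and> value_at_base \<xi> G K Z w \<longrightarrow>
        \<omega> Y Z K = Omega (tangent_ham v) (tangent_ham w))"

definition homogeneous_fedosov :: "plane set \<Rightarrow> gel monoid \<Rightarrow> gel set \<Rightarrow>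
    (gel set vfield \<Rightarrow> gel set vfield \<Rightarrow> gel set func) \<Rightarrow> bool" where
  "homogeneous_fedosov \<xi> G K \<omega> \<longleftrightarrow> (\<exists>D. connection (coset_functions \<xi> G K) D \<and>
     connection_invariant (lcosets\<^bsub>G\<^esub> K) (coset_functions \<xi> G K) (translations_on G) D \<and>
     torsion_free (coset_functions \<xi> G K) D \<and>
     preserves_form (coset_functions \<xi> G K) D \<omega>)"

end

theory Submission
  imports Defs
begin

text \<open>
  The cosets of \<open>K\<close> are parametrised globally by \<open>\<real>\<^sup>4\<close>, the cotangent bundle of the plane: an element
  \<open>((A, b), f)\<close> acts as the cotangent lift of the affine map followed by the translation along the
  differential of \<open>f\<close>. In this chart the induced form is the standard one. If \<open>\<xi>\<close> has degree greater than
  two, it contains a homogeneous cubic, which lies in the stability subalgebra and has trivial linear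
  part; its existence rules out an invariant complement and, since the third derivatives of the
  cubic enter the transformation law of the Christoffel symbols, an invariant connection.

  For the converse, comparison of top-degree coefficients shows that no quadratic normal form can
  preserve a nonzero finite-dimensional space of polynomials modulo constants. In the affine cases
  such a space is spanned by weight vectors of a suitable linear field (\<open>x \<partial>\<^sub>x - y \<partial>\<^sub>y\<close> or
  \<open>\<alpha> E - J\<close> with \<open>\<alpha> \<noteq> 0\<close>), and the remaining fields connect these monomials. For \<open>\<alpha> = 0\<close> the weights
  are not distinct, and one only embeds the space into all polynomials of bounded degree.
\<close>

section \<open>Calculus of formal series\<close>

text \<open>The chart works because base translations combined with linear functions form a
  commutative subgroup that acts on R^4 by translations. It provides a section that is affine in the
  ambient vector space, so topology and smoothness of the quotient reduce to those of R^4, and an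
  invariant form is known once it is known at one point. Apart from the inverse of a determinant,
  the action is polynomial.

  Smoothness is phrased through directional derivatives on spaces without a norm, and vector fields
  are abstract derivations of a function algebra. This obstacle is removed by a chain rule and
  Hadamard's lemma: every vector field gets four components, and tensorial statements become
  identities between Jacobians.

  Transversal primitivity needs one matrix without real eigenvalue, and each of the linear parts
  contains that of \<alpha> E - J for some \<alpha>. In the conformal cases the converse is carried
  out over the complex numbers, where z and its conjugate diagonalise this field. Recentring a
  normal form changes its quadratic fields by terms of degree at most one, so a comparison of top
  degrees does not see the base point.\<close>

lemma pcoeff_eqI: "(\<And>i j. pcoeff F i j = pcoeff G i j) \<Longrightarrow> F = G"
  by (simp add: pcoeff_def fps_eq_iff)

lemma fps_nth_scaleR [simp]: "fps_nth (r *\<^sub>R F) n = r *\<^sub>R fps_nth F n"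
  by (simp add: scaleR_fps_def)

lemma pcoeff_simps [simp]:
  "pcoeff (F + G) i j = pcoeff F i j + pcoeff G i j"
  "pcoeff (F - G) i j = pcoeff F i j - pcoeff G i j"
  "pcoeff (- F) i j = - pcoeff F i j"
  "pcoeff 0 i j = 0"
  "pcoeff 1 i j = (if i = 0 \<and> j = 0 then 1 else 0)"
  by (auto simp: pcoeff_def)

lemma pcoeff_scaleR [simp]: "pcoeff (r *\<^sub>R F) i j = r *\<^sub>R pcoeff F i j"
  by (auto simp: pcoeff_def)

lemma pcoeff_sum: "pcoeff (sum f I) i j = (\<Sum>k\<in>I. pcoeff (f k) i j)"
  by (simp add: pcoeff_def fps_sum_nth)

lemma pcoeff_const [simp]: "pcoeff (fps_const (fps_const c)) i j = (if i = 0 \<and> j = 0 then c else 0)"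
  by (auto simp: pcoeff_def)

lemma pcoeff_const_mult [simp]: "pcoeff (fps_const (fps_const c) * F) i j = c * pcoeff F i j"
  for F :: "'a::comm_ring_1 fps fps"
  by (auto simp: pcoeff_def)

lemma pcoeff_X_mult [simp]: "pcoeff (fps_X * F) i j = (if i = 0 then 0 else pcoeff F (i - 1) j)"
  for F :: "'a::comm_ring_1 fps fps"
  by (auto simp: pcoeff_def)

lemma pcoeff_Y_mult [simp]: "pcoeff (fps_const fps_X * F) i j = (if j = 0 then 0 else pcoeff F i (j - 1))"
  for F :: "'a::comm_ring_1 fps fps"
  by (auto simp: pcoeff_def)

lemma pcoeff_X [simp]: "pcoeff fps_X i j = (if i = 1 \<and> j = 0 then 1 else 0)"
  by (auto simp: pcoeff_def fps_X_def)

lemma pcoeff_Y [simp]: "pcoeff (fps_const fps_X) i j = (if i = 0 \<and> j = 1 then 1 else 0)"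
  by (auto simp: pcoeff_def fps_X_def)

lemma pcoeff_px [simp]: "pcoeff px i j = (if i = 1 \<and> j = 0 then 1 else 0)"
  by (simp add: px_def)

lemma pcoeff_py [simp]: "pcoeff py i j = (if i = 0 \<and> j = 1 then 1 else 0)"
  by (simp add: py_def)

lemma pcoeff_px_mult [simp]: "pcoeff (px * F) i j = (if i = 0 then 0 else pcoeff F (i - 1) j)"
  by (simp add: px_def)

lemma pcoeff_py_mult [simp]: "pcoeff (py * F) i j = (if j = 0 then 0 else pcoeff F i (j - 1))"
  by (simp add: py_def)

lemma scaleR_plane: "r *\<^sub>R (F :: plane) = fps_const (fps_const r) * F"
  by (rule pcoeff_eqI) simp

lemma scaleR_plane_mult [simp]: "(r *\<^sub>R (F :: plane)) * G = r *\<^sub>R (F * G)" "F * (r *\<^sub>R G) = r *\<^sub>R (F * G)"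
  by (simp_all add: scaleR_plane mult_ac)

lemma pcoeff_mult: "pcoeff (F * G) i j = (\<Sum>a\<le>i. \<Sum>b\<le>j. pcoeff F a b * pcoeff G (i - a) (j - b))"
  for F G :: "'a::comm_ring_1 fps fps"
  by (simp add: pcoeff_def fps_mult_nth fps_sum_nth atLeast0AtMost)

lemma pcoeff_mult00 [simp]: "pcoeff (F * G) 0 0 = pcoeff F 0 0 * pcoeff G 0 0"
  for F G :: "'a::comm_ring_1 fps fps"
  by (simp add: pcoeff_mult)

text \<open>Stated over any commutative ring, because complex series are differentiated as well and
  because q_1, q_2 are differentiated with plane series as coefficients.\<close>

definition ddx :: "'a::comm_ring_1 fps fps \<Rightarrow> 'a fps fps" where "ddx = fps_deriv"
definition ddy :: "'a::comm_ring_1 fps fps \<Rightarrow> 'a fps fps" where "ddy = fps_map fps_deriv"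

lemma dx_ddx: "dx = ddx" and dy_ddy: "dy = ddy"
  by (simp_all add: dx_def dy_def ddx_def ddy_def)

lemma pcoeff_ddx [simp]: "pcoeff (ddx F) i j = of_nat (i + 1) * pcoeff F (i + 1) j"
proof -
  have "of_nat (i + 1) = (fps_const (of_nat (i+1)) :: 'a fps)"
    by (simp only: fps_of_nat)
  then show ?thesis by (simp only: pcoeff_def ddx_def fps_deriv_nth fps_mult_left_const_nth)
qed

lemma pcoeff_ddy [simp]: "pcoeff (ddy F) i j = of_nat (j + 1) * pcoeff F i (j + 1)"
  by (simp add: pcoeff_def ddy_def fps_map_def)

lemma dd_simps [simp]:
  "ddx (F + G) = ddx F + ddx G" "ddy (F + G) = ddy F + ddy G"
  "ddx (F - G) = ddx F - ddx G" "ddy (F - G) = ddy F - ddy G"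
  "ddx 0 = 0" "ddy 0 = 0" "ddx 1 = 0" "ddy 1 = 0"
  "ddx (- F) = - ddx F" "ddy (- F) = - ddy F"
  "ddx (fps_const (fps_const c)) = 0" "ddy (fps_const (fps_const c)) = 0"
  "ddx fps_X = 1" "ddy fps_X = 0" "ddx (fps_const fps_X) = 0" "ddy (fps_const fps_X) = 1"
  by (rule pcoeff_eqI; auto simp: algebra_simps)+

lemma ddx_mult: "ddx (F * G) = ddx F * G + F * ddx G"
  by (simp add: ddx_def)

lemma ddy_mult: "ddy (F * G) = ddy F * G + F * ddy G"
  by (rule fps_ext)
     (simp add: ddy_def fps_map_def fps_mult_nth fps_deriv_sum sum.distrib)

lemma dd_commute: "ddx (ddy F) = ddy (ddx F)"
  by (rule pcoeff_eqI) (simp add: algebra_simps)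

lemma ddx_power: "ddx (u ^ n) = of_nat n * u ^ (n - 1) * ddx u"
proof (induct n)
  case (Suc n)
  then show ?case by (cases n) (simp_all add: ddx_mult algebra_simps)
qed simp

lemma ddy_power: "ddy (u ^ n) = of_nat n * u ^ (n - 1) * ddy u"
proof (induct n)
  case (Suc n)
  then show ?case by (cases n) (simp_all add: ddy_mult algebra_simps)
qed simp

lemma dx_pcoeff [simp]: "pcoeff (dx F) i j = real (i + 1) * pcoeff F (i + 1) j"
  and dy_pcoeff [simp]: "pcoeff (dy F) i j = real (j + 1) * pcoeff F i (j + 1)"
  by (simp_all add: dx_ddx dy_ddy)

lemma d_simps [simp]:
  "dx (F + G) = dx F + dx G" "dy (F + G) = dy F + dy G"
  "dx (F - G) = dx F - dx G" "dy (F - G) = dy F - dy G"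
  "dx (- F) = - dx F" "dy (- F) = - dy F"
  "dx 0 = 0" "dy 0 = 0" "dx 1 = 0" "dy 1 = 0"
  "dx (r *\<^sub>R F) = r *\<^sub>R dx F" "dy (r *\<^sub>R F) = r *\<^sub>R dy F"
  "dx px = 1" "dx py = 0" "dy px = 0" "dy py = 1"
  by (simp_all add: dx_ddx dy_ddy px_def py_def)
     (rule pcoeff_eqI; simp)+

lemma dx_mult: "dx (F * G) = dx F * G + F * dx G" and dy_mult: "dy (F * G) = dy F * G + F * dy G"
  by (simp_all add: dx_ddx dy_ddy ddx_mult ddy_mult)

lemma dxdy: "dx (dy F) = dy (dx F)"
  by (simp add: dx_ddx dy_ddy dd_commute)

section \<open>Hamiltonians of degree at most one in the q variables\<close>

lemma scaleR_ham: "r *\<^sub>R (H :: ham) = emb (r *\<^sub>R 1) * H"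
  by (simp add: emb_def fps_eq_iff)

lemma emb_simps [simp]:
  "emb (f + g) = emb f + emb g" "emb (f - g) = emb f - emb g" "emb (- f) = - emb f"
  "emb 0 = 0" "emb 1 = 1"
  by (simp_all add: emb_def)

lemma emb_scaleR: "emb (r *\<^sub>R f) = r *\<^sub>R emb f"
  by (simp add: emb_def fps_eq_iff)

lemma emb_mult: "emb (f * g) = emb f * emb g"
  by (simp add: emb_def)

text \<open>A field on the plane together with a function. All brackets below are computed on these
  three coefficients, which turns Poisson calculus into identities between plane series.\<close>

definition fld :: "plane \<Rightarrow> plane \<Rightarrow> plane \<Rightarrow> ham" where
  "fld a b f = emb a * hq1 + emb b * hq2 + emb f"

lemma qcoeff_eqI: "(\<And>m n. qcoeff H m n = qcoeff H' m n) \<Longrightarrow> H = H'"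
  by (simp add: qcoeff_def fps_eq_iff)

lemma qcoeff_fld: "qcoeff (fld a b f) m n =
    (if m = 1 \<and> n = 0 then a else if m = 0 \<and> n = 1 then b else if m = 0 \<and> n = 0 then f else 0)"
  by (auto simp: qcoeff_def fld_def emb_def hq1_def hq2_def)

lemma qcoeff_fld' [simp]: "qcoeff (fld a b f) 1 0 = a" "qcoeff (fld a b f) (Suc 0) 0 = a"
   "qcoeff (fld a b f) 0 1 = b"  "qcoeff (fld a b f) 0 (Suc 0) = b" "qcoeff (fld a b f) 0 0 = f"
  by (simp_all add: qcoeff_fld)

lemma fld_eq_iff [simp]: "fld a b f = fld a' b' f' \<longleftrightarrow> a = a' \<and> b = b' \<and> f = f'"
  by (metis qcoeff_fld')

lemma scaleR_emb_mult: "(r *\<^sub>R (H::ham)) * H' = r *\<^sub>R (H * H')"  "H * (r *\<^sub>R H') = r *\<^sub>R (H * H')"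
  by (simp_all add: scaleR_ham mult_ac)

lemma fld_add: "fld a b f + fld a' b' f' = fld (a + a') (b + b') (f + f')"
  by (simp add: fld_def algebra_simps)
lemma fld_diff: "fld a b f - fld a' b' f' = fld (a - a') (b - b') (f - f')"
  by (simp add: fld_def algebra_simps)
lemma fld_minus: "- fld a b f = fld (- a) (- b) (- f)"
  by (simp add: fld_def algebra_simps)
lemma fld_scaleR: "r *\<^sub>R fld a b f = fld (r *\<^sub>R a) (r *\<^sub>R b) (r *\<^sub>R f)"
  by (simp add: fld_def emb_scaleR scaleR_emb_mult scaleR_add_right)
lemma fld_emb_mult: "emb c * fld a b f = fld (c * a) (c * b) (c * f)"
  by (simp add: fld_def emb_mult algebra_simps)
lemma fld_zero: "0 = fld 0 0 0" by (simp add: fld_def)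
lemma emb_fld: "emb f = fld 0 0 f" by (simp add: fld_def)
lemma hq1_fld: "hq1 = fld 1 0 0" by (simp add: fld_def)
lemma hq2_fld: "hq2 = fld 0 1 0" by (simp add: fld_def)
lemma hp1_fld: "hp1 = fld 0 0 px" by (simp add: fld_def hp1_def)
lemma hp2_fld: "hp2 = fld 0 0 py" by (simp add: fld_def hp2_def)
lemma emb_hq1: "emb a * hq1 = fld a 0 0" by (simp add: fld_def)
lemma emb_hq2: "emb a * hq2 = fld 0 a 0" by (simp add: fld_def)
lemma field_fld: "emb a * hq1 + emb b * hq2 = fld a b 0" by (simp add: fld_def)

lemmas fld_ops = fld_add fld_diff fld_minus fld_scaleR fld_emb_mult

lemma d_fld:
  "d_q1 (fld a b f) = emb a" "d_q2 (fld a b f) = emb b"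
  "d_p1 (fld a b f) = fld (dx a) (dx b) (dx f)" "d_p2 (fld a b f) = fld (dy a) (dy b) (dy f)"
proof -
  \<comment> \<open>The q variables form the two outer levels of the series, so the coefficient
    formulas for \<open>ddx\<close> and \<open>ddy\<close> apply with plane series as
    coefficients.\<close>
  have q: "qcoeff (d_q1 H) m n = of_nat (m+1) * qcoeff H (m+1) n" for H m n
    using pcoeff_ddx[of H m n] by (simp add: pcoeff_def qcoeff_def ddx_def d_q1_def)
  have q2: "qcoeff (d_q2 H) m n = of_nat (n+1) * qcoeff H m (n+1)" for H m n
    using pcoeff_ddy[of H m n] by (simp add: pcoeff_def qcoeff_def ddy_def d_q2_def)
  have p: "qcoeff (d_p1 H) m n = dx (qcoeff H m n)" "qcoeff (d_p2 H) m n = dy (qcoeff H m n)" for H m n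
    by (simp_all add: qcoeff_def d_p1_def d_p2_def fps_map_def)
  show "d_q1 (fld a b f) = emb a" "d_q2 (fld a b f) = emb b"
   by (rule qcoeff_eqI; unfold q q2 emb_fld; auto simp: qcoeff_fld)+
  show "d_p1 (fld a b f) = fld (dx a) (dx b) (dx f)" "d_p2 (fld a b f) = fld (dy a) (dy b) (dy f)"
   by (rule qcoeff_eqI; auto simp: p qcoeff_fld)+
qed

text \<open>The representative without constant term. In a bracket of two \<open>fld\<close> terms a
  constant can appear only in the function component, so \<open>pb\<close> is the Poisson bracket
  with \<open>nc\<close> applied there.\<close>

definition nc :: "plane \<Rightarrow> plane" where "nc h = h - pcoeff h 0 0 *\<^sub>R 1"

definition php :: "nat \<Rightarrow> plane \<Rightarrow> plane" where
  "php n f = Abs_fps (\<lambda>i. Abs_fps (\<lambda>j. if i + j = n then pcoeff f i j else 0))"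

lemma pcoeff_php [simp]: "pcoeff (php n f) i j = (if i + j = n then pcoeff f i j else 0)"
  by (simp add: php_def pcoeff_def)

lemma pcoeff_nc: "pcoeff (nc h) i j = (if i = 0 \<and> j = 0 then 0 else pcoeff h i j)"
  by (auto simp: nc_def)

lemma php_lin [simp]: "php n (f + g) = php n f + php n g" "php n (r *\<^sub>R f) = r *\<^sub>R php n f" "php n 0 = 0"
  by (rule pcoeff_eqI; auto)+

lemma nc_lin: "nc (f + g) = nc f + nc g" "nc (f - g) = nc f - nc g" "nc (r *\<^sub>R f) = r *\<^sub>R nc f" "nc 0 = 0" "nc (- f) = - nc f"
   "nc (nc f) = nc f"
  by (rule pcoeff_eqI; auto simp: pcoeff_nc)+

lemma nc_id: "pcoeff f 0 0 = 0 \<Longrightarrow> nc f = f" by (simp add: nc_def)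

lemma hom_part_fld: "hom_part n (fld a b f) =
   (if n = 0 then fld 0 0 (php 0 f) else fld (php (n - 1) a) (php (n - 1) b) (php n f))"
proof (rule qcoeff_eqI, rule pcoeff_eqI)
  fix m k i j
  have "pcoeff (qcoeff (hom_part n H) m k) i j = (if m + k + i + j = n then pcoeff (qcoeff H m k) i j else 0)" for H
    by (simp add: hom_part_def pcoeff_def qcoeff_def hcoeff_def)
  then show "pcoeff (qcoeff (hom_part n (fld a b f)) m k) i j = pcoeff (qcoeff
    (if n = 0 then fld 0 0 (php 0 f) else fld (php (n - 1) a) (php (n - 1) b) (php n f)) m k) i j"
    by (auto simp: qcoeff_fld)
qed

lemma pb_fld: "pb (fld a b f) (fld a' b' f') =
   fld (a * dx a' + b * dy a' - (a' * dx a + b' * dy a))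
       (a * dx b' + b * dy b' - (a' * dx b + b' * dy b))
       (nc (a * dx f' + b * dy f' - (a' * dx f + b' * dy f)))"
proof -
  have *: "poisson (fld a b f) (fld a' b' f') =
   fld (a * dx a' + b * dy a' - (a' * dx a + b' * dy a))
       (a * dx b' + b * dy b' - (a' * dx b + b' * dy b))
       (a * dx f' + b * dy f' - (a' * dx f + b' * dy f))"
    by (simp add: poisson_def d_fld mult.commute[of "fld _ _ _" "emb _"] fld_ops)
  have "php 0 h = pcoeff h 0 0 *\<^sub>R 1" for h by (rule pcoeff_eqI) auto
  then show ?thesis by (simp add: pb_def * hom_part_fld fld_diff nc_def)
qed

lemma Der_fld: "Der = {fld a b 0 | a b. True}"
  by (simp add: Der_def fld_def)

lemma abelian_ideal_fld: "abelian_ideal = {fld 0 0 f | f. pcoeff f 0 0 = 0}"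
  by (simp add: abelian_ideal_def fld_def)

lemma p1_inf_fld: "p1_inf = {fld a b f | a b f. pcoeff f 0 0 = 0}"
proof -
  have "u + v \<in> {fld a b f | a b f. pcoeff f 0 0 = 0}" if "u \<in> Der" "v \<in> abelian_ideal" for u v
    using that by (auto simp: Der_fld abelian_ideal_fld fld_add)
  moreover have "fld a b f \<in> Der \<oplus>\<^sub>s abelian_ideal" if "pcoeff f 0 0 = 0" for a b f
    unfolding set_sum_def Der_fld abelian_ideal_fld
    using that fld_add[of a b 0 0 0 f] by simp (metis add.right_neutral add_0)
  ultimately show ?thesis unfolding p1_inf_def set_sum_def by blast
qed

lemma der_part_fld [simp]: "der_part (fld a b f) = fld a b 0"
  by (simp add: der_part_def field_fld)

lemma field_act_fld [simp]: "field_act (fld a b f) F = a * dx F + b * dy F"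
  by (simp add: field_act_def)

lemma func_part_fld: "func_part g = {f. fld 0 0 f \<in> g \<and> pcoeff f 0 0 = 0}"
  by (auto simp: func_part_def abelian_ideal_fld emb_fld)

section \<open>Smooth functions\<close>

text \<open>An indexed family may repeat vectors, as happens for the image of a finite set under a
  linear map; the coefficients of equal vectors then add up.\<close>

lemma fd_open_family:
  assumes S: "fd_open E S" "x \<in> S" and I: "finite I" "\<And>i. i \<in> I \<Longrightarrow> b i \<in> E"
  obtains e where "e > 0" "\<And>c. (\<And>i. i \<in> I \<Longrightarrow> \<bar>c i\<bar> < e) \<Longrightarrow> x + (\<Sum>i\<in>I. c i *\<^sub>R b i) \<in> S"
proof -
  have "finite (b ` I) \<and> b ` I \<subseteq> E" using I by auto
  then obtain e where e: "e > 0" "\<And>c. (\<forall>\<beta>\<in>b ` I. \<bar>c \<beta>\<bar> < e) \<Longrightarrow> x + (\<Sum>\<beta>\<in>b ` I. c \<beta> *\<^sub>R \<beta>) \<in> S"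
    using S unfolding fd_open_def by meson
  \<comment> \<open>At most \<open>card I\<close> coefficients are merged into one, so this radius
    keeps their sum strictly below e, also when I is empty.\<close>
  let ?d = "e / (real (card I) + 1)"
  show thesis
  proof (rule that[of ?d])
    show "?d > 0" using e(1) by simp
    fix c :: "_ \<Rightarrow> real" assume c: "\<And>i. i \<in> I \<Longrightarrow> \<bar>c i\<bar> < ?d"
    define c' where "c' \<beta> = (\<Sum>i\<in>{i\<in>I. b i = \<beta>}. c i)" for \<beta>
    have "\<bar>c' \<beta>\<bar> < e" for \<beta>
    proof -
      have "\<bar>c' \<beta>\<bar> \<le> (\<Sum>i\<in>{i\<in>I. b i = \<beta>}. \<bar>c i\<bar>)" unfolding c'_def by (rule sum_abs)
      also have "\<dots> \<le> (\<Sum>i\<in>I. \<bar>c i\<bar>)" by (rule sum_mono2) (use I in auto)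
      also have "\<dots> \<le> (\<Sum>i\<in>I. ?d)" by (rule sum_mono) (use c in \<open>auto intro: less_imp_le\<close>)
      also have "\<dots> = real (card I) * ?d" by simp
      also have "\<dots> < e" using e(1) by (simp add: field_simps)
      finally show ?thesis .
    qed
    then have "x + (\<Sum>\<beta>\<in>b ` I. c' \<beta> *\<^sub>R \<beta>) \<in> S" by (intro e(2)) auto
    also have "(\<Sum>\<beta>\<in>b ` I. c' \<beta> *\<^sub>R \<beta>) = (\<Sum>i\<in>I. c i *\<^sub>R b i)"
      by (subst sum.image_gen[OF I(1), of _ b]) (auto simp: c'_def scaleR_sum_left intro!: sum.cong)
    finally show "x + (\<Sum>i\<in>I. c i *\<^sub>R b i) \<in> S" .
  qed
qed

lemma fd_open_line:
  assumes "fd_open E U" "x \<in> U" "v \<in> E"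
  shows "\<forall>\<^sub>F t in nhds 0. x + t *\<^sub>R v \<in> U"
proof -
  obtain e where e: "e > 0" "\<And>c. (\<And>i. i \<in> {v} \<Longrightarrow> \<bar>c i\<bar> < e) \<Longrightarrow> x + (\<Sum>i\<in>{v}. c i *\<^sub>R i) \<in> U"
    using fd_open_family[OF assms(1,2), of "{v}" "\<lambda>i. i"] assms(3) by auto
  have "x + t *\<^sub>R v \<in> U" if "dist t 0 < e" for t
    using e(2)[of "\<lambda>_. t"] that by (simp add: dist_real_def)
  then show ?thesis using e(1) unfolding eventually_nhds_metric by blast
qed

lemma fd_open_space: "subspace E \<Longrightarrow> fd_open E E"
  unfolding fd_open_def
  by (auto intro!: exI[of _ 1] subspace_add subspace_sum subspace_scale)

lemma topspace_fd [simp]: "subspace E \<Longrightarrow> topspace (fd_topology E) = E"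
  using fd_open_space[of E] openin_fd_topology[of E] openin_subset openin_topspace fd_open_def
  by (metis subset_antisym)

lemma fd_open_preimage:
  assumes L: "linear L" "L ` E \<subseteq> E'" and S: "fd_open E' S"
    and that: "subspace E"
  shows "fd_open E {x \<in> E. a + L x \<in> S}"
  unfolding fd_open_def
proof (intro conjI ballI allI impI)
  fix x B assume x: "x \<in> {x \<in> E. a + L x \<in> S}" and B: "finite B \<and> B \<subseteq> E"
  obtain e where e: "e > 0" "\<And>c. (\<And>i. i \<in> B \<Longrightarrow> \<bar>c i\<bar> < e) \<Longrightarrow> a + L x + (\<Sum>i\<in>B. c i *\<^sub>R L i) \<in> S"
  proof (rule fd_open_family[OF S, of "a + L x" B L])
    show "L i \<in> E'" if "i \<in> B" for i using that B L(2) by blast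
  qed (use x B in auto)
  have "x + (\<Sum>b\<in>B. c b *\<^sub>R b) \<in> E" for c
    using x B that by (auto intro!: subspace_add subspace_sum subspace_scale)
  moreover have "L (x + (\<Sum>b\<in>B. c b *\<^sub>R b)) = L x + (\<Sum>b\<in>B. c b *\<^sub>R L b)" for c
    using L(1) by (simp add: linear_add linear_sum linear_scale)
  ultimately show "\<exists>e>0. \<forall>c. (\<forall>b\<in>B. \<bar>c b\<bar> < e) \<longrightarrow> x + (\<Sum>b\<in>B. c b *\<^sub>R b) \<in> {x \<in> E. a + L x \<in> S}"
    using e by (auto intro!: exI[of _ e] simp: add.assoc)
qed auto

text \<open>The standard basis tests openness in one direction; in the other, an arbitrary finite
  set of vectors is controlled by the sum of its norms.\<close>

lemma fd_topology_UNIV: "fd_topology (UNIV :: 'a::euclidean_space set) = euclidean"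
proof -
  have "fd_open UNIV U \<longleftrightarrow> open U" for U :: "'a set"
  proof
    assume U: "fd_open UNIV U"
    show "open U" unfolding open_dist
    proof
      fix x assume "x \<in> U"
      obtain e where e: "e > 0" "\<And>c. (\<And>i. i \<in> Basis \<Longrightarrow> \<bar>c i\<bar> < e) \<Longrightarrow> x + (\<Sum>i\<in>Basis. c i *\<^sub>R i) \<in> U"
        using fd_open_family[OF U \<open>x \<in> U\<close>, of Basis "\<lambda>i. i"] by auto
      have "y \<in> U" if "dist y x < e" for y
      proof -
        have "x + (\<Sum>i\<in>Basis. ((y - x) \<bullet> i) *\<^sub>R i) \<in> U"
          by (rule e(2)) (use that Basis_le_norm[of _ "y - x"] in \<open>auto simp: dist_norm intro: le_less_trans\<close>)
        then show ?thesis by (simp only: euclidean_representation) simp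
      qed
      then show "\<exists>e>0. \<forall>y. dist y x < e \<longrightarrow> y \<in> U" using e(1) by blast
    qed
  next
    assume U: "open U"
    show "fd_open UNIV U" unfolding fd_open_def
    proof (intro conjI ballI allI impI)
      fix x and B :: "'a set" assume x: "x \<in> U" and B: "finite B \<and> B \<subseteq> UNIV"
      obtain r where r: "r > 0" "\<And>y. dist y x < r \<Longrightarrow> y \<in> U" using U x unfolding open_dist by blast
      let ?M = "(\<Sum>b\<in>B. norm b) + 1"
      have M: "?M > 0" by (smt (verit) norm_ge_zero sum_nonneg)
      have "x + (\<Sum>b\<in>B. c b *\<^sub>R b) \<in> U" if "\<forall>b\<in>B. \<bar>c b\<bar> < r / ?M" for c
      proof (rule r(2))
        have "norm (\<Sum>b\<in>B. c b *\<^sub>R b) \<le> (\<Sum>b\<in>B. r / ?M * norm b)"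
          by (rule sum_norm_le) (unfold norm_scaleR, rule mult_right_mono, use that in \<open>auto intro: less_imp_le\<close>)
        also have "\<dots> = r / ?M * (\<Sum>b\<in>B. norm b)" by (simp add: sum_distrib_left)
        also have "\<dots> < r" using M r(1) by (simp add: field_simps)
        finally show "dist (x + (\<Sum>b\<in>B. c b *\<^sub>R b)) x < r" by (simp add: dist_norm)
      qed
      then show "\<exists>e>0. \<forall>c. (\<forall>b\<in>B. \<bar>c b\<bar> < e) \<longrightarrow> x + (\<Sum>b\<in>B. c b *\<^sub>R b) \<in> U"
        using M r(1) by (intro exI[of _ "r / ?M"]) auto
    qed simp
  qed
  then show ?thesis
    by (simp add: topology_eq openin_fd_topology)
qed

lemma fd_open_UNIV: "fd_open (UNIV :: 'a::euclidean_space set) U \<longleftrightarrow> open U"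
  by (metis fd_topology_UNIV open_openin openin_fd_topology)

lemma continuous_map_linear_functional:
  assumes l: "linear (l :: 'a::real_vector \<Rightarrow> real)" and E: "subspace E"
  shows "continuous_map (fd_topology E) euclideanreal l"
proof -
  have "fd_open E {x \<in> E. 0 + l x \<in> U}" if "open U" for U
    by (rule fd_open_preimage[where E' = UNIV and L = l and a = 0, OF l]) (use that E in \<open>auto simp: fd_open_UNIV\<close>)
  then show ?thesis using E by (simp add: continuous_map_def openin_fd_topology)
qed

lemma continuous_map_tendsto:
  "continuous_map X (euclidean :: 'b::topological_space topology) f \<longleftrightarrow>
    (\<forall>x\<in>topspace X. (f \<longlongrightarrow> f x) (atin X x))"
  by (simp add: continuous_map_atin limitin_canonical_iff)

section \<open>Calculus of functions of class C_k\<close>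

lemma C_k_cont: "C_k n E U f \<Longrightarrow> continuous_map (subtopology (fd_topology E) U) euclideanreal f"
  by (cases n) auto

lemma C_k_SucD: "C_k (Suc n) E U f \<Longrightarrow> C_k n E U f"
  by (induct n arbitrary: f) auto

lemma fd_open_sub: "fd_open E U \<Longrightarrow> U \<subseteq> E" by (simp add: fd_open_def)

lemma topspace_fd_sub: "subspace E \<Longrightarrow> fd_open E U \<Longrightarrow> topspace (subtopology (fd_topology E) U) = U"
  using fd_open_sub by (auto simp: topspace_subtopology)

lemma dir_deriv_eqI:
  "((\<lambda>t. f (x + t *\<^sub>R v)) has_real_derivative D) (at 0) \<Longrightarrow> dir_deriv f v x = D"
  by (simp add: dir_deriv_def DERIV_imp_deriv)

lemma C_k_deriv:
  assumes "C_k (Suc n) E U f" "v \<in> E" "x \<in> U"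
  shows "((\<lambda>t. f (x + t *\<^sub>R v)) has_real_derivative dir_deriv f v x) (at 0)"
  using assms by (auto simp: dir_deriv_def field_differentiable_derivI)

text \<open>The derivative along v at a point of U sees only a short segment, and this segment lies
  in U because U is open (\<open>fd_open_line\<close>).\<close>

lemma C_k_cong:
  assumes E: "subspace E" "fd_open E U"
  shows "(\<And>x. x \<in> U \<Longrightarrow> f x = g x) \<Longrightarrow> C_k n E U f \<Longrightarrow> C_k n E U g"
proof (induct n arbitrary: f g)
  case 0
  then show ?case using topspace_fd_sub[OF E] by (auto intro: continuous_map_eq)
next
  case (Suc n)
  have ev: "\<forall>\<^sub>F t in nhds 0. f (x + t *\<^sub>R v) = g (x + t *\<^sub>R v)" if "x \<in> U" "v \<in> E" for x v
    using fd_open_line[OF E(2) that] by eventually_elim (use Suc.prems in auto)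
  have d: "((\<lambda>t. g (x + t *\<^sub>R v)) has_real_derivative dir_deriv f v x) (at 0)" if "x \<in> U" "v \<in> E" for x v
    using C_k_deriv[OF Suc.prems(2) that(2,1)] ev[OF that]
    by (subst (asm) DERIV_cong_ev[OF refl _ refl]) auto
  have "continuous_map (subtopology (fd_topology E) U) euclideanreal g"
    using Suc.prems(1) C_k_cont[OF Suc.prems(2)] topspace_fd_sub[OF E] by (auto intro: continuous_map_eq)
  moreover have "C_k n E U (dir_deriv g v)" if v: "v \<in> E" for v
    by (rule Suc.hyps[of "dir_deriv f v"]) (use d v dir_deriv_eqI Suc.prems(2) in \<open>fastforce+\<close>)
  moreover have "(\<lambda>t. g (x + t *\<^sub>R v)) field_differentiable at 0" if "x \<in> U" "v \<in> E" for x v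
    using d[OF that] field_differentiable_def by blast
  ultimately show ?case by simp
qed

text \<open>Works with a candidate D for the derivatives, so that later proofs use derivative rules
  instead of unfolding \<open>dir_deriv\<close>.\<close>

lemma C_k_SucI:
  assumes E: "subspace E" "fd_open E U"
    and "continuous_map (subtopology (fd_topology E) U) euclideanreal f"
    and d: "\<And>x v. x \<in> U \<Longrightarrow> v \<in> E \<Longrightarrow> ((\<lambda>t. f (x + t *\<^sub>R v)) has_real_derivative D v x) (at 0)"
    and D: "\<And>v. v \<in> E \<Longrightarrow> C_k n E U (D v)"
  shows "C_k (Suc n) E U f"
proof -
  have "C_k n E U (dir_deriv f v)" if v: "v \<in> E" for v
    by (rule C_k_cong[OF E _ D[OF v]]) (use d[OF _ v] dir_deriv_eqI in fastforce)
  moreover have "(\<lambda>t. f (x + t *\<^sub>R v)) field_differentiable at 0" if "x \<in> U" "v \<in> E" for x v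
    using d[OF that] field_differentiable_def by blast
  ultimately show ?thesis using assms(3) by simp
qed

lemma C_k_const:
  assumes E: "subspace E" "fd_open E U" shows "C_k n E U (\<lambda>x. c)"
proof (induct n arbitrary: c)
  case (Suc n)
  show ?case by (rule C_k_SucI[OF E, where D = "\<lambda>v x. 0"]) (use Suc in auto)
qed simp

lemma C_k_linear:
  assumes E: "subspace E" "fd_open E U" and l: "linear l" shows "C_k n E U l"
proof (induct n)
  case 0
  show ?case using continuous_map_linear_functional[OF l E(1)] by (auto intro: continuous_map_from_subtopology)
next
  case (Suc n)
  have "((\<lambda>t. l x + t * l v) has_real_derivative l v) (at 0)" for x v
    by (auto intro!: derivative_eq_intros)
  then have "((\<lambda>t. l (x + t *\<^sub>R v)) has_real_derivative l v) (at 0)" for x v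
    using l by (simp add: linear_add linear_scale)
  then show ?case
    by (intro C_k_SucI[OF E C_k_cont[OF Suc], where D = "\<lambda>v x. l v"]) (use C_k_const[OF E] in auto)
qed

lemma C_k_add:
  assumes E: "subspace E" "fd_open E U"
  shows "C_k n E U f \<Longrightarrow> C_k n E U g \<Longrightarrow> C_k n E U (\<lambda>x. f x + g x)"
proof (induct n arbitrary: f g)
  case (Suc n)
  show ?case
    by (rule C_k_SucI[OF E, where D = "\<lambda>v x. dir_deriv f v x + dir_deriv g v x"])
       (use Suc C_k_deriv[OF Suc.prems(1)] C_k_deriv[OF Suc.prems(2)] in
         \<open>auto intro!: continuous_map_add DERIV_add\<close>)
qed (auto intro!: continuous_map_add)

lemma C_k_mult:
  assumes E: "subspace E" "fd_open E U"
  shows "C_k n E U f \<Longrightarrow> C_k n E U g \<Longrightarrow> C_k n E U (\<lambda>x. f x * g x)"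
proof (induct n arbitrary: f g)
  case (Suc n)
  note S = C_k_SucD[OF Suc.prems(1)] C_k_SucD[OF Suc.prems(2)]
  show ?case
  proof (rule C_k_SucI[OF E, where D = "\<lambda>v x. dir_deriv f v x * g x + dir_deriv g v x * f x"])
    show "continuous_map (subtopology (fd_topology E) U) euclideanreal (\<lambda>x. f x * g x)"
      using C_k_cont[OF S(1)] C_k_cont[OF S(2)] by (rule continuous_map_real_mult)
    show "((\<lambda>t. f (x + t *\<^sub>R v) * g (x + t *\<^sub>R v)) has_real_derivative dir_deriv f v x * g x + dir_deriv g v x * f x) (at 0)"
      if "x \<in> U" "v \<in> E" for x v
      using DERIV_mult[OF C_k_deriv[OF Suc.prems(1) that(2,1)] C_k_deriv[OF Suc.prems(2) that(2,1)]]
      by simp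
    show "C_k n E U (\<lambda>x. dir_deriv f v x * g x + dir_deriv g v x * f x)" if "v \<in> E" for v
      by (intro C_k_add[OF E] Suc.hyps) (use S Suc.prems that in auto)
  qed
qed (auto intro!: continuous_map_real_mult)

lemma C_k_sum:
  assumes E: "subspace E" "fd_open E U"
  shows "(\<And>i. i \<in> I \<Longrightarrow> C_k n E U (f i)) \<Longrightarrow> C_k n E U (\<lambda>x. \<Sum>i\<in>I. f i x)"
  by (induct I rule: infinite_finite_induct) (auto intro!: C_k_const[OF E] C_k_add[OF E])

lemma C_k_inverse:
  assumes E: "subspace E" "fd_open E U" and nz: "\<And>x. x \<in> U \<Longrightarrow> f x \<noteq> 0"
  shows "C_k n E U f \<Longrightarrow> C_k n E U (\<lambda>x. inverse (f x))"
proof (induct n)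
  case 0
  then show ?case using nz topspace_fd_sub[OF E] by (auto intro!: continuous_map_real_inverse)
next
  case (Suc n)
  note S = C_k_SucD[OF Suc.prems(1)]
  note I = Suc.hyps[OF S]
  show ?case
  proof (rule C_k_SucI[OF E C_k_cont[OF I], where D = "\<lambda>v x. (-1) * ((inverse (f x) * inverse (f x)) * dir_deriv f v x)"])
    show "((\<lambda>t. inverse (f (x + t *\<^sub>R v))) has_real_derivative (-1) * ((inverse (f x) * inverse (f x)) * dir_deriv f v x)) (at 0)"
      if "x \<in> U" "v \<in> E" for x v
      by (rule DERIV_cong[OF DERIV_inverse'[OF C_k_deriv[OF Suc.prems(1) that(2,1)]]]) (use nz that in auto)
    show "C_k n E U (\<lambda>x. (-1) * ((inverse (f x) * inverse (f x)) * dir_deriv f v x))" if "v \<in> E" for v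
      by (intro C_k_mult[OF E] C_k_const[OF E] I) (use Suc.prems that in auto)
  qed
qed

text \<open>The derivative of the composite along v is the derivative of f along L v, composed with
  the same affine map; the class of such composites is therefore closed under
  differentiation.\<close>

lemma C_k_pullback:
  assumes E: "subspace E" "fd_open E U" and L: "linear L" "L ` E \<subseteq> E'" and E': "subspace E'" "fd_open E' U'"
    and U: "\<And>x. x \<in> U \<Longrightarrow> a + L x \<in> U'"
  shows "C_k n E' U' f \<Longrightarrow> C_k n E U (\<lambda>x. f (a + L x))"
proof (induct n arbitrary: f)
  case 0
  have *: "openin (subtopology (fd_topology E) U) {x \<in> U. a + L x \<in> W}" if W: "openin (subtopology (fd_topology E') U') W" for W
  proof -
    obtain T where T: "fd_open E' T" "W = T \<inter> U'"
      using W by (auto simp: openin_subtopology openin_fd_topology)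
    have "{x \<in> U. a + L x \<in> W} = {x \<in> E. a + L x \<in> T} \<inter> U"
      using T U fd_open_sub[OF E(2)] by auto
    then show ?thesis using fd_open_preimage[OF L T(1) E(1), of a]
      by (auto simp: openin_subtopology openin_fd_topology)
  qed
  have "openin (subtopology (fd_topology E) U) {x \<in> U. f (a + L x) \<in> V}" if "open V" for V
  proof -
    have "openin (subtopology (fd_topology E') U') {y \<in> U'. f y \<in> V}"
      using openin_continuous_map_preimage[OF C_k_cont[OF 0], of V] that topspace_fd_sub[OF E']
      by (simp del: topspace_subtopology)
    from *[OF this] show ?thesis by (rule back_subst) (use U in auto)
  qed
  then show ?case using topspace_fd_sub[OF E] by (simp add: continuous_map_def)
next
  case (Suc n)
  show ?case
  proof (rule C_k_SucI[OF E C_k_cont[OF Suc.hyps[OF C_k_SucD[OF Suc.prems]]], where D = "\<lambda>v x. dir_deriv f (L v) (a + L x)"])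
    show "((\<lambda>t. f (a + L (x + t *\<^sub>R v))) has_real_derivative dir_deriv f (L v) (a + L x)) (at 0)"
      if "x \<in> U" "v \<in> E" for x v
      using C_k_deriv[OF Suc.prems, of "L v" "a + L x"] that U L by (auto simp: linear_add linear_scale add.assoc)
    show "C_k n E U (\<lambda>x. dir_deriv f (L v) (a + L x))" if "v \<in> E" for v
      by (rule Suc.hyps) (use Suc.prems that L in auto)
  qed
qed

text \<open>\<open>C_k\<close> speaks of directional derivatives only, while a chain rule needs
  total differentiability. The passage from x to x + h changes one coordinate at a time, with a mean
  value estimate on each edge.\<close>

lemma has_derivative_of_C1:
  fixes F :: "'n::euclidean_space \<Rightarrow> real"
  assumes F: "C_k (Suc n) UNIV V F" and V: "open V" "x \<in> V"
  shows "(F has_derivative (\<lambda>h. \<Sum>b\<in>Basis. (h \<bullet> b) * dir_deriv F b x)) (at x)"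
  unfolding has_derivative_at_alt
proof (intro conjI allI impI)
  let ?D = "\<lambda>h. \<Sum>b\<in>Basis. (h \<bullet> b) * dir_deriv F b x"
  show "bounded_linear ?D"
    by (intro bounded_linear_sum bounded_linear_mult_const bounded_linear_inner_left)
  fix e :: real assume "e > 0"
  \<comment> \<open>Each of the \<open>DIM('n)\<close> edges has length at most
    \<open>norm h\<close>, so these errors add up to e times \<open>norm h\<close>.\<close>
  define e' where "e' = e / real (DIM('n))"
  have e': "e' > 0" using \<open>e > 0\<close> by (simp add: e'_def)
  have c: "isCont (dir_deriv F b) x" for b
  proof -
    have "C_k n UNIV V (dir_deriv F b)" using F by simp
    from C_k_cont[OF this] have "continuous_on V (dir_deriv F b)" by (simp add: fd_topology_UNIV)
    then show ?thesis using V continuous_on_eq_continuous_at by blast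
  qed
  have "\<forall>\<^sub>F y in nhds x. y \<in> V \<and> (\<forall>b\<in>Basis. \<bar>dir_deriv F b y - dir_deriv F b x\<bar> < e')"
  proof (intro eventually_conj eventually_ball_finite ballI)
    show "\<forall>\<^sub>F y in nhds x. y \<in> V" using V by (rule eventually_nhds_in_open)
    show "\<forall>\<^sub>F y in nhds x. \<bar>dir_deriv F b y - dir_deriv F b x\<bar> < e'" for b
      using c[of b] e' unfolding continuous_at_eps_delta eventually_nhds_metric dist_real_def by blast
  qed simp
  then obtain d where d: "d > 0" "\<And>y. dist y x < d \<Longrightarrow> y \<in> V"
      "\<And>y b. dist y x < d \<Longrightarrow> b \<in> Basis \<Longrightarrow> \<bar>dir_deriv F b y - dir_deriv F b x\<bar> < e'"
    unfolding eventually_nhds_metric by blast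
  \<comment> \<open>S collects the coordinates that have already been changed from those of x to
    those of x + h.\<close>
  have main: "\<bar>F (x + (\<Sum>b\<in>S. (h \<bullet> b) *\<^sub>R b)) - F x - (\<Sum>b\<in>S. (h \<bullet> b) * dir_deriv F b x)\<bar> \<le> e' * (\<Sum>b\<in>S. \<bar>h \<bullet> b\<bar>)"
    if h: "norm h < d" and S: "finite S" "S \<subseteq> Basis" for h S
    using S
  proof (induct S)
    case (insert b0 S)
    let ?y = "x + (\<Sum>b\<in>S. (h \<bullet> b) *\<^sub>R b)"
    let ?c = "h \<bullet> b0"
    \<comment> \<open>Every point of the edge stays within d of x, because its difference from x is
      dominated by h in each coordinate.\<close>
    have near: "dist (?y + t *\<^sub>R b0) x < d" if "\<bar>t\<bar> \<le> \<bar>?c\<bar>" for t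
    proof -
      have "norm ((\<Sum>b\<in>S. (h \<bullet> b) *\<^sub>R b) + t *\<^sub>R b0) \<le> norm h"
      proof (rule norm_le_componentwise)
        fix i :: 'n assume i: "i \<in> Basis"
        have "(\<Sum>b\<in>S. (h \<bullet> b) *\<^sub>R b) \<bullet> i = (\<Sum>b\<in>S. if b = i then h \<bullet> b else 0)"
          unfolding inner_sum_left by (rule sum.cong) (use insert i in \<open>auto simp: inner_Basis\<close>)
        then have "(\<Sum>b\<in>S. (h \<bullet> b) *\<^sub>R b) \<bullet> i = (if i \<in> S then h \<bullet> i else 0)"
          using insert by (simp add: sum.delta)
        then show "\<bar>((\<Sum>b\<in>S. (h \<bullet> b) *\<^sub>R b) + t *\<^sub>R b0) \<bullet> i\<bar> \<le> \<bar>h \<bullet> i\<bar>"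
          using that insert i by (auto simp: inner_add_left inner_Basis)
      qed
      then show ?thesis using h by (simp add: dist_norm add.assoc)
    qed
    \<comment> \<open>After subtraction of the linear term at x, the derivative along the edge is a
      difference of partial derivatives at nearby points, hence at most e'.\<close>
    have "norm ((F (?y + ?c *\<^sub>R b0) - ?c * dir_deriv F b0 x) - (F (?y + 0 *\<^sub>R b0) - 0 * dir_deriv F b0 x)) \<le> e' * norm (?c - 0)"
    proof (rule field_differentiable_bound[of "cball 0 \<bar>?c\<bar>" "\<lambda>t. F (?y + t *\<^sub>R b0) - t * dir_deriv F b0 x" "\<lambda>t. dir_deriv F b0 (?y + t *\<^sub>R b0) - dir_deriv F b0 x"])
      fix t :: real assume t: "t \<in> cball 0 \<bar>?c\<bar>"
      then have n: "dist (?y + t *\<^sub>R b0) x < d" by (intro near) auto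
      have "((\<lambda>s. F ((?y + t *\<^sub>R b0) + s *\<^sub>R b0)) has_real_derivative dir_deriv F b0 (?y + t *\<^sub>R b0)) (at 0)"
        using C_k_deriv[OF F _ d(2)[OF n]] by blast
      then have "((\<lambda>s. F (?y + (s + t) *\<^sub>R b0)) has_real_derivative dir_deriv F b0 (?y + t *\<^sub>R b0)) (at 0)"
        by (simp add: algebra_simps)
      then have "((\<lambda>s. F (?y + s *\<^sub>R b0)) has_real_derivative dir_deriv F b0 (?y + t *\<^sub>R b0)) (at t)"
        using DERIV_shift[of "\<lambda>s. F (?y + s *\<^sub>R b0)" _ 0 t] by simp
      then show "((\<lambda>t. F (?y + t *\<^sub>R b0) - t * dir_deriv F b0 x) has_real_derivative dir_deriv F b0 (?y + t *\<^sub>R b0) - dir_deriv F b0 x) (at t within cball 0 \<bar>?c\<bar>)"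
        by (auto intro!: derivative_eq_intros intro: has_field_derivative_at_within)
      show "norm (dir_deriv F b0 (?y + t *\<^sub>R b0) - dir_deriv F b0 x) \<le> e'"
        using d(3)[OF n, of b0] insert by simp
    qed auto
    then have m1: "\<bar>F (?y + ?c *\<^sub>R b0) - F ?y - ?c * dir_deriv F b0 x\<bar> \<le> e' * \<bar>?c\<bar>" by (simp add: algebra_simps)
    have m2: "\<bar>F ?y - F x - (\<Sum>b\<in>S. (h \<bullet> b) * dir_deriv F b x)\<bar> \<le> e' * (\<Sum>b\<in>S. \<bar>h \<bullet> b\<bar>)"
      using insert by auto
    have y: "x + (\<Sum>b\<in>insert b0 S. (h \<bullet> b) *\<^sub>R b) = ?y + ?c *\<^sub>R b0" using insert by simp
    show ?case
      by (subst y, unfold sum.insert[OF insert(1,2)] distrib_left) (use m1 m2 in linarith)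
  qed simp
  have "norm (F y - F x - ?D (y - x)) \<le> e * norm (y - x)" if y: "norm (y - x) < d" for y
  proof -
    have "\<bar>F y - F x - ?D (y - x)\<bar> \<le> e' * (\<Sum>b\<in>Basis. \<bar>(y - x) \<bullet> b\<bar>)"
      using main[OF y finite_Basis subset_refl] by (simp add: euclidean_representation)
    also have "\<dots> \<le> e' * (\<Sum>b\<in>(Basis::'n set). norm (y - x))"
      using e' by (intro mult_left_mono sum_mono) (auto simp: Basis_le_norm)
    also have "\<dots> = e * norm (y - x)" by (simp add: e'_def)
    finally show ?thesis by simp
  qed
  then show "\<exists>d>0. \<forall>y. norm (y - x) < d \<longrightarrow> norm (F y - F x - ?D (y - x)) \<le> e * norm (y - x)"
    using d(1) by blast
qed

text \<open>Along a line the inner map is a curve in Euclidean space, so only the outer function has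
  to be totally differentiable; the resulting sum of products is handled by induction.\<close>

lemma C_k_compose:
  fixes F :: "'n::euclidean_space \<Rightarrow> real"
  assumes E: "subspace E" "fd_open E U" and V: "open V" "\<And>x. x \<in> U \<Longrightarrow> G x \<in> V"
  shows "(\<And>b. b \<in> Basis \<Longrightarrow> C_k n E U (\<lambda>x. G x \<bullet> b)) \<Longrightarrow> C_k n UNIV V F \<Longrightarrow> C_k n E U (\<lambda>x. F (G x))"
proof (induct n arbitrary: F)
  case 0
  let ?X = "subtopology (fd_topology E) U"
  have "(G \<longlongrightarrow> G x) (atin ?X x)" if "x \<in> topspace ?X" for x
  proof -
    have "((\<lambda>y. \<Sum>b\<in>Basis. (G y \<bullet> b) *\<^sub>R b) \<longlongrightarrow> (\<Sum>b\<in>Basis. (G x \<bullet> b) *\<^sub>R b)) (atin ?X x)"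
      using 0 that by (intro tendsto_sum tendsto_scaleR tendsto_const) (auto simp: continuous_map_tendsto)
    then show ?thesis by (simp add: euclidean_representation)
  qed
  then have "continuous_map ?X euclidean G" by (simp add: continuous_map_tendsto)
  then have "continuous_map ?X (top_of_set V) G"
    using V topspace_fd_sub[OF E] by (auto simp: continuous_map_in_subtopology)
  moreover have "continuous_map (top_of_set V) euclideanreal F" using 0 by (simp add: fd_topology_UNIV)
  ultimately have "continuous_map ?X euclideanreal (F \<circ> G)" by (rule continuous_map_compose)
  then show ?case by (simp add: o_def)
next
  case (Suc n)
  have C: "continuous_map (subtopology (fd_topology E) U) euclideanreal (\<lambda>x. F (G x))"
    by (rule C_k_cont[OF Suc.hyps]) (rule C_k_SucD, rule Suc.prems, assumption?)+
  show ?case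
  proof (rule C_k_SucI[OF E C, where D = "\<lambda>v x. \<Sum>b\<in>Basis. dir_deriv (\<lambda>x. G x \<bullet> b) v x * dir_deriv F b (G x)"])
    fix x v assume x: "x \<in> U" and v: "v \<in> E"
    have g: "((\<lambda>t. G (x + t *\<^sub>R v) \<bullet> b) has_real_derivative dir_deriv (\<lambda>x. G x \<bullet> b) v x) (at 0)" if "b \<in> Basis" for b
      using C_k_deriv[OF Suc.prems(1)[OF that] v x] .
    have "((\<lambda>t. \<Sum>b\<in>Basis. (G (x + t *\<^sub>R v) \<bullet> b) *\<^sub>R b) has_vector_derivative
        (\<Sum>b\<in>Basis. dir_deriv (\<lambda>x. G x \<bullet> b) v x *\<^sub>R b)) (at 0)"
      using g by (intro has_vector_derivative_sum bounded_linear.has_vector_derivative[OF bounded_linear_scaleR_left])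
         (auto simp: has_real_derivative_iff_has_vector_derivative)
    then have G: "((\<lambda>t. G (x + t *\<^sub>R v)) has_vector_derivative
        (\<Sum>b\<in>Basis. dir_deriv (\<lambda>x. G x \<bullet> b) v x *\<^sub>R b)) (at 0)"
      by (simp add: euclidean_representation)
    have F: "(F has_derivative (\<lambda>h. \<Sum>b\<in>Basis. (h \<bullet> b) * dir_deriv F b (G x))) (at (G (x + 0 *\<^sub>R v)))"
      using has_derivative_of_C1[OF Suc.prems(2) V(1) V(2)[OF x]] by simp
    have "((\<lambda>t. F (G (x + t *\<^sub>R v))) has_derivative (\<lambda>t. \<Sum>b\<in>Basis. ((t *\<^sub>R (\<Sum>b\<in>Basis. dir_deriv (\<lambda>x. G x \<bullet> b) v x *\<^sub>R b)) \<bullet> b) * dir_deriv F b (G x))) (at 0)"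
      using has_derivative_compose[OF G[unfolded has_vector_derivative_def] F] by simp
    moreover have "(\<Sum>b\<in>Basis. ((t *\<^sub>R (\<Sum>b\<in>Basis. dir_deriv (\<lambda>x. G x \<bullet> b) v x *\<^sub>R b)) \<bullet> b) * dir_deriv F b (G x))
      = (\<Sum>b\<in>Basis. dir_deriv (\<lambda>x. G x \<bullet> b) v x * dir_deriv F b (G x)) * t" for t
      unfolding sum_distrib_right
      by (rule sum.cong) (auto simp: inner_sum_left_Basis)
    ultimately show "((\<lambda>t. F (G (x + t *\<^sub>R v))) has_real_derivative (\<Sum>b\<in>Basis. dir_deriv (\<lambda>x. G x \<bullet> b) v x * dir_deriv F b (G x))) (at 0)"
      by (simp add: has_field_derivative_def)
  next
    fix v assume v: "v \<in> E"
    show "C_k n E U (\<lambda>x. \<Sum>b\<in>Basis. dir_deriv (\<lambda>x. G x \<bullet> b) v x * dir_deriv F b (G x))"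
    proof (rule C_k_sum[OF E], rule C_k_mult[OF E])
      fix b :: 'n assume b: "b \<in> Basis"
      show "C_k n E U (dir_deriv (\<lambda>x. G x \<bullet> b) v)" using Suc.prems(1)[OF b] v by simp
      show "C_k n E U (\<lambda>x. dir_deriv F b (G x))"
      proof (rule Suc.hyps)
        show "C_k n E U (\<lambda>x. G x \<bullet> b)" if "b \<in> Basis" for b
          using C_k_SucD[OF Suc.prems(1)[OF that]] .
        show "C_k n UNIV V (dir_deriv F b)" using Suc.prems(2) by simp
      qed
    qed
  qed
qed

text \<open>\<open>dir_deriv\<close> is defined pointwise and does not refer to the open set, so
  derivatives computed on different neighbourhoods are restrictions of one function.\<close>

lemma C_k_local:
  fixes f :: "'n::euclidean_space \<Rightarrow> real"
  assumes "open V" "\<And>x. x \<in> V \<Longrightarrow> \<exists>W. open W \<and> x \<in> W \<and> C_k n UNIV W f"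
  shows "C_k n UNIV V f"
  using assms(2)
proof (induct n arbitrary: f)
  case 0
  have "isCont f x" if xV: "x \<in> V" for x
  proof -
    obtain W where W: "open W" "x \<in> W" "C_k 0 UNIV W f" using 0[OF xV] by blast
    then have "continuous_on W f" by (simp add: fd_topology_UNIV)
    then show ?thesis using W continuous_on_eq_continuous_at[OF W(1)] by blast
  qed
  then show ?case using assms(1) by (simp add: fd_topology_UNIV continuous_at_imp_continuous_on)
next
  case (Suc n)
  have "C_k n UNIV V f"
  proof (rule Suc.hyps)
    fix x assume "x \<in> V"
    then obtain W where "open W" "x \<in> W" "C_k (Suc n) UNIV W f" using Suc.prems[of x] by blast
    from this(1,2) C_k_SucD[OF this(3)] show "\<exists>W. open W \<and> x \<in> W \<and> C_k n UNIV W f" by blast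
  qed
  moreover have "C_k n UNIV V (dir_deriv f v)" for v
  proof (rule Suc.hyps)
    fix x assume "x \<in> V"
    then obtain W where "open W" "x \<in> W" "C_k (Suc n) UNIV W f" using Suc.prems[of x] by blast
    then show "\<exists>W. open W \<and> x \<in> W \<and> C_k n UNIV W (dir_deriv f v)" by auto
  qed
  moreover have "(\<lambda>t. f (x + t *\<^sub>R v)) field_differentiable at 0" if "x \<in> V" for x v
    using Suc.prems[OF that] by auto
  ultimately show ?case using C_k_cont[of n UNIV V f] by auto
qed

text \<open>Hadamard's lemma: the coefficients of \<open>f x - f m\<close> are averages of partial derivatives
  along the segment from \<open>m\<close> to \<open>x\<close>; the weight \<open>t ^ j\<close> makes the smoothness claim inductive.\<close>

lemma C_k_segment_average:
  fixes f :: "'n::euclidean_space \<Rightarrow> real"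
  shows "(\<And>k. C_k k UNIV UNIV f) \<Longrightarrow> C_k n UNIV UNIV (\<lambda>x. integral {0..1} (\<lambda>t. t ^ j * f (m + t *\<^sub>R (x - m))))"
proof (induct n arbitrary: f j)
  case 0
  have "continuous_on UNIV f" using 0[of 0] by (simp add: fd_topology_UNIV)
  then have c: "continuous_on X (\<lambda>p. f (g p))" if "continuous_on X g" for X :: "('n \<times> real) set" and g
    using continuous_on_compose2[OF _ that] by auto
  have "continuous_on UNIV (\<lambda>x. integral (cbox 0 1) (\<lambda>t. t ^ j * f (m + t *\<^sub>R (x - m))))"
    by (rule integral_continuous_on_param) (auto simp: split_beta intro!: continuous_intros c)
  then show ?case by (simp add: fd_topology_UNIV)
next
  case (Suc n)
  have C: "continuous_map (subtopology (fd_topology UNIV) UNIV) euclideanreal (\<lambda>x. integral {0..1} (\<lambda>t. t ^ j * f (m + t *\<^sub>R (x - m))))"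
    by (rule C_k_cont[OF Suc.hyps]) (rule Suc.prems)
  have cf: "continuous_on UNIV f" using Suc.prems[of 0] by (simp add: fd_topology_UNIV)
  show ?case
  proof (rule C_k_SucI[OF subspace_UNIV _ C, where D = "\<lambda>v x. integral {0..1} (\<lambda>t. t ^ Suc j * dir_deriv f v (m + t *\<^sub>R (x - m)))"])
    show "C_k n UNIV UNIV (\<lambda>x. integral {0..1} (\<lambda>t. t ^ Suc j * dir_deriv f v (m + t *\<^sub>R (x - m))))" for v
    proof (rule Suc.hyps)
      show "C_k k UNIV UNIV (dir_deriv f v)" for k using Suc.prems[of "Suc k"] by simp
    qed
    fix x v :: 'n
    have cd: "continuous_on UNIV (dir_deriv f v)" using Suc.prems[of "Suc 0"] by (simp add: fd_topology_UNIV)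
    have c: "continuous_on X (\<lambda>p. h (g p))" if "continuous_on X g" "continuous_on UNIV h" for X :: "'z::topological_space set" and g and h :: "'n \<Rightarrow> real"
      using continuous_on_compose2[OF that(2) that(1)] by auto
    have "((\<lambda>s. integral (cbox 0 1) (\<lambda>t. t ^ j * f (m + t *\<^sub>R ((x + s *\<^sub>R v) - m)))) has_field_derivative
       integral (cbox 0 1) (\<lambda>t. t ^ Suc j * dir_deriv f v (m + t *\<^sub>R ((x + 0 *\<^sub>R v) - m)))) (at 0 within UNIV)"
    proof (rule leibniz_rule_field_derivative[where fx = "\<lambda>s t. t ^ Suc j * dir_deriv f v (m + t *\<^sub>R ((x + s *\<^sub>R v) - m))"])
      show "continuous_on (UNIV \<times> cbox 0 1) (\<lambda>(s, t). t ^ Suc j * dir_deriv f v (m + t *\<^sub>R ((x + s *\<^sub>R v) - m)))"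
        by (auto simp: split_beta intro!: continuous_intros c cd)
      show "(\<lambda>t. t ^ j * f (m + t *\<^sub>R ((x + s *\<^sub>R v) - m))) integrable_on cbox 0 1" for s
        by (rule integrable_continuous) (auto intro!: continuous_intros c cf)
      fix s t :: real
      let ?p = "m + t *\<^sub>R ((x + s *\<^sub>R v) - m)"
      \<comment> \<open>The point 0 is written as \<open>t * (s - s)\<close> to match the chain rule
        for the inner function \<open>\<lambda>r. t * (r - s)\<close>.\<close>
      have "((\<lambda>r. f (?p + r *\<^sub>R v)) has_real_derivative dir_deriv f v ?p) (at (t * (s - s)))"
        using C_k_deriv[OF Suc.prems[of "Suc 0"], of v ?p] by simp
      moreover have "((\<lambda>r. t * (r - s)) has_real_derivative t) (at s)" by (auto intro!: derivative_eq_intros)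
      ultimately have "((\<lambda>r. f (?p + (t * (r - s)) *\<^sub>R v)) has_real_derivative dir_deriv f v ?p * t) (at s)"
        by (rule DERIV_chain2)
      moreover have "?p + (t * (r - s)) *\<^sub>R v = m + t *\<^sub>R ((x + r *\<^sub>R v) - m)" for r by (simp add: algebra_simps)
      ultimately have "((\<lambda>r. f (m + t *\<^sub>R ((x + r *\<^sub>R v) - m))) has_real_derivative dir_deriv f v ?p * t) (at s)" by simp
      from DERIV_cmult[OF this, of "t ^ j"]
      show "((\<lambda>r. t ^ j * f (m + t *\<^sub>R ((x + r *\<^sub>R v) - m))) has_field_derivative t ^ Suc j * dir_deriv f v ?p) (at s within UNIV)"
        by (simp add: mult_ac)
    qed auto
    then show "((\<lambda>s. integral {0..1} (\<lambda>t. t ^ j * f (m + t *\<^sub>R (x + s *\<^sub>R v - m)))) has_real_derivative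
       integral {0..1} (\<lambda>t. t ^ Suc j * dir_deriv f v (m + t *\<^sub>R (x - m)))) (at 0)"
      by simp
  qed (simp add: fd_open_space)
qed

lemma hadamard:
  fixes f :: "'n::euclidean_space \<Rightarrow> real"
  assumes f: "\<And>k. C_k k UNIV UNIV f"
  obtains g where "\<And>k b. C_k k UNIV UNIV (g b)" "\<And>b. g b m = dir_deriv f b m"
    "\<And>x. f x = f m + (\<Sum>b\<in>Basis. ((x - m) \<bullet> b) * g b x)"
proof
  \<comment> \<open>The factor \<open>t ^ 0\<close> puts the average into the form of
    \<open>C_k_segment_average\<close>.\<close>
  define g where "g b x = integral {0..1} (\<lambda>t. t ^ 0 * dir_deriv f b (m + t *\<^sub>R (x - m)))" for b x
  show "C_k k UNIV UNIV (g b)" for k b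
    unfolding g_def
  proof (rule C_k_segment_average)
    show "C_k k UNIV UNIV (dir_deriv f b)" for k using f[of "Suc k"] by simp
  qed
  show "g b m = dir_deriv f b m" for b by (simp add: g_def)
  fix x
  have cd: "continuous_on UNIV (dir_deriv f b)" for b using f[of "Suc 0"] by (simp add: fd_topology_UNIV)
  have i: "(\<lambda>t. ((x - m) \<bullet> b) * dir_deriv f b (m + t *\<^sub>R (x - m))) integrable_on {0..1}" for b
  proof (intro integrable_continuous_real continuous_on_mult continuous_on_const)
    show "continuous_on {0..1} (\<lambda>t. dir_deriv f b (m + t *\<^sub>R (x - m)))"
      by (rule continuous_on_compose2[OF cd[of b]]) (auto intro!: continuous_intros)
  qed
  have "((\<lambda>t. \<Sum>b\<in>Basis. ((x - m) \<bullet> b) * dir_deriv f b (m + t *\<^sub>R (x - m))) has_integral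
      f (m + 1 *\<^sub>R (x - m)) - f (m + 0 *\<^sub>R (x - m))) {0..1}"
  proof (rule fundamental_theorem_of_calculus)
    fix t :: real
    have "((\<lambda>t. m + t *\<^sub>R (x - m)) has_derivative (\<lambda>s. s *\<^sub>R (x - m))) (at t within {0..1})"
      by (auto intro!: derivative_eq_intros)
    from has_derivative_compose[OF this has_derivative_of_C1[OF f[of "Suc 0"]]]
    have "((\<lambda>t. f (m + t *\<^sub>R (x - m))) has_derivative (\<lambda>s. \<Sum>b\<in>Basis. ((s *\<^sub>R (x - m)) \<bullet> b) * dir_deriv f b (m + t *\<^sub>R (x - m)))) (at t within {0..1})"
      by simp
    then show "((\<lambda>t. f (m + t *\<^sub>R (x - m))) has_vector_derivative (\<Sum>b\<in>Basis. ((x - m) \<bullet> b) * dir_deriv f b (m + t *\<^sub>R (x - m)))) (at t within {0..1})"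
      unfolding has_vector_derivative_def by (rule has_derivative_eq_rhs) (simp add: fun_eq_iff sum_distrib_left mult_ac)
  qed simp
  then have "f x - f m = integral {0..1} (\<lambda>t. \<Sum>b\<in>Basis. ((x - m) \<bullet> b) * dir_deriv f b (m + t *\<^sub>R (x - m)))"
    by (simp add: integral_unique)
  also have "\<dots> = (\<Sum>b\<in>Basis. ((x - m) \<bullet> b) * g b x)"
    using i by (subst integral_sum) (auto simp: g_def)
  finally show "f x = f m + (\<Sum>b\<in>Basis. ((x - m) \<bullet> b) * g b x)" by simp
qed

section \<open>Evaluation of polynomials\<close>

definition psupp :: "'a::zero fps fps \<Rightarrow> (nat \<times> nat) set" where
  "psupp F = {(i, j). pcoeff F i j \<noteq> 0}"

definition fpoly :: "'a::zero fps fps \<Rightarrow> bool" where "fpoly F \<longleftrightarrow> finite (psupp F)"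

definition mono2 :: "'a::comm_ring_1 \<Rightarrow> nat \<Rightarrow> nat \<Rightarrow> 'a fps fps" where
  "mono2 c i j = fps_const (fps_const c) * (fps_X ^ i * (fps_const fps_X) ^ j)"

lemma pcoeff_mono2 [simp]: "pcoeff (mono2 c i j) m n = (if m = i \<and> n = j then c else 0)"
proof -
  have y: "pcoeff ((fps_const fps_X) ^ j) m n = (if m = 0 \<and> n = j then 1 else (0::'a))" for m n
    by (induct j arbitrary: m n) (auto simp del: fps_const_power fps_const_mult)
  have "pcoeff (fps_X ^ i * (fps_const fps_X) ^ j) m n = (if m = i \<and> n = j then 1 else (0::'a))" for m
    by (induct i arbitrary: m) (auto simp: y mult.assoc simp del: fps_const_power fps_const_mult)
  then show ?thesis by (simp add: mono2_def)
qed

lemma mono2_mult: "mono2 c i j * mono2 d k l = mono2 (c * d) (i + k) (j + l)"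
proof -
  have "fps_const (fps_const (c * d)) = fps_const (fps_const c) * fps_const (fps_const d)" by simp
  then show ?thesis by (simp only: mono2_def power_add mult_ac)
qed

lemma psupp_mono2: "psupp (mono2 c i j) \<subseteq> {(i, j)}"
  by (auto simp: psupp_def split: if_splits)

lemma fpoly_mono2 [simp]: "fpoly (mono2 c i j)"
  unfolding fpoly_def by (rule finite_subset[OF psupp_mono2]) simp

lemma psupp_add: "psupp (F + G) \<subseteq> psupp F \<union> psupp G" for F :: "'a::comm_ring_1 fps fps"
  by (auto simp: psupp_def)

lemma fpoly_zero [simp]: "fpoly (0 :: 'a::comm_ring_1 fps fps)"
  by (simp add: fpoly_def psupp_def)

lemma fpoly_add [simp]: "fpoly F \<Longrightarrow> fpoly G \<Longrightarrow> fpoly (F + G)" for F :: "'a::comm_ring_1 fps fps"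
  unfolding fpoly_def by (rule finite_subset[OF psupp_add]) simp

lemma fpoly_sum: "(\<And>i. i \<in> I \<Longrightarrow> fpoly (f i)) \<Longrightarrow> fpoly (sum f I)" for f :: "'b \<Rightarrow> 'a::comm_ring_1 fps fps"
  by (induct I rule: infinite_finite_induct) auto

lemma fpoly_expand:
  assumes "finite S" "psupp F \<subseteq> S"
  shows "F = (\<Sum>p\<in>S. mono2 (pcoeff F (fst p) (snd p)) (fst p) (snd p))"
proof (rule pcoeff_eqI)
  fix m n
  have "(\<Sum>p\<in>S. pcoeff (mono2 (pcoeff F (fst p) (snd p)) (fst p) (snd p)) m n) =
        (\<Sum>p\<in>S. if p = (m, n) then pcoeff F m n else 0)"
    by (rule sum.cong) auto
  then show "pcoeff F m n = pcoeff (\<Sum>p\<in>S. mono2 (pcoeff F (fst p) (snd p)) (fst p) (snd p)) m n"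
    using assms by (auto simp: pcoeff_sum psupp_def sum.delta)
qed

text \<open>A polynomial is a finite sum of monomials, so a property that passes to sums of
  polynomials need only be checked on \<open>mono2\<close>.\<close>

lemma fpoly_induct [consumes 1, case_names mono add]:
  assumes "fpoly F" and mono: "\<And>c i j. P (mono2 c i j)"
    and add: "\<And>F G. fpoly F \<Longrightarrow> fpoly G \<Longrightarrow> P F \<Longrightarrow> P G \<Longrightarrow> P (F + G)"
  shows "P (F :: 'a::comm_ring_1 fps fps)"
proof -
  \<comment> \<open>The monomial with coefficient zero takes care of the empty sum.\<close>
  have z: "P 0" using mono[of 0 0 0] by (simp add: mono2_def)
  have "P (\<Sum>p\<in>S. mono2 (c p) (fst p) (snd p))" if "finite S" for S c
    using that
  proof (induct S)
    case (insert p S)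
    have "P (mono2 (c p) (fst p) (snd p) + (\<Sum>p\<in>S. mono2 (c p) (fst p) (snd p)))"
      by (rule add) (simp_all add: insert mono fpoly_sum)
    then show ?case using insert by simp
  qed (simp add: z)
  then have "P (\<Sum>p\<in>psupp F. mono2 (pcoeff F (fst p) (snd p)) (fst p) (snd p))"
    using assms(1) by (simp add: fpoly_def)
  moreover have "F = (\<Sum>p\<in>psupp F. mono2 (pcoeff F (fst p) (snd p)) (fst p) (snd p))"
    by (rule fpoly_expand) (use assms(1) in \<open>simp_all add: fpoly_def\<close>)
  ultimately show ?thesis by (rule back_subst[OF _ sym])
qed

lemma fpoly_mult [simp]: "fpoly F \<Longrightarrow> fpoly G \<Longrightarrow> fpoly (F * G)" for F :: "'a::comm_ring_1 fps fps"
proof (induct rule: fpoly_induct)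
  case (mono c i j)
  then show ?case by (induct rule: fpoly_induct) (auto simp: mono2_mult distrib_left)
qed (simp add: distrib_right)

lemma const_mono2: "fps_const (fps_const c) = mono2 c 0 0" 
  and X_mono2: "fps_X = mono2 1 1 0" and Y_mono2: "fps_const fps_X = mono2 1 0 1"
  by (simp_all add: mono2_def)

lemma one_mono2: "1 = mono2 1 0 0" by (simp add: mono2_def)

lemma fpoly_const [simp]: "fpoly (fps_const (fps_const (c :: 'a::comm_ring_1)))" "fpoly (1 :: 'a::comm_ring_1 fps fps)"
  "fpoly (fps_X :: 'a::comm_ring_1 fps fps)" "fpoly (fps_const fps_X :: 'a::comm_ring_1 fps fps)"
  by (simp_all only: const_mono2 X_mono2 Y_mono2 one_mono2 fpoly_mono2)

lemma fpoly_p [simp]: "fpoly px" "fpoly py" by (simp_all add: px_def py_def)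

lemma fpoly_minus [simp]: "fpoly F \<Longrightarrow> fpoly (- F)" for F :: "'a::comm_ring_1 fps fps"
  by (simp add: fpoly_def psupp_def)

lemma fpoly_diff [simp]: "fpoly F \<Longrightarrow> fpoly G \<Longrightarrow> fpoly (F - G)" for F :: "'a::comm_ring_1 fps fps"
  by (metis fpoly_add fpoly_minus uminus_add_conv_diff add.commute)

lemma fpoly_scaleR [simp]: "fpoly F \<Longrightarrow> fpoly (r *\<^sub>R F)" for F :: plane
  by (simp add: scaleR_plane)

lemma fpoly_power [simp]: "fpoly F \<Longrightarrow> fpoly (F ^ n)" for F :: "'a::comm_ring_1 fps fps"
  by (induct n) auto

lemma ddx_mono2: "ddx (mono2 c i j) = mono2 (of_nat i * c) (i - 1) j"
  and ddy_mono2: "ddy (mono2 c i j) = mono2 (of_nat j * c) i (j - 1)"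
  by (rule pcoeff_eqI; cases i; cases j; auto)+

lemma fpoly_dd [simp]: "fpoly F \<Longrightarrow> fpoly (ddx F)" "fpoly F \<Longrightarrow> fpoly (ddy F)" for F :: "'a::comm_ring_1 fps fps"
  by (induct rule: fpoly_induct; simp add: ddx_mono2 ddy_mono2)+

lemma fpoly_d [simp]: "fpoly F \<Longrightarrow> fpoly (dx F)" "fpoly F \<Longrightarrow> fpoly (dy F)"
  by (simp_all add: dx_ddx dy_ddy)

lemma fpoly_bound: "fpoly F \<longleftrightarrow> (\<exists>N. \<forall>i j. N < i + j \<longrightarrow> pcoeff F i j = 0)"
proof
  assume "fpoly F"
  then have "finite ((\<lambda>p. fst p + snd p) ` psupp F)" unfolding fpoly_def by simp
  then obtain N where "\<forall>n\<in>(\<lambda>p. fst p + snd p) ` psupp F. n \<le> N" using finite_nat_set_iff_bounded_le by blast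
  then show "\<exists>N. \<forall>i j. N < i + j \<longrightarrow> pcoeff F i j = 0" by (intro exI[of _ N]) (force simp: psupp_def)
next
  assume "\<exists>N. \<forall>i j. N < i + j \<longrightarrow> pcoeff F i j = 0"
  then obtain N where N: "\<forall>i j. N < i + j \<longrightarrow> pcoeff F i j = 0" by blast
  then have "psupp F \<subseteq> {..N} \<times> {..N}" by (force simp: psupp_def)
  then show "fpoly F" unfolding fpoly_def by (rule finite_subset) simp
qed

lemma is_polynomial_fpoly: "is_polynomial f \<longleftrightarrow> fpoly f"
  by (simp add: is_polynomial_def fpoly_bound)

lemma fpoly_polys_upto: "f \<in> polys_upto N \<Longrightarrow> fpoly f"
  by (auto simp: polys_upto_def fpoly_bound)

text \<open>One construction for two purposes: with h embedding coefficients as constant series it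
  is substitution of series (\<open>psub\<close>), with h the identity it is evaluation at a point
  (\<open>ev\<close>). It is meant for polynomials, whose support is finite.\<close>

definition evl :: "('a \<Rightarrow> 'b) \<Rightarrow> 'b \<Rightarrow> 'b \<Rightarrow> 'a::zero fps fps \<Rightarrow> 'b::comm_ring_1" where
  "evl h u w F = (\<Sum>p\<in>psupp F. h (pcoeff F (fst p) (snd p)) * (u ^ fst p * w ^ snd p))"

locale coeff_hom =
  fixes h :: "'a::comm_ring_1 \<Rightarrow> 'b::comm_ring_1"
  assumes h_add: "h (a + b) = h a + h b" and h_mult: "h (a * b) = h a * h b" and h_one: "h 1 = 1"
begin

lemma h_zero: "h 0 = 0" using h_add[of 0 0] by simp

lemma evl_superset:
  assumes "finite S" "psupp F \<subseteq> S"
  shows "evl h u w F = (\<Sum>p\<in>S. h (pcoeff F (fst p) (snd p)) * (u ^ fst p * w ^ snd p))"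
  unfolding evl_def by (rule sum.mono_neutral_left) (use assms in \<open>auto simp: psupp_def h_zero\<close>)

lemma evl_add: assumes "fpoly F" "fpoly G" shows "evl h u w (F + G) = evl h u w F + evl h u w G"
proof -
  have S: "finite (psupp F \<union> psupp G)" using assms by (simp add: fpoly_def)
  show ?thesis
    by (simp add: evl_superset[OF S] psupp_add h_add distrib_right sum.distrib)
qed

lemma evl_mono2: "evl h u w (mono2 c i j) = h c * (u ^ i * w ^ j)"
  by (subst evl_superset[OF _ psupp_mono2]) auto

lemma evl_mult: "fpoly F \<Longrightarrow> fpoly G \<Longrightarrow> evl h u w (F * G) = evl h u w F * evl h u w G"
proof (induct rule: fpoly_induct)
  case (mono c i j)
  then show ?case
    by (induct rule: fpoly_induct)
       (auto simp: mono2_mult evl_mono2 h_mult power_add evl_add algebra_simps)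
qed (simp add: distrib_right evl_add)

lemma evl_const [simp]: "evl h u w (fps_const (fps_const c)) = h c"
  and evl_X [simp]: "evl h u w fps_X = u" and evl_Y [simp]: "evl h u w (fps_const fps_X) = w"
  and evl_one [simp]: "evl h u w 1 = 1"
  by (simp_all only: const_mono2 X_mono2 Y_mono2 one_mono2 evl_mono2 h_one) simp_all

lemma evl_zero [simp]: "evl h u w 0 = 0" by (simp add: evl_def psupp_def)

lemma evl_minus: assumes "fpoly F" shows "evl h u w (- F) = - evl h u w F"
  using evl_add[of F "- F"] assms by (simp add: eq_neg_iff_add_eq_0 add.commute)

lemma evl_diff: "fpoly F \<Longrightarrow> fpoly G \<Longrightarrow> evl h u w (F - G) = evl h u w F - evl h u w G"
  using evl_add[of F "- G" u w] evl_minus[of G] by simp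

lemma evl_power: "fpoly F \<Longrightarrow> evl h u w (F ^ n) = evl h u w F ^ n"
  by (induct n) (auto simp: evl_mult)

end

definition psub :: "'a::comm_ring_1 fps fps \<Rightarrow> 'a fps fps \<Rightarrow> 'a fps fps \<Rightarrow> 'a fps fps" where
  "psub = evl (\<lambda>c. fps_const (fps_const c))"

definition ev :: "real \<Rightarrow> real \<Rightarrow> plane \<Rightarrow> real" where
  "ev = evl (\<lambda>c. c)"

interpretation ps: coeff_hom "\<lambda>c::'a::comm_ring_1. fps_const (fps_const c)"
  rewrites "evl (\<lambda>c::'a::comm_ring_1. fps_const (fps_const c)) = psub"
  by unfold_locales (simp_all add: psub_def)

interpretation ev: coeff_hom "\<lambda>c::real. c" rewrites "evl (\<lambda>c::real. c) = ev"
  by unfold_locales (simp_all add: ev_def)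

lemma psub_px [simp]: "psub u w px = u" "psub u w py = w"
  by (simp_all add: px_def py_def)

lemma psub_scaleR: "fpoly F \<Longrightarrow> psub u w (r *\<^sub>R F) = r *\<^sub>R psub u w F" for F :: plane
  by (simp add: scaleR_plane ps.evl_mult)

lemma ev_scaleR: "fpoly F \<Longrightarrow> ev a b (r *\<^sub>R F) = r * ev a b F"
  by (simp add: scaleR_plane ev.evl_mult)

lemma ev_px [simp]: "ev a b px = a" "ev a b py = b"
  by (simp_all add: px_def py_def)

text \<open>The index set in \<open>subst2\<close> omits only terms that contribute zero to the
  coefficient, so for a polynomial both are the same finite sum.\<close>

lemma subst2_psub:
  assumes "fpoly f" shows "subst2 f u w = psub u w f"
proof (rule pcoeff_eqI)
  fix m n
  let ?S = "{(i, j). pcoeff f i j \<noteq> 0 \<and> pcoeff (u ^ i * w ^ j) m n \<noteq> 0}"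
  have "pcoeff (psub u w f) m n = (\<Sum>p\<in>psupp f. pcoeff f (fst p) (snd p) * pcoeff (u ^ fst p * w ^ snd p) m n)"
    by (simp add: psub_def evl_def pcoeff_sum)
  also have "\<dots> = (\<Sum>p\<in>?S. pcoeff f (fst p) (snd p) * pcoeff (u ^ fst p * w ^ snd p) m n)"
    by (rule sum.mono_neutral_right) (use assms in \<open>auto simp: psupp_def fpoly_def\<close>)
  finally show "pcoeff (subst2 f u w) m n = pcoeff (psub u w f) m n"
    by (simp add: subst2_def pcoeff_def[of "Abs_fps _"] split_beta)
qed

lemma fpoly_psub [simp]: "fpoly F \<Longrightarrow> fpoly u \<Longrightarrow> fpoly w \<Longrightarrow> fpoly (psub u w F)"
  by (induct rule: fpoly_induct) (auto simp: ps.evl_mono2 ps.evl_add)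

lemma psub_psub:
  assumes "fpoly F" "fpoly u" "fpoly w"
  shows "psub u' w' (psub u w F) = psub (psub u' w' u) (psub u' w' w) F"
  using assms
  by (induct rule: fpoly_induct) (simp_all add: ps.evl_mono2 ps.evl_add ps.evl_mult ps.evl_power)

lemma ev_psub:
  assumes "fpoly F" "fpoly u" "fpoly w"
  shows "ev a b (psub u w F) = ev (ev a b u) (ev a b w) F"
  using assms
  by (induct rule: fpoly_induct)
     (simp_all add: ps.evl_mono2 ps.evl_add ev.evl_add ev.evl_mult ev.evl_power ev.evl_mono2)

lemma psub_id: "fpoly F \<Longrightarrow> psub px py F = F"
proof (induct rule: fpoly_induct)
  case (mono c i j)
  then show ?case by (simp add: ps.evl_mono2) (simp add: mono2_def px_def py_def)
qed (simp add: ps.evl_add)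

lemma ddx_psub:
  assumes "fpoly F"
  shows "ddx (psub u w F) = psub u w (ddx F) * ddx u + psub u w (ddy F) * ddx w"
  using assms
proof (induct rule: fpoly_induct)
  case (mono c i j)
  have "fps_const (fps_const (of_nat n * c)) = of_nat n * fps_const (fps_const c)" for n
    by (metis fps_const_mult fps_of_nat)
  then show ?case
    by (simp add: ps.evl_mono2 ddx_mono2 ddy_mono2 ddx_mult ddx_power del: fps_const_mult) (simp add: algebra_simps)
qed (simp add: ps.evl_add algebra_simps)

lemma ddy_psub:
  assumes "fpoly F"
  shows "ddy (psub u w F) = psub u w (ddx F) * ddy u + psub u w (ddy F) * ddy w"
  using assms
proof (induct rule: fpoly_induct)
  case (mono c i j)
  have "fps_const (fps_const (of_nat n * c)) = of_nat n * fps_const (fps_const c)" for n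
    by (metis fps_const_mult fps_of_nat)
  then show ?case
    by (simp add: ps.evl_mono2 ddx_mono2 ddy_mono2 ddy_mult ddy_power del: fps_const_mult) (simp add: algebra_simps)
qed (simp add: ps.evl_add algebra_simps)

lemma ev_has_derivative:
  assumes "fpoly F" "(p has_real_derivative p') (at t)" "(q has_real_derivative q') (at t)"
  shows "((\<lambda>t. ev (p t) (q t) F) has_real_derivative
           ev (p t) (q t) (dx F) * p' + ev (p t) (q t) (dy F) * q') (at t)"
  using assms(1)
proof (induct rule: fpoly_induct)
  case (mono c i j)
  show ?case unfolding dx_ddx dy_ddy ev.evl_mono2 ddx_mono2 ddy_mono2
    by (rule derivative_eq_intros assms(2,3) refl)+ (simp add: algebra_simps)
next
  case (add F G)
  then show ?case
    by (auto simp: ev.evl_add algebra_simps dest: DERIV_add)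
qed

lemma ev_polys_upto:
  assumes "\<forall>i j. N < i + j \<longrightarrow> pcoeff F i j = 0"
  shows "ev a b F = (\<Sum>p\<in>{..N}\<times>{..N}. pcoeff F (fst p) (snd p) * (a ^ fst p * b ^ snd p))"
  by (rule ev.evl_superset) (use assms in \<open>force simp: psupp_def\<close>)+

lemma ev00: "fpoly F \<Longrightarrow> ev 0 0 F = pcoeff F 0 0"
proof (induct rule: fpoly_induct)
  case (mono c i j)
  then show ?case by (cases i; cases j) (auto simp: ev.evl_mono2)
qed (simp add: ev.evl_add)

lemma fpoly_nc [simp]: "fpoly h \<Longrightarrow> fpoly (nc h)" by (simp add: nc_def)

text \<open>Substitution fixes constants, so it descends to polynomials modulo constants.\<close>

lemma nc_psub_nc: "fpoly h \<Longrightarrow> nc (psub u w (nc h)) = nc (psub u w h)"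
  by (simp add: nc_def[of h] ps.evl_diff psub_scaleR nc_lin) (simp add: nc_def)

lemma d_nc [simp]: "dx (nc h) = dx h" "dy (nc h) = dy h"
  by (simp_all add: nc_def)

text \<open>Serves both as component of an affine vector field and as coordinate of an affine map.
  In the second role substitution is composition of maps (\<open>lin_psub\<close>).\<close>

definition lin :: "real^2^2 \<Rightarrow> real^2 \<Rightarrow> 2 \<Rightarrow> plane" where
  "lin A b r = (A $ r $ 1) *\<^sub>R px + (A $ r $ 2) *\<^sub>R py + (b $ r) *\<^sub>R 1"

lemma fpoly_lin [simp]: "fpoly (lin A b r)" by (simp add: lin_def)

lemma d_lin [simp]: "dx (lin A b r) = (A $ r $ 1) *\<^sub>R 1" "dy (lin A b r) = (A $ r $ 2) *\<^sub>R 1"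
  by (simp_all add: lin_def)

lemma ev_lin: "ev x y (lin A b r) = A $ r $ 1 * x + A $ r $ 2 * y + b $ r"
  by (simp add: lin_def ev.evl_add ev_scaleR)

lemma aff_field_fld: "aff_field (A, b) = fld (lin A b 1) (lin A b 2) 0"
proof -
  have "r *\<^sub>R hp1 = emb (r *\<^sub>R px)" "r *\<^sub>R hp2 = emb (r *\<^sub>R py)" "r *\<^sub>R (1::ham) = emb (r *\<^sub>R 1)" for r
    by (simp_all add: emb_scaleR hp1_def hp2_def)
  then show ?thesis by (simp add: aff_field_def lin_def field_fld flip: emb_simps)
qed

lemma lin_psub: "psub (lin B d 1) (lin B d 2) (lin A b r) = lin (A ** B) (A *v d + b) r"
proof -
  have "psub (lin B d 1) (lin B d 2) (lin A b r) =
     (A $ r $ 1) *\<^sub>R lin B d 1 + (A $ r $ 2) *\<^sub>R lin B d 2 + (b $ r) *\<^sub>R 1"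
    unfolding lin_def[of A] by (simp add: ps.evl_add psub_scaleR)
  then show ?thesis
    by (simp add: lin_def matrix_matrix_mult_def matrix_vector_mult_def sum_2 algebra_simps scaleR_add_left)
qed

section \<open>Affine maps and their action on polynomials\<close>

lemma aff_group_simps [simp]:
  "carrier aff_group = {(A, b). invertible A}"
  "(A, b) \<otimes>\<^bsub>aff_group\<^esub> (A', b') = (A ** A', A *v b' + b)"
  "\<one>\<^bsub>aff_group\<^esub> = (mat 1, 0)"
  by (simp_all add: aff_group_def)

lemma matrix_inv_cancel: "invertible (A::real^2^2) \<Longrightarrow> A ** matrix_inv A = mat 1 \<and> matrix_inv A ** A = mat 1"
  unfolding invertible_def matrix_inv_def by (rule someI_ex)

lemma invertible_matrix_inv: "invertible (A::real^2^2) \<Longrightarrow> invertible (matrix_inv A)"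
  using matrix_inv_cancel invertible_def by blast

lemma group_aff: "group aff_group"
proof (rule groupI)
  fix x y z assume "x \<in> carrier aff_group" "y \<in> carrier aff_group" "z \<in> carrier aff_group"
  then show "x \<otimes>\<^bsub>aff_group\<^esub> y \<otimes>\<^bsub>aff_group\<^esub> z = x \<otimes>\<^bsub>aff_group\<^esub> (y \<otimes>\<^bsub>aff_group\<^esub> z)"
    by (cases x; cases y; cases z)
       (simp add: matrix_mul_assoc matrix_vector_mul_assoc matrix_vector_right_distrib)
next
  fix x assume "x \<in> carrier aff_group"
  then obtain A b where x: "x = (A, b)" "invertible A" by auto
  then show "\<exists>y\<in>carrier aff_group. y \<otimes>\<^bsub>aff_group\<^esub> x = \<one>\<^bsub>aff_group\<^esub>"
    using matrix_inv_cancel[OF x(2)] invertible_matrix_inv[OF x(2)]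
    by (intro bexI[of _ "(matrix_inv A, - (matrix_inv A *v b))"]) auto
qed (auto simp: invertible_mult invertible_def[of "mat 1"] intro: exI[of _ "mat 1"])

lemma inv_aff:
  assumes "invertible A" shows "inv\<^bsub>aff_group\<^esub> (A, b) = (matrix_inv A, - (matrix_inv A *v b))"
proof (rule group.inv_equality[OF group_aff])
  show "(matrix_inv A, - (matrix_inv A *v b)) \<otimes>\<^bsub>aff_group\<^esub> (A, b) = \<one>\<^bsub>aff_group\<^esub>"
    using matrix_inv_cancel[OF assms] by simp
qed (use assms invertible_matrix_inv in auto)

lemma aff_act_psub:
  assumes "fpoly f" shows "aff_act \<phi> f = (case inv\<^bsub>aff_group\<^esub> \<phi> of (B, d) \<Rightarrow> nc (psub (lin B d 1) (lin B d 2) f))"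
  by (simp add: aff_act_def Let_def subst2_psub[OF assms] nc_def lin_def split: prod.split)

lemma fpoly_aff_act [simp]: "fpoly f \<Longrightarrow> fpoly (aff_act \<phi> f)"
  by (simp add: aff_act_psub split: prod.split)

lemma aff_act_add: "fpoly f \<Longrightarrow> fpoly g \<Longrightarrow> aff_act \<phi> (f + g) = aff_act \<phi> f + aff_act \<phi> g"
  by (simp add: aff_act_psub ps.evl_add nc_lin split: prod.split)

text \<open>Inversion reverses the order of the product and substitution reverses it once more,
  which makes composition with the inverse map a left action.\<close>

lemma aff_act_mult:
  assumes "\<phi> \<in> carrier aff_group" "\<psi> \<in> carrier aff_group" "fpoly f"
  shows "aff_act (\<phi> \<otimes>\<^bsub>aff_group\<^esub> \<psi>) f = aff_act \<phi> (aff_act \<psi> f)"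
proof -
  obtain A a B b where i: "inv\<^bsub>aff_group\<^esub> \<phi> = (A, a)" "inv\<^bsub>aff_group\<^esub> \<psi> = (B, b)" by fastforce
  have "inv\<^bsub>aff_group\<^esub> (\<phi> \<otimes>\<^bsub>aff_group\<^esub> \<psi>) = (B ** A, B *v a + b)"
    using group.inv_mult_group[OF group_aff assms(1,2)] i by simp
  then show ?thesis
    by (simp add: aff_act_psub assms i nc_psub_nc psub_psub lin_psub)
qed

lemma lin_id: "lin (mat 1) 0 1 = px" "lin (mat 1) 0 2 = py"
  by (simp_all add: lin_def mat_def)

lemma aff_act_one: "fpoly f \<Longrightarrow> pcoeff f 0 0 = 0 \<Longrightarrow> aff_act \<one>\<^bsub>aff_group\<^esub> f = f"
  using inv_aff[of "mat 1" 0] matrix_inv_cancel[of "mat 1"]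
  by (simp add: aff_act_psub lin_id psub_id nc_id invertible_def)

text \<open>By the chain rule, the differential of the transported function at the image point is
  the old differential times the inverse matrix. This is the transformation law of covectors under
  the cotangent lift.\<close>

lemma ev_d_aff_act:
  assumes f: "fpoly f" and A: "invertible A"
  shows "ev (A $ 1 $ 1 * x + A $ 1 $ 2 * y + a $ 1) (A $ 2 $ 1 * x + A $ 2 $ 2 * y + a $ 2) (dx (aff_act (A, a) f)) =
      ev x y (dx f) * matrix_inv A $ 1 $ 1 + ev x y (dy f) * matrix_inv A $ 2 $ 1" (is "ev ?X ?Y _ = _")
    and "ev (A $ 1 $ 1 * x + A $ 1 $ 2 * y + a $ 1) (A $ 2 $ 1 * x + A $ 2 $ 2 * y + a $ 2) (dy (aff_act (A, a) f)) =
      ev x y (dx f) * matrix_inv A $ 1 $ 2 + ev x y (dy f) * matrix_inv A $ 2 $ 2"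
proof -
  let ?C = "matrix_inv A" let ?d = "- (?C *v a)"
  have "?C *v (A *v (vector [x, y] :: real^2) + a) + ?d = vector [x, y]"
    using matrix_inv_cancel[OF A] by (simp add: matrix_vector_mul_assoc matrix_vector_right_distrib)
  moreover have "A *v (vector [x, y] :: real^2) + a = vector [?X, ?Y]"
    by (simp add: vec_eq_iff forall_2 matrix_vector_mult_def sum_2)
  ultimately have *: "?C *v vector [?X, ?Y] + ?d = vector [x, y]" by simp
  have "(?C *v vector [?X, ?Y] + ?d) $ r = ?C $ r $ 1 * ?X + ?C $ r $ 2 * ?Y + ?d $ r" for r
    by (simp add: matrix_vector_mult_def sum_2)
  then have e: "ev ?X ?Y (lin ?C ?d 1) = x" "ev ?X ?Y (lin ?C ?d 2) = y"
    unfolding ev_lin * by (metis vector_2)+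
  define X Y where XY: "X = ?X" "Y = ?Y"
  note e = e[folded XY]
  show "ev ?X ?Y (dx (aff_act (A, a) f)) = ev x y (dx f) * ?C $ 1 $ 1 + ev x y (dy f) * ?C $ 2 $ 1"
       "ev ?X ?Y (dy (aff_act (A, a) f)) = ev x y (dx f) * ?C $ 1 $ 2 + ev x y (dy f) * ?C $ 2 $ 2"
    unfolding XY[symmetric]
    using f by (simp_all add: aff_act_psub inv_aff[OF A] dx_ddx dy_ddy ddx_psub ddy_psub d_lin[unfolded dx_ddx dy_ddy]
       d_nc[unfolded dx_ddx dy_ddy] ev.evl_add ev_scaleR ev_psub e)
qed

section \<open>The semidirect sums as Lie algebras\<close>

lemma lin_add: "lin A b r + lin A' b' r = lin (A + A') (b + b') r"
  and lin_diff: "lin A b r - lin A' b' r = lin (A - A') (b - b') r"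
  and lin_scaleR: "c *\<^sub>R lin A b r = lin (c *\<^sub>R A) (c *\<^sub>R b) r"
  and lin_zero [simp]: "lin 0 0 r = 0"
  by (simp_all add: lin_def algebra_simps scaleR_add_left)

text \<open>Matrices are composed in reverse order here, so that brackets of affine fields carry the
  matrix commutator with the opposite sign (\<open>pb_gg\<close>).\<close>

lemma lin_act: "lin A b 1 * dx (lin A' b' r) + lin A b 2 * dy (lin A' b' r) = lin (A' ** A) (A' *v b) r"
  by (simp add: lin_def matrix_matrix_mult_def matrix_vector_mult_def sum_2 algebra_simps scaleR_add_left)

lemma pcoeff_lin: "pcoeff (lin A b r) i j = (if i = 1 \<and> j = 0 then A $ r $ 1 else if i = 0 \<and> j = 1 then A $ r $ 2
     else if i = 0 \<and> j = 0 then b $ r else 0)"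
  by (auto simp: lin_def)

lemma lin_inject: "lin A b 1 = lin A' b' 1 \<Longrightarrow> lin A b 2 = lin A' b' 2 \<Longrightarrow> A = A' \<and> b = b'"
proof -
  assume *: "lin A b 1 = lin A' b' 1" "lin A b 2 = lin A' b' 2"
  have "pcoeff (lin A b r) i j = pcoeff (lin A' b' r) i j" if "r = 1 \<or> r = 2" for i j and r :: 2
    using * that by auto
  from this[of _ 1 0] this[of _ 0 1] this[of _ 0 0] show ?thesis
    by (simp add: pcoeff_lin vec_eq_iff forall_2)
qed

lemma php_lin_eq: "php 0 (lin A b r) = b $ r *\<^sub>R 1" "php (Suc 0) (lin A b r) = lin A 0 r" 
  by (rule pcoeff_eqI; auto simp: pcoeff_lin)+

lemma php1: "php (Suc 0) f = pcoeff f 1 0 *\<^sub>R px + pcoeff f 0 1 *\<^sub>R py"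
proof (rule pcoeff_eqI)
  fix i j show "pcoeff (php (Suc 0) f) i j = pcoeff (pcoeff f 1 0 *\<^sub>R px + pcoeff f 0 1 *\<^sub>R py) i j"
    by (cases i; cases j) auto
qed

lemma span_V: "span {hp1, hp2, hq1, hq2} = {fld (r *\<^sub>R 1) (s *\<^sub>R 1) (t *\<^sub>R px + u *\<^sub>R py) | r s t u. True}"
proof -
  have "x \<in> span {hp1, hp2, hq1, hq2} \<longleftrightarrow> (\<exists>t u r s. x - t *\<^sub>R hp1 - u *\<^sub>R hp2 - r *\<^sub>R hq1 - s *\<^sub>R hq2 = 0)" for x
    by (simp add: span_breakdown_eq)
  moreover have "x - t *\<^sub>R hp1 - u *\<^sub>R hp2 - r *\<^sub>R hq1 - s *\<^sub>R hq2 = 0 \<longleftrightarrow>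
      x = fld (r *\<^sub>R 1) (s *\<^sub>R 1) (t *\<^sub>R px + u *\<^sub>R py)" for x r s t u
  proof -
    have "fld (r *\<^sub>R 1) (s *\<^sub>R 1) (t *\<^sub>R px + u *\<^sub>R py) = t *\<^sub>R hp1 + u *\<^sub>R hp2 + r *\<^sub>R hq1 + s *\<^sub>R hq2"
      by (simp add: hp1_fld hp2_fld hq1_fld hq2_fld fld_ops)
    then show ?thesis by (simp add: algebra_simps)
  qed
  ultimately show ?thesis unfolding set_eq_iff mem_Collect_eq by blast
qed

lemma span_q: "span {hq1, hq2} = {fld (r *\<^sub>R 1) (s *\<^sub>R 1) 0 | r s. True}"
proof -
  have "x \<in> span {hq1, hq2} \<longleftrightarrow> (\<exists>r s. x - r *\<^sub>R hq1 - s *\<^sub>R hq2 = 0)" for x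
    by (simp add: span_breakdown_eq)
  moreover have "x - r *\<^sub>R hq1 - s *\<^sub>R hq2 = 0 \<longleftrightarrow> x = fld (r *\<^sub>R 1) (s *\<^sub>R 1) 0" for x r s
  proof -
    have "fld (r *\<^sub>R 1) (s *\<^sub>R 1) 0 = r *\<^sub>R hq1 + s *\<^sub>R hq2"
      by (simp add: hq1_fld hq2_fld fld_ops)
    then show ?thesis by (simp add: algebra_simps)
  qed
  ultimately show ?thesis by auto
qed

lemma span_quadrics: "span {px\<^sup>2, px * py, py\<^sup>2} = {f. \<forall>i j. i + j \<noteq> 2 \<longrightarrow> pcoeff f i j = 0}"
proof -
  have q: "pcoeff (px\<^sup>2) i j = (if i = 2 \<and> j = 0 then 1 else 0)" "pcoeff (px * py) i j = (if i = 1 \<and> j = 1 then 1 else 0)"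
    "pcoeff (py\<^sup>2) i j = (if i = 0 \<and> j = 2 then 1 else 0)" for i j
    unfolding power2_eq_square by auto
  have "f \<in> span {px\<^sup>2, px * py, py\<^sup>2} \<longleftrightarrow> (\<exists>a b c. f = a *\<^sub>R px\<^sup>2 + b *\<^sub>R (px * py) + c *\<^sub>R py\<^sup>2)" for f
  proof -
    have "x - u - v - w = 0 \<longleftrightarrow> x = u + v + w" for x u v w :: plane by (auto simp: algebra_simps)
    then show ?thesis by (simp only: span_breakdown_eq span_empty singleton_iff)
  qed
  moreover have "(\<exists>a b c. f = a *\<^sub>R px\<^sup>2 + b *\<^sub>R (px * py) + c *\<^sub>R py\<^sup>2) \<longleftrightarrow> (\<forall>i j. i + j \<noteq> 2 \<longrightarrow> pcoeff f i j = 0)" for f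
  proof
    assume "\<forall>i j. i + j \<noteq> 2 \<longrightarrow> pcoeff f i j = 0"
    then have "f = pcoeff f 2 0 *\<^sub>R px\<^sup>2 + pcoeff f 1 1 *\<^sub>R (px * py) + pcoeff f 0 2 *\<^sub>R py\<^sup>2"
      by (intro pcoeff_eqI) (simp only: pcoeff_simps pcoeff_scaleR q, auto)
    then show "\<exists>a b c. f = a *\<^sub>R px\<^sup>2 + b *\<^sub>R (px * py) + c *\<^sub>R py\<^sup>2" by blast
  qed (auto simp: q)
  ultimately show ?thesis by blast
qed

lemma subspace_polys_upto: "subspace (polys_upto N)"
  by (rule subspaceI) (auto simp: polys_upto_def)

text \<open>The matrix of the linear field \<alpha> E - J. Its eigenvalues \<alpha> + i and \<alpha>
  - i are not real.\<close>

definition rot_mat :: "real \<Rightarrow> real^2^2" where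
  "rot_mat \<alpha> = vector [vector [\<alpha>, 1], vector [-1, \<alpha>]]"

lemma rot_mat_simps [simp]: "rot_mat \<alpha> $ 1 $ 1 = \<alpha>" "rot_mat \<alpha> $ 1 $ 2 = 1" "rot_mat \<alpha> $ 2 $ 1 = -1" "rot_mat \<alpha> $ 2 $ 2 = \<alpha>"
  by (simp_all add: rot_mat_def)

definition aff_alg :: "(real^2^2) set \<Rightarrow> ham set" where
  "aff_alg l = {aff_field (A, b) | A b. A \<in> l}"

definition lie_act :: "real^2^2 \<Rightarrow> real^2 \<Rightarrow> plane \<Rightarrow> plane" where
  "lie_act A b f = nc (lin A b 1 * dx f + lin A b 2 * dy f)"

lemma aff_alg_fld: "aff_alg l = {fld (lin A b 1) (lin A b 2) 0 | A b. A \<in> l}"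
  by (simp add: aff_alg_def aff_field_fld)

lemma mem_set_sum: "x \<in> A \<oplus>\<^sub>s B \<longleftrightarrow> (\<exists>u\<in>A. \<exists>v\<in>B. x = u + v)"
  by (auto simp: set_sum_def)

lemma fld_plus_emb: "fld a b 0 + emb f = fld a b f"
  by (simp add: emb_fld fld_add)

lemma set_sum_embI: "fld a b 0 \<in> A \<Longrightarrow> f \<in> X \<Longrightarrow> fld a b f \<in> A \<oplus>\<^sub>s emb ` X"
  unfolding mem_set_sum by (metis fld_plus_emb imageI)

text \<open>The common ground of all four cases: an affine algebra with linear part l and a module
  of polynomials. \<open>l_rot\<close> yields primitivity, \<open>xi_p\<close> transitivity, and
  \<open>xi_php\<close> the description of the isotropy algebra and the existence of cubics.\<close>

locale star_alg =
  fixes l :: "(real^2^2) set" and \<xi> :: "plane set" and N :: nat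
  assumes l_sub: "subspace l"
    and l_bracket: "\<And>A B. A \<in> l \<Longrightarrow> B \<in> l \<Longrightarrow> A ** B - B ** A \<in> l"
    and l_rot: "\<exists>\<alpha>. rot_mat \<alpha> \<in> l"
    and xi_sub: "subspace \<xi>"
    and xi_deg: "\<xi> \<subseteq> polys_upto N"
    and xi_p: "px \<in> \<xi>" "py \<in> \<xi>"
    and xi_php: "\<And>f k. f \<in> \<xi> \<Longrightarrow> php k f \<in> \<xi>"
    and xi_lie: "\<And>A b f. A \<in> l \<Longrightarrow> f \<in> \<xi> \<Longrightarrow> lie_act A b f \<in> \<xi>"
begin

abbreviation "gg \<equiv> star_algebra (aff_alg l) \<xi>"

lemma xi_fpoly: "f \<in> \<xi> \<Longrightarrow> fpoly f" using xi_deg fpoly_polys_upto by blast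
lemma xi_00: "f \<in> \<xi> \<Longrightarrow> pcoeff f 0 0 = 0" using xi_deg by (auto simp: polys_upto_def)
lemma xi_bound: "f \<in> \<xi> \<Longrightarrow> \<forall>i j. N < i + j \<longrightarrow> pcoeff f i j = 0" using xi_deg by (auto simp: polys_upto_def)

lemma gg_fld: "gg = {fld (lin A b 1) (lin A b 2) f | A b f. A \<in> l \<and> f \<in> \<xi>}"
proof
  show "gg \<subseteq> {fld (lin A b 1) (lin A b 2) f | A b f. A \<in> l \<and> f \<in> \<xi>}"
    unfolding star_algebra_def by (auto simp: mem_set_sum aff_alg_fld fld_plus_emb simp del: fld_eq_iff) blast
  show "{fld (lin A b 1) (lin A b 2) f | A b f. A \<in> l \<and> f \<in> \<xi>} \<subseteq> gg"
    unfolding star_algebra_def by (auto simp: aff_alg_fld intro!: set_sum_embI)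
qed

lemma gg_memI: "A \<in> l \<Longrightarrow> f \<in> \<xi> \<Longrightarrow> fld (lin A b 1) (lin A b 2) f \<in> gg"
  by (auto simp: gg_fld)

lemma zero_l: "0 \<in> l" using l_sub subspace_0 by blast
lemma zero_xi: "0 \<in> \<xi>" using xi_sub subspace_0 by blast

lemma aff_alg_gg: "aff_alg l \<subseteq> gg"
  using gg_memI[OF _ zero_xi] by (auto simp: aff_alg_fld)

lemma emb_gg: "f \<in> \<xi> \<Longrightarrow> fld 0 0 f \<in> gg"
  using gg_memI[OF zero_l, of f 0] by simp

lemma subspace_gg: "subspace gg"
proof (rule subspaceI)
  show "0 \<in> gg" using emb_gg[OF zero_xi] by (simp add: fld_zero)
  fix x y c assume x: "x \<in> gg" and y: "y \<in> gg"
  obtain A b f where xe: "x = fld (lin A b 1) (lin A b 2) f" "A \<in> l" "f \<in> \<xi>" using x unfolding gg_fld by blast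
  obtain A' b' f' where ye: "y = fld (lin A' b' 1) (lin A' b' 2) f'" "A' \<in> l" "f' \<in> \<xi>" using y unfolding gg_fld by blast
  show "x + y \<in> gg" unfolding xe(1) ye(1) fld_add lin_add
    by (intro gg_memI subspace_add[OF l_sub] subspace_add[OF xi_sub] xe ye)
  show "c *\<^sub>R x \<in> gg" unfolding xe(1) fld_scaleR lin_scaleR
    by (intro gg_memI subspace_scale[OF l_sub] subspace_scale[OF xi_sub] xe)
qed

lemma pb_gg: "pb (fld (lin A b 1) (lin A b 2) f) (fld (lin A' b' 1) (lin A' b' 2) f') =
    fld (lin (A' ** A - A ** A') (A' *v b - A *v b') 1) (lin (A' ** A - A ** A') (A' *v b - A *v b') 2)
      (lie_act A b f' - lie_act A' b' f)"
  unfolding pb_fld lin_act lin_diff lie_act_def nc_lin(2)[symmetric] ..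

lemma lie_subalgebra_gg: "lie_subalgebra gg"
  unfolding lie_subalgebra_def
proof (intro conjI subspace_gg ballI)
  fix u v assume "u \<in> gg" "v \<in> gg"
  then obtain A b f A' b' f' where *: "u = fld (lin A b 1) (lin A b 2) f" "v = fld (lin A' b' 1) (lin A' b' 2) f'"
     "A \<in> l" "A' \<in> l" "f \<in> \<xi>" "f' \<in> \<xi>" unfolding gg_fld by blast
  show "pb u v \<in> gg" unfolding *(1,2) pb_gg
    by (intro gg_memI l_bracket subspace_diff[OF xi_sub] xi_lie) (use * in auto)
qed

lemma gg_p1_inf: "gg \<subseteq> p1_inf"
  using xi_00 by (auto simp: gg_fld p1_inf_fld)

lemma finite_dim_gg: "finite_dim gg"
proof -
  define B where "B = {fld px 0 0, fld py 0 0, fld 1 0 0, fld 0 px 0, fld 0 py 0, fld 0 1 0} \<union>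
     (\<lambda>p. fld 0 0 (mono2 1 (fst p) (snd p))) ` ({..N} \<times> {..N})"
  have in_B: "x \<in> span B" if "x \<in> B" for x using that by (rule span_base)
  have "fld (lin A b 1) (lin A b 2) f \<in> span B" if f: "f \<in> \<xi>" for A b f
  proof -
    have 1: "fld (lin A b 1) (lin A b 2) 0 \<in> span B"
    proof -
      have "fld (lin A b 1) (lin A b 2) 0 = (A$1$1) *\<^sub>R fld px 0 0 + (A$1$2) *\<^sub>R fld py 0 0 + (b$1) *\<^sub>R fld 1 0 0 +
         ((A$2$1) *\<^sub>R fld 0 px 0 + (A$2$2) *\<^sub>R fld 0 py 0 + (b$2) *\<^sub>R fld 0 1 0)"
        by (simp add: fld_ops lin_def)
      moreover have "{fld px 0 0, fld py 0 0, fld 1 0 0, fld 0 px 0, fld 0 py 0, fld 0 1 0} \<subseteq> B" by (auto simp: B_def)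
      ultimately show ?thesis by (simp only:) (rule span_add span_scale in_B | blast)+
    qed
    have "psupp f \<subseteq> {..N} \<times> {..N}" using xi_bound[OF f] by (force simp: psupp_def)
    from fpoly_expand[OF _ this]
    have "f = (\<Sum>p\<in>{..N}\<times>{..N}. pcoeff f (fst p) (snd p) *\<^sub>R mono2 1 (fst p) (snd p))"
      by (simp add: scaleR_plane mono2_def)
    moreover have "fld 0 0 (\<Sum>p\<in>S. c p *\<^sub>R g p) = (\<Sum>p\<in>S. c p *\<^sub>R fld 0 0 (g p))" for S :: "(nat \<times> nat) set" and c g
    proof (induct S rule: infinite_finite_induct)
      case (insert x F)
      have "fld 0 0 (c x *\<^sub>R g x + (\<Sum>p\<in>F. c p *\<^sub>R g p)) = c x *\<^sub>R fld 0 0 (g x) + fld 0 0 (\<Sum>p\<in>F. c p *\<^sub>R g p)"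
        by (simp add: fld_ops)
      then show ?case using insert by simp
    qed (simp_all add: fld_zero)
    ultimately have "fld 0 0 f = (\<Sum>p\<in>{..N}\<times>{..N}. pcoeff f (fst p) (snd p) *\<^sub>R fld 0 0 (mono2 1 (fst p) (snd p)))"
      by metis
    moreover have "\<dots> \<in> span B" by (intro span_sum span_scale in_B) (auto simp: B_def)
    ultimately have "fld 0 0 f \<in> span B" by simp
    from span_add[OF 1 this] show ?thesis by (simp add: fld_add)
  qed
  moreover have "finite B" by (simp add: B_def)
  ultimately show ?thesis unfolding finite_dim_def gg_fld by blast
qed

lemma transitive_gg: "transitive gg"
proof -
  have *: "hom_part 1 (fld a b f) = fld (pcoeff a 0 0 *\<^sub>R 1) (pcoeff b 0 0 *\<^sub>R 1) (pcoeff f 1 0 *\<^sub>R px + pcoeff f 0 1 *\<^sub>R py)" for a b f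
  proof -
    have "php 0 a = pcoeff a 0 0 *\<^sub>R 1" for a by (rule pcoeff_eqI) auto
    then show ?thesis by (simp add: hom_part_fld php1)
  qed
  have "fld (r *\<^sub>R 1) (s *\<^sub>R 1) (t *\<^sub>R px + u *\<^sub>R py) \<in> hom_part 1 ` gg" for r s t u
  proof
    show "fld (lin 0 (vector [r, s]) 1) (lin 0 (vector [r, s]) 2) (t *\<^sub>R px + u *\<^sub>R py) \<in> gg"
      by (intro gg_memI zero_l subspace_add[OF xi_sub] subspace_scale[OF xi_sub] xi_p)
    show "fld (r *\<^sub>R 1) (s *\<^sub>R 1) (t *\<^sub>R px + u *\<^sub>R py) =
       hom_part 1 (fld (lin 0 (vector [r, s]) 1) (lin 0 (vector [r, s]) 2) (t *\<^sub>R px + u *\<^sub>R py))"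
      unfolding * by (simp add: pcoeff_lin)
  qed
  moreover have "hom_part 1 ` gg \<subseteq> {fld (r *\<^sub>R 1) (s *\<^sub>R 1) (t *\<^sub>R px + u *\<^sub>R py) | r s t u. True}"
    unfolding gg_fld using * by blast
  ultimately show ?thesis unfolding transitive_def span_V by blast
qed

lemma der_part_gg: "der_part ` gg = aff_alg l"
proof
  show "der_part ` gg \<subseteq> aff_alg l" unfolding gg_fld by (auto simp: aff_alg_fld simp del: fld_eq_iff) blast
  show "aff_alg l \<subseteq> der_part ` gg"
  proof
    fix x assume x: "x \<in> aff_alg l"
    then have "x = der_part x" by (auto simp: aff_alg_fld)
    then show "x \<in> der_part ` gg" using x aff_alg_gg by blast
  qed
qed

text \<open>An invariant line field would give a real eigenvector at the origin for a matrix
  in \<open>l\<close> that has no real eigenvalue.\<close>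

lemma transversally_primitive_gg: "transversally_primitive gg"
  unfolding transversally_primitive_def der_part_gg primitive_def
proof (intro conjI notI)
  have h: "hom_part 1 (fld (lin A b 1) (lin A b 2) 0) = fld ((b$1) *\<^sub>R 1) ((b$2) *\<^sub>R 1) 0" for A b
    by (simp add: hom_part_fld php_lin_eq)
  have "fld (r *\<^sub>R 1) (s *\<^sub>R 1) 0 \<in> hom_part 1 ` aff_alg l" for r s
    by (rule image_eqI[where x = "fld (lin 0 (vector [r, s]) 1) (lin 0 (vector [r, s]) 2) 0"])
       (use zero_l in \<open>auto simp: h[simplified] aff_alg_fld\<close>)
  then show "plane_transitive (aff_alg l)"
    unfolding plane_transitive_def span_q by (auto simp: aff_alg_fld h[simplified])
next
  assume "\<exists>D. nontrivial_distribution D \<and> involutive D \<and> (\<forall>X\<in>aff_alg l. \<forall>Y\<in>D. pb X Y \<in> D)"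
  then obtain D where D: "nontrivial_distribution D" "\<And>X Y. X \<in> aff_alg l \<Longrightarrow> Y \<in> D \<Longrightarrow> pb X Y \<in> D" by blast
  then obtain Y where Y: "Y \<in> Der" "hom_part 1 Y \<noteq> 0" "D = {emb h * Y | h. True}"
    unfolding nontrivial_distribution_def by blast
  then obtain a b where ab: "Y = fld a b 0" by (auto simp: Der_fld)
  have php0: "php 0 a = pcoeff a 0 0 *\<^sub>R 1" for a by (rule pcoeff_eqI) auto
  let ?a = "pcoeff a 0 0" and ?b = "pcoeff b 0 0"
  have nz: "?a \<noteq> 0 \<or> ?b \<noteq> 0" using Y(2) by (auto simp: ab hom_part_fld php0 fld_zero)
  obtain \<alpha> where r: "rot_mat \<alpha> \<in> l" using l_rot by blast
  let ?X = "fld (lin (rot_mat \<alpha>) 0 1) (lin (rot_mat \<alpha>) 0 2) 0"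
  have "Y \<in> D" unfolding Y(3) by (auto intro!: exI[of _ 1])
  moreover have "?X \<in> aff_alg l" using r by (auto simp: aff_alg_fld)
  ultimately have "pb ?X Y \<in> D" using D(2) by blast
  then obtain h where "pb ?X Y = emb h * Y" unfolding Y(3) by blast
  then have "lin (rot_mat \<alpha>) 0 1 * dx a + lin (rot_mat \<alpha>) 0 2 * dy a - (a * dx (lin (rot_mat \<alpha>) 0 1) + b * dy (lin (rot_mat \<alpha>) 0 1)) = h * a"
    "lin (rot_mat \<alpha>) 0 1 * dx b + lin (rot_mat \<alpha>) 0 2 * dy b - (a * dx (lin (rot_mat \<alpha>) 0 2) + b * dy (lin (rot_mat \<alpha>) 0 2)) = h * b"
    unfolding ab pb_fld fld_emb_mult by simp_all
  from arg_cong[OF this(1), of "\<lambda>f. pcoeff f 0 0"] arg_cong[OF this(2), of "\<lambda>f. pcoeff f 0 0"]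
  have "- (\<alpha> * ?a + ?b) = pcoeff h 0 0 * ?a" "?a - \<alpha> * ?b = pcoeff h 0 0 * ?b"
    by (simp_all add: pcoeff_lin)
  \<comment> \<open>The constant terms say that the value of Y at the origin is an eigenvector of
    the negative of \<open>rot_mat \<alpha>\<close>. Cross-multiplication eliminates the eigenvalue
    and leaves a sum of two squares.\<close>
  then have "(- (\<alpha> * ?a + ?b)) * ?b = (?a - \<alpha> * ?b) * ?a" by (simp add: mult_ac)
  then have "?a * ?a + ?b * ?b = 0" by algebra
  then show False using nz by simp
qed

lemma linear_part_zero_iff: "hom_part 1 (fld (lin A b 1) (lin A b 2) f) = 0 \<longleftrightarrow> b = 0 \<and> pcoeff f 1 0 = 0 \<and> pcoeff f 0 1 = 0"
proof -
  have "(pcoeff f 1 0 *\<^sub>R px + pcoeff f 0 1 *\<^sub>R py) = 0 \<longleftrightarrow> pcoeff f 1 0 = 0 \<and> pcoeff f 0 1 = 0"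
  proof
    assume "pcoeff f 1 0 *\<^sub>R px + pcoeff f 0 1 *\<^sub>R py = 0"
    then have "pcoeff (pcoeff f 1 0 *\<^sub>R px + pcoeff f 0 1 *\<^sub>R py) i j = 0" for i j by simp
    from this[of 1 0] this[of 0 1] show "pcoeff f 1 0 = 0 \<and> pcoeff f 0 1 = 0" by simp
  qed simp
  moreover have "r *\<^sub>R (1::plane) = 0 \<longleftrightarrow> r = 0" for r by simp
  ultimately show ?thesis
    by (simp add: hom_part_fld php_lin_eq php1[simplified] fld_zero vec_eq_iff forall_2 del: scaleR_eq_0_iff)
qed

lemma order_ge2_iff: "pcoeff f 0 0 = 0 \<Longrightarrow> f \<in> order_ge2 \<longleftrightarrow> pcoeff f 1 0 = 0 \<and> pcoeff f 0 1 = 0"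
proof -
  assume "pcoeff f 0 0 = 0"
  moreover have "i + j < 2 \<longleftrightarrow> i = 0 \<and> j = 0 \<or> i = 1 \<and> j = 0 \<or> i = 0 \<and> j = 1" for i j :: nat by auto
  ultimately show ?thesis by (auto simp: order_ge2_def)
qed

lemma stability_fld: "stability gg = {fld (lin A 0 1) (lin A 0 2) f | A f. A \<in> l \<and> f \<in> \<xi> \<inter> order_ge2}"
proof -
  have "x \<in> stability gg \<longleftrightarrow> (\<exists>A b f. x = fld (lin A b 1) (lin A b 2) f \<and> A \<in> l \<and> f \<in> \<xi> \<and> b = 0 \<and> f \<in> order_ge2)" for x
    unfolding stability_def gg_fld using linear_part_zero_iff order_ge2_iff[OF xi_00] by auto
  then show ?thesis by blast
qed

lemma stability_aff: "stability (aff_alg l) = {fld (lin A 0 1) (lin A 0 2) 0 | A. A \<in> l}"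
  unfolding stability_def aff_alg_fld using linear_part_zero_iff by auto

lemma stability_gg: "stability gg = stability (aff_alg l) \<oplus>\<^sub>s emb ` (\<xi> \<inter> order_ge2)"
  unfolding stability_fld stability_aff set_eq_iff mem_set_sum
  by (auto simp: fld_plus_emb)

text \<open>The quadratic component of an element of \<xi> is again in \<xi>, and a quadratic
  element of \<xi> lies in the stability subalgebra and is its own quadratic component.\<close>

lemma isotropy_gg: "isotropy gg = stability (aff_alg l) \<oplus>\<^sub>s emb ` (\<xi> \<inter> span {px\<^sup>2, px * py, py\<^sup>2})"
proof -
  have h: "hom_part 2 (fld (lin A 0 1) (lin A 0 2) f) = fld (lin A 0 1) (lin A 0 2) (php 2 f)" for A f
    by (simp add: hom_part_fld php_lin_eq numeral_2_eq_2)
  have 1: "php 2 f \<in> \<xi> \<inter> span {px\<^sup>2, px * py, py\<^sup>2}" if "f \<in> \<xi>" for f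
    using xi_php[OF that] unfolding span_quadrics by auto
  have 2: "f \<in> \<xi> \<inter> order_ge2" "php 2 f = f" if "f \<in> \<xi> \<inter> span {px\<^sup>2, px * py, py\<^sup>2}" for f
    using that unfolding span_quadrics order_ge2_def by (auto intro: pcoeff_eqI)
  have "hom_part 2 ` stability gg = {fld (lin A 0 1) (lin A 0 2) f | A f. A \<in> l \<and> f \<in> \<xi> \<inter> span {px\<^sup>2, px * py, py\<^sup>2}}"
  proof
    show "hom_part 2 ` stability gg \<subseteq> {fld (lin A 0 1) (lin A 0 2) f | A f. A \<in> l \<and> f \<in> \<xi> \<inter> span {px\<^sup>2, px * py, py\<^sup>2}}"
      unfolding stability_fld using h 1 by blast
    show "{fld (lin A 0 1) (lin A 0 2) f | A f. A \<in> l \<and> f \<in> \<xi> \<inter> span {px\<^sup>2, px * py, py\<^sup>2}} \<subseteq> hom_part 2 ` stability gg"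
    proof
      fix x assume "x \<in> {fld (lin A 0 1) (lin A 0 2) f | A f. A \<in> l \<and> f \<in> \<xi> \<inter> span {px\<^sup>2, px * py, py\<^sup>2}}"
      then obtain A f where x: "x = fld (lin A 0 1) (lin A 0 2) f" "A \<in> l" "f \<in> \<xi> \<inter> span {px\<^sup>2, px * py, py\<^sup>2}" by blast
      then have "x = hom_part 2 (fld (lin A 0 1) (lin A 0 2) f)" using h 2(2) by metis
      moreover have "fld (lin A 0 1) (lin A 0 2) f \<in> stability gg" unfolding stability_fld using x(2) 2(1)[OF x(3)] by blast
      ultimately show "x \<in> hom_part 2 ` stability gg" by blast
    qed
  qed
  moreover have "{fld (lin A 0 1) (lin A 0 2) f | A f. A \<in> l \<and> f \<in> X} = stability (aff_alg l) \<oplus>\<^sub>s emb ` X" for X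
    unfolding stability_aff set_eq_iff mem_set_sum by (auto simp: fld_plus_emb)
  ultimately show ?thesis unfolding isotropy_def by (simp only:)
qed

lemma xi_d: assumes "f \<in> \<xi>" shows "nc (dx f) \<in> \<xi>" "nc (dy f) \<in> \<xi>"
  using xi_lie[OF zero_l assms, of "vector [1, 0]"] xi_lie[OF zero_l assms, of "vector [0, 1]"]
  by (simp_all add: lie_act_def lin_def)

text \<open>Partial derivatives lower the degree one step at a time from the maximal degree to
  three, and \<xi> contains the homogeneous components of its elements.\<close>

lemma cubic_exists:
  assumes "2 < max_degree \<xi>"
  obtains f where "f \<in> \<xi>" "f \<noteq> 0" "\<And>i j. i + j \<noteq> 3 \<Longrightarrow> pcoeff f i j = 0"
proof -
  let ?D = "{i + j | f i j. f \<in> \<xi> \<and> pcoeff f i j \<noteq> 0}"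
  have "?D \<subseteq> {..N}" using xi_bound by (auto simp: not_less[symmetric])
  then have "finite ?D" by (rule finite_subset) simp
  moreover have "1 \<in> ?D" using xi_p(1) by (intro CollectI exI[of _ px] exI[of _ "1::nat"] exI[of _ "0::nat"]) auto
  ultimately have "max_degree \<xi> \<in> ?D" unfolding max_degree_def by (intro Max_in) auto
  then obtain f i j where "f \<in> \<xi>" "pcoeff f i j \<noteq> 0" "i + j = max_degree \<xi>" by (smt (verit) mem_Collect_eq)
  \<comment> \<open>A single nonvanishing coefficient is followed: differentiation in x if its
    exponent of x is positive, in y otherwise.\<close>
  moreover have "f \<in> \<xi> \<Longrightarrow> pcoeff f i j \<noteq> 0 \<Longrightarrow> i + j = n + 3 \<Longrightarrow> \<exists>f\<in>\<xi>. \<exists>i j. pcoeff f i j \<noteq> 0 \<and> i + j = 3" for n f i j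
  proof (induct n arbitrary: f i j)
    case (Suc n)
    show ?case
    proof (cases i)
      case 0
      then show ?thesis using Suc.hyps[OF xi_d(2)[OF Suc.prems(1)], of 0 "j - 1"] Suc.prems
        by (cases j) (auto simp: pcoeff_nc)
    next
      case (Suc i')
      then have "pcoeff (nc (dx f)) i' j \<noteq> 0" "i' + j = n + 3" using Suc.prems by (auto simp: pcoeff_nc)
      then show ?thesis by (rule Suc.hyps[OF xi_d(1)[OF Suc.prems(1)]])
    qed
  qed auto
  ultimately obtain f i j where f: "f \<in> \<xi>" "pcoeff f i j \<noteq> 0" "i + j = 3"
    using assms by (metis add.commute le_add_diff_inverse less_eq_Suc_le numeral_3_eq_3 numeral_2_eq_2)
  show thesis
  proof (rule that[OF xi_php[OF f(1), of 3]])
    show "php 3 f \<noteq> 0"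
    proof
      assume "php 3 f = 0"
      then have "pcoeff (php 3 f) i j = 0" by simp
      then show False using f(2,3) by simp
    qed
  qed auto
qed

text \<open>If \<open>m\<close> complements the stability subalgebra invariantly and \<open>v \<in> m\<close> has value \<open>\<partial>\<^sub>x\<close>, then
  for a cubic \<open>f\<close> the bracket of \<open>f\<close> with \<open>v\<close> lies in \<open>m\<close> and in the stability subalgebra.\<close>

lemma not_reductive:
  assumes "2 < max_degree \<xi>" shows "\<not> reductive gg"
proof
  assume "reductive gg"
  then obtain m where m': "subspace m \<and> m \<subseteq> gg \<and> stability gg \<inter> m = {0} \<and> stability gg \<oplus>\<^sub>s m = gg \<and>
    (\<forall>u\<in>stability gg. \<forall>v\<in>m. pb u v \<in> m)" unfolding reductive_def by (rule exE)
  then have m: "m \<subseteq> gg" "stability gg \<inter> m = {0}" "stability gg \<oplus>\<^sub>s m = gg" by simp_all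
  have m_pb: "pb u v \<in> m" if "u \<in> stability gg" "v \<in> m" for u v using m' that by simp
  obtain f where f: "f \<in> \<xi>" "f \<noteq> 0" and fz: "\<And>i j. i + j \<noteq> 3 \<Longrightarrow> pcoeff f i j = 0"
    using cubic_exists[OF assms] by blast
  have fs: "fld 0 0 f \<in> stability gg"
    unfolding stability_fld using zero_l f fz by (auto intro!: exI[of _ 0] simp: order_ge2_def)
  have key: "(b $ 1) *\<^sub>R pcoeff (dx f) i j + (b $ 2) *\<^sub>R pcoeff (dy f) i j = 0" if ij: "i + j = 2" for b :: "real^2" and i j
  proof -
    have "fld (lin 0 b 1) (lin 0 b 2) 0 \<in> stability gg \<oplus>\<^sub>s m"
      unfolding m(3) by (rule gg_memI[OF zero_l zero_xi])
    then obtain u v where uv: "u \<in> stability gg" "v \<in> m" "fld (lin 0 b 1) (lin 0 b 2) 0 = u + v"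
      unfolding set_sum_def by blast
    obtain A h where u: "u = fld (lin A 0 1) (lin A 0 2) h" using uv(1) unfolding stability_fld by blast
    \<comment> \<open>v has the prescribed value b at the origin; its linear part and its function
      come from the unknown u.\<close>
    have v: "v = fld (lin (- A) b 1) (lin (- A) b 2) (- h)"
    proof -
      have "v = fld (lin 0 b 1) (lin 0 b 2) 0 - u" using uv(3) by simp
      then show ?thesis unfolding u by (simp add: fld_diff lin_diff)
    qed
    have z: "(0 :: real^2^2) ** M = 0" "M ** (0 :: real^2^2) = 0" for M :: "real^2^2"
      by (simp_all add: vec_eq_iff matrix_matrix_mult_def)
    let ?g = "- lie_act (- A) b f"
    have "pb (fld 0 0 f) v = fld 0 0 ?g"
      using pb_gg[of 0 0 f "- A" b "- h"] unfolding v by (simp add: lie_act_def nc_lin z)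
    then have gm: "fld 0 0 ?g \<in> m" using m_pb[OF fs uv(2)] by simp
    \<comment> \<open>A linear field maps the cubic f to a cubic, so in degree at most two only the
      constant field b contributes, whatever A is.\<close>
    have p: "pcoeff (lie_act (- A) b f) i j = (if i = 0 \<and> j = 0 then 0 else
        (b $ 1) *\<^sub>R pcoeff (dx f) i j + (b $ 2) *\<^sub>R pcoeff (dy f) i j)" if "i + j \<le> 2" for i j
      using that by (simp add: lie_act_def pcoeff_nc lin_def distrib_right left_diff_distrib fz)
    have "fld 0 0 ?g \<in> stability gg"
    proof -
      have "fld (lin 0 0 1) (lin 0 0 2) ?g \<in> gg" using gm m(1) by auto
      moreover have "hom_part 1 (fld (lin 0 0 1) (lin 0 0 2) ?g) = 0"
        unfolding linear_part_zero_iff using p[of 1 0] p[of 0 1] by (simp add: fz)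
      ultimately show ?thesis by (simp add: stability_def)
    qed
    then have "fld 0 0 ?g = 0" using gm m(2) by blast
    then have "?g = 0" by (simp add: fld_zero)
    then have "pcoeff (lie_act (- A) b f) i j = 0" by (metis neg_equal_0_iff_equal pcoeff_simps(4))
    moreover have "\<not> (i = 0 \<and> j = 0)" using ij by auto
    ultimately show ?thesis using p[of i j] ij by (simp only: if_False order_refl)
  qed
  have "pcoeff f i j = 0" for i j
  proof (cases "i + j = 3")
    case True
    show ?thesis
    proof (cases i)
      case 0
      then show ?thesis using key[of 0 2 "vector [0, 1]"] True by (simp add: eval_nat_numeral)
    next
      case (Suc i')
      then show ?thesis using key[of i' j "vector [1, 0]"] True by simp
    qed
  qed (rule fz)
  then show False using f(2) by (metis pcoeff_eqI pcoeff_simps(4))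
qed

end

section \<open>The group and the global chart of its coset space\<close>

definition vec4 :: "real \<Rightarrow> real \<Rightarrow> real \<Rightarrow> real \<Rightarrow> real^4" where
  "vec4 a b c d = (\<chi> i. if i = 1 then a else if i = 2 then b else if i = 3 then c else d)"

lemma vec4_simps [simp]: "vec4 a b c d $ 1 = a" "vec4 a b c d $ 2 = b" "vec4 a b c d $ 3 = c" "vec4 a b c d $ 4 = d"
  by (simp_all add: vec4_def)

lemma vec4_eqI: "v $ 1 = w $ 1 \<Longrightarrow> v $ 2 = w $ 2 \<Longrightarrow> v $ 3 = w $ 3 \<Longrightarrow> v $ 4 = w $ 4 \<Longrightarrow> v = (w :: real^4)"
  by (simp add: vec_eq_iff forall_4)

lemma vec2_eqI: "v $ 1 = w $ 1 \<Longrightarrow> v $ 2 = w $ 2 \<Longrightarrow> v = (w :: real^2)"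
  by (simp add: vec_eq_iff forall_2)

lemma matrix_inv_2:
  assumes "invertible (A :: real^2^2)"
  shows "matrix_inv A $ 1 $ 1 = A $ 2 $ 2 * inverse (det A)" "matrix_inv A $ 1 $ 2 = - A $ 1 $ 2 * inverse (det A)"
    "matrix_inv A $ 2 $ 1 = - A $ 2 $ 1 * inverse (det A)" "matrix_inv A $ 2 $ 2 = A $ 1 $ 1 * inverse (det A)"
proof -
  let ?C = "matrix_inv A"
  have d: "det A \<noteq> 0" using assms by (simp add: invertible_det_nz)
  have m: "A ** ?C = mat 1" using matrix_inv_cancel[OF assms] by simp
  have "(A ** ?C) $ i $ j = mat 1 $ i $ j" for i j using m by simp
  from this[of 1 1] this[of 1 2] this[of 2 1] this[of 2 2]
  have e: "A$1$1 * ?C$1$1 + A$1$2 * ?C$2$1 = 1" "A$1$1 * ?C$1$2 + A$1$2 * ?C$2$2 = 0"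
    "A$2$1 * ?C$1$1 + A$2$2 * ?C$2$1 = 0" "A$2$1 * ?C$1$2 + A$2$2 * ?C$2$2 = 1"
    by (simp_all add: matrix_matrix_mult_def sum_2 mat_def)
  have "?C$1$1 * det A = A$2$2" "?C$1$2 * det A = - A$1$2" "?C$2$1 * det A = - A$2$1" "?C$2$2 * det A = A$1$1"
    unfolding det_2 using e by algebra+
  then show "?C $ 1 $ 1 = A $ 2 $ 2 * inverse (det A)" "?C $ 1 $ 2 = - A $ 1 $ 2 * inverse (det A)"
    "?C $ 2 $ 1 = - A $ 2 $ 1 * inverse (det A)" "?C $ 2 $ 2 = A $ 1 $ 1 * inverse (det A)"
    using d by (simp_all add: field_simps)
qed

text \<open>The covector to which a group element moves the zero covector at the origin
  (\<open>Sig_0\<close>). Its zero set is the stabiliser of that covector, which is K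
  (\<open>K_eq\<close>).\<close>

definition Phi :: "gel \<Rightarrow> real^4" where
  "Phi = (\<lambda>((B, b), f). vec4 (b $ 1) (b $ 2) (ev (b $ 1) (b $ 2) (dx f)) (ev (b $ 1) (b $ 2) (dy f)))"

definition trq :: "aff \<Rightarrow> 2 \<Rightarrow> real \<Rightarrow> real \<Rightarrow> real" where
  "trq = (\<lambda>(A, a) r x y. A $ r $ 1 * x + A $ r $ 2 * y + a $ r)"

text \<open>The action of the group in the chart: the cotangent lift of an affine map followed by
  translation along the differential of \<open>f\<close>.\<close>

definition Sig :: "gel \<Rightarrow> real^4 \<Rightarrow> real^4" where
  "Sig = (\<lambda>((A, a), f) v. let x = trq (A, a) 1 (v $ 1) (v $ 2); y = trq (A, a) 2 (v $ 1) (v $ 2) in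
     vec4 x y (ev x y (dx f) + (v $ 3 * A $ 2 $ 2 - v $ 4 * A $ 2 $ 1) * inverse (det A))
          (ev x y (dy f) + (v $ 4 * A $ 1 $ 1 - v $ 3 * A $ 1 $ 2) * inverse (det A)))"

text \<open>A translation of the base combined with a linear function. These elements multiply by
  addition of v, and in the chart they act by translations (\<open>Sig_sect\<close>).\<close>

definition sect :: "real^4 \<Rightarrow> gel" where
  "sect v = ((mat 1, vector [v $ 1, v $ 2]), v $ 3 *\<^sub>R px + v $ 4 *\<^sub>R py)"

lemma Phi_simps: "Phi ((A, a), f) = vec4 (a $ 1) (a $ 2) (ev (a $ 1) (a $ 2) (dx f)) (ev (a $ 1) (a $ 2) (dy f))"
  by (simp add: Phi_def)

lemma Phi_sect [simp]: "Phi (sect v) = v"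
  by (rule vec4_eqI) (simp_all add: sect_def Phi_simps ev_scaleR)

lemma mat_simps: "(mat 1 :: real^2^2) $ 1 $ 1 = 1" "(mat 1 :: real^2^2) $ 1 $ 2 = 0"
    "(mat 1 :: real^2^2) $ 2 $ 1 = 0" "(mat 1 :: real^2^2) $ 2 $ 2 = 1"
  by (simp_all add: mat_def)

text \<open>A translation changes a linear function by a constant, which is discarded.\<close>

lemma aff_act_one_linear: "aff_act (mat 1, b) (s *\<^sub>R px + t *\<^sub>R py) = s *\<^sub>R px + t *\<^sub>R py"
proof -
  have i: "inv\<^bsub>aff_group\<^esub> (mat 1, b) = (mat 1, - b)"
    by (rule group.inv_equality[OF group_aff]) (auto simp: invertible_def intro: exI[of _ "mat 1"])
  show ?thesis
    by (simp add: mat_simps aff_act_psub i ps.evl_add psub_scaleR lin_def nc_lin)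
       (rule pcoeff_eqI, auto simp: pcoeff_nc)
qed

locale star_grp = star_alg +
  fixes H :: "(real^2^2) set"
  assumes H_inv: "\<And>A. A \<in> H \<Longrightarrow> invertible A" and H_one: "mat 1 \<in> H"
    and H_mult: "\<And>A B. A \<in> H \<Longrightarrow> B \<in> H \<Longrightarrow> A ** B \<in> H"
    and H_minv: "\<And>A. A \<in> H \<Longrightarrow> matrix_inv A \<in> H"
    and xi_act: "\<And>A b f. A \<in> H \<Longrightarrow> f \<in> \<xi> \<Longrightarrow> aff_act (A, b) f \<in> \<xi>"
begin

definition "Gt = {(A, b :: real^2). A \<in> H}"
definition "Kt = {(A, b :: real^2). A \<in> H \<and> b = 0}"
definition "G = semidirect Gt \<xi>"
definition "K = Kt \<times> (\<xi> \<inter> order_ge2)"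

lemma G_simps [simp]: "carrier G = Gt \<times> \<xi>"
  "(\<phi>, f) \<otimes>\<^bsub>G\<^esub> (\<psi>, h) = (\<phi> \<otimes>\<^bsub>aff_group\<^esub> \<psi>, f + aff_act \<phi> h)"
  "\<one>\<^bsub>G\<^esub> = (\<one>\<^bsub>aff_group\<^esub>, 0)"
  by (simp_all add: G_def semidirect_def)

lemma Gt_aff: "\<phi> \<in> Gt \<Longrightarrow> \<phi> \<in> carrier aff_group" using H_inv by (auto simp: Gt_def)

lemma subgroup_Gt: "subgroup Gt aff_group"
proof (rule group.subgroupI[OF group_aff])
  show "Gt \<subseteq> carrier aff_group" using Gt_aff by blast
  show "Gt \<noteq> {}" using H_one by (auto simp: Gt_def)
  show "inv\<^bsub>aff_group\<^esub> a \<in> Gt" if "a \<in> Gt" for a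
    using that H_inv H_minv by (auto simp: Gt_def inv_aff)
  show "a \<otimes>\<^bsub>aff_group\<^esub> b \<in> Gt" if "a \<in> Gt" "b \<in> Gt" for a b
    using that H_mult by (auto simp: Gt_def)
qed

lemma group_G: "group G"
proof (rule groupI)
  note c = subgroup.m_closed[OF subgroup_Gt]
  show "\<one>\<^bsub>G\<^esub> \<in> carrier G" using subgroup.one_closed[OF subgroup_Gt] zero_xi by simp
  show "x \<otimes>\<^bsub>G\<^esub> y \<in> carrier G" if "x \<in> carrier G" "y \<in> carrier G" for x y
    using that xi_act c by (cases x; cases y) (auto simp: Gt_def intro!: subspace_add[OF xi_sub] H_mult)
  show "\<one>\<^bsub>G\<^esub> \<otimes>\<^bsub>G\<^esub> x = x" if "x \<in> carrier G" for x
  proof (cases x)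
    case (Pair \<phi> f)
    then have "aff_act \<one>\<^bsub>aff_group\<^esub> f = f" using that xi_fpoly xi_00 by (intro aff_act_one) auto
    moreover have "\<one>\<^bsub>aff_group\<^esub> \<otimes>\<^bsub>aff_group\<^esub> \<phi> = \<phi>" by (cases \<phi>) simp
    ultimately show ?thesis using Pair by simp
  qed
  show "x \<otimes>\<^bsub>G\<^esub> y \<otimes>\<^bsub>G\<^esub> z = x \<otimes>\<^bsub>G\<^esub> (y \<otimes>\<^bsub>G\<^esub> z)" if xyz: "x \<in> carrier G" "y \<in> carrier G" "z \<in> carrier G" for x y z
  proof -
    obtain \<phi> f \<psi> g \<eta> h where e: "x = (\<phi>, f)" "y = (\<psi>, g)" "z = (\<eta>, h)" by (metis surj_pair)
    then have c: "\<phi> \<in> carrier aff_group" "\<psi> \<in> carrier aff_group" "\<eta> \<in> carrier aff_group" "fpoly f" "fpoly g" "fpoly h"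
      using xyz Gt_aff xi_fpoly by auto
    have "aff_act \<phi> (g + aff_act \<psi> h) = aff_act \<phi> g + aff_act (\<phi> \<otimes>\<^bsub>aff_group\<^esub> \<psi>) h"
      using c by (simp add: aff_act_add aff_act_mult del: aff_group_simps)
    then show ?thesis using monoid.m_assoc[OF group.is_monoid[OF group_aff] c(1-3)] by (simp add: e add.assoc)
  qed
  show "\<exists>y\<in>carrier G. y \<otimes>\<^bsub>G\<^esub> x = \<one>\<^bsub>G\<^esub>" if x: "x \<in> carrier G" for x
  proof -
    obtain \<phi> f where e: "x = (\<phi>, f)" by (metis surj_pair)
    have i: "inv\<^bsub>aff_group\<^esub> \<phi> \<in> Gt" using x e subgroup.m_inv_closed[OF subgroup_Gt] by auto
    have "- aff_act (inv\<^bsub>aff_group\<^esub> \<phi>) f \<in> \<xi>"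
      using i x e xi_act by (cases "inv\<^bsub>aff_group\<^esub> \<phi>") (auto simp: Gt_def intro: subspace_neg[OF xi_sub])
    then show ?thesis using i x e group.l_inv[OF group_aff Gt_aff]
      by (intro bexI[of _ "(inv\<^bsub>aff_group\<^esub> \<phi>, - aff_act (inv\<^bsub>aff_group\<^esub> \<phi>) f)"]) auto
  qed
qed

text \<open>Equivariance of the chart: at the new base point the differential of the product's
  function is that of f plus the transported differential of h.\<close>

lemma Phi_mult:
  assumes "a \<in> carrier G" "b \<in> carrier G" shows "Phi (a \<otimes>\<^bsub>G\<^esub> b) = Sig a (Phi b)"
proof -
  obtain A a0 f B b0 h where e: "a = ((A, a0), f)" "b = ((B, b0), h)" by (metis surj_pair)
  have A: "invertible A" "fpoly f" "fpoly h" using assms e H_inv xi_fpoly by (auto simp: Gt_def)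
  have x: "(A *v b0 + a0) $ r = trq (A, a0) r (b0 $ 1) (b0 $ 2)" for r
    by (simp add: trq_def matrix_vector_mult_def sum_2)
  have p: "fpoly (aff_act (A, a0) h)" using A by simp
  show ?thesis
    unfolding e G_simps aff_group_simps Phi_simps x Sig_def Let_def
    using ev_d_aff_act[OF A(3,1), of "b0 $ 1" "b0 $ 2" a0] A p
    by (intro vec4_eqI) (simp_all add: trq_def ev.evl_add matrix_inv_2 algebra_simps)
qed

lemma sect_carrier [simp]: "sect v \<in> carrier G"
  using H_one xi_p by (simp add: sect_def Gt_def subspace_add[OF xi_sub] subspace_scale[OF xi_sub])

lemma Phi_one [simp]: "Phi \<one>\<^bsub>G\<^esub> = 0"
  by (rule vec4_eqI) (simp_all add: Phi_simps)

text \<open>Over the base point 0 the last two chart coordinates are the linear coefficients of f,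
  whose vanishing is membership in \<open>order_ge2\<close>.\<close>

lemma K_eq: "K = {k \<in> carrier G. Phi k = 0}"
proof -
  have "((A, b), f) \<in> K \<longleftrightarrow> ((A, b), f) \<in> carrier G \<and> Phi ((A, b), f) = 0" for A b f
  proof (cases "A \<in> H \<and> f \<in> \<xi>")
    case True
    have "Phi ((A, b), f) = 0 \<longleftrightarrow> b $ 1 = 0 \<and> b $ 2 = 0 \<and> ev (b $ 1) (b $ 2) (dx f) = 0 \<and> ev (b $ 1) (b $ 2) (dy f) = 0"
      by (simp add: Phi_simps vec_eq_iff forall_4)
    also have "\<dots> \<longleftrightarrow> b = 0 \<and> pcoeff f 1 0 = 0 \<and> pcoeff f 0 1 = 0"
      using True xi_fpoly by (auto simp: vec_eq_iff forall_2 ev00)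
    also have "\<dots> \<longleftrightarrow> b = 0 \<and> f \<in> order_ge2" using order_ge2_iff[OF xi_00] True by blast
    finally show ?thesis using True by (auto simp: K_def Kt_def Gt_def)
  qed (auto simp: K_def Kt_def Gt_def)
  then show ?thesis by auto
qed

text \<open>Here and below, laws for \<open>Sig\<close> are read off from the group laws, because
  every point of the chart is of the form \<open>Phi (sect v)\<close>.\<close>

lemma Sig_one: "Sig \<one>\<^bsub>G\<^esub> v = v"
proof -
  have "Phi (\<one>\<^bsub>G\<^esub> \<otimes>\<^bsub>G\<^esub> sect v) = Sig \<one>\<^bsub>G\<^esub> (Phi (sect v))"
    by (rule Phi_mult) (use sect_carrier monoid.one_closed[OF group.is_monoid[OF group_G]] in blast)+
  then show ?thesis using monoid.l_one[OF group.is_monoid[OF group_G] sect_carrier] by (simp del: G_simps)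
qed

lemma Sig_mult: assumes "a \<in> carrier G" "b \<in> carrier G" shows "Sig (a \<otimes>\<^bsub>G\<^esub> b) v = Sig a (Sig b v)"
proof -
  interpret group G by (rule group_G)
  have "Phi (a \<otimes>\<^bsub>G\<^esub> b \<otimes>\<^bsub>G\<^esub> sect v) = Phi (a \<otimes>\<^bsub>G\<^esub> (b \<otimes>\<^bsub>G\<^esub> sect v))" using assms m_assoc[OF assms sect_carrier] by (simp del: G_simps)
  then show ?thesis using assms Phi_mult m_closed sect_carrier by (simp del: G_simps)
qed

lemma Sig_inv: assumes "a \<in> carrier G"
  shows "Sig (inv\<^bsub>G\<^esub> a) (Sig a v) = v" "Sig a (Sig (inv\<^bsub>G\<^esub> a) v) = v"
proof -
  interpret group G by (rule group_G)
  show "Sig (inv\<^bsub>G\<^esub> a) (Sig a v) = v" "Sig a (Sig (inv\<^bsub>G\<^esub> a) v) = v"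
    using assms Sig_mult[symmetric] by (simp_all del: G_simps add: Sig_one)
qed

lemma Sig_0: assumes "a \<in> carrier G" shows "Sig a 0 = Phi a"
proof -
  interpret group G by (rule group_G)
  show ?thesis using Phi_mult[OF assms one_closed] Phi_one assms by (simp del: G_simps)
qed

lemma subgroup_K: "subgroup K G"
proof (rule group.subgroupI[OF group_G])
  interpret group G by (rule group_G)
  show "K \<subseteq> carrier G" by (auto simp: K_eq)
  have "\<one>\<^bsub>G\<^esub> \<in> K" by (simp only: K_eq mem_Collect_eq one_closed Phi_one simp_thms)
  then show "K \<noteq> {}" by blast
  show "inv\<^bsub>G\<^esub> a \<in> K" if "a \<in> K" for a
  proof -
    have a: "a \<in> carrier G" "Phi a = 0" using that by (auto simp: K_eq)
    then have "Phi (inv\<^bsub>G\<^esub> a) = Sig (inv\<^bsub>G\<^esub> a) (Phi a)" using Sig_0 inv_closed by (simp only:)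
    also have "\<dots> = 0" using Phi_mult[of "inv\<^bsub>G\<^esub> a" a] a Phi_one by (metis inv_closed l_inv)
    finally show ?thesis using a by (simp add: K_eq del: G_simps)
  qed
  show "a \<otimes>\<^bsub>G\<^esub> b \<in> K" if "a \<in> K" "b \<in> K" for a b
  proof -
    have *: "a \<in> carrier G" "Phi a = 0" "b \<in> carrier G" "Phi b = 0" using that by (auto simp: K_eq)
    then have "Phi (a \<otimes>\<^bsub>G\<^esub> b) = Phi a" using Phi_mult Sig_0 by (simp del: G_simps)
    then show ?thesis using * by (simp add: K_eq del: G_simps)
  qed
qed

text \<open>The cosets of K turn out to be these fibres (\<open>coset_fib\<close>,
  \<open>M_fib\<close>), which makes \<open>fib\<close> the inverse of the chart.\<close>

definition fib :: "real^4 \<Rightarrow> gel set" where "fib v = {x \<in> carrier G. Phi x = v}"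

lemma sect_fib: "sect v \<in> fib v" using sect_carrier by (simp add: fib_def del: G_simps)

lemma inj_fib: "inj fib"
  by (rule injI) (metis (mono_tags, lifting) fib_def mem_Collect_eq sect_fib)

lemma translate_fib: assumes a: "a \<in> carrier G" shows "a <#\<^bsub>G\<^esub> fib v = fib (Sig a v)"
proof
  interpret group G by (rule group_G)
  show "a <#\<^bsub>G\<^esub> fib v \<subseteq> fib (Sig a v)"
  proof
    fix x assume "x \<in> a <#\<^bsub>G\<^esub> fib v"
    then obtain y where y: "y \<in> fib v" "x = a \<otimes>\<^bsub>G\<^esub> y" unfolding l_coset_def by blast
    then have "y \<in> carrier G" "Phi y = v" by (auto simp: fib_def)
    then show "x \<in> fib (Sig a v)" using a y Phi_mult m_closed by (simp add: fib_def del: G_simps)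
  qed
  show "fib (Sig a v) \<subseteq> a <#\<^bsub>G\<^esub> fib v"
  proof
    fix x assume "x \<in> fib (Sig a v)"
    then have x: "x \<in> carrier G" "Phi x = Sig a v" by (auto simp: fib_def)
    have "inv\<^bsub>G\<^esub> a \<otimes>\<^bsub>G\<^esub> x \<in> fib v"
      using x a Phi_mult Sig_inv(1) inv_closed m_closed by (simp add: fib_def del: G_simps)
    moreover have "x = a \<otimes>\<^bsub>G\<^esub> (inv\<^bsub>G\<^esub> a \<otimes>\<^bsub>G\<^esub> x)"
      using a x m_assoc[symmetric] by (simp del: G_simps)
    ultimately show "x \<in> a <#\<^bsub>G\<^esub> fib v" by (auto simp: l_coset_def simp del: G_simps)
  qed
qed

lemma K_fib: "K = fib 0" by (simp add: K_eq fib_def)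

lemma coset_fib: "a \<in> carrier G \<Longrightarrow> a <#\<^bsub>G\<^esub> K = fib (Phi a)"
  unfolding K_fib using translate_fib Sig_0 by simp

section \<open>The coset space as a smooth manifold\<close>

abbreviation "M \<equiv> lcosets\<^bsub>G\<^esub> K"

lemma M_fib: "M = range fib"
proof -
  have "M = (\<lambda>a. fib (Phi a)) ` carrier G" using coset_fib by (auto simp: LCOSETS_def simp del: G_simps)
  also have "\<dots> = range fib"
  proof -
    have "fib v \<in> (\<lambda>a. fib (Phi a)) ` carrier G" for v
      by (rule image_eqI[where x = "sect v"]) (simp_all only: Phi_sect sect_carrier)
    then show ?thesis by blast
  qed
  finally show ?thesis .
qed

definition phi :: "gel set \<Rightarrow> real^4" where "phi = inv_into UNIV fib"

lemma phi_fib [simp]: "phi (fib v) = v" unfolding phi_def using inj_fib by simp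
lemma fib_in_M [simp]: "fib v \<in> M" by (simp add: M_fib)
lemma fib_phi: "m \<in> M \<Longrightarrow> fib (phi m) = m" by (auto simp: M_fib)

abbreviation "E \<equiv> ambient \<xi>"

lemma sub_E: "subspace E" using subspace_Times[OF subspace_UNIV xi_sub] .

lemma carrier_E: "carrier G \<subseteq> E" by auto

text \<open>The support of f x varies with x; the common degree bound replaces it by a fixed index
  set, so that evaluation is a finite sum of products of smooth functions.\<close>

lemma Sm_ev:
  fixes f :: "'z::real_vector \<Rightarrow> plane"
  assumes EU: "subspace E'" "fd_open E' U" and deg: "\<And>x. x \<in> U \<Longrightarrow> f x \<in> \<xi>"
    and p: "C_k n E' U p" "C_k n E' U q" and f: "\<And>i j. C_k n E' U (\<lambda>x. pcoeff (f x) i j)"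
  shows "C_k n E' U (\<lambda>x. ev (p x) (q x) (dx (f x)))" "C_k n E' U (\<lambda>x. ev (p x) (q x) (dy (f x)))"
proof -
  have pow: "C_k n E' U (\<lambda>x. h x ^ i)" if "C_k n E' U h" for h i
    by (induct i) (auto intro: C_k_const[OF EU] C_k_mult[OF EU that])
  have b: "\<forall>i j. N < i + j \<longrightarrow> pcoeff (dx (f x)) i j = 0" "\<forall>i j. N < i + j \<longrightarrow> pcoeff (dy (f x)) i j = 0" if "x \<in> U" for x
    using xi_bound[OF deg[OF that]] by auto
  show "C_k n E' U (\<lambda>x. ev (p x) (q x) (dx (f x)))"
    by (rule C_k_cong[OF EU ev_polys_upto[OF b(1), symmetric]], assumption)
       (intro C_k_sum[OF EU] C_k_mult[OF EU] pow p, unfold dx_pcoeff, intro C_k_mult[OF EU] C_k_const[OF EU] f)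
  show "C_k n E' U (\<lambda>x. ev (p x) (q x) (dy (f x)))"
    by (rule C_k_cong[OF EU ev_polys_upto[OF b(2), symmetric]], assumption)
       (intro C_k_sum[OF EU] C_k_mult[OF EU] pow p, unfold dy_pcoeff, intro C_k_mult[OF EU] C_k_const[OF EU] f)
qed

lemma linear_gel: "linear (\<lambda>a::gel. fst (fst a) $ i $ j)" "linear (\<lambda>a::gel. snd (fst a) $ i)" "linear (\<lambda>a::gel. pcoeff (snd a) m n)"
  by (auto intro!: linearI)

lemma C_k_vec:
  fixes F :: "real^4 \<Rightarrow> real"
  assumes "subspace E'" "fd_open E' U" "open V" "\<And>x. x \<in> U \<Longrightarrow> T x \<in> V"
    and "\<And>i. C_k n E' U (\<lambda>x. T x $ i)" "C_k n UNIV V F"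
  shows "C_k n E' U (\<lambda>x. F (T x))"
  by (rule C_k_compose[OF assms(1-4) _ assms(6)]) (auto simp: Basis_vec_def inner_axis assms(5))

lemma Phi_smooth: assumes "fd_open E U" shows "C_k n E U (\<lambda>a. Phi a $ i)"
proof -
  note S = sub_E assms
  note l = C_k_linear[OF S linear_gel(2)] C_k_linear[OF S linear_gel(3)]
  have U: "snd a \<in> \<xi>" if "a \<in> U" for a using that fd_open_sub[OF assms] by auto
  have "C_k n E U (\<lambda>a. snd (fst a) $ 1)" "C_k n E U (\<lambda>a. snd (fst a) $ 2)" by (rule l)+
  moreover have "C_k n E U (\<lambda>a. ev (snd (fst a) $ 1) (snd (fst a) $ 2) (dx (snd a)))"
    "C_k n E U (\<lambda>a. ev (snd (fst a) $ 1) (snd (fst a) $ 2) (dy (snd a)))"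
    by (rule Sm_ev[OF S U]; (assumption | rule l))+
  ultimately show ?thesis
    using exhaust_4[of i] by (auto simp: Phi_def split_beta)
qed

lemma open_preimage_Phi: assumes "open V" shows "fd_open E {a \<in> E. Phi a \<in> V}"
proof -
  let ?X = "fd_topology E"
  have "continuous_map ?X euclideanreal (\<lambda>a. Phi a $ i)" for i
    using C_k_cont[OF Phi_smooth[OF fd_open_space[OF sub_E], of 0 i]]
    by (metis subtopology_topspace topspace_fd[OF sub_E])
  then have "(Phi \<longlongrightarrow> Phi a) (atin ?X a)" if "a \<in> topspace ?X" for a
    using that by (intro vec_tendstoI) (auto simp: continuous_map_tendsto)
  then have "continuous_map ?X euclidean Phi" by (simp add: continuous_map_tendsto)
  from openin_continuous_map_preimage[OF this, of V] show ?thesis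
    using assms by (simp add: sub_E openin_fd_topology)
qed

definition sect_lin :: "real^4 \<Rightarrow> gel" where
  "sect_lin v = ((0, vector [v $ 1, v $ 2]), v $ 3 *\<^sub>R px + v $ 4 *\<^sub>R py)"

lemma sect_affine: "sect v = ((mat 1, 0), 0) + sect_lin v"
  by (simp add: sect_def sect_lin_def)

lemma sect_lin: "linear sect_lin" "sect_lin ` UNIV \<subseteq> E"
proof -
  have "(vector [v $ 1 + w $ 1, v $ 2 + w $ 2] :: real^2) = vector [v $ 1, v $ 2] + vector [w $ 1, w $ 2]"
    "(vector [c * v $ 1, c * v $ 2] :: real^2) = c *\<^sub>R vector [v $ 1, v $ 2]" for v w :: "real^4" and c
    by (rule vec2_eqI; simp)+
  then show "linear sect_lin"
    by (intro linearI) (simp_all add: sect_lin_def scaleR_add_left scaleR_add_right)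
  show "sect_lin ` UNIV \<subseteq> E"
    using xi_p by (auto simp: sect_lin_def subspace_add[OF xi_sub] subspace_scale[OF xi_sub])
qed

lemma open_preimage_sect: "fd_open E T \<Longrightarrow> open {v. sect v \<in> T}"
  using fd_open_preimage[OF sect_lin _ subspace_UNIV, where S = T and a = "((mat 1, 0), 0)"]
  by (simp add: sect_affine fd_open_UNIV)

abbreviation "CT \<equiv> coset_topology \<xi> G K"

lemma topspace_G: "topspace (group_topology \<xi> G) = carrier G"
  using carrier_E by (auto simp: group_topology_def topspace_subtopology sub_E)

text \<open>Openness is pulled back along \<open>sect\<close> in one direction and along
  \<open>Phi\<close> in the other, both being continuous.\<close>

lemma openin_CT: "openin CT U \<longleftrightarrow> U \<subseteq> M \<and> open {v. fib v \<in> U}"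
proof -
  have 1: "(\<lambda>a. a <#\<^bsub>G\<^esub> K) ` topspace (group_topology \<xi> G) = M"
    unfolding topspace_G LCOSETS_def by auto
  have 2: "{a \<in> topspace (group_topology \<xi> G). a <#\<^bsub>G\<^esub> K \<in> U} = {a \<in> carrier G. fib (Phi a) \<in> U}"
    unfolding topspace_G using coset_fib by (auto simp del: G_simps)
  have "openin (group_topology \<xi> G) {a \<in> carrier G. fib (Phi a) \<in> U} \<longleftrightarrow> open {v. fib v \<in> U}"
  proof
    assume "openin (group_topology \<xi> G) {a \<in> carrier G. fib (Phi a) \<in> U}"
    then obtain T where T: "fd_open E T" "{a \<in> carrier G. fib (Phi a) \<in> U} = T \<inter> carrier G"
      by (auto simp: group_topology_def openin_subtopology openin_fd_topology)
    have "fib v \<in> U \<longleftrightarrow> sect v \<in> T" for v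
    proof -
      have "sect v \<in> {a \<in> carrier G. fib (Phi a) \<in> U} \<longleftrightarrow> sect v \<in> T \<inter> carrier G" using T(2) by simp
      then show ?thesis using sect_carrier[of v] by (simp del: G_simps)
    qed
    then show "open {v. fib v \<in> U}" using open_preimage_sect[OF T(1)] by simp
  next
    assume o: "open {v. fib v \<in> U}"
    have "{a \<in> carrier G. fib (Phi a) \<in> U} = {a \<in> E. Phi a \<in> {v. fib v \<in> U}} \<inter> carrier G" using carrier_E by auto
    then show "openin (group_topology \<xi> G) {a \<in> carrier G. fib (Phi a) \<in> U}"
      using open_preimage_Phi[OF o] unfolding group_topology_def openin_subtopology openin_fd_topology by blast
  qed
  then show ?thesis unfolding coset_topology_def openin_quotient_topology 1 2 by simp
qed

lemma topspace_CT: "topspace CT = M"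
proof -
  have "openin CT M" unfolding openin_CT by (simp add: M_fib)
  then show ?thesis unfolding topspace_def using openin_CT by blast
qed

text \<open>A local extension to the ambient space, restricted along the affine section, is smooth
  in the chart; conversely, composition of a smooth chart function with \<open>Phi\<close> is
  already an extension.\<close>

lemma coset_smooth_iff:
  assumes W: "openin CT W"
  shows "F \<in> coset_smooth \<xi> G K W \<longleftrightarrow> (\<forall>n. C_k n UNIV {v. fib v \<in> W} (\<lambda>v. F (fib v)))"
proof
  let ?V = "{v. fib v \<in> W}" and ?S = "{a \<in> carrier G. a <#\<^bsub>G\<^esub> K \<in> W}"
  have V: "open ?V" using W openin_CT by blast
  {
    assume F: "F \<in> coset_smooth \<xi> G K W"
    show "\<forall>n. C_k n UNIV ?V (\<lambda>v. F (fib v))"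
    proof
      fix n
      show "C_k n UNIV ?V (\<lambda>v. F (fib v))"
      proof (rule C_k_local[OF V])
        fix v assume v: "v \<in> ?V"
        have "sect v \<in> ?S" using v sect_carrier coset_fib by (simp del: G_simps)
        then obtain P F' where P: "sect v \<in> P" "smooth_on_open E P F'" "\<forall>y\<in>P \<inter> ?S. F' y = F (y <#\<^bsub>G\<^esub> K)"
          using F unfolding coset_smooth_def smooth_on_subset_def by blast
        have Po: "fd_open E P" and PC: "C_k n E P F'" using P(2) by (auto simp: smooth_on_open_def openin_fd_topology)
        let ?W = "{u. sect u \<in> P} \<inter> ?V"
        have o: "open ?W" using open_preimage_sect[OF Po] V by blast
        have "C_k n UNIV ?W (\<lambda>u. F' (((mat 1, 0), 0) + sect_lin u))"
          by (rule C_k_pullback[OF subspace_UNIV _ sect_lin sub_E Po _ PC])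
             (use o in \<open>auto simp: fd_open_UNIV sect_affine[symmetric]\<close>)
        then have "C_k n UNIV ?W (\<lambda>v. F (fib v))"
        proof (rule C_k_cong[OF subspace_UNIV, rotated 2])
          show "fd_open UNIV ?W" using o by (simp only: fd_open_UNIV)
          show "F' (((mat 1, 0), 0) + sect_lin u) = F (fib u)" if "u \<in> ?W" for u
          using that P(3) sect_carrier[of u] coset_fib[OF sect_carrier[of u]] by (simp add: sect_affine[symmetric] del: G_simps)
        qed
        then show "\<exists>W. open W \<and> v \<in> W \<and> C_k n UNIV W (\<lambda>v. F (fib v))"
          using o v P(1) by blast
      qed
    qed
  }
  assume F: "\<forall>n. C_k n UNIV ?V (\<lambda>v. F (fib v))"
  \<comment> \<open>\<open>Phi\<close> makes sense and is smooth on all of E, without invertibility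
    of the matrix, so one neighbourhood serves all points.\<close>
  have o: "fd_open E {a \<in> E. Phi a \<in> ?V}" by (rule open_preimage_Phi[OF V])
  have "C_k n E {a \<in> E. Phi a \<in> ?V} (\<lambda>a. F (fib (Phi a)))" for n
    by (rule C_k_vec[OF sub_E o V _ Phi_smooth[OF o]]) (use F in auto)
  then have "smooth_on_open E {a \<in> E. Phi a \<in> ?V} (\<lambda>a. F (fib (Phi a)))"
    using o by (simp add: smooth_on_open_def openin_fd_topology)
  moreover have "x \<in> {a \<in> E. Phi a \<in> ?V}" if "x \<in> ?S" for x
    using that carrier_E coset_fib[of x] by (auto simp del: G_simps)
  ultimately show "F \<in> coset_smooth \<xi> G K W"
    unfolding coset_smooth_def smooth_on_subset_def mem_Collect_eq
    using coset_fib by (metis (no_types, lifting) IntE mem_Collect_eq)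
qed

lemma inv_into_phi: "inv_into M phi v = fib v"
proof -
  have "inj_on phi M" using fib_phi by (metis inj_onI)
  then show ?thesis by (intro inv_into_f_eq) auto
qed

lemma phi_image: "U \<subseteq> M \<Longrightarrow> phi ` U = {v. fib v \<in> U}"
  using fib_phi by (auto intro: image_eqI[of _ _ "fib v" for v])

lemma homeo_phi: "homeomorphic_map CT (euclidean :: (real^4) topology) phi"
proof (rule bijective_open_imp_homeomorphic_map)
  show "inj_on phi (topspace CT)" unfolding topspace_CT using fib_phi by (metis inj_onI)
  show "phi ` topspace CT = topspace euclidean" unfolding topspace_CT by (simp add: phi_image)
  show "open_map CT (euclidean :: (real^4) topology) phi"
    unfolding open_map_def by (metis openin_CT phi_image open_openin)
  show "continuous_map CT (euclidean :: (real^4) topology) phi"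
    unfolding continuous_map_def topspace_CT
  proof (intro conjI allI impI)
    fix U :: "(real^4) set" assume "openin euclidean U"
    then show "openin CT {x \<in> M. phi x \<in> U}" unfolding openin_CT by simp
  qed simp
qed

lemma manifold: "smooth_4_manifold CT (coset_smooth \<xi> G K)"
  unfolding smooth_4_manifold_def
proof (intro conjI ballI)
  show "Hausdorff_space CT"
    using homeomorphic_Hausdorff_space[OF homeomorphic_map_imp_homeomorphic_space[OF homeo_phi]]
    by (simp add: Hausdorff_space_euclidean)
  obtain B :: "(real^4) set set" where B: "countable B" "topological_basis B" using ex_countable_basis by blast
  have "openin CT U \<longleftrightarrow> (\<exists>\<U>\<subseteq>(\<lambda>V. fib ` V) ` B. U = \<Union>\<U>)" for U
  proof
    assume U: "openin CT U"
    then obtain B' where B': "B' \<subseteq> B" "\<Union>B' = {v. fib v \<in> U}"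
      using B(2) unfolding openin_CT topological_basis_def by metis
    have "U = fib ` {v. fib v \<in> U}" using U unfolding openin_CT M_fib by auto
    also have "\<dots> = \<Union>((\<lambda>V. fib ` V) ` B')" unfolding B'(2)[symmetric] by auto
    finally have "U = \<Union>((\<lambda>V. fib ` V) ` B')" .
    with image_mono[OF B'(1)] show "\<exists>\<U>\<subseteq>(\<lambda>V. fib ` V) ` B. U = \<Union>\<U>" by (intro exI conjI)
  next
    assume "\<exists>\<U>\<subseteq>(\<lambda>V. fib ` V) ` B. U = \<Union>\<U>"
    then obtain B' where B': "B' \<subseteq> B" "U = \<Union>((\<lambda>V. fib ` V) ` B')" by (metis subset_image_iff)
    then have "{v. fib v \<in> U} = \<Union>B'" using inj_fib by (auto simp: inj_eq)
    moreover have "open (\<Union>B')" using B'(1) B(2) by (meson open_Union subset_iff topological_basis_open)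
    ultimately show "openin CT U" unfolding openin_CT using B'(2) M_fib by auto
  qed
  then show "\<exists>\<B>. countable \<B> \<and> (\<forall>U. openin CT U \<longleftrightarrow> (\<exists>\<U>\<subseteq>\<B>. U = \<Union>\<U>))"
    using B(1) by (intro exI[of _ "(\<lambda>V. fib ` V) ` B"]) simp
  fix m assume m: "m \<in> topspace CT"
  have pM: "phi ` M = UNIV" by (simp add: phi_image)
  show "\<exists>U (\<phi> :: _ \<Rightarrow> real^4). openin CT U \<and> m \<in> U \<and> open (\<phi> ` U) \<and>
        homeomorphic_map (subtopology CT U) (top_of_set (\<phi> ` U)) \<phi> \<and>
        (\<forall>W F. openin CT W \<and> W \<subseteq> U \<longrightarrow>
           (F \<in> coset_smooth \<xi> G K W \<longleftrightarrow> smooth_on_open UNIV (\<phi> ` W) (F \<circ> inv_into U \<phi>)))"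
  proof (intro exI[of _ M] exI[of _ phi] conjI allI impI)
    show "openin CT M" by (metis openin_topspace topspace_CT)
    show "m \<in> M" using m by (simp add: topspace_CT)
    show "open (phi ` M)" by (simp add: pM)
    show "homeomorphic_map (subtopology CT M) (top_of_set (phi ` M)) phi"
    proof -
      have "subtopology CT M = CT" by (metis subtopology_topspace topspace_CT)
      then show ?thesis using homeo_phi by (simp add: pM)
    qed
    fix W F assume W: "openin CT W \<and> W \<subseteq> M"
    have "open {v. fib v \<in> W}" using W openin_CT by blast
    then show "F \<in> coset_smooth \<xi> G K W \<longleftrightarrow> smooth_on_open UNIV (phi ` W) (F \<circ> inv_into M phi)"
      using W by (simp add: coset_smooth_iff phi_image smooth_on_open_def inv_into_phi o_def fd_topology_UNIV)
  qed
qed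

lemma closed_K: "closedin (group_topology \<xi> G) K"
proof -
  have "fd_open E {a \<in> E. Phi a \<in> - {0}}" by (rule open_preimage_Phi) auto
  then have "openin (group_topology \<xi> G) ({a \<in> E. Phi a \<in> - {0}} \<inter> carrier G)"
    unfolding group_topology_def openin_subtopology openin_fd_topology by blast
  moreover have "{a \<in> E. Phi a \<in> - {0}} \<inter> carrier G = carrier G - K" using carrier_E by (auto simp: K_eq)
  ultimately show ?thesis unfolding closedin_def topspace_G by (simp add: K_eq del: G_simps)
qed

end

section \<open>Vector fields, forms and connections in the chart\<close>

definition Sm :: "(real^4 \<Rightarrow> real) \<Rightarrow> bool" where "Sm f \<longleftrightarrow> (\<forall>n. C_k n UNIV UNIV f)"

definition D :: "4 \<Rightarrow> (real^4 \<Rightarrow> real) \<Rightarrow> real^4 \<Rightarrow> real" where "D i f = dir_deriv f (axis i 1)"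

lemma fd_open_UNIV4: "fd_open (UNIV :: (real^4) set) UNIV" by (simp add: fd_open_UNIV)

lemmas SU = subspace_UNIV fd_open_UNIV4

lemma Sm_const [simp]: "Sm (\<lambda>u. c)" by (simp add: Sm_def C_k_const[OF SU])
lemma Sm_add: "Sm f \<Longrightarrow> Sm g \<Longrightarrow> Sm (\<lambda>u. f u + g u)" by (simp add: Sm_def C_k_add[OF SU])
lemma Sm_mult: "Sm f \<Longrightarrow> Sm g \<Longrightarrow> Sm (\<lambda>u. f u * g u)" by (simp add: Sm_def C_k_mult[OF SU])
lemma Sm_diff: "Sm f \<Longrightarrow> Sm g \<Longrightarrow> Sm (\<lambda>u. f u - g u)"
  using Sm_add[of f "\<lambda>u. (-1) * g u"] Sm_mult[OF Sm_const[of "-1"], of g] by simp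
lemma Sm_sum: "(\<And>i. i \<in> I \<Longrightarrow> Sm (f i)) \<Longrightarrow> Sm (\<lambda>u. \<Sum>i\<in>I. f i u)" by (simp add: Sm_def C_k_sum[OF SU])
lemma Sm_proj [simp]: "Sm (\<lambda>u. u $ i)"
  by (simp add: Sm_def C_k_linear[OF SU] linearI)
lemma Sm_D: "Sm f \<Longrightarrow> Sm (D i f)" unfolding Sm_def D_def by (metis C_k.simps(2) UNIV_I)

lemma D_deriv: "Sm f \<Longrightarrow> ((\<lambda>t. f (v + t *\<^sub>R axis i 1)) has_real_derivative D i f v) (at 0)"
  unfolding Sm_def D_def using C_k_deriv[of 0 UNIV UNIV f "axis i 1" v] by blast

lemma D_eqI: "((\<lambda>t. f (v + t *\<^sub>R axis i 1)) has_real_derivative d) (at 0) \<Longrightarrow> D i f v = d"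
  unfolding D_def by (rule dir_deriv_eqI)

lemma D_add: "Sm f \<Longrightarrow> Sm g \<Longrightarrow> D i (\<lambda>u. f u + g u) v = D i f v + D i g v"
  by (rule D_eqI) (intro DERIV_add D_deriv)
lemma D_mult: "Sm f \<Longrightarrow> Sm g \<Longrightarrow> D i (\<lambda>u. f u * g u) v = D i f v * g v + f v * D i g v"
  by (rule D_eqI) (use DERIV_mult[OF D_deriv D_deriv, of f g] in \<open>simp add: algebra_simps\<close>)
lemma D_const [simp]: "D i (\<lambda>u. c) v = 0" by (rule D_eqI) simp
lemma D_cmult: "Sm f \<Longrightarrow> D i (\<lambda>u. c * f u) v = c * D i f v" by (simp add: D_mult)
lemma line_nth: "(v + t *\<^sub>R axis i (1::real)) $ j = v $ j + (if i = j then t else 0)"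
  by (auto simp: axis_def)
lemma D_proj [simp]: "D i (\<lambda>u. u $ j) v = (if i = j then 1 else 0)"
  by (rule D_eqI) (auto simp: axis_def intro!: derivative_eq_intros)

lemma sum_Basis_vec: "(\<Sum>b\<in>Basis. h b) = (\<Sum>i\<in>UNIV. h (axis i 1))" for h :: "real^4 \<Rightarrow> 'b::comm_monoid_add"
proof -
  have B: "(Basis :: (real^4) set) = range (\<lambda>i. axis i 1)" by (auto simp: Basis_vec_def)
  have "inj (\<lambda>i::4. axis i (1::real) :: real^4)" by (rule injI) (simp add: axis_eq_axis)
  then show ?thesis unfolding B by (simp add: sum.reindex)
qed

lemma Sm_compose:
  assumes "Sm h" "\<And>i. Sm (\<lambda>v. T v $ i)" shows "Sm (\<lambda>v. h (T v))"
  unfolding Sm_def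
proof
  fix n
  show "C_k n UNIV UNIV (\<lambda>v. h (T v))"
    by (rule C_k_compose[OF SU open_UNIV]) (use assms in \<open>auto simp: Sm_def Basis_vec_def inner_axis\<close>)
qed

text \<open>A derivation at v annihilates constants, and Hadamard's lemma writes f as a constant
  plus products in which one factor is a coordinate difference vanishing at v.\<close>

lemma derivation_formula:
  fixes \<delta> :: "(real^4 \<Rightarrow> real) \<Rightarrow> real"
  assumes add: "\<And>f g. Sm f \<Longrightarrow> Sm g \<Longrightarrow> \<delta> (\<lambda>u. f u + g u) = \<delta> f + \<delta> g"
    and cmul: "\<And>c f. Sm f \<Longrightarrow> \<delta> (\<lambda>u. c * f u) = c * \<delta> f"
    and mul: "\<And>f g. Sm f \<Longrightarrow> Sm g \<Longrightarrow> \<delta> (\<lambda>u. f u * g u) = \<delta> f * g v + f v * \<delta> g"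
    and f: "Sm f"
  shows "\<delta> f = (\<Sum>i\<in>UNIV. D i f v * \<delta> (\<lambda>u. u $ i))"
proof -
  have "\<delta> (\<lambda>u. 1) = 0" using mul[of "\<lambda>u. 1" "\<lambda>u. 1"] by simp
  then have const: "\<delta> (\<lambda>u. c) = 0" for c using cmul[of "\<lambda>u. 1" c] by simp
  obtain g where g: "\<And>k b. C_k k UNIV UNIV (g b)" "\<And>b. g b v = dir_deriv f b v"
    "\<And>x. f x = f v + (\<Sum>b\<in>Basis. ((x - v) \<bullet> b) * g b x)"
    using hadamard[of f v] f unfolding Sm_def by blast
  let ?g = "\<lambda>i. g (axis i 1)"
  have gS: "Sm (?g i)" for i using g(1) by (simp add: Sm_def)
  have p: "Sm (\<lambda>u. u $ i + (- v $ i))" for i by (intro Sm_add Sm_proj Sm_const)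
  have t: "\<delta> (\<lambda>u. (u $ i + (- v $ i)) * ?g i u) = \<delta> (\<lambda>u. u $ i) * D i f v" for i
    using mul[OF p gS, of i i] add[OF Sm_proj Sm_const, of i "- v $ i"] by (simp add: const g(2) D_def)
  have tS: "Sm (\<lambda>u. (u $ i + (- v $ i)) * ?g i u)" for i by (intro Sm_mult p gS)
  \<comment> \<open>Additivity is available for two summands, so the sum over the four coordinates
    is written as nested binary sums.\<close>
  define T where "T i = (\<lambda>u. (u $ i + (- v $ i)) * ?g i u)" for i
  note t = t[folded T_def] and tS = tS[folded T_def]
  have "f = (\<lambda>u. f v + (((T 1 u + T 2 u) + T 3 u) + T 4 u))"
    by (rule ext, rule trans[OF g(3)]) (simp add: sum_Basis_vec sum_4 inner_axis inner_diff_left T_def)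
  then have "\<delta> f = \<delta> (\<lambda>u. f v + (((T 1 u + T 2 u) + T 3 u) + T 4 u))" by (rule arg_cong)
  also have "\<dots> = \<delta> (\<lambda>u. f v) + (((\<delta> (T 1) + \<delta> (T 2)) + \<delta> (T 3)) + \<delta> (T 4))"
  proof -
    have s12: "Sm (\<lambda>u. T 1 u + T 2 u)" by (rule Sm_add[OF tS tS])
    have s123: "Sm (\<lambda>u. (T 1 u + T 2 u) + T 3 u)" by (rule Sm_add[OF s12 tS])
    have s: "Sm (\<lambda>u. ((T 1 u + T 2 u) + T 3 u) + T 4 u)" by (rule Sm_add[OF s123 tS])
    show ?thesis unfolding add[OF Sm_const s] add[OF s123 tS] add[OF s12 tS] add[OF tS tS] ..
  qed
  also have "\<dots> = (\<Sum>i\<in>UNIV. D i f v * \<delta> (\<lambda>u. u $ i))" unfolding t const sum_4 by simp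
  finally show ?thesis .
qed

context star_grp begin

definition lift :: "(real^4 \<Rightarrow> real) \<Rightarrow> gel set \<Rightarrow> real" where
  "lift f = (\<lambda>m. if m \<in> M then f (phi m) else 0)"

definition "A = coset_functions \<xi> G K"
abbreviation "VF \<equiv> vector_fields A"
definition "xx i = lift (\<lambda>u. u $ i)"

lemma lift_fib [simp]: "lift f (fib v) = f v" by (simp add: lift_def)
lemma lift_off: "m \<notin> M \<Longrightarrow> lift f m = 0" by (simp add: lift_def)

lemma A_iff: "F \<in> A \<longleftrightarrow> Sm (\<lambda>v. F (fib v)) \<and> (\<forall>m. m \<notin> M \<longrightarrow> F m = 0)"
proof -
  have "openin CT M" by (metis openin_topspace topspace_CT)
  from coset_smooth_iff[OF this] show ?thesis
    by (auto simp: A_def coset_functions_def Sm_def)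
qed

lemma lift_A: "Sm f \<Longrightarrow> lift f \<in> A" by (simp add: A_iff lift_off)
lemma A_lift: "F \<in> A \<Longrightarrow> lift (\<lambda>v. F (fib v)) = F"
  by (auto simp: fun_eq_iff lift_def fib_phi A_iff)
lemma A_Sm: "F \<in> A \<Longrightarrow> Sm (\<lambda>v. F (fib v))" by (simp add: A_iff)
lemma A_off: "F \<in> A \<Longrightarrow> m \<notin> M \<Longrightarrow> F m = 0" by (simp add: A_iff)
lemma A_add: "F \<in> A \<Longrightarrow> F' \<in> A \<Longrightarrow> (\<lambda>m. F m + F' m) \<in> A" by (auto simp: A_iff Sm_add)
lemma A_mult: "F \<in> A \<Longrightarrow> F' \<in> A \<Longrightarrow> (\<lambda>m. F m * F' m) \<in> A" by (auto simp: A_iff Sm_mult)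
lemma A_diff: "F \<in> A \<Longrightarrow> F' \<in> A \<Longrightarrow> (\<lambda>m. F m - F' m) \<in> A" by (auto simp: A_iff Sm_diff)
lemma A_zero: "(\<lambda>m. 0) \<in> A" by (simp add: A_iff)
lemma xx_A [simp]: "xx i \<in> A" by (simp add: xx_def lift_A)

lemma M_cases: assumes "m \<in> M" obtains v where "m = fib v" using assms by (auto simp: M_fib)

lemma fun_M_eqI:
  assumes "\<And>m. m \<notin> M \<Longrightarrow> F m = F' m" "\<And>v. F (fib v) = F' (fib v)" shows "F = F'"
  using assms M_cases by (metis ext)

lemma lift_add: "lift (\<lambda>u. f u + g u) = (\<lambda>m. lift f m + lift g m)"
  and lift_mult: "lift (\<lambda>u. f u * g u) = (\<lambda>m. lift f m * lift g m)"
  and lift_cmult: "lift (\<lambda>u. c * f u) = (\<lambda>m. c * lift f m)"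
  by (auto simp: lift_def fun_eq_iff)

lemma VF_rules:
  assumes "X \<in> VF"
  shows "F \<in> A \<Longrightarrow> X F \<in> A" "F \<notin> A \<Longrightarrow> X F = (\<lambda>m. 0)"
    "F \<in> A \<Longrightarrow> F' \<in> A \<Longrightarrow> X (\<lambda>m. F m + F' m) = (\<lambda>m. X F m + X F' m)"
    "F \<in> A \<Longrightarrow> X (\<lambda>m. c * F m) = (\<lambda>m. c * X F m)"
    "F \<in> A \<Longrightarrow> F' \<in> A \<Longrightarrow> X (\<lambda>m. F m * F' m) = (\<lambda>m. X F m * F' m + F m * X F' m)"
  using assms unfolding vector_fields_def by blast+

lemma VF_diff: assumes X: "X \<in> VF" and F: "F \<in> A" "F' \<in> A" shows "X (\<lambda>m. F m - F' m) = (\<lambda>m. X F m - X F' m)"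
proof -
  have "(\<lambda>m. - 1 * F' m) \<in> A" using F(2) A_diff[OF A_zero F(2)] by simp
  from VF_rules(3)[OF X F(1) this] VF_rules(4)[OF X F(2), of "-1"] show ?thesis by simp
qed

lemma VF_zero: "X \<in> VF \<Longrightarrow> X (\<lambda>m. 0) = (\<lambda>m. 0)"
  using VF_rules(4)[of X "\<lambda>m. 0" 0] A_zero by simp

definition co :: "gel set vfield \<Rightarrow> 4 \<Rightarrow> real^4 \<Rightarrow> real" where "co X i v = X (xx i) (fib v)"

lemma co_Sm: "X \<in> VF \<Longrightarrow> Sm (co X i)"
  using A_Sm[OF VF_rules(1)[OF _ xx_A]] by (simp add: co_def[abs_def])

text \<open>As a function of h, the left side is a derivation at the point T v. With T the identity
  this gives the component formula, with T the group action the transformation law of vector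
  fields.\<close>

lemma VF_pull:
  assumes X: "X \<in> VF" and T: "\<And>i. Sm (\<lambda>v. T v $ i)" and h: "Sm h"
  shows "X (lift (\<lambda>v. h (T v))) (fib v) = (\<Sum>k\<in>UNIV. D k h (T v) * X (lift (\<lambda>v. T v $ k)) (fib v))"
proof (rule derivation_formula[of "\<lambda>h. X (lift (\<lambda>v. h (T v))) (fib v)", OF _ _ _ h])
  note l = lift_A[OF Sm_compose[OF _ T]]
  fix f g c assume f: "Sm f"
  show "X (lift (\<lambda>v. c * f (T v))) (fib v) = c * X (lift (\<lambda>v. f (T v))) (fib v)"
    unfolding lift_cmult VF_rules(4)[OF X l[OF f]] ..
  assume g: "Sm g"
  show "X (lift (\<lambda>v. f (T v) + g (T v))) (fib v) = X (lift (\<lambda>v. f (T v))) (fib v) + X (lift (\<lambda>v. g (T v))) (fib v)"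
    unfolding lift_add VF_rules(3)[OF X l[OF f] l[OF g]] ..
  show "X (lift (\<lambda>v. f (T v) * g (T v))) (fib v) = X (lift (\<lambda>v. f (T v))) (fib v) * g (T v) + f (T v) * X (lift (\<lambda>v. g (T v))) (fib v)"
    unfolding lift_mult VF_rules(5)[OF X l[OF f] l[OF g]] lift_fib ..
qed

lemma VF_formula:
  assumes "X \<in> VF" "F \<in> A"
  shows "X F (fib v) = (\<Sum>i\<in>UNIV. D i (\<lambda>v. F (fib v)) v * co X i v)"
  using VF_pull[OF assms(1) Sm_proj A_Sm[OF assms(2)], of v] by (simp add: A_lift[OF assms(2)] co_def xx_def)

definition vfc :: "(4 \<Rightarrow> real^4 \<Rightarrow> real) \<Rightarrow> gel set vfield" where
  "vfc c = (\<lambda>F. if F \<in> A then lift (\<lambda>v. \<Sum>i\<in>UNIV. c i v * D i (\<lambda>v. F (fib v)) v) else (\<lambda>m. 0))"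

lemma vfc_fib: "F \<in> A \<Longrightarrow> vfc c F (fib v) = (\<Sum>i\<in>UNIV. c i v * D i (\<lambda>v. F (fib v)) v)"
  by (simp add: vfc_def)

lemma vfc_VF: assumes c: "\<And>i. Sm (c i)" shows "vfc c \<in> VF"
proof -
  have off: "vfc c F m = 0" if "m \<notin> M" for F m using that by (simp add: vfc_def lift_off)
  have "vfc c F \<in> A" if "F \<in> A" for F
    unfolding vfc_def using that by (simp, intro lift_A Sm_sum Sm_mult c Sm_D A_Sm)
  moreover have "vfc c (\<lambda>m. F m + F' m) = (\<lambda>m. vfc c F m + vfc c F' m)" if "F \<in> A" "F' \<in> A" for F F'
    by (rule fun_M_eqI) (use that off in \<open>simp_all add: vfc_fib A_add D_add A_Sm sum.distrib distrib_left\<close>)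
  moreover have "vfc c (\<lambda>m. r * F m) = (\<lambda>m. r * vfc c F m)" if "F \<in> A" for F r
  proof -
    have "(\<lambda>m. r * F m) \<in> A" using that by (auto simp: A_iff Sm_mult)
    then show ?thesis by (intro fun_M_eqI) (use that off in \<open>simp_all add: vfc_fib D_cmult A_Sm sum_distrib_left mult_ac\<close>)
  qed
  moreover have "vfc c (\<lambda>m. F m * F' m) = (\<lambda>m. vfc c F m * F' m + F m * vfc c F' m)" if "F \<in> A" "F' \<in> A" for F F'
    by (rule fun_M_eqI) (use that off in \<open>simp_all add: vfc_fib A_mult D_mult A_Sm sum_4 algebra_simps\<close>)
  ultimately show ?thesis unfolding vector_fields_def by (auto simp: vfc_def)
qed

lemma co_vfc [simp]: "co (vfc c) i v = c i v"
proof -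
  have "co (vfc c) i v = (\<Sum>j\<in>UNIV. c j v * (if j = i then 1 else 0))"
    unfolding co_def by (simp add: vfc_fib) (simp add: xx_def)
  also have "\<dots> = c i v" by (simp add: sum.delta' if_distrib cong: if_cong)
  finally show ?thesis .
qed

lemma vf_bracket_VF: assumes X: "X \<in> VF" and Y: "Y \<in> VF" shows "vf_bracket X Y \<in> VF"
proof -
  note x = VF_rules[OF X] and y = VF_rules[OF Y]
  show ?thesis
    unfolding vector_fields_def vf_bracket_def
    by (auto simp: x y A_diff A_add A_mult VF_zero[OF X] VF_zero[OF Y] algebra_simps)
qed

text \<open>The form dx_1 dx_3 + dx_2 dx_4 (wedge products), with the sign for which q pairs with p
  to +1 as in \<open>Omega\<close>. Written through the derivations themselves, it is visibly
  bilinear over the function algebra.\<close>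

definition om :: "gel set vfield \<Rightarrow> gel set vfield \<Rightarrow> gel set \<Rightarrow> real" where
  "om X Y = (\<lambda>m. (X (xx 1) m * Y (xx 3) m - X (xx 3) m * Y (xx 1) m) +
                 (X (xx 2) m * Y (xx 4) m - X (xx 4) m * Y (xx 2) m))"

lemma om_A: assumes "X \<in> VF" "Y \<in> VF" shows "om X Y \<in> A"
  unfolding om_def by (intro A_add A_diff A_mult VF_rules(1)[OF assms(1)] VF_rules(1)[OF assms(2)] xx_A)

lemma two_form_om: "two_form A om"
  unfolding two_form_def
  by (auto simp: om_A) (auto simp: om_def vf_add_def vf_scale_def algebra_simps)

lemma om_fib: "om X Y (fib v) = co X 1 v * co Y 3 v - co X 3 v * co Y 1 v + (co X 2 v * co Y 4 v - co X 4 v * co Y 2 v)"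
  by (simp add: om_def co_def)

text \<open>The form is built from differentials of the functions \<open>xx i\<close>. The Leibniz
  rule produces iterated derivatives of these functions, and they cancel against the
  brackets.\<close>

lemma closed_om: "closed_form A om"
  unfolding closed_form_def
proof (intro ballI allI)
  fix X Y Z m assume X: "X \<in> VF" and Y: "Y \<in> VF" and Z: "Z \<in> VF"
  have d: "X (om Y Z) m = (X (Y (xx 1)) m * Z (xx 3) m + Y (xx 1) m * X (Z (xx 3)) m
       - (X (Y (xx 3)) m * Z (xx 1) m + Y (xx 3) m * X (Z (xx 1)) m)) +
      (X (Y (xx 2)) m * Z (xx 4) m + Y (xx 2) m * X (Z (xx 4)) m
       - (X (Y (xx 4)) m * Z (xx 2) m + Y (xx 4) m * X (Z (xx 2)) m))"
    if X: "X \<in> VF" and Y: "Y \<in> VF" and Z: "Z \<in> VF" for X Y Z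
    unfolding om_def
    by (simp add: VF_rules[OF X] VF_diff[OF X] A_diff A_mult VF_rules(1)[OF Y] VF_rules(1)[OF Z])
  show "X (om Y Z) m - Y (om X Z) m + Z (om X Y) m - om (vf_bracket X Y) Z m + om (vf_bracket X Z) Y m - om (vf_bracket Y Z) X m = 0"
    unfolding d[OF X Y Z] d[OF Y X Z] d[OF Z X Y] by (simp add: om_def vf_bracket_def algebra_simps)
qed

lemma nondegenerate_om: "nondegenerate M A om"
  unfolding nondegenerate_def
proof (intro ballI impI)
  fix m X F assume m: "m \<in> M" and X: "X \<in> VF" and z: "\<forall>Y\<in>VF. om X Y m = 0" and F: "F \<in> A"
  obtain v where v: "m = fib v" using m by (rule M_cases)
  have "co X i v = 0" for i
  proof -
    have e: "vfc (\<lambda>j u. if j = k then 1 else 0) \<in> VF" for k by (rule vfc_VF) simp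
    have "om X (vfc (\<lambda>j u. if j = k then 1 else 0)) (fib v) = 0" for k using z e v by blast
    from this[of 1] this[of 2] this[of 3] this[of 4] show ?thesis
      using exhaust_4[of i] by (auto simp: om_fib)
  qed
  then show "X F m = 0" unfolding v VF_formula[OF X F] by simp
qed

lemma Sig_smooth: assumes a: "a \<in> carrier G" shows "Sm (\<lambda>v. Sig a v $ i)"
proof -
  obtain B b f where e: "a = ((B, b), f)" by (metis surj_pair)
  have f: "f \<in> \<xi>" using a e by auto
  have q: "Sm (\<lambda>v. trq (B, b) r (v $ 1) (v $ 2))" for r
    unfolding trq_def by (simp, intro Sm_add Sm_mult Sm_proj Sm_const)
  have ev: "Sm (\<lambda>v. ev (trq (B, b) 1 (v $ 1) (v $ 2)) (trq (B, b) 2 (v $ 1) (v $ 2)) (dx f))"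
    "Sm (\<lambda>v. ev (trq (B, b) 1 (v $ 1) (v $ 2)) (trq (B, b) 2 (v $ 1) (v $ 2)) (dy f))"
    unfolding Sm_def by (intro allI Sm_ev[OF SU] f C_k_const[OF SU] q[unfolded Sm_def, rule_format])+
  show ?thesis unfolding e Sig_def Let_def
    using exhaust_4[of i] q ev by (auto intro!: Sm_add Sm_mult Sm_diff ev)
qed

text \<open>The Jacobian in block form: B on the base, its inverse transpose on the fibre, and the
  Hessian of f at the image point, composed with B, from base to fibre.\<close>

lemma D_Sig:
  assumes e: "a = ((B, b), f)" and f: "f \<in> \<xi>"
  defines "x v \<equiv> trq (B, b) 1 (v $ 1) (v $ 2)" and "y v \<equiv> trq (B, b) 2 (v $ 1) (v $ 2)"
    and "\<epsilon> k j \<equiv> (if j = k then 1 else 0 :: real)"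
  shows "D j (\<lambda>u. Sig a u $ 1) v = B $ 1 $ 1 * \<epsilon> 1 j + B $ 1 $ 2 * \<epsilon> 2 j"
    "D j (\<lambda>u. Sig a u $ 2) v = B $ 2 $ 1 * \<epsilon> 1 j + B $ 2 $ 2 * \<epsilon> 2 j"
    "D j (\<lambda>u. Sig a u $ 3) v = ev (x v) (y v) (dx (dx f)) * (B $ 1 $ 1 * \<epsilon> 1 j + B $ 1 $ 2 * \<epsilon> 2 j) +
        ev (x v) (y v) (dx (dy f)) * (B $ 2 $ 1 * \<epsilon> 1 j + B $ 2 $ 2 * \<epsilon> 2 j) +
        (\<epsilon> 3 j * B $ 2 $ 2 - \<epsilon> 4 j * B $ 2 $ 1) * inverse (det B)"
    "D j (\<lambda>u. Sig a u $ 4) v = ev (x v) (y v) (dx (dy f)) * (B $ 1 $ 1 * \<epsilon> 1 j + B $ 1 $ 2 * \<epsilon> 2 j) +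
        ev (x v) (y v) (dy (dy f)) * (B $ 2 $ 1 * \<epsilon> 1 j + B $ 2 $ 2 * \<epsilon> 2 j) +
        (\<epsilon> 4 j * B $ 1 $ 1 - \<epsilon> 3 j * B $ 1 $ 2) * inverse (det B)"
proof -
  have l: "((\<lambda>t. (v + t *\<^sub>R axis j (1::real)) $ k) has_real_derivative \<epsilon> k j) (at 0)" for k
    unfolding line_nth \<epsilon>_def by (auto intro!: derivative_eq_intros)
  have q: "((\<lambda>t. trq (B, b) r ((v + t *\<^sub>R axis j 1) $ 1) ((v + t *\<^sub>R axis j 1) $ 2)) has_real_derivative
      B $ r $ 1 * \<epsilon> 1 j + B $ r $ 2 * \<epsilon> 2 j) (at 0)" for r
    unfolding trq_def prod.case by (rule derivative_eq_intros l refl)+ simp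
  have ev: "((\<lambda>t. ev (x (v + t *\<^sub>R axis j 1)) (y (v + t *\<^sub>R axis j 1)) g) has_real_derivative
      ev (x v) (y v) (dx g) * (B $ 1 $ 1 * \<epsilon> 1 j + B $ 1 $ 2 * \<epsilon> 2 j) +
      ev (x v) (y v) (dy g) * (B $ 2 $ 1 * \<epsilon> 1 j + B $ 2 $ 2 * \<epsilon> 2 j)) (at 0)" if "fpoly g" for g
    using ev_has_derivative[OF that q[of 1] q[of 2]] by (simp add: x_def y_def)
  show "D j (\<lambda>u. Sig a u $ 1) v = B $ 1 $ 1 * \<epsilon> 1 j + B $ 1 $ 2 * \<epsilon> 2 j"
    "D j (\<lambda>u. Sig a u $ 2) v = B $ 2 $ 1 * \<epsilon> 1 j + B $ 2 $ 2 * \<epsilon> 2 j"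
    by (rule D_eqI, simp only: e Sig_def Let_def prod.case vec4_simps, rule q)+
  show "D j (\<lambda>u. Sig a u $ 3) v = ev (x v) (y v) (dx (dx f)) * (B $ 1 $ 1 * \<epsilon> 1 j + B $ 1 $ 2 * \<epsilon> 2 j) +
        ev (x v) (y v) (dx (dy f)) * (B $ 2 $ 1 * \<epsilon> 1 j + B $ 2 $ 2 * \<epsilon> 2 j) +
        (\<epsilon> 3 j * B $ 2 $ 2 - \<epsilon> 4 j * B $ 2 $ 1) * inverse (det B)"
    unfolding dxdy
    by (rule D_eqI, simp only: e Sig_def Let_def prod.case vec4_simps x_def[symmetric] y_def[symmetric])
       (intro DERIV_add ev fpoly_d xi_fpoly[OF f] DERIV_cmult_right DERIV_diff l)
  show "D j (\<lambda>u. Sig a u $ 4) v = ev (x v) (y v) (dx (dy f)) * (B $ 1 $ 1 * \<epsilon> 1 j + B $ 1 $ 2 * \<epsilon> 2 j) +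
        ev (x v) (y v) (dy (dy f)) * (B $ 2 $ 1 * \<epsilon> 1 j + B $ 2 $ 2 * \<epsilon> 2 j) +
        (\<epsilon> 4 j * B $ 1 $ 1 - \<epsilon> 3 j * B $ 1 $ 2) * inverse (det B)"
    by (rule D_eqI, simp only: e Sig_def Let_def prod.case vec4_simps x_def[symmetric] y_def[symmetric])
       (intro DERIV_add ev fpoly_d xi_fpoly[OF f] DERIV_cmult_right DERIV_diff l)
qed

lemma pull_eq:
  assumes "a \<in> carrier G"
  shows "(\<lambda>m. if m \<in> M then F (a <#\<^bsub>G\<^esub> m) else 0) = lift (\<lambda>v. F (fib (Sig a v)))"
  by (rule fun_M_eqI) (use translate_fib[OF assms] in \<open>simp_all add: lift_off\<close>)

lemma VF_lift: "X \<in> VF \<Longrightarrow> Sm h \<Longrightarrow> X (lift h) (fib v) = (\<Sum>j\<in>UNIV. D j h v * co X j v)"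
  using VF_formula[of X "lift h"] lift_A by simp

lemma related_co:
  assumes a: "a \<in> carrier G" and r: "vf_related M A (\<lambda>m. a <#\<^bsub>G\<^esub> m) X X'"
  shows "co X' i (Sig a v) = (\<Sum>j\<in>UNIV. D j (\<lambda>u. Sig a u $ i) v * co X j v)"
proof -
  have X: "X \<in> VF" using r by (simp add: vf_related_def)
  have "X (lift (\<lambda>v. xx i (fib (Sig a v)))) (fib v) = X' (xx i) (fib (Sig a v))"
    using r xx_A[of i] fib_in_M[of v] unfolding vf_related_def pull_eq[OF a] translate_fib[OF a, symmetric] by blast
  then show ?thesis by (simp add: co_def[of X'] xx_def[of i] VF_lift[OF X Sig_smooth[OF a]])
qed

text \<open>Both sides of the relation are derivations at a point, so it suffices to compare them on
  the coordinate functions.\<close>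

lemma relatedI:
  assumes a: "a \<in> carrier G" and X: "X \<in> VF" and X': "X' \<in> VF"
    and r: "\<And>i v. co X' i (Sig a v) = (\<Sum>j\<in>UNIV. D j (\<lambda>u. Sig a u $ i) v * co X j v)"
  shows "vf_related M A (\<lambda>m. a <#\<^bsub>G\<^esub> m) X X'"
  unfolding vf_related_def
proof (intro conjI X X' ballI)
  fix F m assume F: "F \<in> A" and "m \<in> M"
  then obtain v where v: "m = fib v" by (auto elim: M_cases)
  have "X (lift (\<lambda>v. F (fib (Sig a v)))) (fib v) = (\<Sum>k\<in>UNIV. D k (\<lambda>v. F (fib v)) (Sig a v) * co X' k (Sig a v))"
    using VF_pull[OF X Sig_smooth[OF a] A_Sm[OF F], of v] by (simp add: VF_lift[OF X Sig_smooth[OF a]] r)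
  then show "X (\<lambda>m. if m \<in> M then F (a <#\<^bsub>G\<^esub> m) else 0) m = X' F (a <#\<^bsub>G\<^esub> m)"
    unfolding pull_eq[OF a] v translate_fib[OF a] by (simp add: VF_formula[OF X' F])
qed

lemma form_invariant_om: "form_invariant M A (translations_on G) om"
  unfolding form_invariant_def translations_on_def
proof (intro ballI allI impI, clarify)
  fix a X X' Y Y' m
  assume a: "a \<in> carrier G" and rX: "vf_related M A (\<lambda>m. a <#\<^bsub>G\<^esub> m) X X'"
    and rY: "vf_related M A (\<lambda>m. a <#\<^bsub>G\<^esub> m) Y Y'" and m: "m \<in> M"
  obtain v where v: "m = fib v" using m by (rule M_cases)
  obtain B b f where e: "a = ((B, b), f)" by (metis surj_pair)
  have f: "f \<in> \<xi>" and B: "det B \<noteq> 0" using a e H_inv by (auto simp: Gt_def invertible_det_nz)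
  have B': "(B$1$1 * B$2$2 - B$1$2 * B$2$1) * inverse (det B) = 1" using B by (simp add: det_2)
  define d where "d = inverse (det B)"
  define p q r where pqr: "p = ev (trq (B, b) 1 (v $ 1) (v $ 2)) (trq (B, b) 2 (v $ 1) (v $ 2)) (dx (dx f))"
    "q = ev (trq (B, b) 1 (v $ 1) (v $ 2)) (trq (B, b) 2 (v $ 1) (v $ 2)) (dx (dy f))"
    "r = ev (trq (B, b) 1 (v $ 1) (v $ 2)) (trq (B, b) 2 (v $ 1) (v $ 2)) (dy (dy f))"
  have c: "co X' 1 (Sig a v) = B$1$1 * co X 1 v + B$1$2 * co X 2 v"
    "co X' 2 (Sig a v) = B$2$1 * co X 1 v + B$2$2 * co X 2 v"
    "co X' 3 (Sig a v) = p * (B$1$1 * co X 1 v + B$1$2 * co X 2 v) + q * (B$2$1 * co X 1 v + B$2$2 * co X 2 v)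
         + (co X 3 v * B$2$2 - co X 4 v * B$2$1) * d"
    "co X' 4 (Sig a v) = q * (B$1$1 * co X 1 v + B$1$2 * co X 2 v) + r * (B$2$1 * co X 1 v + B$2$2 * co X 2 v)
         + (co X 4 v * B$1$1 - co X 3 v * B$1$2) * d"
    if "vf_related M A (\<lambda>m. a <#\<^bsub>G\<^esub> m) X X'" for X X'
    unfolding related_co[OF a that] sum_4 D_Sig[OF e f] pqr[symmetric] d_def[symmetric] by (simp_all add: algebra_simps)
  \<comment> \<open>The Hessian terms cancel because the mixed derivative q occurs symmetrically.
    The remaining factors are the inverse of B applied to B times a vector, which i
    resolves.\<close>
  have key: "x1 * (p * y1 + q * y2 + (Y3 * b22 - Y4 * b21) * d) - (p * x1 + q * x2 + (X3 * b22 - X4 * b21) * d) * y1 +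
      (x2 * (q * y1 + r * y2 + (Y4 * b11 - Y3 * b12) * d) - (q * x1 + r * x2 + (X4 * b11 - X3 * b12) * d) * y2)
      = ((x1 * b22 - x2 * b12) * d) * Y3 + ((x2 * b11 - x1 * b21) * d) * Y4
        - ((y1 * b22 - y2 * b12) * d) * X3 - ((y2 * b11 - y1 * b21) * d) * X4" for x1 x2 y1 y2 X3 X4 Y3 Y4 b11 b12 b21 b22 :: real
    by (simp add: algebra_simps)
  have i: "((B$1$1 * z + B$1$2 * w) * B$2$2 - (B$2$1 * z + B$2$2 * w) * B$1$2) * d = z"
    "((B$2$1 * z + B$2$2 * w) * B$1$1 - (B$1$1 * z + B$1$2 * w) * B$2$1) * d = w" for z w
    using B' unfolding d_def[symmetric] by algebra+
  show "om X Y m = om X' Y' (a <#\<^bsub>G\<^esub> m)"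
    unfolding v translate_fib[OF a] om_fib c[OF rX] c[OF rY] key i by (simp add: algebra_simps)
qed

end

section \<open>The induced form, invariant connections and smoothness of the action\<close>

context star_grp begin

lemma K_fib0: "fib 0 = K" by (simp add: K_fib)

lemma Phi_curve:
  assumes "one_parameter_subgroup G \<gamma> v"
  shows "((\<lambda>t. Phi (\<gamma> t) $ 1) has_real_derivative snd (fst v) $ 1) (at 0)"
    "((\<lambda>t. Phi (\<gamma> t) $ 2) has_real_derivative snd (fst v) $ 2) (at 0)"
    "((\<lambda>t. Phi (\<gamma> t) $ 3) has_real_derivative pcoeff (snd v) 1 0) (at 0)"
    "((\<lambda>t. Phi (\<gamma> t) $ 4) has_real_derivative pcoeff (snd v) 0 1) (at 0)"
proof -
  have g: "\<And>t. \<gamma> t \<in> carrier G" "\<gamma> 0 = \<one>\<^bsub>G\<^esub>" "((\<lambda>t. fst (\<gamma> t)) has_vector_derivative fst v) (at 0)"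
    "\<And>i j. ((\<lambda>t. pcoeff (snd (\<gamma> t)) i j) has_real_derivative pcoeff (snd v) i j) (at 0)"
    using assms unfolding one_parameter_subgroup_def by blast+
  have xi: "snd (\<gamma> t) \<in> \<xi>" for t using g(1)[of t] by auto
  have z: "snd (fst (\<gamma> 0)) = 0" "snd (\<gamma> 0) = 0" using g(2) by simp_all
  have b: "((\<lambda>t. snd (fst (\<gamma> t)) $ r) has_real_derivative snd (fst v) $ r) (at 0)" for r
    using bounded_linear.has_vector_derivative[OF bounded_linear_compose[OF bounded_linear_vec_nth bounded_linear_snd] g(3)]
    by (simp add: has_real_derivative_iff_has_vector_derivative)
  then show "((\<lambda>t. Phi (\<gamma> t) $ 1) has_real_derivative snd (fst v) $ 1) (at 0)"
    "((\<lambda>t. Phi (\<gamma> t) $ 2) has_real_derivative snd (fst v) $ 2) (at 0)"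
    by (simp_all add: Phi_def split_beta)
  \<comment> \<open>At time 0 both the coefficient and the base point vanish, so the derivative of a
    term survives only for the constant monomial, where it is the derivative of the
    coefficient.\<close>
  have trm: "((\<lambda>t. c t * (snd (fst (\<gamma> t)) $ 1 ^ i * snd (fst (\<gamma> t)) $ 2 ^ j)) has_real_derivative
      (if i = 0 \<and> j = 0 then c' else 0)) (at 0)" if c: "(c has_real_derivative c') (at 0)" "c 0 = 0" for c c' i j
  proof -
    have "((\<lambda>t. snd (fst (\<gamma> t)) $ 1 ^ i * snd (fst (\<gamma> t)) $ 2 ^ j) has_real_derivative
       (of_nat i * (snd (fst v) $ 1 * snd (fst (\<gamma> 0)) $ 1 ^ (i - Suc 0))) * snd (fst (\<gamma> 0)) $ 2 ^ j +
       (of_nat j * (snd (fst v) $ 2 * snd (fst (\<gamma> 0)) $ 2 ^ (j - Suc 0))) * snd (fst (\<gamma> 0)) $ 1 ^ i) (at 0)"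
      by (rule DERIV_mult DERIV_power b)+
    from DERIV_mult[OF c(1) this] show ?thesis
      by (rule DERIV_cong) (cases i; cases j; simp add: c(2) z)
  qed
  have ev: "((\<lambda>t. ev (snd (fst (\<gamma> t)) $ 1) (snd (fst (\<gamma> t)) $ 2) (F t)) has_real_derivative c 0 0) (at 0)"
    if N: "\<And>t i j. N < i + j \<Longrightarrow> pcoeff (F t) i j = 0" and c: "\<And>i j. ((\<lambda>t. pcoeff (F t) i j) has_real_derivative c i j) (at 0)"
      and F0: "F 0 = 0" for F c
  proof -
    have e: "ev (snd (fst (\<gamma> t)) $ 1) (snd (fst (\<gamma> t)) $ 2) (F t) =
       (\<Sum>p\<in>{..N}\<times>{..N}. pcoeff (F t) (fst p) (snd p) * (snd (fst (\<gamma> t)) $ 1 ^ fst p * snd (fst (\<gamma> t)) $ 2 ^ snd p))" for t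
      by (rule ev_polys_upto) (use N in blast)
    have "((\<lambda>t. \<Sum>p\<in>{..N}\<times>{..N}. pcoeff (F t) (fst p) (snd p) * (snd (fst (\<gamma> t)) $ 1 ^ fst p * snd (fst (\<gamma> t)) $ 2 ^ snd p))
       has_real_derivative (\<Sum>p\<in>{..N}\<times>{..N}. if fst p = 0 \<and> snd p = 0 then c (fst p) (snd p) else 0)) (at 0)"
      by (intro DERIV_sum trm c) (simp add: F0)
    moreover have "(\<Sum>p\<in>{..N}\<times>{..N}. if fst p = 0 \<and> snd p = 0 then c (fst p) (snd p) else 0) =
       (\<Sum>p\<in>{..N}\<times>{..N}. if p = (0, 0) then c 0 0 else 0)"
      by (rule sum.cong) auto
    ultimately show ?thesis unfolding e by simp
  qed
  have "((\<lambda>t. ev (snd (fst (\<gamma> t)) $ 1) (snd (fst (\<gamma> t)) $ 2) (dx (snd (\<gamma> t)))) has_real_derivative real (0 + 1) * pcoeff (snd v) (0 + 1) 0) (at 0)"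
    by (rule ev[where c = "\<lambda>i j. real (i + 1) * pcoeff (snd v) (i + 1) j"])
       (use xi_bound[OF xi] in \<open>simp_all add: z DERIV_cmult[OF g(4)]\<close>)
  moreover have "((\<lambda>t. ev (snd (fst (\<gamma> t)) $ 1) (snd (fst (\<gamma> t)) $ 2) (dy (snd (\<gamma> t)))) has_real_derivative real (0 + 1) * pcoeff (snd v) 0 (0 + 1)) (at 0)"
    by (rule ev[where c = "\<lambda>i j. real (j + 1) * pcoeff (snd v) i (j + 1)"])
       (use xi_bound[OF xi] in \<open>simp_all add: z DERIV_cmult[OF g(4)]\<close>)
  ultimately show "((\<lambda>t. Phi (\<gamma> t) $ 3) has_real_derivative pcoeff (snd v) 1 0) (at 0)"
    "((\<lambda>t. Phi (\<gamma> t) $ 4) has_real_derivative pcoeff (snd v) 0 1) (at 0)"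
    by (simp_all add: Phi_def split_beta)
qed

lemma base_co:
  assumes "value_at_base \<xi> G K Y v"
  shows "co Y 1 0 = snd (fst v) $ 1" "co Y 2 0 = snd (fst v) $ 2"
    "co Y 3 0 = pcoeff (snd v) 1 0" "co Y 4 0 = pcoeff (snd v) 0 1"
proof -
  obtain \<gamma> where g: "one_parameter_subgroup G \<gamma> v"
    "\<And>F. F \<in> A \<Longrightarrow> ((\<lambda>t. F (\<gamma> t <#\<^bsub>G\<^esub> K)) has_real_derivative Y F K) (at 0)"
    using assms unfolding value_at_base_def A_def by blast
  have c: "\<gamma> t \<in> carrier G" for t using g(1) unfolding one_parameter_subgroup_def by blast
  have d: "((\<lambda>t. Phi (\<gamma> t) $ i) has_real_derivative co Y i 0) (at 0)" for i
    using g(2)[OF xx_A, of i] by (simp only: coset_fib[OF c] co_def K_fib0) (simp add: xx_def)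
  show "co Y 1 0 = snd (fst v) $ 1" "co Y 2 0 = snd (fst v) $ 2"
    "co Y 3 0 = pcoeff (snd v) 1 0" "co Y 4 0 = pcoeff (snd v) 0 1"
    by (rule DERIV_unique[OF d], rule Phi_curve[OF g(1)])+
qed

lemma Omega_tangent:
  "Omega (tangent_ham v) (tangent_ham w) =
     snd (fst v) $ 1 * pcoeff (snd w) 1 0 - pcoeff (snd v) 1 0 * snd (fst w) $ 1 +
     (snd (fst v) $ 2 * pcoeff (snd w) 0 1 - pcoeff (snd v) 0 1 * snd (fst w) $ 2)"
proof -
  have t: "tangent_ham v = fld (lin (fst (fst v)) (snd (fst v)) 1) (lin (fst (fst v)) (snd (fst v)) 2) (snd v)" for v
    by (cases "fst v") (simp add: tangent_ham_def aff_field_fld emb_fld fld_add)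
  have q: "qcoeff (fld a b f) 0 0 = f" "qcoeff (fld a b f) 1 0 = a" "qcoeff (fld a b f) 0 1 = b" for a b f
    by simp_all
  show ?thesis unfolding Omega_def hcoeff_def t q by (simp add: pcoeff_lin)
qed

lemma om_base:
  assumes "value_at_base \<xi> G K Y v" "value_at_base \<xi> G K Z w"
  shows "om Y Z K = Omega (tangent_ham v) (tangent_ham w)"
  unfolding K_fib0[symmetric] om_fib Omega_tangent base_co[OF assms(1)] base_co[OF assms(2)] ..

lemma induced_om: "induced_form \<xi> G K om"
  unfolding induced_form_def A_def[symmetric]
  using two_form_om form_invariant_om om_base by blast

text \<open>The curve \<open>sect (t *\<^sub>R c)\<close> is a one-parameter subgroup, and its orbit
  is the straight line through the chart in the direction c of the given field. Every field
  therefore has a value to which the condition in \<open>induced_form\<close> applies.\<close>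

lemma base_exists: assumes Y: "Y \<in> VF" shows "\<exists>v. value_at_base \<xi> G K Y v"
proof -
  define c :: "real^4" where "c = (\<chi> i. co Y i 0)"
  define \<gamma> where "\<gamma> t = sect (t *\<^sub>R c)" for t
  have "one_parameter_subgroup G \<gamma> (sect_lin c)"
    unfolding one_parameter_subgroup_def
  proof (intro conjI allI)
    show "\<gamma> t \<in> carrier G" for t unfolding \<gamma>_def by (rule sect_carrier)
    show "\<gamma> 0 = \<one>\<^bsub>G\<^esub>" unfolding \<gamma>_def sect_def by (simp add: vec_eq_iff forall_2)
    show "\<gamma> (s + t) = \<gamma> s \<otimes>\<^bsub>G\<^esub> \<gamma> t" for s t
      unfolding \<gamma>_def sect_def G_simps aff_group_simps aff_act_one_linear
      by (simp add: vec_eq_iff forall_2 algebra_simps scaleR_add_left)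
    have "fst (\<gamma> t) = (mat 1, 0) + t *\<^sub>R fst (sect_lin c)" for t
      by (simp add: \<gamma>_def sect_affine linear_scale[OF sect_lin(1)])
    then show "((\<lambda>t. fst (\<gamma> t)) has_vector_derivative fst (sect_lin c)) (at 0)"
      by (auto intro!: derivative_eq_intros)
    fix i j
    have "pcoeff (snd (\<gamma> t)) i j = t * pcoeff (snd (sect_lin c)) i j" for t
      by (simp add: \<gamma>_def sect_affine linear_scale[OF sect_lin(1)])
    then show "((\<lambda>t. pcoeff (snd (\<gamma> t)) i j) has_real_derivative pcoeff (snd (sect_lin c)) i j) (at 0)"
      by (auto intro!: derivative_eq_intros)
  qed
  moreover have "((\<lambda>t. F (\<gamma> t <#\<^bsub>G\<^esub> K)) has_real_derivative Y F K) (at 0)" if F: "F \<in> A" for F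
  proof -
    let ?f = "\<lambda>v. F (fib v)"
    have "C_k (Suc 0) UNIV UNIV ?f" using A_Sm[OF F] unfolding Sm_def by blast
    from has_derivative_of_C1[OF this open_UNIV UNIV_I]
    have f: "(?f has_derivative (\<lambda>h. \<Sum>b\<in>Basis. (h \<bullet> b) * dir_deriv ?f b 0)) (at (0 *\<^sub>R c))" by simp
    have "((\<lambda>t. t *\<^sub>R c) has_derivative (\<lambda>t. t *\<^sub>R c)) (at (0::real))" by (auto intro!: derivative_eq_intros)
    from has_derivative_compose[OF this f]
    have "((\<lambda>t. ?f (t *\<^sub>R c)) has_derivative (\<lambda>t. (\<Sum>i\<in>UNIV. D i ?f 0 * co Y i 0) * t)) (at 0)"
      by (rule has_derivative_eq_rhs)
         (simp add: fun_eq_iff sum_Basis_vec inner_axis c_def D_def sum_distrib_left sum_distrib_right mult_ac)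
    then have "((\<lambda>t. ?f (t *\<^sub>R c)) has_real_derivative Y F (fib 0)) (at 0)"
      by (simp add: has_field_derivative_def VF_formula[OF Y F])
    moreover have "\<gamma> t <#\<^bsub>G\<^esub> K = fib (t *\<^sub>R c)" for t
      unfolding \<gamma>_def coset_fib[OF sect_carrier] Phi_sect ..
    ultimately show ?thesis by (simp add: K_fib0)
  qed
  ultimately show ?thesis unfolding value_at_base_def A_def by blast
qed

lemma Sig_sect: "Sig (sect w) u = u + w"
proof -
  have "sect w \<otimes>\<^bsub>G\<^esub> sect u = sect (u + w)"
    unfolding sect_def G_simps aff_group_simps aff_act_one_linear
    by (simp add: vec_eq_iff forall_2 algebra_simps scaleR_add_left)
  then have "Phi (sect (u + w)) = Sig (sect w) (Phi (sect u))"
    using Phi_mult[OF sect_carrier sect_carrier, of w u] by simp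
  then show ?thesis by simp
qed

text \<open>Translations of the chart come from the group, so an induced form is determined by its
  values at the base point.\<close>

lemma induced_unique:
  assumes \<omega>: "induced_form \<xi> G K \<omega>" and X: "X \<in> VF" and Y: "Y \<in> VF"
  shows "\<omega> X Y = om X Y"
proof (rule fun_M_eqI)
  have tf: "two_form A \<omega>" and inv: "form_invariant M A (translations_on G) \<omega>"
    and base: "\<And>Y Z v w. Y \<in> VF \<Longrightarrow> Z \<in> VF \<Longrightarrow> value_at_base \<xi> G K Y v \<Longrightarrow> value_at_base \<xi> G K Z w \<Longrightarrow>
      \<omega> Y Z K = Omega (tangent_ham v) (tangent_ham w)"
    using \<omega> unfolding induced_form_def A_def[symmetric] by blast+
  have "\<omega> X Y \<in> A" using tf X Y unfolding two_form_def by blast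
  then show "\<omega> X Y m = om X Y m" if "m \<notin> M" for m using that A_off[OF _ that] om_A[OF X Y] by metis
  fix v
  \<comment> \<open>The image of X under the chart translation by -v, which carries the point
    \<open>fib v\<close> to the base point.\<close>
  define sh where "sh X = vfc (\<lambda>i u. co X i (u + v))" for X
  have sS: "Sm (\<lambda>u. co X i (u + v))" if "X \<in> VF" for X i
    by (rule Sm_compose[OF co_Sm[OF that]]) (simp add: Sm_add)
  have sh: "sh X \<in> VF" if "X \<in> VF" for X unfolding sh_def by (rule vfc_VF[OF sS[OF that]])
  have cs: "co (sh X) i u = co X i (u + v)" for X i u by (simp add: sh_def)
  have rel: "vf_related M A (\<lambda>m. sect (- v) <#\<^bsub>G\<^esub> m) X (sh X)" if X: "X \<in> VF" for X
  proof (rule relatedI[OF sect_carrier X sh[OF X]])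
    fix i u
    have "D j (\<lambda>u. Sig (sect (- v)) u $ i) u = (if j = i then 1 else 0)" for j
      using D_add[OF Sm_proj Sm_const, of j i "- v $ i" u] by (simp add: Sig_sect)
    then show "co (sh X) i (Sig (sect (- v)) u) = (\<Sum>j\<in>UNIV. D j (\<lambda>u. Sig (sect (- v)) u $ i) u * co X j u)"
      by (simp add: cs Sig_sect if_distrib[of "\<lambda>x. x * _"] sum.delta' cong: if_cong)
  qed
  have "(\<lambda>m. sect (- v) <#\<^bsub>G\<^esub> m) \<in> translations_on G" unfolding translations_on_def using sect_carrier by blast
  then have "\<omega> X Y (fib v) = \<omega> (sh X) (sh Y) (sect (- v) <#\<^bsub>G\<^esub> fib v)"
    using inv rel[OF X] rel[OF Y] fib_in_M unfolding form_invariant_def by blast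
  also have "sect (- v) <#\<^bsub>G\<^esub> fib v = K" unfolding translate_fib[OF sect_carrier] by (simp add: Sig_sect K_fib0)
  also obtain w z where wz: "value_at_base \<xi> G K (sh X) w" "value_at_base \<xi> G K (sh Y) z"
    using base_exists sh X Y by metis
  have "\<omega> (sh X) (sh Y) K = om (sh X) (sh Y) K"
    using base[OF sh[OF X] sh[OF Y] wz] om_base[OF wz] by simp
  also have "\<dots> = om X Y (fib v)" unfolding K_fib0[symmetric] om_fib cs by simp
  finally show "\<omega> X Y (fib v) = om X Y (fib v)" .
qed

lemma induced_symplectic: assumes \<omega>: "induced_form \<xi> G K \<omega>" shows "symplectic_form M A \<omega>"
proof -
  note u = induced_unique[OF \<omega>]
  have "two_form A \<omega>" using \<omega> unfolding induced_form_def A_def by blast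
  moreover have "closed_form A \<omega>"
    using closed_om unfolding closed_form_def by (simp add: u vf_bracket_VF)
  moreover have "nondegenerate M A \<omega>"
    using nondegenerate_om unfolding nondegenerate_def by (simp add: u)
  ultimately show ?thesis by (simp add: symplectic_form_def)
qed

text \<open>A cubic \<open>f\<close> acts with trivial linear part at the base point, so an invariant connection would
  force the third derivatives of \<open>f\<close> there to vanish.\<close>

lemma not_fedosov:
  assumes deg: "2 < max_degree \<xi>" shows "\<not> homogeneous_fedosov \<xi> G K \<omega>"
proof
  assume "homogeneous_fedosov \<xi> G K \<omega>"
  then obtain nb where conn: "connection A nb"
    and inv: "connection_invariant M A (translations_on G) nb"
    unfolding homogeneous_fedosov_def A_def[symmetric] by blast
  obtain f where f: "f \<in> \<xi>" "f \<noteq> 0" and fz: "\<And>i j. i + j \<noteq> 3 \<Longrightarrow> pcoeff f i j = 0"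
    using cubic_exists[OF deg] by blast
  \<comment> \<open>This element fixes the base plane and shifts each fibre by the differential of
    f.\<close>
  define a where "a = ((mat 1 :: real^2^2, 0 :: real^2), f)"
  have a: "a \<in> carrier G" using H_one f by (simp add: a_def Gt_def)
  define d :: "4 \<Rightarrow> plane \<Rightarrow> plane" where "d i = (if i = 1 then dx else dy)" for i
  define g where "g i j = lift (\<lambda>v. ev (v $ 1) (v $ 2) (d i (d j f)))" for i j
  have fp: "fpoly (d i h)" if "fpoly h" for i h using that by (simp add: d_def)
  have dd: "d i (d j h) = d j (d i h)" for i j h by (simp add: d_def dxdy)
  have evS: "Sm (\<lambda>v. ev (v $ 1) (v $ 2) h)" and evD: "D i (\<lambda>v. ev (v $ 1) (v $ 2) h) v =
      (if i = 1 then ev (v $ 1) (v $ 2) (dx h) else if i = 2 then ev (v $ 1) (v $ 2) (dy h) else 0)" if "fpoly h" for h i v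
  proof -
    have pow: "Sm (\<lambda>v. v $ k ^ n)" for k n by (induct n) (auto intro: Sm_mult)
    show "Sm (\<lambda>v. ev (v $ 1) (v $ 2) h)"
      unfolding ev_def evl_def by (intro Sm_sum Sm_mult Sm_const pow)
    have l: "((\<lambda>t. (v + t *\<^sub>R axis i (1::real)) $ k) has_real_derivative (if i = k then 1 else 0)) (at 0)" for k
      unfolding line_nth by (auto intro!: derivative_eq_intros)
    show "D i (\<lambda>v. ev (v $ 1) (v $ 2) h) v =
      (if i = 1 then ev (v $ 1) (v $ 2) (dx h) else if i = 2 then ev (v $ 1) (v $ 2) (dy h) else 0)"
      by (rule D_eqI, rule DERIV_cong[OF ev_has_derivative[OF that l l]]) auto
  qed
  have ff: "fpoly f" using xi_fpoly f by blast
  have gA: "g i j \<in> A" for i j unfolding g_def by (intro lift_A evS fp ff)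
  define e where "e k = vfc (\<lambda>j u. if j = k then 1 else 0)" for k :: 4
  have eV: "e k \<in> VF" for k unfolding e_def by (rule vfc_VF) simp
  have ce: "co (e k) i v = (if i = k then 1 else 0)" for k i v by (simp add: e_def)
  \<comment> \<open>The image of the coordinate field \<open>e i\<close> under a, for i = 1, 2:
    motion in the base direction i changes the shift of the fibre by row i of the Hessian of
    f.\<close>
  define X' where "X' i = vf_add (vf_add (e i) (vf_scale (g i 1) (e 3))) (vf_scale (g i 2) (e 4))" for i
  have sV: "vf_scale h X \<in> VF" if "h \<in> A" "X \<in> VF" for h X
  proof -
    have "vf_scale h X F \<in> A" if "F \<in> A" for F
      unfolding vf_scale_def by (rule A_mult) (use \<open>h \<in> A\<close> \<open>X \<in> VF\<close> that VF_rules(1) in auto)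
    then show ?thesis using VF_rules[OF \<open>X \<in> VF\<close>]
      unfolding vector_fields_def by (auto simp: vf_scale_def algebra_simps)
  qed
  have aV: "vf_add X Y \<in> VF" if "X \<in> VF" "Y \<in> VF" for X Y
    using VF_rules[OF that(1)] VF_rules[OF that(2)] unfolding vector_fields_def
    by (auto simp: vf_add_def A_add algebra_simps)
  have X'V: "X' i \<in> VF" for i unfolding X'_def by (intro aV sV eV gA)
  have cX': "co (X' i) k v = co (e i) k v + ev (v $ 1) (v $ 2) (d i (d 1 f)) * co (e 3) k v + ev (v $ 1) (v $ 2) (d i (d 2 f)) * co (e 4) k v" for i k v
    by (simp add: co_def X'_def vf_add_def vf_scale_def g_def)
  have q: "trq (mat 1, 0) 1 x y = x" "trq (mat 1, 0) 2 x y = y" for x y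
    by (simp_all add: trq_def mat_simps)
  have S: "Sig a v $ 1 = v $ 1" "Sig a v $ 2 = v $ 2" for v
    by (simp_all add: a_def Sig_def q Let_def)
  have DS: "D j (\<lambda>u. Sig a u $ 1) v = (if j = 1 then 1 else 0)" "D j (\<lambda>u. Sig a u $ 2) v = (if j = 2 then 1 else 0)"
    "D j (\<lambda>u. Sig a u $ 3) v = ev (v $ 1) (v $ 2) (dx (dx f)) * (if j = 1 then 1 else 0) + ev (v $ 1) (v $ 2) (dx (dy f)) * (if j = 2 then 1 else 0) + (if j = 3 then 1 else 0)"
    "D j (\<lambda>u. Sig a u $ 4) v = ev (v $ 1) (v $ 2) (dx (dy f)) * (if j = 1 then 1 else 0) + ev (v $ 1) (v $ 2) (dy (dy f)) * (if j = 2 then 1 else 0) + (if j = 4 then 1 else 0)" for j v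
    unfolding D_Sig[OF a_def f(1)] q by (simp_all add: mat_simps)
  have rel: "vf_related M A (\<lambda>m. a <#\<^bsub>G\<^esub> m) (e i) (X' i)" if i: "i = 1 \<or> i = 2" for i
  proof (rule relatedI[OF a eV X'V])
    fix k v
    have "co (X' i) k (Sig a v) = (\<Sum>j\<in>UNIV. D j (\<lambda>u. Sig a u $ k) v * (if j = i then 1 else 0))"
      unfolding cX' ce S sum_4 using exhaust_4[of k] i by (auto simp: DS d_def dxdy)
    then show "co (X' i) k (Sig a v) = (\<Sum>j\<in>UNIV. D j (\<lambda>u. Sig a u $ k) v * co (e i) j v)" by (simp only: ce)
  qed
  \<comment> \<open>The Hessian of a cubic vanishes at the origin, so \<open>X' i\<close> and
    \<open>e i\<close> agree at the base point, though not their derivatives.\<close>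
  have g0: "g i j K = 0" for i j
    unfolding K_fib0[symmetric] g_def lift_fib by (simp add: ev00 fp ff) (simp add: d_def fz)
  have nV: "nb X Y \<in> VF" and nadd: "Z \<in> VF \<Longrightarrow> nb (vf_add X Z) Y = vf_add (nb X Y) (nb Z Y)"
    "Z \<in> VF \<Longrightarrow> nb X (vf_add Y Z) = vf_add (nb X Y) (nb X Z)"
    and nsc: "h \<in> A \<Longrightarrow> nb (vf_scale h X) Y = vf_scale h (nb X Y)"
    "h \<in> A \<Longrightarrow> nb X (vf_scale h Y) = vf_add (vf_scale (X h) Y) (vf_scale h (nb X Y))"
    if "X \<in> VF" "Y \<in> VF" for X Y Z h
    using conn that unfolding connection_def by blast+
  have left: "nb (X' i) Y F K = nb (e i) Y F K" if Y: "Y \<in> VF" for i Y F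
  proof -
    have "nb (X' i) Y = vf_add (vf_add (nb (e i) Y) (vf_scale (g i 1) (nb (e 3) Y))) (vf_scale (g i 2) (nb (e 4) Y))"
      unfolding X'_def by (simp add: nadd nsc aV sV eV gA Y)
    then show ?thesis by (simp add: vf_add_def vf_scale_def g0)
  qed
  \<comment> \<open>The connection is a derivation in its second argument; at the base point the
    surviving extra terms are the derivatives of the Hessian entries.\<close>
  have right: "nb (e i) (X' j) F K = nb (e i) (e j) F K + e i (g j 1) K * e 3 F K + e i (g j 2) K * e 4 F K" for i j F
  proof -
    have "nb (e i) (X' j) = vf_add (vf_add (nb (e i) (e j)) (vf_add (vf_scale (e i (g j 1)) (e 3)) (vf_scale (g j 1) (nb (e i) (e 3)))))
       (vf_add (vf_scale (e i (g j 2)) (e 4)) (vf_scale (g j 2) (nb (e i) (e 4))))"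
      unfolding X'_def by (simp add: nadd nsc aV sV eV gA)
    then show ?thesis by (simp add: vf_add_def vf_scale_def g0)
  qed
  have third: "ev 0 0 (d i (d j (d k f))) = 0" if "i = 1 \<or> i = 2" "j = 1 \<or> j = 2" "k = 1 \<or> k = 2" for i j k
  proof -
    \<comment> \<open>The fibre coordinate conjugate to the base coordinate k.\<close>
    define m where "m = (if k = 1 then 3 else 4 :: 4)"
    have "(\<lambda>m. a <#\<^bsub>G\<^esub> m) \<in> translations_on G" using a unfolding translations_on_def by blast
    then have "vf_related M A (\<lambda>m. a <#\<^bsub>G\<^esub> m) (nb (e i) (e j)) (nb (X' i) (X' j))"
      using inv rel[OF that(1)] rel[OF that(2)] unfolding connection_invariant_def by blast
    from related_co[OF a this, of m 0]
    have r: "co (nb (X' i) (X' j)) m (Sig a 0) = (\<Sum>l\<in>UNIV. D l (\<lambda>u. Sig a u $ m) 0 * co (nb (e i) (e j)) l 0)" .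
    have "Sig a 0 = 0" unfolding Sig_0[OF a]
      by (rule vec4_eqI) (simp_all add: a_def Phi_simps ev00 ff fz)
    \<comment> \<open>Row m of the Jacobian of a at the base point is that of the identity, again
      because the Hessian vanishes there.\<close>
    moreover have "D l (\<lambda>u. Sig a u $ m) 0 = (if l = m then 1 else 0)" for l
      by (simp add: m_def DS ev00 ff) (simp add: fz)
    ultimately have "nb (X' i) (X' j) (xx m) K = nb (e i) (e j) (xx m) K"
      using r by (simp add: co_def K_fib0 if_distrib[of "\<lambda>x. x * _"] sum.delta' cong: if_cong)
    then have "e i (g j 1) K * e 3 (xx m) K + e i (g j 2) K * e 4 (xx m) K = 0"
      unfolding left[OF X'V] right by simp
    moreover have "e n (xx m) K = (if m = n then 1 else 0)" for n
      using ce[of n m 0] by (simp add: co_def K_fib0)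
    ultimately have "e i (g j k) K = 0" using that(3) by (auto simp: m_def split: if_splits)
    moreover have "e i (g j k) K = (\<Sum>l\<in>UNIV. (if l = i then 1 else 0) * D l (\<lambda>v. ev (v $ 1) (v $ 2) (d j (d k f))) 0)"
      unfolding K_fib0[symmetric] e_def vfc_fib[OF gA] by (simp add: g_def)
    ultimately have "D i (\<lambda>v. ev (v $ 1) (v $ 2) (d j (d k f))) 0 = 0"
      by (simp add: if_distrib[of "\<lambda>x. x * _"] sum.delta' cong: if_cong)
    then show ?thesis using that(1) unfolding evD[OF fp[OF fp[OF ff]]] by (auto simp: d_def)
  qed
  have c3: "pcoeff (d i (d j (d k f))) 0 0 = 0" if "i = 1 \<or> i = 2" "j = 1 \<or> j = 2" "k = 1 \<or> k = 2" for i j k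
    using third[OF that] by (simp add: ev00 fp ff)
  have "pcoeff f 3 0 = 0" "pcoeff f 2 1 = 0" "pcoeff f 1 2 = 0" "pcoeff f 0 3 = 0"
    using c3[of 1 1 1] c3[of 1 1 2] c3[of 1 2 2] c3[of 2 2 2] by (simp_all add: d_def eval_nat_numeral)
  moreover have "i = 3 \<and> j = 0 \<or> i = 2 \<and> j = 1 \<or> i = 1 \<and> j = 2 \<or> i = 0 \<and> j = 3" if "i + j = 3" for i j :: nat
    using that by auto
  ultimately have "pcoeff f i j = 0" for i j using fz by (cases "i + j = 3") blast+
  then have "f = 0" by (intro pcoeff_eqI) simp
  then show False using f by simp
qed

lemma smooth_action: "smooth_action \<xi> G K"
  unfolding smooth_action_def A_def[symmetric]
proof
  fix F assume F: "F \<in> A"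
  let ?E = "E \<times> E"
  have sub: "subspace ?E" by (rule subspace_Times[OF sub_E sub_E])
  note S0 = sub fd_open_space[OF sub]
  have linA: "linear (\<lambda>p::gel \<times> gel. fst (fst (fst p)) $ i $ j)" "linear (\<lambda>p::gel \<times> gel. snd (fst (fst p)) $ i)"
    "linear (\<lambda>p::gel \<times> gel. pcoeff (snd (fst p)) m n)" for i j m n
    by (auto intro!: linearI)
  have linS: "linear (snd :: gel \<times> gel \<Rightarrow> gel)" "snd ` ?E \<subseteq> E" by (auto intro!: linearI)
  define dt where "dt p = det (fst (fst (fst p)))" for p :: "gel \<times> gel"
  have dtC: "C_k n ?E U dt" if "fd_open ?E U" for U n
  proof -
    have "C_k n ?E U (\<lambda>p. fst (fst (fst p)) $ 1 $ 1 * fst (fst (fst p)) $ 2 $ 2 + (-1) * (fst (fst (fst p)) $ 1 $ 2 * fst (fst (fst p)) $ 2 $ 1))"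
      by (intro C_k_add[OF sub that] C_k_mult[OF sub that] C_k_const[OF sub that] C_k_linear[OF sub that linA(1)])
    then show ?thesis by (simp add: dt_def[abs_def] det_2)
  qed
  \<comment> \<open>The action extends from the group to all pairs in the ambient space except for
    the inverse determinant of the first factor, so its nonvanishing cuts out the domain of the
    extension.\<close>
  define N0 where "N0 = {p \<in> ?E. dt p \<in> - {0}}"
  have o: "fd_open ?E N0"
  proof -
    have "continuous_map (fd_topology ?E) euclideanreal dt"
      using C_k_cont[OF dtC[OF S0(2), of 0]] by (metis subtopology_topspace topspace_fd[OF sub])
    from openin_continuous_map_preimage[OF this, of "- {0}"] show ?thesis
      unfolding N0_def by (simp add: sub openin_fd_topology open_Compl)
  qed
  note S = sub o
  have PS: "C_k n ?E N0 (\<lambda>p. Phi (snd p) $ i)" for n i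
  proof -
    have "C_k n ?E N0 (\<lambda>p. Phi (0 + snd p) $ i)"
      by (rule C_k_pullback[OF S linS sub_E fd_open_space[OF sub_E] _ Phi_smooth[OF fd_open_space[OF sub_E]]])
         (auto simp: N0_def)
    then show ?thesis by simp
  qed
  note l = C_k_linear[OF S linA(1)] C_k_linear[OF S linA(2)] C_k_linear[OF S linA(3)]
  have qS: "C_k n ?E N0 (\<lambda>p. trq (fst (fst p)) r (Phi (snd p) $ 1) (Phi (snd p) $ 2))" for n r
    unfolding trq_def split_beta by (intro C_k_add[OF S] C_k_mult[OF S] l PS)
  have xiN: "snd (fst p) \<in> \<xi>" if "p \<in> N0" for p using that by (auto simp: N0_def)
  have evS: "C_k n ?E N0 (\<lambda>p. ev (trq (fst (fst p)) 1 (Phi (snd p) $ 1) (Phi (snd p) $ 2)) (trq (fst (fst p)) 2 (Phi (snd p) $ 1) (Phi (snd p) $ 2)) (dx (snd (fst p))))"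
    "C_k n ?E N0 (\<lambda>p. ev (trq (fst (fst p)) 1 (Phi (snd p) $ 1) (Phi (snd p) $ 2)) (trq (fst (fst p)) 2 (Phi (snd p) $ 1) (Phi (snd p) $ 2)) (dy (snd (fst p))))" for n
    by (rule Sm_ev[OF S xiN qS qS l(3)], assumption)+
  have iS: "C_k n ?E N0 (\<lambda>p. inverse (det (fst (fst (fst p)))))" for n
    by (rule C_k_inverse[OF S _ dtC[OF o, unfolded dt_def]]) (auto simp: N0_def dt_def)
  have mS: "C_k n ?E N0 (\<lambda>p. (f p * f' p - h p * h' p) * k p)"
    if "C_k n ?E N0 f" "C_k n ?E N0 f'" "C_k n ?E N0 h" "C_k n ?E N0 h'" "C_k n ?E N0 k" for n f f' h h' k
  proof -
    have "C_k n ?E N0 (\<lambda>p. (f p * f' p + (-1) * (h p * h' p)) * k p)"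
      by (intro C_k_add[OF S] C_k_mult[OF S] C_k_const[OF S] that)
    then show ?thesis by simp
  qed
  have TS: "C_k n ?E N0 (\<lambda>p. Sig (fst p) (Phi (snd p)) $ i)" for n i
    using exhaust_4[of i] qS[of n] evS[of n]
    by (auto simp: Sig_def split_beta Let_def intro!: C_k_add[OF S] mS PS l iS)
  have "smooth_on_open ?E N0 (\<lambda>p. F (fib (Sig (fst p) (Phi (snd p)))))"
    unfolding smooth_on_open_def openin_fd_topology
  proof (intro conjI o allI)
    fix n
    show "C_k n ?E N0 (\<lambda>p. F (fib (Sig (fst p) (Phi (snd p)))))"
      by (rule C_k_vec[OF S open_UNIV UNIV_I TS]) (use A_Sm[OF F] in \<open>simp add: Sm_def\<close>)
  qed
  moreover have "p \<in> N0" "F (fib (Sig (fst p) (Phi (snd p)))) = (case p of (a, b) \<Rightarrow> F (a <#\<^bsub>G\<^esub> (b <#\<^bsub>G\<^esub> K)))"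
    if "p \<in> carrier G \<times> carrier G" for p
  proof -
    obtain a b where p: "p = (a, b)" "a \<in> carrier G" "b \<in> carrier G" using \<open>p \<in> _\<close> by (auto simp del: G_simps)
    show "p \<in> N0" using p H_inv by (auto simp: N0_def dt_def Gt_def invertible_det_nz)
    show "F (fib (Sig (fst p) (Phi (snd p)))) = (case p of (a, b) \<Rightarrow> F (a <#\<^bsub>G\<^esub> (b <#\<^bsub>G\<^esub> K)))"
      using p by (simp add: coset_fib translate_fib del: G_simps)
  qed
  ultimately show "smooth_on_subset ?E (carrier G \<times> carrier G) (\<lambda>(a, b). F (a <#\<^bsub>G\<^esub> (b <#\<^bsub>G\<^esub> K)))"
    unfolding smooth_on_subset_def by (metis (no_types, lifting) IntE)
qed

end

section \<open>One-parameter groups of affine transformations\<close>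

definition m2 :: "real \<Rightarrow> real \<Rightarrow> real \<Rightarrow> real \<Rightarrow> real^2^2" where
  "m2 a b c d = vector [vector [a, b], vector [c, d]]"

lemma m2_simps [simp]: "m2 a b c d $ 1 $ 1 = a" "m2 a b c d $ 1 $ 2 = b" "m2 a b c d $ 2 $ 1 = c" "m2 a b c d $ 2 $ 2 = d"
  by (simp_all add: m2_def)

lemma mat2_eqI: "A $ 1 $ 1 = B $ 1 $ 1 \<Longrightarrow> A $ 1 $ 2 = B $ 1 $ 2 \<Longrightarrow> A $ 2 $ 1 = B $ 2 $ 1 \<Longrightarrow> A $ 2 $ 2 = B $ 2 $ 2 \<Longrightarrow> A = (B :: real^2^2)"
  by (simp add: vec_eq_iff forall_2)

lemma m2_eq: "A = m2 (A $ 1 $ 1) (A $ 1 $ 2) (A $ 2 $ 1) (A $ 2 $ 2)"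
  by (rule mat2_eqI) simp_all

lemma m2_mult: "m2 a b c d ** m2 a' b' c' d' = m2 (a * a' + b * c') (a * b' + b * d') (c * a' + d * c') (c * b' + d * d')"
  by (rule mat2_eqI) (simp_all add: matrix_matrix_mult_def sum_2)

lemma m2_one: "mat 1 = m2 1 0 0 1"
  by (rule mat2_eqI) (simp_all add: mat_simps)

lemma det_m2 [simp]: "det (m2 a b c d) = a * d - b * c"
  by (simp add: det_2)

lemma mult_nth: "(A ** B) $ i $ j = A $ i $ 1 * B $ 1 $ j + A $ i $ 2 * B $ 2 $ j" for A B :: "real^2^2"
  by (simp add: matrix_matrix_mult_def sum_2)

definition mflow :: "(real \<Rightarrow> real^2^2) \<Rightarrow> real^2^2 \<Rightarrow> bool" where
  "mflow B A \<longleftrightarrow> B 0 = mat 1 \<and> (\<forall>s t. B (s + t) = B s ** B t) \<and> (B has_vector_derivative A) (at 0)"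

lemma has_vector_derivative_mat2:
  fixes B :: "real \<Rightarrow> real^2^2"
  shows "(B has_vector_derivative A) (at t) \<longleftrightarrow> (\<forall>i j. ((\<lambda>t. B t $ i $ j) has_real_derivative A $ i $ j) (at t))"
proof -
  have "(B has_vector_derivative A) (at t) \<longleftrightarrow>
      (\<forall>b\<in>Basis. ((\<lambda>t. B t \<bullet> b) has_derivative (\<lambda>h. (h *\<^sub>R A) \<bullet> b)) (at t))"
    unfolding has_vector_derivative_def by (rule has_derivative_componentwise_within)
  also have "\<dots> \<longleftrightarrow> (\<forall>i j. ((\<lambda>t. B t $ i $ j) has_derivative (\<lambda>h. h * A $ i $ j)) (at t))"
    by (auto simp: Basis_vec_def inner_axis)
  also have "\<dots> \<longleftrightarrow> (\<forall>i j. ((\<lambda>t. B t $ i $ j) has_real_derivative A $ i $ j) (at t))"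
    by (simp add: has_field_derivative_def mult_commute_abs)
  finally show ?thesis .
qed

lemma bounded_bilinear_mat2: "bounded_bilinear ((**) :: real^2^2 \<Rightarrow> real^2^2 \<Rightarrow> real^2^2)"
  unfolding bilinear_conv_bounded_bilinear[symmetric] bilinear_def
  by (auto intro!: linearI mat2_eqI simp: mult_nth algebra_simps)

lemma bounded_bilinear_mat2_vec: "bounded_bilinear ((*v) :: real^2^2 \<Rightarrow> real^2 \<Rightarrow> real^2)"
  unfolding bilinear_conv_bounded_bilinear[symmetric] bilinear_def
  by (auto intro!: linearI vec2_eqI simp: matrix_vector_mult_def sum_2 algebra_simps)

lemma mflow_deriv:
  assumes "mflow B A"
  shows "(B has_vector_derivative B t ** A) (at t)" "(B has_vector_derivative A ** B t) (at t)"
proof -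
  have B: "B (s + t) = B s ** B t" "(B has_vector_derivative A) (at 0)" for s t using assms by (auto simp: mflow_def)
  have sh: "((\<lambda>s. s - t) has_real_derivative 1) (at t)" by (auto intro!: derivative_eq_intros)
  have "((B \<circ> (\<lambda>s. s - t)) has_vector_derivative 1 *\<^sub>R A) (at t)"
    by (rule vector_diff_chain_at) (use sh B(2) in \<open>simp_all add: has_real_derivative_iff_has_vector_derivative\<close>)
  then have d: "((\<lambda>s. B (s - t)) has_vector_derivative A) (at t)" by (simp add: o_def)
  have e: "B s = B t ** B (s - t)" "B s = B (s - t) ** B t" for s
    using B(1)[of t "s - t"] B(1)[of "s - t" t] by simp_all
  show "(B has_vector_derivative B t ** A) (at t)"
    using bounded_linear.has_vector_derivative[OF bounded_bilinear.bounded_linear_right[OF bounded_bilinear_mat2] d, of "B t"]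
    by (simp flip: e)
  show "(B has_vector_derivative A ** B t) (at t)"
    using bounded_linear.has_vector_derivative[OF bounded_bilinear.bounded_linear_left[OF bounded_bilinear_mat2] d, of "B t"]
    by (simp flip: e)
qed

lemma zero_vector_derivative_const:
  fixes f :: "real \<Rightarrow> 'a::real_normed_vector"
  assumes "\<And>t. (f has_vector_derivative 0) (at t)" shows "f t = f 0"
  by (rule has_derivative_zero_unique[of UNIV]) (use assms in \<open>auto simp: has_vector_derivative_def\<close>)

lemma mflow_inverse: "mflow B A \<Longrightarrow> B t ** B (- t) = mat 1" "mflow B A \<Longrightarrow> B (- t) ** B t = mat 1"
  unfolding mflow_def by (metis add.right_inverse, metis add.left_inverse)

lemma mflow_invertible: "mflow B A \<Longrightarrow> invertible (B t)"
  using mflow_inverse unfolding invertible_def by blast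

text \<open>The product B t C(-t) has derivative zero, hence is constantly the identity.\<close>

lemma mflow_unique:
  assumes B: "mflow B A" and C: "mflow C A" shows "B t = C t"
proof -
  have neg: "((\<lambda>t. C (- t)) has_vector_derivative - (A ** C (- t))) (at t)" for t
  proof -
    have "((C \<circ> (\<lambda>t. - t)) has_vector_derivative (-1) *\<^sub>R (A ** C (- t))) (at t)"
      by (rule vector_diff_chain_at) (auto intro!: derivative_eq_intros mflow_deriv(2)[OF C])
    then show ?thesis by (simp add: o_def)
  qed
  have "((\<lambda>t. B t ** C (- t)) has_vector_derivative B t ** (- (A ** C (- t))) + (B t ** A) ** C (- t)) (at t)" for t
    by (rule bounded_bilinear.has_vector_derivative[OF bounded_bilinear_mat2 mflow_deriv(1)[OF B] neg])
  moreover have "B t ** (- (A ** C (- t))) + (B t ** A) ** C (- t) = 0" for t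
    by (simp add: bounded_bilinear.minus_right[OF bounded_bilinear_mat2] matrix_mul_assoc)
  ultimately have "B t ** C (- t) = B 0 ** C (- 0)"
    using zero_vector_derivative_const[of "\<lambda>t. B t ** C (- t)"] by simp
  also have "\<dots> = mat 1" using B C by (simp add: mflow_def)
  finally have "B t ** C (- t) ** C t = C t" by simp
  then show ?thesis using mflow_inverse(2)[OF C] by (simp flip: matrix_mul_assoc)
qed

text \<open>After half of the trace is split off, a traceless matrix remains, whose square is the
  scalar \<delta>. Its exponential is therefore q + p times the matrix, where q and p are
  hyperbolic, polynomial or trigonometric according to the sign of \<delta>.\<close>

lemma mflow_exists: "\<exists>B. mflow B A"
proof -
  define \<tau> where "\<tau> = (A $ 1 $ 1 + A $ 2 $ 2) / 2"
  define a b c where "a = (A $ 1 $ 1 - A $ 2 $ 2) / 2" and "b = A $ 1 $ 2" and "c = A $ 2 $ 1"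
  define \<delta> where "\<delta> = a * a + b * c"
  have A: "A = m2 (\<tau> + a) b c (\<tau> - a)"
    by (rule mat2_eqI) (simp_all add: \<tau>_def a_def b_def c_def field_simps)
  have "\<exists>q p. q 0 = 1 \<and> p 0 = 0 \<and> (\<forall>s t. q (s + t) = q s * q t + \<delta> * (p s * p t)) \<and>
      (\<forall>s t. p (s + t) = p s * q t + q s * p t) \<and>
      (q has_real_derivative 0) (at 0) \<and> (p has_real_derivative 1) (at (0::real))"
  proof -
    consider "\<delta> > 0" | "\<delta> = 0" | "\<delta> < 0" by linarith
    then show ?thesis
    proof cases
      case 1
      define w where "w = sqrt \<delta>"
      have w: "w \<noteq> 0" "w * w = \<delta>" using 1 by (auto simp: w_def)
      have e: "\<delta> * (x / w * (y / w)) = x * y" for x y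
        unfolding w(2)[symmetric] using w(1) by simp
      show ?thesis
        by (rule exI[of _ "\<lambda>t. cosh (w * t)"], rule exI[of _ "\<lambda>t. sinh (w * t) / w"])
           (use w e in \<open>auto simp: distrib_left cosh_add sinh_add add_divide_distrib mult_ac intro!: derivative_eq_intros\<close>)
    next
      case 2
      show ?thesis
        by (rule exI[of _ "\<lambda>t. 1"], rule exI[of _ "\<lambda>t. t"]) (use 2 in auto)
    next
      case 3
      define w where "w = sqrt (- \<delta>)"
      have w: "w \<noteq> 0" "w * w = - \<delta>" using 3 by (auto simp: w_def)
      have e: "\<delta> * (x / w * (y / w)) = - (x * y)" for x y
      proof -
        have "\<delta> * (x / w * (y / w)) = \<delta> * (x * y) / (w * w)" by simp
        then show ?thesis unfolding w(2) using 3 by simp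
      qed
      show ?thesis
        by (rule exI[of _ "\<lambda>t. cos (w * t)"], rule exI[of _ "\<lambda>t. sin (w * t) / w"])
           (use w e in \<open>auto simp: distrib_left cos_add sin_add add_divide_distrib mult_ac intro!: derivative_eq_intros\<close>)
    qed
  qed
  then obtain q p where qp: "q 0 = 1" "p 0 = 0" "\<And>s t. q (s + t) = q s * q t + \<delta> * (p s * p t)"
      "\<And>s t. p (s + t) = p s * q t + q s * p t" "(q has_real_derivative 0) (at 0)" "(p has_real_derivative 1) (at 0)"
    by blast
  define B where "B t = m2 (exp (\<tau> * t) * (q t + p t * a)) (exp (\<tau> * t) * (p t * b)) (exp (\<tau> * t) * (p t * c)) (exp (\<tau> * t) * (q t - p t * a))" for t
  have ex: "((\<lambda>t. exp (\<tau> * t)) has_real_derivative \<tau>) (at 0)" by (auto intro!: derivative_eq_intros)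
  have d: "((\<lambda>t. exp (\<tau> * t) * f t) has_real_derivative \<tau> * f 0 + f') (at 0)" if "(f has_real_derivative f') (at 0)" for f f'
    using DERIV_mult[OF ex that] by simp
  have e: "((\<lambda>t. exp (\<tau> * t) * (q t + p t * a)) has_real_derivative \<tau> + a) (at 0)"
    "((\<lambda>t. exp (\<tau> * t) * (p t * b)) has_real_derivative b) (at 0)"
    "((\<lambda>t. exp (\<tau> * t) * (p t * c)) has_real_derivative c) (at 0)"
    "((\<lambda>t. exp (\<tau> * t) * (q t - p t * a)) has_real_derivative \<tau> - a) (at 0)"
    using d[OF DERIV_add[OF qp(5) DERIV_cmult_right[OF qp(6)]], of a] d[OF DERIV_cmult_right[OF qp(6)], of b]
      d[OF DERIV_cmult_right[OF qp(6)], of c] d[OF DERIV_diff[OF qp(5) DERIV_cmult_right[OF qp(6)]], of a]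
    by (simp_all add: qp(1,2))
  have "(B has_vector_derivative A) (at 0)"
    unfolding has_vector_derivative_mat2 A B_def using e by (simp add: forall_2)
  moreover have "B (s + t) = B s ** B t" for s t
    unfolding B_def m2_mult qp(3,4) distrib_left exp_add \<delta>_def by (rule mat2_eqI; simp; algebra)
  moreover have "B 0 = mat 1" by (simp add: B_def m2_one qp)
  ultimately show ?thesis unfolding mflow_def by blast
qed

text \<open>Liouville's formula; the determinant is positive because B t is the square of the
  invertible matrix B (t/2).\<close>

lemma mflow_det:
  assumes B: "mflow B A"
  shows "((\<lambda>t. det (B t)) has_real_derivative (A $ 1 $ 1 + A $ 2 $ 2) * det (B t)) (at t)" "det (B t) > 0"
proof -
  have d: "((\<lambda>t. B t $ i $ j) has_real_derivative (B t ** A) $ i $ j) (at t)" for i j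
    using mflow_deriv(1)[OF B, of t] unfolding has_vector_derivative_mat2 by blast
  show "((\<lambda>t. det (B t)) has_real_derivative (A $ 1 $ 1 + A $ 2 $ 2) * det (B t)) (at t)"
    unfolding det_2 by (rule DERIV_cong[OF DERIV_diff[OF DERIV_mult[OF d d] DERIV_mult[OF d d]]]) (simp add: mult_nth algebra_simps)
  have "B t = B (t/2) ** B (t/2)" using B unfolding mflow_def by (metis field_sum_of_halves)
  then have "det (B t) = det (B (t/2)) * det (B (t/2))" by (simp add: det_mul)
  moreover have "det (B (t/2)) \<noteq> 0" using mflow_invertible[OF B] by (simp add: invertible_det_nz)
  ultimately show "det (B t) > 0" by (metis not_real_square_gt_zero)
qed

lemma mflow_det_one: assumes B: "mflow B A" shows "(\<forall>t. det (B t) = 1) \<longleftrightarrow> A $ 1 $ 1 + A $ 2 $ 2 = 0"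
proof
  have d0: "det (B 0) = 1" using B by (simp add: mflow_def)
  { assume "\<forall>t. det (B t) = 1"
    then show "A $ 1 $ 1 + A $ 2 $ 2 = 0" using mflow_det(1)[OF B, of 0] DERIV_unique[OF _ DERIV_const] by fastforce
  }
  assume "A $ 1 $ 1 + A $ 2 $ 2 = 0"
  then have "((\<lambda>t. det (B t)) has_vector_derivative 0) (at t)" for t
    using mflow_det(1)[OF B, of t] by (simp add: has_real_derivative_iff_has_vector_derivative)
  from zero_vector_derivative_const[OF this] show "\<forall>t. det (B t) = 1" using d0 by simp
qed

text \<open>\<open>rotm x y\<close> is multiplication by \<open>x - i y\<close>.\<close>

definition rotm :: "real \<Rightarrow> real \<Rightarrow> real^2^2" where "rotm x y = m2 x y (- y) x"

lemma mflow_conf: "mflow (\<lambda>t. rotm (exp (a * t) * cos (b * t)) (exp (a * t) * sin (b * t))) (rotm a b)"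
  unfolding mflow_def
proof (intro conjI allI)
  show "rotm (exp (a * 0) * cos (b * 0)) (exp (a * 0) * sin (b * 0)) = mat 1" by (simp add: rotm_def m2_one)
  show "rotm (exp (a * (s + t)) * cos (b * (s + t))) (exp (a * (s + t)) * sin (b * (s + t))) =
    rotm (exp (a * s) * cos (b * s)) (exp (a * s) * sin (b * s)) ** rotm (exp (a * t) * cos (b * t)) (exp (a * t) * sin (b * t))" for s t
    unfolding rotm_def m2_mult distrib_left exp_add cos_add sin_add by (rule mat2_eqI) (simp_all add: algebra_simps)
  show "((\<lambda>t. rotm (exp (a * t) * cos (b * t)) (exp (a * t) * sin (b * t))) has_vector_derivative rotm a b) (at 0)"
    unfolding has_vector_derivative_mat2 rotm_def by (auto simp: forall_2 intro!: derivative_eq_intros)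
qed

lemma mflow_upper: "mflow (\<lambda>t. m2 1 t 0 1) (m2 0 1 0 0)" and mflow_lower: "mflow (\<lambda>t. m2 1 0 t 1) (m2 0 0 1 0)"
  unfolding mflow_def by (auto simp: m2_one m2_mult has_vector_derivative_mat2 forall_2 add.commute intro!: derivative_eq_intros)

section \<open>Affine flows and the connected groups they generate\<close>

lemma aff_flow_iff:
  "aff_flow \<gamma> (A, b) \<longleftrightarrow> mflow (\<lambda>t. fst (\<gamma> t)) A \<and> snd (\<gamma> 0) = 0 \<and>
     (\<forall>s t. snd (\<gamma> (s + t)) = fst (\<gamma> s) *v snd (\<gamma> t) + snd (\<gamma> s)) \<and>
     ((\<lambda>t. snd (\<gamma> t)) has_vector_derivative b) (at 0)"
proof -
  have d: "(\<gamma> has_vector_derivative (A, b)) (at 0) \<longleftrightarrow>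
     ((\<lambda>t. fst (\<gamma> t)) has_vector_derivative A) (at 0) \<and> ((\<lambda>t. snd (\<gamma> t)) has_vector_derivative b) (at 0)"
  proof
    assume g: "(\<gamma> has_vector_derivative (A, b)) (at 0)"
    show "((\<lambda>t. fst (\<gamma> t)) has_vector_derivative A) (at 0) \<and> ((\<lambda>t. snd (\<gamma> t)) has_vector_derivative b) (at 0)"
      using bounded_linear.has_vector_derivative[OF bounded_linear_fst g] bounded_linear.has_vector_derivative[OF bounded_linear_snd g] by simp
  next
    assume "((\<lambda>t. fst (\<gamma> t)) has_vector_derivative A) (at 0) \<and> ((\<lambda>t. snd (\<gamma> t)) has_vector_derivative b) (at 0)"
    then have "((\<lambda>t. (fst (\<gamma> t), snd (\<gamma> t))) has_vector_derivative (A, b)) (at 0)"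
      unfolding has_vector_derivative_def using has_derivative_Pair by fastforce
    then show "(\<gamma> has_vector_derivative (A, b)) (at 0)" by simp
  qed
  have m: "\<phi> \<otimes>\<^bsub>aff_group\<^esub> \<psi> = (fst \<phi> ** fst \<psi>, fst \<phi> *v snd \<psi> + snd \<phi>)" for \<phi> \<psi>
    by (cases \<phi>; cases \<psi>) simp
  have e: "(x = (y, z)) \<longleftrightarrow> fst x = y \<and> snd x = z" for x :: aff and y z by (cases x) auto
  have c: "x \<in> carrier aff_group \<longleftrightarrow> invertible (fst x)" for x by (cases x) simp
  show ?thesis
    unfolding aff_flow_def d m e c aff_group_simps(3) mflow_def
    using mflow_invertible[of "\<lambda>t. fst (\<gamma> t)" A] unfolding mflow_def by blast
qed

lemma aff_flow_deriv:
  assumes "aff_flow \<gamma> (A, b)"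
  shows "(\<gamma> has_vector_derivative (fst (\<gamma> t) ** A, fst (\<gamma> t) *v b)) (at t)"
proof -
  have f: "mflow (\<lambda>t. fst (\<gamma> t)) A" "\<And>s t. snd (\<gamma> (s + t)) = fst (\<gamma> s) *v snd (\<gamma> t) + snd (\<gamma> s)"
     "((\<lambda>t. snd (\<gamma> t)) has_vector_derivative b) (at 0)"
    using assms unfolding aff_flow_iff by blast+
  have "(((\<lambda>t. snd (\<gamma> t)) \<circ> (\<lambda>s. s - t)) has_vector_derivative 1 *\<^sub>R b) (at t)"
    by (rule vector_diff_chain_at) (use f(3) in \<open>auto intro!: derivative_eq_intros\<close>)
  then have "((\<lambda>s. snd (\<gamma> (s - t))) has_vector_derivative b) (at t)" by (simp add: o_def)
  then have "((\<lambda>s. fst (\<gamma> t) *v snd (\<gamma> (s - t)) + snd (\<gamma> t)) has_vector_derivative fst (\<gamma> t) *v b + 0) (at t)"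
    by (intro has_vector_derivative_add has_vector_derivative_const bounded_linear.has_vector_derivative[OF matrix_vector_mul_bounded_linear])
  moreover have "fst (\<gamma> t) *v snd (\<gamma> (s - t)) + snd (\<gamma> t) = snd (\<gamma> s)" for s using f(2)[of t "s - t"] by simp
  ultimately have "((\<lambda>t. snd (\<gamma> t)) has_vector_derivative fst (\<gamma> t) *v b) (at t)" by simp
  then have "((\<lambda>t. (fst (\<gamma> t), snd (\<gamma> t))) has_vector_derivative (fst (\<gamma> t) ** A, fst (\<gamma> t) *v b)) (at t)"
    using mflow_deriv(1)[OF f(1), of t] unfolding has_vector_derivative_def
    using has_derivative_Pair by fastforce
  then show ?thesis by simp
qed

lemma aff_flow_continuous: assumes "aff_flow \<gamma> v" shows "continuous_on UNIV \<gamma>"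
proof -
  have "aff_flow \<gamma> (fst v, snd v)" using assms by simp
  from aff_flow_deriv[OF this] show ?thesis
    by (intro continuous_at_imp_continuous_on ballI has_vector_derivative_continuous)
qed

lemma aff_flow_linear: assumes "mflow B A" shows "aff_flow (\<lambda>t. (B t, 0)) (A, 0)"
  unfolding aff_flow_iff using assms by simp

lemma aff_flow_linear_snd: assumes "aff_flow \<gamma> (A, 0)" shows "snd (\<gamma> t) = 0"
proof -
  have "((\<lambda>t. snd (\<gamma> t)) has_vector_derivative 0) (at t)" for t
    using bounded_linear.has_vector_derivative[OF bounded_linear_snd aff_flow_deriv[OF assms]] by simp
  from zero_vector_derivative_const[OF this] show ?thesis using assms unfolding aff_flow_iff by simp
qed

text \<open>Variation of constants: the translation part is the integral of the linear flow applied
  to b.\<close>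

lemma aff_flow_exists: "\<exists>\<gamma>. aff_flow \<gamma> (A, b)"
proof -
  obtain B where B: "mflow B A" using mflow_exists by blast
  define c where "c u = (LBINT y=ereal 0..ereal u. B y *v b)" for u
  have Bd: "((\<lambda>t. B t *v b) has_vector_derivative (B t ** A) *v b) (at t)" for t
    by (rule bounded_linear.has_vector_derivative[OF bounded_bilinear.bounded_linear_left[OF bounded_bilinear_mat2_vec] mflow_deriv(1)[OF B]])
  then have cont: "continuous_on X (\<lambda>t. B t *v b)" for X
    by (intro continuous_at_imp_continuous_on ballI has_vector_derivative_continuous)
  have cd: "(c has_vector_derivative B t *v b) (at t)" for t
  proof -
    \<comment> \<open>An interval with both 0 and t in its interior, so that the one-sided form of
      the fundamental theorem gives a derivative at t.\<close>
    let ?l = "- \<bar>t\<bar> - 1" and ?r = "\<bar>t\<bar> + 1"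
    have "(c has_vector_derivative B t *v b) (at t within {?l..?r})"
      unfolding c_def by (rule interval_integral_FTC2) (auto intro!: cont)
    then have "(c has_vector_derivative B t *v b) (at t within {?l<..<?r})"
      by (rule has_vector_derivative_within_subset) auto
    then show ?thesis by (subst (asm) has_vector_derivative_within_open) auto
  qed
  have c0: "c 0 = 0" by (simp add: c_def)
  have "c (s + t) = B s *v c t + c s" for s t
  proof -
    have "((c \<circ> (\<lambda>t. s + t)) has_vector_derivative 1 *\<^sub>R (B (s + t) *v b)) (at t)" for t
      by (rule vector_diff_chain_at) (auto intro!: derivative_eq_intros cd)
    then have "((\<lambda>t. c (s + t) - B s *v c t) has_vector_derivative B (s + t) *v b - B s *v (B t *v b)) (at t)" for t
      by (intro has_vector_derivative_diff bounded_linear.has_vector_derivative[OF matrix_vector_mul_bounded_linear] cd) (simp add: o_def)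
    moreover have "B (s + t) *v b - B s *v (B t *v b) = 0" for t
      using B by (simp add: mflow_def matrix_vector_mul_assoc)
    ultimately have "c (s + t) - B s *v c t = c (s + 0) - B s *v c 0"
      using zero_vector_derivative_const[of "\<lambda>t. c (s + t) - B s *v c t"] by simp
    then show ?thesis using c0 by (simp add: algebra_simps)
  qed
  moreover have "B 0 *v b = b" using B by (simp add: mflow_def)
  ultimately have "aff_flow (\<lambda>t. (B t, c t)) (A, b)"
    unfolding aff_flow_iff using B c0 cd[of 0] by simp
  then show ?thesis by blast
qed

lemma aff_flow_translation: "aff_flow (\<lambda>t. (mat 1, t *\<^sub>R b)) (0, b)"
proof -
  have "mflow (\<lambda>t. mat 1) 0" by (simp add: mflow_def)
  then show ?thesis unfolding aff_flow_iff by (auto simp: algebra_simps scaleR_add_left intro!: derivative_eq_intros)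
qed

lemma integral_subgroup_subgroup: "subgroup (integral_subgroup L) aff_group"
  unfolding integral_subgroup_def
  by (rule group.generate_is_subgroup[OF group_aff]) (unfold aff_flow_def, blast)

lemma flow_mem: "aff_flow \<gamma> v \<Longrightarrow> aff_field v \<in> L \<Longrightarrow> \<gamma> t \<in> integral_subgroup L"
  unfolding integral_subgroup_def by (rule generate.incl) blast

text \<open>Each flow joins its elements to the identity, the inverse of a flow element belongs to
  the same flow, and left translation by h1 carries a connected set joining the identity to h2 to
  one joining h1 to the product.\<close>

lemma connected_integral_subgroup: "connected (integral_subgroup L)"
proof -
  let ?S = "integral_subgroup L" and ?e = "\<one>\<^bsub>aff_group\<^esub>"
  have sg: "subgroup ?S aff_group" by (rule integral_subgroup_subgroup)
  have fl: "connected_component ?S ?e (\<gamma> t)" if g: "aff_flow \<gamma> v" "aff_field v \<in> L" for \<gamma> t v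
  proof (rule connected_componentI[of "range \<gamma>"])
    show "connected (range \<gamma>)" by (rule connected_continuous_image[OF aff_flow_continuous[OF g(1)] connected_UNIV])
    show "range \<gamma> \<subseteq> ?S" using flow_mem[OF g] by blast
    have "\<gamma> 0 = ?e" using g(1) by (simp only: aff_flow_def)
    then show "?e \<in> range \<gamma>" by (metis rangeI)
  qed auto
  have "connected_component ?S ?e x" if "x \<in> ?S" for x
    using that unfolding integral_subgroup_def
  proof (induct rule: generate.induct)
    case one
    show ?case by (rule connected_component_refl) (rule generate.one)
  next
    case (incl h)
    then show ?case using fl unfolding integral_subgroup_def by blast
  next
    case (inv h)
    then obtain \<gamma> t v where g: "h = \<gamma> t" "aff_flow \<gamma> v" "aff_field v \<in> L" by blast
    have "\<gamma> (- t + t) = \<gamma> (- t) \<otimes>\<^bsub>aff_group\<^esub> \<gamma> t" "\<gamma> 0 = \<one>\<^bsub>aff_group\<^esub>" "\<gamma> t \<in> carrier aff_group" "\<gamma> (- t) \<in> carrier aff_group"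
      using g(2) unfolding aff_flow_def by blast+
    then have "inv\<^bsub>aff_group\<^esub> h = \<gamma> (- t)" unfolding g(1)
      by (intro group.inv_equality[OF group_aff]) (simp_all del: aff_group_simps)
    then show ?case using fl[OF g(2,3), of "- t"] unfolding integral_subgroup_def by simp
  next
    case (eng h1 h2)
    then have h1: "h1 \<in> ?S" and cc: "connected_component ?S ?e h1" "connected_component ?S ?e h2"
      unfolding integral_subgroup_def by auto
    obtain T where T: "connected T" "T \<subseteq> ?S" "?e \<in> T" "h2 \<in> T" using cc(2) unfolding connected_component_def by blast
    have me: "h1 \<otimes>\<^bsub>aff_group\<^esub> x = (fst h1 ** fst x, fst h1 *v snd x + snd h1)" for x
      by (cases h1; cases x) simp
    have "continuous_on T (\<lambda>x. h1 \<otimes>\<^bsub>aff_group\<^esub> x)"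
      unfolding me
      by (intro continuous_on_Pair continuous_on_add continuous_on_const
            bounded_linear.continuous_on[OF bounded_bilinear.bounded_linear_right[OF bounded_bilinear_mat2]]
            bounded_linear.continuous_on[OF matrix_vector_mul_bounded_linear] continuous_on_fst continuous_on_snd continuous_on_id)
    then have "connected ((\<lambda>x. h1 \<otimes>\<^bsub>aff_group\<^esub> x) ` T)" using T(1) by (rule connected_continuous_image)
    moreover have "(\<lambda>x. h1 \<otimes>\<^bsub>aff_group\<^esub> x) ` T \<subseteq> ?S" using T(2) h1 subgroup.m_closed[OF sg] by blast
    moreover have "h1 \<in> (\<lambda>x. h1 \<otimes>\<^bsub>aff_group\<^esub> x) ` T"
      using T(3) by (intro image_eqI[of _ _ ?e]) (cases h1, simp_all)
    ultimately have "connected_component ?S h1 (h1 \<otimes>\<^bsub>aff_group\<^esub> h2)" using T(4) by (intro connected_componentI) auto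
    then show ?case using connected_component_trans[OF cc(1)] unfolding integral_subgroup_def by blast
  qed
  then show ?thesis unfolding connected_iff_connected_component
    by (meson connected_component_sym connected_component_trans)
qed

lemma aff_field_inject: "aff_field v = aff_field w \<longleftrightarrow> v = w"
  by (cases v; cases w) (auto simp: aff_field_fld dest: lin_inject)

lemma stability_aff_alg: "stability (aff_alg l) = {aff_field (A, 0) | A. A \<in> l}"
proof -
  have "hom_part 1 (aff_field (A, b)) = 0 \<longleftrightarrow> b = 0" for A b
  proof -
    have "r *\<^sub>R (1::plane) = 0 \<longleftrightarrow> r = 0" for r by simp
    then show ?thesis by (simp add: aff_field_fld hom_part_fld php_lin_eq fld_zero vec_eq_iff forall_2 del: scaleR_eq_0_iff)
  qed
  then show ?thesis unfolding stability_def aff_alg_def by auto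
qed

text \<open>X is the connected linear group of l: the flows of l lie in X and generate it, every
  one-parameter subgroup of X has its generator in l, and X is closed among the invertible
  matrices.\<close>

locale lin_group =
  fixes l :: "(real^2^2) set" and X :: "(real^2^2) set"
  assumes l0: "0 \<in> l"
    and X_mult: "\<And>A B. A \<in> X \<Longrightarrow> B \<in> X \<Longrightarrow> A ** B \<in> X"
    and X_minv: "\<And>A. A \<in> X \<Longrightarrow> matrix_inv A \<in> X"
    and X_inv: "\<And>A. A \<in> X \<Longrightarrow> invertible A"
    and flow_X: "\<And>A B t. A \<in> l \<Longrightarrow> mflow B A \<Longrightarrow> B t \<in> X"
    and X_gen: "\<And>S A. (\<And>A B t. A \<in> l \<Longrightarrow> mflow B A \<Longrightarrow> B t \<in> S) \<Longrightarrow>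
       (\<And>B C. B \<in> S \<Longrightarrow> C \<in> S \<Longrightarrow> B ** C \<in> S) \<Longrightarrow> A \<in> X \<Longrightarrow> A \<in> S"
    and X_lie: "\<And>A B. mflow B A \<Longrightarrow> (\<And>t. B t \<in> X) \<Longrightarrow> A \<in> l"
    and X_closed: "\<exists>C. closed C \<and> X = C \<inter> {A. invertible A}"
begin

lemma X_one: "mat 1 \<in> X"
  using flow_X[OF l0, of "\<lambda>t. mat 1"] by (simp add: mflow_def)

lemma subgroup_X: "subgroup {(B, b :: real^2). B \<in> X} aff_group" "subgroup {(B, b :: real^2). B \<in> X \<and> b = 0} aff_group"
  by (rule group.subgroupI[OF group_aff]; use X_one X_mult X_minv X_inv in \<open>auto simp: inv_aff\<close>)+

lemma integral_stab: "integral_subgroup (stability (aff_alg l)) = {(B, b). B \<in> X \<and> b = 0}"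
proof
  note sg = integral_subgroup_subgroup[of "stability (aff_alg l)"]
  show "integral_subgroup (stability (aff_alg l)) \<subseteq> {(B, b). B \<in> X \<and> b = 0}"
    unfolding integral_subgroup_def
  proof (rule group.generate_subgroup_incl[OF group_aff _ subgroup_X(2)], clarify)
    fix \<gamma> t A b B c assume g: "aff_flow \<gamma> (A, b)" "aff_field (A, b) \<in> stability (aff_alg l)" and e: "(B, c) = \<gamma> t"
    have A: "A \<in> l" "b = 0" using g(2) by (auto simp: stability_aff_alg aff_field_inject)
    have "mflow (\<lambda>t. fst (\<gamma> t)) A" using g(1) unfolding aff_flow_iff by blast
    then show "B \<in> X \<and> c = 0" using flow_X[OF A(1), of "\<lambda>t. fst (\<gamma> t)" t] aff_flow_linear_snd g(1) A(2) e by (metis fst_conv snd_conv)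
  qed
  have "(A, 0) \<in> integral_subgroup (stability (aff_alg l))" if "A \<in> X" for A
  proof -
    have "A \<in> {B. (B, 0) \<in> integral_subgroup (stability (aff_alg l))}"
    proof (rule X_gen[OF _ _ that])
      fix A B t assume A: "A \<in> l" and B: "mflow B A"
      have "aff_field (A, 0) \<in> stability (aff_alg l)" using A by (auto simp: stability_aff_alg)
      then have "(B t, 0) \<in> integral_subgroup (stability (aff_alg l))" by (rule flow_mem[OF aff_flow_linear[OF B]])
      then show "B t \<in> {B. (B, 0) \<in> integral_subgroup (stability (aff_alg l))}" by simp
    next
      fix B C assume "B \<in> {B. (B, 0) \<in> integral_subgroup (stability (aff_alg l))}" "C \<in> {B. (B, 0) \<in> integral_subgroup (stability (aff_alg l))}"
      then show "B ** C \<in> {B. (B, 0) \<in> integral_subgroup (stability (aff_alg l))}"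
        using subgroup.m_closed[OF sg, of "(B, 0)" "(C, 0)"] by simp
    qed
    then show ?thesis by simp
  qed
  then show "{(B, b). B \<in> X \<and> b = 0} \<subseteq> integral_subgroup (stability (aff_alg l))" by auto
qed

lemma integral_aff: "integral_subgroup (aff_alg l) = {(B, b). B \<in> X}"
proof
  note sg = integral_subgroup_subgroup[of "aff_alg l"]
  have mem: "aff_field (A, b) \<in> aff_alg l \<longleftrightarrow> A \<in> l" for A b by (auto simp: aff_alg_def aff_field_inject)
  have fl: "\<gamma> t \<in> integral_subgroup (aff_alg l)" if "aff_flow \<gamma> (A, b)" "A \<in> l" for \<gamma> A b t
    using flow_mem that mem by blast
  show "integral_subgroup (aff_alg l) \<subseteq> {(B, b). B \<in> X}"
    unfolding integral_subgroup_def
  proof (rule group.generate_subgroup_incl[OF group_aff _ subgroup_X(1)], clarify)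
    fix \<gamma> t A b B c assume g: "aff_flow \<gamma> (A, b)" "aff_field (A, b) \<in> aff_alg l" and e: "(B, c) = \<gamma> t"
    have "mflow (\<lambda>t. fst (\<gamma> t)) A" using g(1) unfolding aff_flow_iff by blast
    then show "B \<in> X" using flow_X[of A "\<lambda>t. fst (\<gamma> t)" t] g(2) mem e by (metis fst_conv)
  qed
  have tr: "(mat 1, b) \<in> integral_subgroup (aff_alg l)" for b using fl[OF aff_flow_translation l0, of 1 b] by simp
  have "(A, b) \<in> integral_subgroup (aff_alg l)" if "A \<in> X" for A b
  proof -
    have "A \<in> {B. (B, 0) \<in> integral_subgroup (aff_alg l)}"
    proof (rule X_gen[OF _ _ that])
      fix A B t assume A: "A \<in> l" and B: "mflow B A"
      show "B t \<in> {B. (B, 0) \<in> integral_subgroup (aff_alg l)}" using fl[OF aff_flow_linear[OF B] A] by simp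
    next
      fix B C assume "B \<in> {B. (B, 0) \<in> integral_subgroup (aff_alg l)}" "C \<in> {B. (B, 0) \<in> integral_subgroup (aff_alg l)}"
      then show "B ** C \<in> {B. (B, 0) \<in> integral_subgroup (aff_alg l)}"
        using subgroup.m_closed[OF sg, of "(B, 0)" "(C, 0)"] by simp
    qed
    then show ?thesis using subgroup.m_closed[OF sg tr, of "(A, 0)" b] by simp
  qed
  then show "{(B, b). B \<in> X} \<subseteq> integral_subgroup (aff_alg l)" by auto
qed

lemma connected_lie_group_aff: "connected_lie_group (integral_subgroup (aff_alg l)) (aff_alg l)"
  unfolding connected_lie_group_def
proof (intro conjI integral_subgroup_subgroup connected_integral_subgroup)
  obtain C where C: "closed C" "X = C \<inter> {A. invertible A}" using X_closed by blast
  have "integral_subgroup (aff_alg l) = carrier aff_group \<inter> (C \<times> UNIV)" unfolding integral_aff C(2) by auto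
  moreover have "closed (C \<times> (UNIV :: (real^2) set))" using C(1) by (intro closed_Times closed_UNIV)
  ultimately show "closedin (top_of_set (carrier aff_group)) (integral_subgroup (aff_alg l))"
    unfolding closedin_closed by blast
  show "aff_lie_algebra (integral_subgroup (aff_alg l)) = aff_alg l"
  proof
    show "aff_lie_algebra (integral_subgroup (aff_alg l)) \<subseteq> aff_alg l"
    proof
      fix y assume "y \<in> aff_lie_algebra (integral_subgroup (aff_alg l))"
      then obtain A b \<gamma> where y: "y = aff_field (A, b)" "aff_flow \<gamma> (A, b)" "range \<gamma> \<subseteq> {(B, b). B \<in> X}"
        unfolding aff_lie_algebra_def integral_aff by auto
      have "fst (\<gamma> t) \<in> X" for t
      proof -
        have "\<gamma> t \<in> {(B, b). B \<in> X}" by (rule subsetD[OF y(3) rangeI])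
        then show ?thesis by (cases "\<gamma> t") simp
      qed
      moreover have "mflow (\<lambda>t. fst (\<gamma> t)) A" using y(2) unfolding aff_flow_iff by blast
      ultimately have "A \<in> l" using X_lie by blast
      then show "y \<in> aff_alg l" using y(1) unfolding aff_alg_def by blast
    qed
    show "aff_alg l \<subseteq> aff_lie_algebra (integral_subgroup (aff_alg l))"
    proof
      fix y assume y: "y \<in> aff_alg l"
      then obtain A b where e: "y = aff_field (A, b)" "A \<in> l" by (auto simp: aff_alg_def)
      obtain \<gamma> where g: "aff_flow \<gamma> (A, b)" using aff_flow_exists by blast
      have "range \<gamma> \<subseteq> integral_subgroup (aff_alg l)"
        using flow_mem[OF g] y e by blast
      then show "y \<in> aff_lie_algebra (integral_subgroup (aff_alg l))" unfolding aff_lie_algebra_def using g e by blast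
    qed
  qed
qed

lemma connected_lie_group_stab: "connected_lie_group (integral_subgroup (stability (aff_alg l))) (stability (aff_alg l))"
  unfolding connected_lie_group_def
proof (intro conjI integral_subgroup_subgroup connected_integral_subgroup)
  obtain C where C: "closed C" "X = C \<inter> {A. invertible A}" using X_closed by blast
  have "integral_subgroup (stability (aff_alg l)) = carrier aff_group \<inter> (C \<times> {0})" unfolding integral_stab C(2) by auto
  moreover have "closed (C \<times> {0 :: real^2})" using C(1) by (intro closed_Times closed_singleton)
  ultimately show "closedin (top_of_set (carrier aff_group)) (integral_subgroup (stability (aff_alg l)))"
    unfolding closedin_closed by blast
  show "aff_lie_algebra (integral_subgroup (stability (aff_alg l))) = stability (aff_alg l)"
  proof
    show "aff_lie_algebra (integral_subgroup (stability (aff_alg l))) \<subseteq> stability (aff_alg l)"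
    proof
      fix y assume "y \<in> aff_lie_algebra (integral_subgroup (stability (aff_alg l)))"
      then obtain A b \<gamma> where y: "y = aff_field (A, b)" "aff_flow \<gamma> (A, b)" "range \<gamma> \<subseteq> {(B, b). B \<in> X \<and> b = 0}"
        unfolding aff_lie_algebra_def integral_stab by auto
      have r: "fst (\<gamma> t) \<in> X \<and> snd (\<gamma> t) = 0" for t
      proof -
        have "\<gamma> t \<in> {(B, b). B \<in> X \<and> b = 0}" by (rule subsetD[OF y(3) rangeI])
        then show ?thesis by (cases "\<gamma> t") simp
      qed
      have "mflow (\<lambda>t. fst (\<gamma> t)) A" "((\<lambda>t. snd (\<gamma> t)) has_vector_derivative b) (at 0)" using y(2) unfolding aff_flow_iff by auto
      then have "A \<in> l" "((\<lambda>t. 0) has_vector_derivative b) (at (0::real))" using X_lie[of "\<lambda>t. fst (\<gamma> t)" A] r by simp_all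
      then have "A \<in> l" "b = 0" using vector_derivative_unique_at[OF has_vector_derivative_const] by blast+
      then show "y \<in> stability (aff_alg l)" using y(1) by (auto simp: stability_aff_alg)
    qed
    show "stability (aff_alg l) \<subseteq> aff_lie_algebra (integral_subgroup (stability (aff_alg l)))"
    proof
      fix y assume y: "y \<in> stability (aff_alg l)"
      then obtain A where e: "y = aff_field (A, 0)" "A \<in> l" by (auto simp: stability_aff_alg)
      obtain \<gamma> where g: "aff_flow \<gamma> (A, 0)" using aff_flow_exists by blast
      have "range \<gamma> \<subseteq> integral_subgroup (stability (aff_alg l))"
        using flow_mem[OF g] y e by blast
      then show "y \<in> aff_lie_algebra (integral_subgroup (stability (aff_alg l)))" unfolding aff_lie_algebra_def using g e by blast
    qed
  qed
qed

end

section \<open>The four affine algebras and their groups\<close>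

definition "l_sl2 = {A :: real^2^2. A $ 1 $ 1 + A $ 2 $ 2 = 0}"
definition "l_conf = {rotm x y | x y. True}"
definition "l_euc \<alpha> = {s *\<^sub>R rot_mat \<alpha> | s. True}"
definition "X_sl2 = {A :: real^2^2. det A = 1}"
definition "X_gl2 = {A :: real^2^2. det A > 0}"
definition "X_conf = {rotm x y | x y. x \<noteq> 0 \<or> y \<noteq> 0}"
definition "X_euc \<alpha> = {rotm (exp (\<alpha> * s) * cos s) (exp (\<alpha> * s) * sin s) | s. True}"

lemma rotm_simps [simp]: "rotm x y $ 1 $ 1 = x" "rotm x y $ 1 $ 2 = y" "rotm x y $ 2 $ 1 = - y" "rotm x y $ 2 $ 2 = x"
  by (simp_all add: rotm_def)

lemma rotm_mult: "rotm x y ** rotm u v = rotm (x * u - y * v) (x * v + y * u)"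
  by (simp add: rotm_def m2_mult) (rule mat2_eqI, simp_all)

lemma det_rotm: "det (rotm x y) = x\<^sup>2 + y\<^sup>2" by (simp add: det_2 power2_eq_square)

lemma rot_mat_rotm: "rot_mat \<alpha> = rotm \<alpha> 1" by (rule mat2_eqI) simp_all

lemma rotm_scaleR: "s *\<^sub>R rotm x y = rotm (s * x) (s * y)" by (rule mat2_eqI) simp_all

lemma matrix_inv_unique: "A ** B = mat 1 \<Longrightarrow> B ** A = mat 1 \<Longrightarrow> matrix_inv A = B" for A B :: "real^2^2"
proof -
  assume *: "A ** B = mat 1" "B ** A = mat 1"
  then have "invertible A" unfolding invertible_def by blast
  from matrix_inv_cancel[OF this] show ?thesis using * by (metis matrix_mul_assoc matrix_mul_lid matrix_mul_rid)
qed

lemma det_matrix_inv: assumes "invertible (A :: real^2^2)" shows "det (matrix_inv A) = inverse (det A)"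
proof -
  have "det A * det (matrix_inv A) = 1" using matrix_inv_cancel[OF assms] by (metis det_I det_mul)
  then show ?thesis by (metis inverse_unique)
qed

text \<open>A matrix of determinant one with nonzero lower left entry is a product of an upper, a
  lower and an upper shear; if that entry is zero, a lower shear makes it nonzero.\<close>

lemma sl2_generated:
  assumes U: "\<And>t. m2 1 t 0 1 \<in> S" and L: "\<And>t. m2 1 0 t 1 \<in> S" and m: "\<And>B C. B \<in> S \<Longrightarrow> C \<in> S \<Longrightarrow> B ** C \<in> S"
    and A: "det A = 1"
  shows "A \<in> S"
proof -
  have main: "m2 a b c d \<in> S" if "c \<noteq> 0" "a * d - b * c = 1" for a b c d
  proof -
    have b: "b = (a * d - 1) / c" using that by (simp add: field_simps)
    \<comment> \<open>The middle shear must carry the entry c; the diagonal entries then determine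
      the two outer parameters.\<close>
    then have "m2 a b c d = (m2 1 ((a - 1) / c) 0 1 ** m2 1 0 c 1) ** m2 1 ((d - 1) / c) 0 1"
      unfolding m2_mult b by (intro mat2_eqI) (use that(1) in \<open>simp_all add: field_simps\<close>)
    then show ?thesis using m[OF m[OF U L] U] by metis
  qed
  obtain a b c d where e: "A = m2 a b c d" using m2_eq by blast
  have d: "a * d - b * c = 1" using A e by simp
  show ?thesis
  proof (cases "c = 0")
    case False
    then show ?thesis using main d e by blast
  next
    case True
    then have "a \<noteq> 0" using d by auto
    \<comment> \<open>The first row has been added to the second, which puts a into the lower left
      corner.\<close>
    then have "m2 a b a (b + d) \<in> S" using main[of a a "b + d" b] d True by (simp add: algebra_simps)
    moreover have "A = m2 1 0 (-1) 1 ** m2 a b a (b + d)" unfolding e m2_mult by (intro mat2_eqI) (simp_all add: True)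
    ultimately show ?thesis using m[OF L] by metis
  qed
qed

lemma conf_flow: "mflow B (rotm a b) \<Longrightarrow> B t = rotm (exp (a * t) * cos (b * t)) (exp (a * t) * sin (b * t))"
  using mflow_unique mflow_conf by blast

interpretation sl2: lin_group l_sl2 X_sl2
proof
  show "0 \<in> l_sl2" by (simp add: l_sl2_def)
  show "A ** B \<in> X_sl2" if "A \<in> X_sl2" "B \<in> X_sl2" for A B using that by (simp add: X_sl2_def det_mul)
  show inv: "invertible A" if "A \<in> X_sl2" for A using that by (simp add: X_sl2_def invertible_det_nz)
  show "matrix_inv A \<in> X_sl2" if "A \<in> X_sl2" for A
    using det_matrix_inv[OF inv[OF that]] that by (simp add: X_sl2_def)
  show "B t \<in> X_sl2" if "A \<in> l_sl2" "mflow B A" for A B t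
    using mflow_det_one[OF that(2)] that(1) by (simp add: X_sl2_def l_sl2_def)
  show "A \<in> S" if S: "\<And>A B t. A \<in> l_sl2 \<Longrightarrow> mflow B A \<Longrightarrow> B t \<in> S" "\<And>B C. B \<in> S \<Longrightarrow> C \<in> S \<Longrightarrow> B ** C \<in> S" and A: "A \<in> X_sl2" for S A
    by (rule sl2_generated[OF S(1)[OF _ mflow_upper] S(1)[OF _ mflow_lower] S(2)])
       (use A in \<open>simp_all add: l_sl2_def X_sl2_def\<close>)
  show "A \<in> l_sl2" if "mflow B A" "\<And>t. B t \<in> X_sl2" for A B
    using mflow_det_one[OF that(1)] that(2) by (simp add: X_sl2_def l_sl2_def)
  have "closed X_sl2" unfolding X_sl2_def det_2 by (intro closed_Collect_eq continuous_intros)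
  moreover have "X_sl2 = X_sl2 \<inter> {A. invertible A}" using inv by blast
  ultimately show "\<exists>C. closed C \<and> X_sl2 = C \<inter> {A. invertible A}" by blast
qed

interpretation gl2: lin_group UNIV X_gl2
proof
  show "0 \<in> (UNIV :: (real^2^2) set)" by simp
  show "A ** B \<in> X_gl2" if "A \<in> X_gl2" "B \<in> X_gl2" for A B using that by (simp add: X_gl2_def det_mul)
  show inv: "invertible A" if "A \<in> X_gl2" for A using that by (simp add: X_gl2_def invertible_det_nz)
  show "matrix_inv A \<in> X_gl2" if "A \<in> X_gl2" for A
    using det_matrix_inv[OF inv[OF that]] that by (simp add: X_gl2_def)
  show "B t \<in> X_gl2" if "mflow B A" for A B t
    using mflow_det(2)[OF that] by (simp add: X_gl2_def)
  show "A \<in> S" if S: "\<And>A B t. A \<in> UNIV \<Longrightarrow> mflow B A \<Longrightarrow> B t \<in> S" "\<And>B C. B \<in> S \<Longrightarrow> C \<in> S \<Longrightarrow> B ** C \<in> S" and A: "A \<in> X_gl2" for S A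
  proof -
    \<comment> \<open>Division by r normalises the determinant to one; the scalar matrix r is itself
      a flow element, with generator \<open>ln r\<close> times the identity.\<close>
    define r where "r = sqrt (det A)"
    have r: "r > 0" "r * r = det A" using A by (auto simp: r_def X_gl2_def)
    have "det ((1 / r) *\<^sub>R A) = det A / (r * r)" by (simp add: det_2 diff_divide_distrib)
    then have d1: "det ((1 / r) *\<^sub>R A) = 1" using A by (simp add: r(2) X_gl2_def)
    have "(1 / r) *\<^sub>R A \<in> S"
      by (rule sl2_generated[OF S(1)[OF UNIV_I mflow_upper] S(1)[OF UNIV_I mflow_lower] S(2)]) (use d1 in simp_all)
    moreover have "rotm r 0 \<in> S" using S(1)[OF _ mflow_conf[of "ln r" 0], of 1] r(1) by simp
    ultimately have "rotm r 0 ** ((1 / r) *\<^sub>R A) \<in> S" using S(2) by blast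
    moreover have "rotm r 0 ** ((1 / r) *\<^sub>R A) = A" using r(1) by (intro mat2_eqI) (simp_all add: mult_nth)
    ultimately show ?thesis by simp
  qed
  have "closed {A :: real^2^2. 0 \<le> det A}" unfolding det_2 by (intro closed_Collect_le continuous_intros)
  moreover have "X_gl2 = {A :: real^2^2. 0 \<le> det A} \<inter> {A. invertible A}" by (auto simp: X_gl2_def invertible_det_nz)
  ultimately show "\<exists>C. closed C \<and> X_gl2 = C \<inter> {A. invertible A}" by blast
qed simp

lemma X_conf_eq: "X_conf = {A. A $ 1 $ 1 = A $ 2 $ 2 \<and> A $ 1 $ 2 = - A $ 2 $ 1} \<inter> {A. invertible A}"
proof -
  have "invertible (rotm x y) \<longleftrightarrow> x \<noteq> 0 \<or> y \<noteq> 0" for x y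
    by (simp add: invertible_det_nz det_rotm sum_power2_eq_zero_iff)
  moreover have "A = rotm (A $ 1 $ 1) (A $ 1 $ 2)" if "A $ 1 $ 1 = A $ 2 $ 2" "A $ 1 $ 2 = - A $ 2 $ 1" for A
    by (rule mat2_eqI) (use that in simp_all)
  ultimately show ?thesis unfolding X_conf_def by (auto, metis rotm_simps(1,2))
qed

lemma rotm_inv: assumes "x \<noteq> 0 \<or> y \<noteq> 0" shows "matrix_inv (rotm x y) = rotm (x / (x\<^sup>2 + y\<^sup>2)) (- y / (x\<^sup>2 + y\<^sup>2))"
proof (rule matrix_inv_unique)
  have "x\<^sup>2 + y\<^sup>2 \<noteq> 0" using assms by (simp add: sum_power2_eq_zero_iff)
  then have "x * (x / (x\<^sup>2 + y\<^sup>2)) + y * (y / (x\<^sup>2 + y\<^sup>2)) = 1" by (simp add: add_divide_distrib[symmetric] power2_eq_square)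
  then show "rotm x y ** rotm (x / (x\<^sup>2 + y\<^sup>2)) (- y / (x\<^sup>2 + y\<^sup>2)) = mat 1"
    "rotm (x / (x\<^sup>2 + y\<^sup>2)) (- y / (x\<^sup>2 + y\<^sup>2)) ** rotm x y = mat 1"
    unfolding rotm_mult m2_one by (auto intro!: mat2_eqI simp: algebra_simps)
qed

text \<open>Linear relations between the entries of the flow pass to its derivative at 0.\<close>

lemma mflow_entries_conf:
  assumes B: "mflow B A" and X: "\<And>t. B t \<in> X_conf"
  shows "A = rotm (A $ 1 $ 1) (A $ 1 $ 2)"
proof -
  have d: "((\<lambda>t. B t $ i $ j) has_real_derivative A $ i $ j) (at 0)" for i j
    using B unfolding mflow_def has_vector_derivative_mat2 by blast
  have e: "B t $ 1 $ 1 = B t $ 2 $ 2" "B t $ 2 $ 1 = - B t $ 1 $ 2" for t using X[of t] by (auto simp: X_conf_def)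
  have "A $ 2 $ 2 = A $ 1 $ 1" by (rule DERIV_unique[OF d]) (use d[of 1 1] in \<open>simp add: e\<close>)
  moreover have "A $ 2 $ 1 = - A $ 1 $ 2"
    by (rule DERIV_unique[OF d]) (use DERIV_minus[OF d[of 1 2]] in \<open>simp add: e\<close>)
  ultimately show ?thesis by (intro mat2_eqI) simp_all
qed

interpretation cf: lin_group l_conf X_conf
proof
  have "(0 :: real^2^2) = rotm 0 0" by (rule mat2_eqI) simp_all
  then show "0 \<in> l_conf" by (auto simp: l_conf_def)
  show inv: "invertible A" if "A \<in> X_conf" for A using that by (simp add: X_conf_eq)
  show mult: "A ** B \<in> X_conf" if "A \<in> X_conf" "B \<in> X_conf" for A B
  proof -
    have "A ** B \<in> {A. A $ 1 $ 1 = A $ 2 $ 2 \<and> A $ 1 $ 2 = - A $ 2 $ 1}" using that by (auto simp: X_conf_eq mult_nth)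
    then show ?thesis using invertible_mult[OF inv[OF that(1)] inv[OF that(2)]] by (simp add: X_conf_eq)
  qed
  show "matrix_inv A \<in> X_conf" if "A \<in> X_conf" for A
  proof -
    obtain x y where e: "A = rotm x y" "x \<noteq> 0 \<or> y \<noteq> 0" using \<open>A \<in> X_conf\<close> unfolding X_conf_def by blast
    show ?thesis using invertible_matrix_inv[OF inv[OF that]] unfolding e rotm_inv[OF e(2)] by (simp add: X_conf_eq)
  qed
  show flow: "B t \<in> X_conf" if "A \<in> l_conf" "mflow B A" for A B t
  proof -
    have "\<exists>a b. A = rotm a b" using that(1) unfolding l_conf_def by blast
    then obtain a b where "A = rotm a b" by blast
    then have "B t $ 1 $ 1 = B t $ 2 $ 2 \<and> B t $ 1 $ 2 = - B t $ 2 $ 1" using conf_flow[of B a b t] that(2) by simp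
    then show ?thesis using mflow_invertible[OF that(2)] by (simp add: X_conf_eq)
  qed
  show "A \<in> S" if S: "\<And>A B t. A \<in> l_conf \<Longrightarrow> mflow B A \<Longrightarrow> B t \<in> S" "\<And>B C. B \<in> S \<Longrightarrow> C \<in> S \<Longrightarrow> B ** C \<in> S" and A: "A \<in> X_conf" for S A
  proof -
    obtain x y where e: "A = rotm x y" "x \<noteq> 0 \<or> y \<noteq> 0" using A unfolding X_conf_def by blast
    \<comment> \<open>Polar coordinates: modulus and angle give the generator
      \<open>rotm (ln r) \<theta>\<close>, whose flow reaches A at time one.\<close>
    define r where "r = sqrt (x\<^sup>2 + y\<^sup>2)"
    have r: "r > 0" "r * r = x\<^sup>2 + y\<^sup>2" using e(2) by (auto simp: r_def sum_power2_gt_zero_iff)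
    have "(x / r)\<^sup>2 + (y / r)\<^sup>2 = (x\<^sup>2 + y\<^sup>2) / (r * r)" by (simp add: power_divide add_divide_distrib power2_eq_square)
    also have "\<dots> = 1" unfolding r(2) using e(2) by (simp add: sum_power2_eq_zero_iff)
    finally obtain \<theta> where "x / r = cos \<theta>" "y / r = sin \<theta>" using sincos_total_2pi by blast
    then have "x = r * cos \<theta>" "y = r * sin \<theta>" using r(1) by (auto simp: field_simps)
    then show ?thesis using S(1)[OF _ mflow_conf[of "ln r" \<theta>], of 1] r(1) e(1) by (auto simp: l_conf_def)
  qed
  show "A \<in> l_conf" if "mflow B A" "\<And>t. B t \<in> X_conf" for A B
    using mflow_entries_conf[OF that] unfolding l_conf_def by blast
  have "closed {A :: real^2^2. A $ 1 $ 1 = A $ 2 $ 2 \<and> A $ 1 $ 2 = - A $ 2 $ 1}"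
    by (intro closed_Collect_conj closed_Collect_eq continuous_intros)
  then show "\<exists>C. closed C \<and> X_conf = C \<inter> {A. invertible A}" unfolding X_conf_eq by blast
qed

lemma X_euc_conf: "X_euc \<alpha> \<subseteq> X_conf"
proof
  fix A assume "A \<in> X_euc \<alpha>"
  then obtain s where A: "A = rotm (exp (\<alpha> * s) * cos s) (exp (\<alpha> * s) * sin s)" by (auto simp: X_euc_def)
  have "(sin s)\<^sup>2 + (cos s)\<^sup>2 \<noteq> 0" by simp
  then have "cos s \<noteq> 0 \<or> sin s \<noteq> 0" by (metis add.right_neutral zero_power2)
  then have "exp (\<alpha> * s) * cos s \<noteq> 0 \<or> exp (\<alpha> * s) * sin s \<noteq> 0" by simp
  then show "A \<in> X_conf" using A unfolding X_conf_def by blast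
qed

text \<open>For \<alpha> = 0 this is the rotation group. Otherwise it is a logarithmic spiral, on
  which the angle is determined by the modulus r as \<open>ln r / \<alpha>\<close>; this presents it
  as the zero set of a function continuous on the invertible matrices. Since it accumulates at the
  zero matrix, closedness is only relative to these.\<close>

lemma X_euc_closed: "\<exists>C. closed C \<and> X_euc \<alpha> = C \<inter> {A. invertible A}"
proof (cases "\<alpha> = 0")
  case True
  have "X_euc \<alpha> = {A. det A = 1 \<and> A $ 1 $ 1 = A $ 2 $ 2 \<and> A $ 1 $ 2 = - A $ 2 $ 1} \<inter> {A. invertible A}"
  proof (intro equalityI subsetI)
    fix A assume A: "A \<in> X_euc \<alpha>"
    then show "A \<in> {A. det A = 1 \<and> A $ 1 $ 1 = A $ 2 $ 2 \<and> A $ 1 $ 2 = - A $ 2 $ 1} \<inter> {A. invertible A}"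
      using X_euc_conf[of \<alpha>] by (auto simp: X_conf_eq X_euc_def det_rotm True)
  next
    fix A :: "real^2^2" assume A: "A \<in> {A. det A = 1 \<and> A $ 1 $ 1 = A $ 2 $ 2 \<and> A $ 1 $ 2 = - A $ 2 $ 1} \<inter> {A. invertible A}"
    then have "(A $ 1 $ 1)\<^sup>2 + (A $ 1 $ 2)\<^sup>2 = 1" by (auto simp: det_2 power2_eq_square)
    then obtain s where "A $ 1 $ 1 = cos s" "A $ 1 $ 2 = sin s" using sincos_total_2pi by blast
    then have "A = rotm (cos s) (sin s)" using A by (intro mat2_eqI) auto
    then show "A \<in> X_euc \<alpha>" by (auto simp: X_euc_def True)
  qed
  moreover have "closed {A :: real^2^2. det A = 1 \<and> A $ 1 $ 1 = A $ 2 $ 2 \<and> A $ 1 $ 2 = - A $ 2 $ 1}"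
    unfolding det_2 by (intro closed_Collect_conj closed_Collect_eq continuous_intros)
  ultimately show ?thesis by blast
next
  case False
  define r where "r A = sqrt \<bar>det A\<bar>" for A :: "real^2^2"
  define f where "f A = (A $ 1 $ 1 - A $ 2 $ 2, A $ 1 $ 2 + A $ 2 $ 1,
     A $ 1 $ 1 - r A * cos (ln (r A) / \<alpha>), A $ 1 $ 2 - r A * sin (ln (r A) / \<alpha>))" for A
  have r0: "r A > 0" if "invertible A" for A using that by (simp add: r_def invertible_det_nz)
  have "continuous_on {A. invertible A} r"
    unfolding r_def[abs_def] det_2 by (intro continuous_intros)
  then have "continuous_on {A. invertible A} f"
    unfolding f_def[abs_def] using False r0
    by (intro continuous_intros) (auto simp: less_imp_neq[THEN not_sym])
  then have "closedin (top_of_set {A. invertible A}) {A \<in> {A. invertible A}. f A = (0, 0, 0, 0)}"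
    by (rule continuous_closedin_preimage_constant)
  moreover have "{A \<in> {A. invertible A}. f A = (0, 0, 0, 0)} = X_euc \<alpha>"
  proof (intro equalityI subsetI)
    fix A assume "A \<in> X_euc \<alpha>"
    moreover from this obtain s where A: "A = rotm (exp (\<alpha> * s) * cos s) (exp (\<alpha> * s) * sin s)" by (auto simp: X_euc_def)
    have "det A = (exp (\<alpha> * s))\<^sup>2 * ((cos s)\<^sup>2 + (sin s)\<^sup>2)" unfolding A det_rotm by (simp only: power_mult_distrib distrib_left)
    then have "r A = exp (\<alpha> * s)" by (simp add: r_def)
    ultimately show "A \<in> {A \<in> {A. invertible A}. f A = (0, 0, 0, 0)}"
      using X_euc_conf[of \<alpha>] False by (auto simp: f_def A X_conf_eq)
  next
    fix A assume A: "A \<in> {A \<in> {A. invertible A}. f A = (0, 0, 0, 0)}"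
    define s where "s = ln (r A) / \<alpha>"
    have "exp (\<alpha> * s) = r A" using r0 A False by (simp add: s_def)
    then have "A = rotm (exp (\<alpha> * s) * cos s) (exp (\<alpha> * s) * sin s)"
      using A by (intro mat2_eqI) (auto simp: f_def s_def)
    then show "A \<in> X_euc \<alpha>" by (auto simp: X_euc_def)
  qed
  ultimately show ?thesis unfolding closedin_closed by blast
qed

lemma euc_mult: "rotm (exp (\<alpha> * s) * cos s) (exp (\<alpha> * s) * sin s) ** rotm (exp (\<alpha> * t) * cos t) (exp (\<alpha> * t) * sin t)
   = rotm (exp (\<alpha> * (s + t)) * cos (s + t)) (exp (\<alpha> * (s + t)) * sin (s + t))"
  unfolding rotm_mult distrib_left exp_add cos_add sin_add by (rule mat2_eqI) (simp_all add: algebra_simps)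

lemma lin_group_euc: "lin_group (l_euc \<alpha>) (X_euc \<alpha>)"
proof
  show "0 \<in> l_euc \<alpha>" by (auto simp: l_euc_def intro: exI[of _ 0])
  show "A ** B \<in> X_euc \<alpha>" if "A \<in> X_euc \<alpha>" "B \<in> X_euc \<alpha>" for A B using that euc_mult[of \<alpha>] by (auto simp: X_euc_def)
  show inv: "invertible A" if "A \<in> X_euc \<alpha>" for A using that X_euc_conf[of \<alpha>] by (auto simp: X_conf_eq)
  show "matrix_inv A \<in> X_euc \<alpha>" if A: "A \<in> X_euc \<alpha>" for A
  proof -
    obtain s where s: "A = rotm (exp (\<alpha> * s) * cos s) (exp (\<alpha> * s) * sin s)" using A by (auto simp: X_euc_def)
    have "rotm 1 0 = mat 1" by (rule mat2_eqI) (simp_all add: mat_simps)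
    then have "matrix_inv A = rotm (exp (\<alpha> * (- s)) * cos (- s)) (exp (\<alpha> * (- s)) * sin (- s))"
      unfolding s using euc_mult[of \<alpha> s "- s"] euc_mult[of \<alpha> "- s" s] by (intro matrix_inv_unique) simp_all
    then show ?thesis unfolding X_euc_def by blast
  qed
  show "B t \<in> X_euc \<alpha>" if "A \<in> l_euc \<alpha>" "mflow B A" for A B t
  proof -
    have "\<exists>s. A = rotm (s * \<alpha>) s" using that(1) unfolding l_euc_def rot_mat_rotm rotm_scaleR by auto
    then obtain s where "A = rotm (s * \<alpha>) s" by blast
    then have "B t = rotm (exp (\<alpha> * (s * t)) * cos (s * t)) (exp (\<alpha> * (s * t)) * sin (s * t))"
      using conf_flow[of B "s * \<alpha>" s t] that(2) by (simp add: mult_ac)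
    then show ?thesis unfolding X_euc_def by blast
  qed
  show "A \<in> S" if S: "\<And>A B t. A \<in> l_euc \<alpha> \<Longrightarrow> mflow B A \<Longrightarrow> B t \<in> S" "\<And>B C. B \<in> S \<Longrightarrow> C \<in> S \<Longrightarrow> B ** C \<in> S" and A: "A \<in> X_euc \<alpha>" for S A
  proof -
    obtain s where s: "A = rotm (exp (\<alpha> * s) * cos s) (exp (\<alpha> * s) * sin s)" using A by (auto simp: X_euc_def)
    have "rotm \<alpha> 1 \<in> l_euc \<alpha>" by (auto simp: l_euc_def rot_mat_rotm intro: exI[of _ 1])
    from S(1)[OF this mflow_conf, of s] show ?thesis by (simp add: s)
  qed
  show "A \<in> l_euc \<alpha>" if B: "mflow B A" and X: "\<And>t. B t \<in> X_euc \<alpha>" for A B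
  proof -
    have A: "A = rotm (A $ 1 $ 1) (A $ 1 $ 2)" by (rule mflow_entries_conf[OF B]) (use X X_euc_conf in blast)
    define a b where "a = A $ 1 $ 1" and "b = A $ 1 $ 2"
    have fl: "B t = rotm (exp (a * t) * cos (b * t)) (exp (a * t) * sin (b * t))" for t
      using conf_flow[of B a b t] B A by (simp add: a_def b_def)
    \<comment> \<open>Comparison of moduli gives the first equation; the angles agree modulo full
      turns, which the cosine expresses.\<close>
    have key: "\<exists>s. a * t = \<alpha> * s \<and> cos (b * t - s) = 1" for t
    proof -
      obtain s where s: "B t = rotm (exp (\<alpha> * s) * cos s) (exp (\<alpha> * s) * sin s)" using X[of t] by (auto simp: X_euc_def)
      have e: "exp (a * t) * cos (b * t) = exp (\<alpha> * s) * cos s" "exp (a * t) * sin (b * t) = exp (\<alpha> * s) * sin s"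
        using arg_cong[OF trans[OF sym[OF fl[of t]] s], of "\<lambda>M. M $ 1 $ 1"] arg_cong[OF trans[OF sym[OF fl[of t]] s], of "\<lambda>M. M $ 1 $ 2"]
        by simp_all
      have sq: "(exp x * cos y)\<^sup>2 + (exp x * sin y)\<^sup>2 = (exp x)\<^sup>2" for x y :: real
      proof -
        have "(exp x * cos y)\<^sup>2 + (exp x * sin y)\<^sup>2 = (exp x)\<^sup>2 * ((cos y)\<^sup>2 + (sin y)\<^sup>2)"
          by (simp only: power_mult_distrib distrib_left)
        then show ?thesis by simp
      qed
      have "(exp (a * t))\<^sup>2 = (exp (\<alpha> * s))\<^sup>2"
        unfolding sq[of "a * t" "b * t", symmetric] sq[of "\<alpha> * s" s, symmetric] e ..
      then have at: "a * t = \<alpha> * s" by (simp add: power2_eq_iff_nonneg)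
      then have "cos (b * t) = cos s" "sin (b * t) = sin s" using e by simp_all
      then have "cos (b * t - s) = cos s * cos s + sin s * sin s" by (simp add: cos_diff)
      also have "\<dots> = 1" using sin_cos_squared_add2[of s] by (simp add: power2_eq_square)
      finally show ?thesis using at by blast
    qed
    have "a = \<alpha> * b"
    proof (cases "\<alpha> = 0")
      case True
      then show ?thesis using key[of 1] by auto
    next
      case False
      have c: "cos ((b - a / \<alpha>) * t) = 1" for t
      proof -
        obtain s where s: "a * t = \<alpha> * s" "cos (b * t - s) = 1" using key by blast
        then have "s = a * t / \<alpha>" using False by (simp add: field_simps)
        then show ?thesis using s(2) by (simp add: algebra_simps)
      qed
      \<comment> \<open>An angle proportional to t that is a multiple of a full turn for every t
        must vanish: otherwise it equals a half turn at some time.\<close>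
      have "b - a / \<alpha> = 0"
      proof (rule ccontr)
        assume "b - a / \<alpha> \<noteq> 0"
        then have "cos ((b - a / \<alpha>) * (pi / (b - a / \<alpha>))) = -1" by simp
        then show False using c[of "pi / (b - a / \<alpha>)"] by simp
      qed
      then show ?thesis using False by (simp add: field_simps)
    qed
    then have "A = b *\<^sub>R rot_mat \<alpha>" using A by (simp add: rot_mat_rotm rotm_scaleR a_def b_def mult.commute)
    then show ?thesis unfolding l_euc_def by blast
  qed
  show "\<exists>C. closed C \<and> X_euc \<alpha> = C \<inter> {A. invertible A}" by (rule X_euc_closed)
qed

section \<open>Matrix form of the affine algebras\<close>

lemma subspace_l_sl2: "subspace l_sl2" by (rule subspaceI) (auto simp: l_sl2_def algebra_simps simp flip: distrib_left)
lemma subspace_l_conf: "subspace l_conf"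
proof (rule subspaceI)
  show "0 \<in> l_conf" by (rule cf.l0)
  have "rotm x y + rotm u v = rotm (x + u) (y + v)" for x y u v by (rule mat2_eqI) simp_all
  then show "x + y \<in> l_conf" if "x \<in> l_conf" "y \<in> l_conf" for x y using that unfolding l_conf_def by (smt (verit) mem_Collect_eq)
  show "c *\<^sub>R x \<in> l_conf" if "x \<in> l_conf" for c x using that rotm_scaleR unfolding l_conf_def by blast
qed
lemma subspace_l_euc: "subspace (l_euc \<alpha>)"
proof -
  have "l_euc \<alpha> = span {rot_mat \<alpha>}" by (auto simp: l_euc_def span_singleton)
  then show ?thesis by simp
qed

lemma subspace_aff_alg: assumes l: "subspace l" shows "subspace (aff_alg l)"
proof (rule subspaceI)
  show "0 \<in> aff_alg l" unfolding aff_alg_fld using subspace_0[OF l]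
    by (auto simp: fld_zero intro!: exI[of _ 0])
  fix x y c assume "x \<in> aff_alg l" "y \<in> aff_alg l"
  then obtain A b A' b' where e: "x = fld (lin A b 1) (lin A b 2) 0" "A \<in> l" "y = fld (lin A' b' 1) (lin A' b' 2) 0" "A' \<in> l"
    unfolding aff_alg_fld by blast
  show "x + y \<in> aff_alg l" unfolding e aff_alg_fld fld_add lin_add using subspace_add[OF l e(2,4)] by auto
  show "c *\<^sub>R x \<in> aff_alg l" unfolding e aff_alg_fld fld_scaleR lin_scaleR using subspace_scale[OF l e(2)] by auto
qed

lemma aff_alg_memI:
  assumes "A \<in> l" "a = lin A v 1" "b = lin A v 2" shows "fld a b 0 \<in> aff_alg l"
  using assms unfolding aff_alg_fld by blast

lemma gens_fld: "hp1 * hq1 = fld px 0 0" "hp2 * hq1 = fld py 0 0" "hp1 * hq2 = fld 0 px 0" "hp2 * hq2 = fld 0 py 0"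
  "euler = fld px py 0" "rotation = fld (- py) px 0"
  by (simp_all add: euler_def rotation_def hp1_def hp2_def emb_hq1 emb_hq2 fld_ops)

lemma lin_expand: "fld (lin A b 1) (lin A b 2) 0 = (A $ 1 $ 1) *\<^sub>R fld px 0 0 + (A $ 1 $ 2) *\<^sub>R fld py 0 0 + (b $ 1) *\<^sub>R hq1 +
    ((A $ 2 $ 1) *\<^sub>R fld 0 px 0 + (A $ 2 $ 2) *\<^sub>R fld 0 py 0 + (b $ 2) *\<^sub>R hq2)"
  by (simp add: hq1_fld hq2_fld fld_ops lin_def)

lemma q_aff_alg: assumes "0 \<in> l" shows "hq1 \<in> aff_alg l" "hq2 \<in> aff_alg l"
  unfolding hq1_fld hq2_fld
  by (rule aff_alg_memI[OF assms, where v = "vector [1, 0]"], simp_all add: lin_def)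
     (rule aff_alg_memI[OF assms, where v = "vector [0, 1]"], simp_all add: lin_def)

lemma aff_gl2_alg: "aff_gl2 = aff_alg UNIV"
proof
  show "aff_gl2 \<subseteq> aff_alg UNIV"
    unfolding aff_gl2_def gens_fld
  proof (rule span_minimal[OF _ subspace_aff_alg[OF subspace_UNIV]])
    show "{hq1, hq2, fld px 0 0, fld py 0 0, fld 0 px 0, fld 0 py 0} \<subseteq> aff_alg UNIV"
      using q_aff_alg[of UNIV] aff_alg_memI[of "m2 1 0 0 0" UNIV px 0 0] aff_alg_memI[of "m2 0 1 0 0" UNIV py 0 0]
        aff_alg_memI[of "m2 0 0 1 0" UNIV 0 0 px] aff_alg_memI[of "m2 0 0 0 1" UNIV 0 0 py]
      by (simp add: lin_def)
  qed
  show "aff_alg UNIV \<subseteq> aff_gl2"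
    unfolding aff_alg_fld lin_expand aff_gl2_def gens_fld
    by (auto intro!: span_add[OF span_add[OF span_add] span_add[OF span_add]] span_scale intro: span_base)
qed

lemma aff_sl2_alg: "aff_sl2 = aff_alg l_sl2"
proof
  show "aff_sl2 \<subseteq> aff_alg l_sl2"
    unfolding aff_sl2_def gens_fld
  proof (rule span_minimal[OF _ subspace_aff_alg[OF subspace_l_sl2]])
    show "{hq1, hq2, fld px 0 0 - fld 0 py 0, fld py 0 0, fld 0 px 0} \<subseteq> aff_alg l_sl2"
      using q_aff_alg[OF sl2.l0] aff_alg_memI[of "m2 1 0 0 (-1)" l_sl2 px 0 "- py"] aff_alg_memI[of "m2 0 1 0 0" l_sl2 py 0 0]
        aff_alg_memI[of "m2 0 0 1 0" l_sl2 0 0 px]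
      by (simp add: lin_def l_sl2_def fld_ops)
  qed
  show "aff_alg l_sl2 \<subseteq> aff_sl2"
  proof
    fix x assume "x \<in> aff_alg l_sl2"
    then obtain A b where x: "x = fld (lin A b 1) (lin A b 2) 0" "A $ 2 $ 2 = - A $ 1 $ 1" by (auto simp: aff_alg_fld l_sl2_def)
    have "x = (A $ 1 $ 1) *\<^sub>R (fld px 0 0 - fld 0 py 0) + (A $ 1 $ 2) *\<^sub>R fld py 0 0 + (b $ 1) *\<^sub>R hq1 +
      ((A $ 2 $ 1) *\<^sub>R fld 0 px 0 + (b $ 2) *\<^sub>R hq2)"
      unfolding x(1) lin_expand x(2) by (simp add: algebra_simps)
    then show "x \<in> aff_sl2" unfolding aff_sl2_def gens_fld
      by (simp only:) (intro span_add span_scale; rule span_base; simp)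
  qed
qed

lemma conf_alg: "conf = aff_alg l_conf"
proof
  show "conf \<subseteq> aff_alg l_conf"
    unfolding conf_def gens_fld
  proof (rule span_minimal[OF _ subspace_aff_alg[OF subspace_l_conf]])
    have "rotm 1 0 \<in> l_conf" "rotm 0 (-1) \<in> l_conf" by (auto simp: l_conf_def)
    then show "{hq1, hq2, fld px py 0, fld (- py) px 0} \<subseteq> aff_alg l_conf"
      using q_aff_alg[OF cf.l0] aff_alg_memI[of "rotm 1 0" l_conf px 0 py] aff_alg_memI[of "rotm 0 (-1)" l_conf "- py" 0 px]
      by (simp add: lin_def)
  qed
  show "aff_alg l_conf \<subseteq> conf"
  proof
    fix x assume "x \<in> aff_alg l_conf"
    then obtain u v b where x: "x = fld (lin (rotm u v) b 1) (lin (rotm u v) b 2) 0" by (auto simp: aff_alg_fld l_conf_def)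
    have "x = u *\<^sub>R fld px py 0 + (- v) *\<^sub>R fld (- py) px 0 + (b $ 1) *\<^sub>R hq1 + (b $ 2) *\<^sub>R hq2"
      unfolding x by (simp add: lin_def hq1_fld hq2_fld fld_ops)
    then show "x \<in> conf" unfolding conf_def gens_fld
      by (simp only:) (intro span_add span_scale; rule span_base; simp)
  qed
qed

lemma euc_alg: "euc \<alpha> = aff_alg (l_euc \<alpha>)"
proof
  have e: "\<alpha> *\<^sub>R euler - rotation = fld (lin (rot_mat \<alpha>) 0 1) (lin (rot_mat \<alpha>) 0 2) 0"
    by (simp add: gens_fld fld_ops lin_def)
  show "euc \<alpha> \<subseteq> aff_alg (l_euc \<alpha>)"
    unfolding euc_def
  proof (rule span_minimal[OF _ subspace_aff_alg[OF subspace_l_euc]])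
    have "rot_mat \<alpha> \<in> l_euc \<alpha>" by (auto simp: l_euc_def intro: exI[of _ 1])
    then show "{hq1, hq2, \<alpha> *\<^sub>R euler - rotation} \<subseteq> aff_alg (l_euc \<alpha>)"
      using q_aff_alg[of "l_euc \<alpha>"] lin_group.l0[OF lin_group_euc] aff_alg_memI[of "rot_mat \<alpha>"] by (auto simp: e)
  qed
  show "aff_alg (l_euc \<alpha>) \<subseteq> euc \<alpha>"
  proof
    fix x assume "x \<in> aff_alg (l_euc \<alpha>)"
    then obtain s b where x: "x = fld (lin (s *\<^sub>R rot_mat \<alpha>) b 1) (lin (s *\<^sub>R rot_mat \<alpha>) b 2) 0" by (auto simp: aff_alg_fld l_euc_def)
    have "x = s *\<^sub>R (\<alpha> *\<^sub>R euler - rotation) + (b $ 1) *\<^sub>R hq1 + (b $ 2) *\<^sub>R hq2"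
      unfolding x e by (simp add: lin_def hq1_fld hq2_fld fld_ops algebra_simps)
    then show "x \<in> euc \<alpha>" unfolding euc_def
      by (simp only:) (intro span_add span_scale; rule span_base; simp)
  qed
qed

section \<open>Triangle modules\<close>

lemma fps_map_nth [simp]: "fps_nth (fps_map h F) n = h (fps_nth F n)"
  by (simp add: fps_map_def)

lemma pcoeff_complexify [simp]: "pcoeff (complexify F) i j = complex_of_real (pcoeff F i j)"
  by (simp add: complexify_def pcoeff_def)

lemma pcoeff_cscale [simp]: "pcoeff (cscale c F) i j = c * pcoeff F i j"
  by (simp add: cscale_def)

interpretation cv: vector_space cscale
  by unfold_locales (rule pcoeff_eqI; simp add: algebra_simps)+

lemma cscale_mult: "cscale c F * G = cscale c (F * G)" "F * cscale c G = cscale c (F * G)"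
  by (simp_all add: cscale_def mult_ac)

lemma complexify_simps [simp]:
  "complexify (F + G) = complexify F + complexify G" "complexify (F - G) = complexify F - complexify G"
  "complexify (r *\<^sub>R F) = cscale (complex_of_real r) (complexify F)" "complexify 0 = 0" "complexify 1 = 1"
  "complexify px = fps_X" "complexify py = fps_const fps_X"
  "complexify (fps_const (fps_const r)) = fps_const (fps_const (complex_of_real r))"
  by (rule pcoeff_eqI; auto)+

lemma complexify_mult: "complexify (F * G) = complexify F * complexify G"
  by (rule pcoeff_eqI) (simp add: pcoeff_mult)

lemma complexify_power: "complexify (F ^ n) = complexify F ^ n"
  by (induct n) (simp_all add: complexify_mult)

lemma complexify_d: "complexify (dx F) = ddx (complexify F)" "complexify (dy F) = ddy (complexify F)"
  by (rule pcoeff_eqI; simp)+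

lemma complexify_inject: "complexify F = complexify G \<longleftrightarrow> F = G"
proof
  assume "complexify F = complexify G"
  then have "pcoeff (complexify F) i j = pcoeff (complexify G) i j" for i j by simp
  then show "F = G" by (intro pcoeff_eqI) simp
qed simp

lemma fpoly_complexify [simp]: "fpoly (complexify F) \<longleftrightarrow> fpoly F"
  by (simp add: fpoly_def psupp_def)

lemma fpoly_cscale [simp]: "fpoly F \<Longrightarrow> fpoly (cscale c F)"
  by (simp add: cscale_def)

lemma complexify_mono2: "complexify (mono2 c i j) = mono2 (complex_of_real c) i j"
  by (rule pcoeff_eqI) simp

lemma complexify_psub: "fpoly F \<Longrightarrow> complexify (psub u w F) = psub (complexify u) (complexify w) (complexify F)"
  by (induct rule: fpoly_induct)
     (simp_all add: ps.evl_mono2 ps.evl_add complexify_mono2 complexify_mult complexify_power)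

definition cnc :: "complex fps fps \<Rightarrow> complex fps fps" where
  "cnc F = F - fps_const (fps_const (pcoeff F 0 0))"

lemma pcoeff_cnc: "pcoeff (cnc F) i j = (if i = 0 \<and> j = 0 then 0 else pcoeff F i j)"
  by (simp add: cnc_def)

lemma cnc_lin: "cnc (F + G) = cnc F + cnc G" "cnc (cscale c F) = cscale c (cnc F)" "cnc 0 = 0"
  by (rule pcoeff_eqI; simp add: pcoeff_cnc)+

lemma complexify_nc: "complexify (nc F) = cnc (complexify F)"
  by (rule pcoeff_eqI) (simp add: pcoeff_cnc pcoeff_nc)

definition zz :: "nat \<Rightarrow> nat \<Rightarrow> complex fps fps" where "zz a b = zvar ^ a * zbar ^ b"

lemma fpoly_z [simp]: "fpoly zvar" "fpoly zbar" by (simp_all add: zvar_def zbar_def)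
lemma fpoly_zz [simp]: "fpoly (zz a b)" by (simp add: zz_def)

definition homog :: "nat \<Rightarrow> 'a::comm_ring_1 fps fps \<Rightarrow> bool" where
  "homog n F \<longleftrightarrow> (\<forall>i j. i + j \<noteq> n \<longrightarrow> pcoeff F i j = 0)"

lemma homog_mult: "homog m F \<Longrightarrow> homog n G \<Longrightarrow> homog (m + n) (F * G)"
  unfolding homog_def pcoeff_mult
proof (intro allI impI sum.neutral ballI)
  fix i j a b
  assume F: "\<forall>i j. i + j \<noteq> m \<longrightarrow> pcoeff F i j = 0" and G: "\<forall>i j. i + j \<noteq> n \<longrightarrow> pcoeff G i j = 0"
    and ij: "i + j \<noteq> m + n" and a: "a \<in> {..i}" and b: "b \<in> {..j}"
  show "pcoeff F a b * pcoeff G (i - a) (j - b) = 0"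
  proof (cases "a + b = m")
    case True
    then have "(i - a) + (j - b) \<noteq> n" using ij a b by auto
    then show ?thesis using G by simp
  qed (use F in simp)
qed

lemma homog_power: "homog m F \<Longrightarrow> homog (m * n) (F ^ n)"
proof (induct n)
  case 0
  show ?case by (simp add: homog_def)
next
  case (Suc n)
  then show ?case using homog_mult[of m F "m * n" "F ^ n"] by simp
qed

lemma homog_zz: "homog (a + b) (zz a b)"
proof -
  have "homog 1 zvar" "homog 1 zbar" by (auto simp: homog_def zvar_def zbar_def)
  then have "homog (1 * a) (zvar ^ a)" "homog (1 * b) (zbar ^ b)" by (blast intro: homog_power)+
  then show ?thesis using homog_mult unfolding zz_def by fastforce
qed

lemma pcoeff_zz00: "pcoeff (zz a b) 0 0 = (if a = 0 \<and> b = 0 then 1 else 0)"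
proof (cases "a = 0 \<and> b = 0")
  case False
  then have "0 + 0 \<noteq> a + b" by simp
  then show ?thesis using homog_zz[of a b] False unfolding homog_def by metis
qed (simp add: zz_def)

lemma cnc_zz: "cnc (zz a b) = (if a = 0 \<and> b = 0 then 0 else zz a b)"
proof (cases "a = 0 \<and> b = 0")
  case True
  then show ?thesis by (simp add: cnc_def zz_def)
next
  case False
  then show ?thesis by (simp only: cnc_def pcoeff_zz00 if_False) simp
qed

lemma dd_z: "ddx zvar = 1" "ddx zbar = 1" "ddy zvar = cscale \<i> 1" "ddy zbar = - cscale \<i> 1"
  by (rule pcoeff_eqI; auto simp: zvar_def zbar_def)+

lemma zvar_zz: "zvar * zz a b = zz (Suc a) b" and zbar_zz: "zbar * zz a b = zz a (Suc b)"
  by (simp_all add: zz_def mult_ac)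
lemma zz_1: "zz 1 0 = zvar" "zz 0 1 = zbar" "zz 0 0 = 1" by (simp_all add: zz_def)

lemma of_nat_cscale: "of_nat n * F = cscale (of_nat n) F"
  by (metis cscale_def fps_of_nat)

lemma ddx_zz: "ddx (zz a b) = cscale (of_nat a) (zz (a - 1) b) + cscale (of_nat b) (zz a (b - 1))"
  unfolding zz_def ddx_mult ddx_power dd_z by (simp add: of_nat_cscale cscale_mult)

lemma ddy_zz: "ddy (zz a b) = cscale (\<i> * of_nat a) (zz (a - 1) b) - cscale (\<i> * of_nat b) (zz a (b - 1))"
  unfolding zz_def ddy_mult ddy_power dd_z by (simp add: of_nat_cscale cscale_mult cv.scale_scale mult_ac)

text \<open>T is assumed linear on polynomials only, so the induction over the span also keeps track
  of \<open>fpoly\<close>.\<close>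

lemma span_map:
  assumes add: "\<And>F G. fpoly F \<Longrightarrow> fpoly G \<Longrightarrow> T (F + G) = T F + T G"
    and scale: "\<And>c F. fpoly F \<Longrightarrow> T (cscale c F) = cscale c (T F)"
    and Z: "\<And>x. x \<in> Z \<Longrightarrow> fpoly x \<and> T x \<in> cv.span Z'" and F: "F \<in> cv.span Z"
  shows "fpoly F \<and> T F \<in> cv.span Z'"
  using F
proof (induct rule: cv.span_induct_alt)
  case base
  have "T 0 = 0" using scale[of 0 0] by simp
  then show ?case by (simp add: cv.span_zero)
next
  case (step c x y)
  then show ?case using Z[of x] by (simp add: add scale cv.span_add cv.span_scale)
qed

text \<open>
  In exponents \<open>a = (k + l) / 2\<close> and \<open>b = (k - l) / 2\<close> of \<open>z\<close> and its conjugate, a triangle module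
  consists of the pairs below \<open>(a, b)\<close> other than \<open>(0, 0)\<close>; sums of such modules are order ideals.
\<close>

definition tri_index :: "(nat \<times> nat) set \<Rightarrow> bool" where
  "tri_index S \<longleftrightarrow> finite S \<and> (0, 0) \<notin> S \<and> (\<forall>(a, b)\<in>S. (b, a) \<in> S) \<and>
     (\<forall>(a, b)\<in>S. \<forall>a'\<le>a. \<forall>b'\<le>b. (a', b') \<noteq> (0, 0) \<longrightarrow> (a', b') \<in> S)"

lemma tri_indexD:
  assumes "tri_index S"
  shows "finite S" "(0, 0) \<notin> S" "(a, b) \<in> S \<Longrightarrow> (b, a) \<in> S"
    "(a, b) \<in> S \<Longrightarrow> a' \<le> a \<Longrightarrow> b' \<le> b \<Longrightarrow> (a', b') \<noteq> (0, 0) \<Longrightarrow> (a', b') \<in> S"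
  using assms unfolding tri_index_def by fast+

definition zset :: "(nat \<times> nat) set \<Rightarrow> complex fps fps set" where "zset S = (\<lambda>(a, b). zz a b) ` S"

definition tri_space :: "(nat \<times> nat) set \<Rightarrow> plane set" where
  "tri_space S = {f. complexify f \<in> cv.span (zset S)}"

lemma zz_in: "(a, b) \<in> S \<Longrightarrow> zz a b \<in> cv.span (zset S)"
  by (rule cv.span_base) (auto simp: zset_def)

section \<open>Sums of triangle modules as order ideals of exponents\<close>

lemma P_nonzero_iff: "P_nonzero k l \<longleftrightarrow> (\<exists>a b :: nat. k = int a + int b \<and> l = int a - int b)"
proof
  assume "P_nonzero k l"
  then obtain c where "k - l = 2 * c" "0 \<le> k" "\<bar>l\<bar> \<le> k" unfolding P_nonzero_def by blast
  then have "k = int (nat (k - c)) + int (nat c) \<and> l = int (nat (k - c)) - int (nat c)" by auto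
  then show "\<exists>a b :: nat. k = int a + int b \<and> l = int a - int b" by blast
qed (auto simp: P_nonzero_def)

lemma P_mod_eq: "P_mod (int a + int b) (int a - int b) = {cscale c (zz a b) | c. True}"
  using P_nonzero_iff[of "int a + int b" "int a - int b"] by (auto simp: P_mod_def zz_def)

text \<open>The two derivatives lower a and b respectively, and the nonzero spaces are those with
  natural exponents. The reachable exponents therefore form the full rectangle below the starting
  pair.\<close>

lemma reached_iff: "reached (int a0 + int b0) (int a0 - int b0) k l \<longleftrightarrow>
   (\<exists>a\<le>a0. \<exists>b\<le>b0. k = int a + int b \<and> l = int a - int b)"
proof
  assume "reached (int a0 + int b0) (int a0 - int b0) k l"
  then show "\<exists>a\<le>a0. \<exists>b\<le>b0. k = int a + int b \<and> l = int a - int b"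
  proof induct
    case 1
    show ?case by blast
  next
    case (2 k l)
    then obtain a b where ab: "a \<le> a0" "b \<le> b0" "k = int a + int b" "l = int a - int b" by blast
    obtain a' b' where "k - 1 = int a' + int b'" "l - 1 = int a' - int b'" using 2 P_nonzero_iff by blast
    then have "a = Suc a'" "b = b'" using ab by linarith+
    then show ?case using ab by (intro exI[of _ a'] conjI exI[of _ b']) auto
  next
    case (3 k l)
    then obtain a b where ab: "a \<le> a0" "b \<le> b0" "k = int a + int b" "l = int a - int b" by blast
    obtain a' b' where "k - 1 = int a' + int b'" "l + 1 = int a' - int b'" using 3 P_nonzero_iff by blast
    then have "a = a'" "b = Suc b'" using ab by linarith+
    then show ?case using ab by (intro exI[of _ a'] conjI exI[of _ b']) auto
  qed
next
  assume "\<exists>a\<le>a0. \<exists>b\<le>b0. k = int a + int b \<and> l = int a - int b"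
  then obtain a b where ab: "a \<le> a0" "b \<le> b0" "k = int a + int b" "l = int a - int b" by blast
  have "reached (int a0 + int b0) (int a0 - int b0) (int a + int b) (int a - int b)" if "(a0 - a) + (b0 - b) = n" "a \<le> a0" "b \<le> b0" for n a b
    using that
  proof (induct n arbitrary: a b)
    case 0
    then have "a = a0" "b = b0" by auto
    moreover have "P_nonzero (int a0 + int b0) (int a0 - int b0)" unfolding P_nonzero_iff by blast
    ultimately show ?case using reached.intros(1) by simp
  next
    case (Suc n)
    show ?case
    proof (cases "a < a0")
      case True
      then have r: "reached (int a0 + int b0) (int a0 - int b0) (int (Suc a) + int b) (int (Suc a) - int b)"
        using Suc by (intro Suc.hyps) auto
      have "P_nonzero (int (Suc a) + int b - 1) (int (Suc a) - int b - 1)" unfolding P_nonzero_iff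
        by (intro exI[of _ a] exI[of _ b]) auto
      from reached.intros(2)[OF r this] show ?thesis by simp
    next
      case False
      then have "b < b0" using Suc by auto
      then have r: "reached (int a0 + int b0) (int a0 - int b0) (int a + int (Suc b)) (int a - int (Suc b))"
        using Suc by (intro Suc.hyps) auto
      have "P_nonzero (int a + int (Suc b) - 1) (int a - int (Suc b) + 1)" unfolding P_nonzero_iff
        by (intro exI[of _ a] exI[of _ b]) auto
      from reached.intros(3)[OF r this] show ?thesis by simp
    qed
  qed
  then show "reached (int a0 + int b0) (int a0 - int b0) k l" using ab by blast
qed

definition below :: "nat \<Rightarrow> nat \<Rightarrow> (nat \<times> nat) set" where
  "below a0 b0 = {(a, b). a \<le> a0 \<and> b \<le> b0 \<and> (a, b) \<noteq> (0, 0)}"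

lemma W_mod_eq: "W_mod (int a0 + int b0) (int a0 - int b0) = cv.span (zset (below a0 b0))"
proof -
  let ?U = "\<Union>{P_mod k l | k l. 0 < k \<and> reached (int a0 + int b0) (int a0 - int b0) k l}"
  have U: "x \<in> ?U \<longleftrightarrow> (\<exists>a b c. (a, b) \<in> below a0 b0 \<and> x = cscale c (zz a b))" for x
  proof
    assume "x \<in> ?U"
    then obtain k l where kl: "x \<in> P_mod k l" "0 < k" "reached (int a0 + int b0) (int a0 - int b0) k l" by blast
    then obtain a b where ab: "a \<le> a0" "b \<le> b0" "k = int a + int b" "l = int a - int b" unfolding reached_iff by blast
    then obtain c where "x = cscale c (zz a b)" using kl(1) P_mod_eq by blast
    then show "\<exists>a b c. (a, b) \<in> below a0 b0 \<and> x = cscale c (zz a b)" using ab kl(2)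
      by (intro exI[of _ a] exI[of _ b] exI[of _ c]) (auto simp: below_def)
  next
    assume "\<exists>a b c. (a, b) \<in> below a0 b0 \<and> x = cscale c (zz a b)"
    then obtain a b c where ab: "(a, b) \<in> below a0 b0" "x = cscale c (zz a b)" by blast
    then have "x \<in> P_mod (int a + int b) (int a - int b)" unfolding P_mod_eq by blast
    moreover have "0 < int a + int b" using ab(1) by (auto simp: below_def)
    moreover have "reached (int a0 + int b0) (int a0 - int b0) (int a + int b) (int a - int b)"
      using ab(1) unfolding reached_iff by (auto simp: below_def)
    ultimately show "x \<in> ?U" by blast
  qed
  show ?thesis unfolding W_mod_def
  proof (rule cv.span_eq[THEN iffD2], intro conjI subsetI)
    fix x assume "x \<in> ?U"
    then obtain a b c where "(a, b) \<in> below a0 b0" "x = cscale c (zz a b)" unfolding U by blast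
    then show "x \<in> cv.span (zset (below a0 b0))" by (auto intro!: cv.span_scale zz_in)
  next
    fix x assume "x \<in> zset (below a0 b0)"
    then obtain a b where "(a, b) \<in> below a0 b0" "x = cscale 1 (zz a b)" by (auto simp: zset_def)
    then have "x \<in> ?U" unfolding U by blast
    then show "x \<in> cv.span ?U" by (rule cv.span_base)
  qed
qed

lemma span_Union_span: "cv.span (\<Union>i\<in>I. cv.span (f i)) = cv.span (\<Union>i\<in>I. f i)"
proof (rule cv.span_eq[THEN iffD2], intro conjI UN_least)
  show "cv.span (f i) \<subseteq> cv.span (\<Union>i\<in>I. f i)" if "i \<in> I" for i using that by (intro cv.span_mono) blast
  show "f i \<subseteq> cv.span (\<Union>i\<in>I. cv.span (f i))" if "i \<in> I" for i
    by (rule order_trans[OF cv.span_superset order_trans[OF _ cv.span_superset]]) (use that in blast)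
qed

text \<open>The exponents occurring in finitely many triangles form a finite order ideal without (0,
  0), and conjugation swaps the two exponents. In the other direction, all elements of the ideal
  serve as starting points.\<close>

lemma triangle_sum_iff: "triangle_sum \<xi> \<longleftrightarrow> (\<exists>S. tri_index S \<and> \<xi> = tri_space S)"
proof
  assume "triangle_sum \<xi>"
  then obtain I where I: "finite I" "\<And>k l. (k, l) \<in> I \<Longrightarrow> P_nonzero k l \<and> (k, - l) \<in> I"
    "\<xi> = {f. complexify f \<in> cv.span (\<Union>(k, l)\<in>I. W_mod k l)}" unfolding triangle_sum_def by blast
  define J where "J = {p :: nat \<times> nat. (int (fst p) + int (snd p), int (fst p) - int (snd p)) \<in> I}"
  have J: "I = (\<lambda>(a, b). (int a + int b, int a - int b)) ` J"
  proof (intro equalityI subsetI)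
    fix p assume p: "p \<in> I"
    obtain k l where kl: "p = (k, l)" by fastforce
    then obtain a b :: nat where "k = int a + int b" "l = int a - int b" using I(2) p P_nonzero_iff by blast
    then show "p \<in> (\<lambda>(a, b). (int a + int b, int a - int b)) ` J"
      using p kl by (intro image_eqI[of _ _ "(a, b)"]) (simp_all add: J_def)
  qed (auto simp: J_def)
  have "inj_on (\<lambda>(a, b). (int a + int b, int a - int b)) J" by (auto intro!: inj_onI)
  with I(1) have fJ: "finite J" unfolding J by (rule finite_imageD)
  define S where "S = (\<Union>(a, b)\<in>J. below a b)"
  have "finite (below a b)" for a b by (rule finite_subset[of _ "{..a} \<times> {..b}"]) (auto simp: below_def)
  then have finS: "finite S" using fJ by (auto simp: S_def)
  have Jsym: "(b, a) \<in> J" if "(a, b) \<in> J" for a b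
    using I(2)[of "int a + int b" "int a - int b"] that by (simp add: J_def add.commute)
  have S0: "(0, 0) \<notin> S" by (simp add: S_def below_def split_beta)
  have Sd: "(a', b') \<in> S" if t: "(a, b) \<in> S" "a' \<le> a" "b' \<le> b" "(a', b') \<noteq> (0, 0)" for a b a' b'
  proof -
    obtain c d where cd: "(c, d) \<in> J" "(a, b) \<in> below c d" using t(1) by (auto simp: S_def)
    then have "(a', b') \<in> below c d" using t by (auto simp: below_def)
    then show ?thesis using cd(1) by (auto simp: S_def)
  qed
  have Ss: "(b, a) \<in> S" if ab: "(a, b) \<in> S" for a b
  proof -
    obtain c d where cd: "(c, d) \<in> J" "(a, b) \<in> below c d" using ab by (auto simp: S_def)
    then have "(b, a) \<in> below d c" "(d, c) \<in> J" using Jsym by (auto simp: below_def)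
    then show ?thesis by (auto simp: S_def)
  qed
  have "tri_index S" unfolding tri_index_def using finS S0 Sd Ss by (intro conjI) fast+
  moreover have "\<xi> = tri_space S"
  proof -
    have "(\<Union>(k, l)\<in>I. W_mod k l) = (\<Union>p\<in>J. cv.span (zset (below (fst p) (snd p))))"
      unfolding J by (auto simp: W_mod_eq split_beta)
    moreover have "(\<Union>p\<in>J. zset (below (fst p) (snd p))) = zset S"
    proof -
      have "S = (\<Union>p\<in>J. below (fst p) (snd p))" by (simp add: S_def split_beta)
      then show ?thesis by (simp add: zset_def image_UN)
    qed
    ultimately show ?thesis unfolding I(3) tri_space_def by (simp add: span_Union_span)
  qed
  ultimately show "\<exists>S. tri_index S \<and> \<xi> = tri_space S" by blast
next
  assume "\<exists>S. tri_index S \<and> \<xi> = tri_space S"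
  then obtain S where S: "tri_index S" "\<xi> = tri_space S" by blast
  define I where "I = (\<lambda>(a, b). (int a + int b, int a - int b)) ` S"
  have fI: "finite I" using S(1) by (simp add: I_def tri_index_def)
  have sym: "P_nonzero k l \<and> (k, - l) \<in> I" if kl: "(k, l) \<in> I" for k l
  proof -
    obtain a b where ab: "(a, b) \<in> S" "k = int a + int b" "l = int a - int b" using kl by (auto simp: I_def)
    then have "(b, a) \<in> S" using S(1) by (auto simp: tri_index_def)
    then have "(k, - l) \<in> I" using ab by (auto simp: I_def intro!: image_eqI[of _ _ "(b, a)"])
    then show ?thesis using ab by (auto simp: P_nonzero_iff)
  qed
  have 1: "(\<Union>(k, l)\<in>I. W_mod k l) = (\<Union>p\<in>S. cv.span (zset (below (fst p) (snd p))))"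
    unfolding I_def by (auto simp: W_mod_eq split_beta)
  have 2: "(\<Union>p\<in>S. zset (below (fst p) (snd p))) = zset S"
  proof -
    have "(\<Union>p\<in>S. below (fst p) (snd p)) = S"
    proof
      show "(\<Union>p\<in>S. below (fst p) (snd p)) \<subseteq> S"
      proof clarify
        fix a b a' b' assume "(a, b) \<in> S" "(a', b') \<in> below (fst (a, b)) (snd (a, b))"
        then show "(a', b') \<in> S" using tri_indexD(4)[OF S(1)] by (simp add: below_def)
      qed
      show "S \<subseteq> (\<Union>p\<in>S. below (fst p) (snd p))"
      proof
        fix p assume p: "p \<in> S"
        then have "p \<noteq> (0, 0)" using tri_indexD(2)[OF S(1)] by metis
        then have "p \<in> below (fst p) (snd p)" by (cases p) (auto simp: below_def)
        then show "p \<in> (\<Union>p\<in>S. below (fst p) (snd p))" using p by blast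
      qed
    qed
    then show ?thesis by (simp add: zset_def flip: image_UN)
  qed
  have "\<xi> = {f. complexify f \<in> cv.span (\<Union>(k, l)\<in>I. W_mod k l)}"
    unfolding S(2) tri_space_def 1 span_Union_span 2 ..
  then show "triangle_sum \<xi>" unfolding triangle_sum_def using fI sym by blast
qed

text \<open>Reduces invariance of the real form to the monomials in z and its conjugate, provided
  the real operation is the restriction of a complex linear one.\<close>

lemma tri_space_map:
  assumes T: "\<And>F G. fpoly F \<Longrightarrow> fpoly G \<Longrightarrow> T (F + G) = T F + T G"
    "\<And>c F. fpoly F \<Longrightarrow> T (cscale c F) = cscale c (T F)"
    "\<And>a b. (a, b) \<in> S \<Longrightarrow> T (zz a b) \<in> cv.span (zset S)"
    and f: "f \<in> tri_space S" and g: "complexify g = T (complexify f)"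
  shows "g \<in> tri_space S"
proof -
  have Z: "fpoly x \<and> T x \<in> cv.span (zset S)" if "x \<in> zset S" for x using that T(3) by (auto simp: zset_def)
  have "fpoly (complexify f) \<and> T (complexify f) \<in> cv.span (zset S)"
    by (rule span_map[where T = T, OF T(1,2) Z]) (use f in \<open>simp_all add: tri_space_def\<close>)
  then show ?thesis by (simp add: tri_space_def g)
qed

lemma cnc_zz_in:
  assumes S: "tri_index S" "(a, b) \<in> S" and "i \<le> a" "j \<le> b" shows "cnc (zz i j) \<in> cv.span (zset S)"
  using tri_indexD(4)[OF assms] by (auto simp: cnc_zz cv.span_zero intro!: zz_in)

lemma subspace_tri: "subspace (tri_space S)"
  by (rule subspaceI) (auto simp: tri_space_def cv.span_zero cv.span_add cv.span_scale)

lemma tri_deg: assumes S: "tri_index S" and N: "\<And>a b. (a, b) \<in> S \<Longrightarrow> a + b \<le> N"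
  shows "tri_space S \<subseteq> polys_upto N"
proof
  fix f assume f: "f \<in> tri_space S"
  have "F \<in> cv.span (zset S) \<Longrightarrow> pcoeff F 0 0 = 0 \<and> (\<forall>i j. N < i + j \<longrightarrow> pcoeff F i j = 0)" for F
  proof (induct rule: cv.span_induct_alt)
    case (step c x y)
    then obtain a b where ab: "x = zz a b" "(a, b) \<in> S" by (auto simp: zset_def)
    have "(a, b) \<noteq> (0, 0)" using ab(2) tri_indexD(2)[OF S] by metis
    moreover have "pcoeff x i j = 0" if "N < i + j" for i j using homog_zz[of a b] N[OF ab(2)] that unfolding homog_def ab by auto
    ultimately show ?case using step by (auto simp: ab pcoeff_zz00)
  qed simp
  from this[of "complexify f"] f show "f \<in> polys_upto N" by (auto simp: tri_space_def polys_upto_def)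
qed

lemma tri_p: assumes "(1, 0) \<in> S" "(0, 1) \<in> S" shows "px \<in> tri_space S" "py \<in> tri_space S"
proof -
  have z: "zvar \<in> cv.span (zset S)" "zbar \<in> cv.span (zset S)" using zz_in[OF assms(1)] zz_in[OF assms(2)] unfolding zz_1 by blast+
  have e: "fps_X = cscale (1/2) zvar + cscale (1/2) zbar" "fps_const fps_X = cscale (- \<i> / 2) zvar + cscale (\<i> / 2) zbar"
    by (rule pcoeff_eqI; auto simp: zvar_def zbar_def)+
  show "px \<in> tri_space S"
    unfolding tri_space_def mem_Collect_eq complexify_simps e(1) by (intro cv.span_add cv.span_scale z)
  show "py \<in> tri_space S"
    unfolding tri_space_def mem_Collect_eq complexify_simps e(2) by (intro cv.span_add cv.span_scale z)
qed

lemma tri_php: assumes "f \<in> tri_space S" shows "php k f \<in> tri_space S"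
proof -
  define T where "T F = Abs_fps (\<lambda>i. Abs_fps (\<lambda>j. if i + j = k then pcoeff F i j else (0::complex)))" for F
  have T: "pcoeff (T F) i j = (if i + j = k then pcoeff F i j else 0)" for F i j by (simp add: T_def pcoeff_def)
  have "T (zz a b) = (if a + b = k then zz a b else 0)" for a b
    by (rule pcoeff_eqI) (use homog_zz[of a b] in \<open>auto simp: T homog_def\<close>)
  then have "T (zz a b) \<in> cv.span (zset S)" if "(a, b) \<in> S" for a b using zz_in[OF that] by (simp add: cv.span_zero)
  then show ?thesis
    by (rule tri_space_map[of T S f, rotated 2]) (auto simp: assms T intro!: pcoeff_eqI)
qed

lemma complexify_lin: "complexify (lin (rotm x y) b 1) + cscale \<i> (complexify (lin (rotm x y) b 2)) =
     cscale (Complex x (- y)) zvar + cscale (Complex (b $ 1) (b $ 2)) 1"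
  "complexify (lin (rotm x y) b 1) - cscale \<i> (complexify (lin (rotm x y) b 2)) =
     cscale (Complex x y) zbar + cscale (Complex (b $ 1) (- b $ 2)) 1"
  by (rule pcoeff_eqI; auto simp: lin_def zvar_def zbar_def complex_eq_iff)+

text \<open>A conformal affine field is the sum of an affine expression in z times the derivative by
  z and of its conjugate. On a monomial it keeps both exponents or lowers one of them by
  one.\<close>

lemma clie_zz:
  "complexify (lin (rotm x y) b 1) * ddx (zz m n) + complexify (lin (rotm x y) b 2) * ddy (zz m n) =
    cscale (of_nat m * Complex x (- y) + of_nat n * Complex x y) (zz m n) +
    cscale (of_nat m * Complex (b $ 1) (b $ 2)) (zz (m - 1) n) + cscale (of_nat n * Complex (b $ 1) (- b $ 2)) (zz m (n - 1))"
proof -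
  let ?L = "complexify (lin (rotm x y) b 1)" and ?M = "complexify (lin (rotm x y) b 2)"
  have "?L * ddx (zz m n) + ?M * ddy (zz m n) =
     cscale (of_nat m) ((?L + cscale \<i> ?M) * zz (m - 1) n) + cscale (of_nat n) ((?L - cscale \<i> ?M) * zz m (n - 1))"
    unfolding ddx_zz ddy_zz
    by (simp add: algebra_simps cscale_mult cv.scale_right_distrib cv.scale_right_diff_distrib cv.scale_scale)
  also have "\<dots> = cscale (of_nat m) (cscale (Complex x (- y)) (zvar * zz (m - 1) n) + cscale (Complex (b $ 1) (b $ 2)) (zz (m - 1) n)) +
     cscale (of_nat n) (cscale (Complex x y) (zbar * zz m (n - 1)) + cscale (Complex (b $ 1) (- b $ 2)) (zz m (n - 1)))"
    unfolding complexify_lin by (simp add: distrib_right cscale_mult)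
  also have "\<dots> = cscale (of_nat m * Complex x (- y) + of_nat n * Complex x y) (zz m n) +
    cscale (of_nat m * Complex (b $ 1) (b $ 2)) (zz (m - 1) n) + cscale (of_nat n * Complex (b $ 1) (- b $ 2)) (zz m (n - 1))"
    unfolding zvar_zz zbar_zz
    \<comment> \<open>For exponent 0 the truncated difference spoils the product with z, but then
      the coefficient is zero.\<close>
    by (cases m; cases n) (simp_all add: cv.scale_right_distrib cv.scale_left_distrib cv.scale_scale algebra_simps)
  finally show ?thesis .
qed

definition clie :: "real^2^2 \<Rightarrow> real^2 \<Rightarrow> complex fps fps \<Rightarrow> complex fps fps" where
  "clie A b F = cnc (complexify (lin A b 1) * ddx F + complexify (lin A b 2) * ddy F)"

lemma dd_cscale: "ddx (cscale c F) = cscale c (ddx F)" "ddy (cscale c F) = cscale c (ddy F)"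
  by (rule pcoeff_eqI; simp)+

lemma clie_lin: "clie A b (F + G) = clie A b F + clie A b G" "clie A b (cscale c F) = cscale c (clie A b F)"
  by (simp_all add: clie_def dd_cscale cscale_mult distrib_left cnc_lin cv.scale_right_distrib)

lemma complexify_lie_act: "complexify (lie_act A b f) = clie A b (complexify f)"
  by (simp add: lie_act_def clie_def complexify_nc complexify_mult complexify_d)

lemma clie_rotm: "clie (rotm x y) b (zz m n) =
    cscale (of_nat m * Complex x (- y) + of_nat n * Complex x y) (cnc (zz m n)) +
    cscale (of_nat m * Complex (b $ 1) (b $ 2)) (cnc (zz (m - 1) n)) + cscale (of_nat n * Complex (b $ 1) (- b $ 2)) (cnc (zz m (n - 1)))"
  by (simp add: clie_def clie_zz cnc_lin)

lemma tri_lie: assumes S: "tri_index S" and f: "f \<in> tri_space S" shows "lie_act (rotm x y) b f \<in> tri_space S"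
proof (rule tri_space_map[of "clie (rotm x y) b", OF clie_lin _ f complexify_lie_act])
  show "clie (rotm x y) b (zz m n) \<in> cv.span (zset S)" if "(m, n) \<in> S" for m n
    unfolding clie_rotm by (intro cv.span_add cv.span_scale cnc_zz_in[OF S that]) auto
qed

text \<open>A conformal affine map substitutes an affine function of z for z and its conjugate for
  the conjugate. Expansion of a monomial then yields exponents no larger than the given ones, and
  these belong to the order ideal.\<close>

lemma tri_act:
  assumes S: "tri_index S" and f: "f \<in> tri_space S" and pf: "fpoly f" and A: "A \<in> X_conf"
  shows "aff_act (A, b) f \<in> tri_space S"
proof -
  obtain x y where C: "matrix_inv A = rotm x y" using cf.X_minv[OF A] unfolding X_conf_def by blast
  define d where "d = - (matrix_inv A *v b)"
  let ?u = "complexify (lin (rotm x y) d 1)" and ?w = "complexify (lin (rotm x y) d 2)"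
  let ?p = "Complex x (- y)" and ?q = "Complex (d $ 1) (d $ 2)" and ?p' = "Complex x y" and ?q' = "Complex (d $ 1) (- d $ 2)"
  have z: "psub ?u ?w zvar = cscale ?p zvar + cscale ?q 1" "psub ?u ?w zbar = cscale ?p' zbar + cscale ?q' 1"
    unfolding complexify_lin[symmetric]
    by (simp_all add: zvar_def zbar_def cscale_def ps.evl_add ps.evl_diff ps.evl_mult del: fps_const_mult)
  \<comment> \<open>The rectangle includes the exponent (0, 0); this constant is removed afterwards
    by \<open>cnc\<close>.\<close>
  have s: "(cscale ?p zvar + cscale ?q 1) ^ m * (cscale ?p' zbar + cscale ?q' 1) ^ n \<in> cv.span (zset ({..m} \<times> {..n}))" for m n
  proof (induct m)
    case 0
    show ?case
    proof (induct n)
      case 0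
      show ?case using zz_in[of 0 0 "{..0} \<times> {..0}"] by (simp add: zz_1)
    next
      case (Suc n)
      have "fpoly F \<and> (cscale ?p' zbar + cscale ?q' 1) * F \<in> cv.span (zset ({..0} \<times> {..Suc n}))"
        if "F \<in> cv.span (zset ({..0} \<times> {..n}))" for F
        by (rule span_map[OF _ _ _ that]) (auto simp: zset_def distrib_left distrib_right cscale_mult zbar_zz cv.scale_right_distrib cv.scale_scale mult.commute intro!: cv.span_add cv.span_scale zz_in[unfolded zset_def])
      from this[OF Suc] show ?case by simp
    qed
  next
    case (Suc m)
    have "fpoly F \<and> (cscale ?p zvar + cscale ?q 1) * F \<in> cv.span (zset ({..Suc m} \<times> {..n}))"
      if "F \<in> cv.span (zset ({..m} \<times> {..n}))" for F
      by (rule span_map[OF _ _ _ that]) (auto simp: zset_def distrib_left distrib_right cscale_mult zvar_zz cv.scale_right_distrib cv.scale_scale mult.commute intro!: cv.span_add cv.span_scale zz_in[unfolded zset_def])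
    from this[OF Suc] show ?case by (simp add: mult.assoc)
  qed
  show ?thesis
  proof (rule tri_space_map[of "\<lambda>F. cnc (psub ?u ?w F)", OF _ _ _ f])
    show "complexify (aff_act (A, b) f) = cnc (psub ?u ?w (complexify f))"
      by (simp add: aff_act_psub[OF pf] inv_aff[OF cf.X_inv[OF A]] C d_def complexify_nc complexify_psub[OF pf])
    show "cnc (psub ?u ?w (F + G)) = cnc (psub ?u ?w F) + cnc (psub ?u ?w G)" if "fpoly F" "fpoly G" for F G
      by (simp add: ps.evl_add that cnc_lin)
    show "cnc (psub ?u ?w (cscale c F)) = cscale c (cnc (psub ?u ?w F))" if "fpoly F" for c F
      by (simp add: cscale_def ps.evl_mult that) (simp add: cscale_def[symmetric] cnc_lin)
    fix m n assume mn: "(m, n) \<in> S"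
    have "psub ?u ?w (zz m n) \<in> cv.span (zset ({..m} \<times> {..n}))"
      using s[of m n] by (simp add: zz_def ps.evl_mult ps.evl_power z)
    then have "fpoly (psub ?u ?w (zz m n)) \<and> cnc (psub ?u ?w (zz m n)) \<in> cv.span (zset S)"
      by (rule span_map[rotated 3]) (auto simp: cnc_lin zset_def cnc_zz_in[OF S mn, unfolded zset_def])
    then show "cnc (psub ?u ?w (zz m n)) \<in> cv.span (zset S)" by simp
  qed
qed

section \<open>The two families of modules satisfy the hypotheses on \<xi>\<close>

definition degb :: "nat \<Rightarrow> 'a::comm_ring_1 fps fps \<Rightarrow> bool" where
  "degb N F \<longleftrightarrow> (\<forall>i j. N < i + j \<longrightarrow> pcoeff F i j = 0)"

lemma degb_mult: "degb m F \<Longrightarrow> degb n G \<Longrightarrow> degb (m + n) (F * G)"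
  unfolding degb_def pcoeff_mult
proof (intro allI impI sum.neutral ballI)
  fix i j a b
  assume F: "\<forall>i j. m < i + j \<longrightarrow> pcoeff F i j = 0" and G: "\<forall>i j. n < i + j \<longrightarrow> pcoeff G i j = 0"
    and ij: "m + n < i + j" and a: "a \<in> {..i}" and b: "b \<in> {..j}"
  show "pcoeff F a b * pcoeff G (i - a) (j - b) = 0"
  proof (cases "a + b \<le> m")
    case True
    then have "n < (i - a) + (j - b)" using ij a b by auto
    then show ?thesis using G by simp
  qed (use F in simp)
qed

lemma degb_power: "degb 1 F \<Longrightarrow> degb n (F ^ n)"
proof (induct n)
  case 0
  show ?case by (simp add: degb_def)
next
  case (Suc n)
  then show ?case using degb_mult[of 1 F n "F ^ n"] by simp
qed

lemma degb_psub:
  assumes F: "degb N F" and u: "degb 1 u" "degb 1 w" shows "degb N (psub u w F)"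
  unfolding degb_def psub_def evl_def pcoeff_sum
proof (intro allI impI sum.neutral ballI)
  fix i j p assume ij: "N < i + j" and p: "p \<in> psupp F"
  have "fst p + snd p \<le> N" using p F by (force simp: psupp_def degb_def not_less[symmetric])
  moreover have "degb (fst p + snd p) (u ^ fst p * w ^ snd p)" by (intro degb_mult degb_power u)
  ultimately show "pcoeff (fps_const (fps_const (pcoeff F (fst p) (snd p))) * (u ^ fst p * w ^ snd p)) i j = 0"
    using ij by (simp add: degb_def)
qed

lemma star_grpI:
  assumes L: "lin_group l X" and "subspace l" and "\<And>A B. A \<in> l \<Longrightarrow> B \<in> l \<Longrightarrow> A ** B - B ** A \<in> l"
    and "\<exists>\<alpha>. rot_mat \<alpha> \<in> l" "subspace \<xi>" "\<xi> \<subseteq> polys_upto N" "px \<in> \<xi>" "py \<in> \<xi>"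
    and "\<And>f k. f \<in> \<xi> \<Longrightarrow> php k f \<in> \<xi>" "\<And>A b f. A \<in> l \<Longrightarrow> f \<in> \<xi> \<Longrightarrow> lie_act A b f \<in> \<xi>"
    and "\<And>A b f. A \<in> X \<Longrightarrow> f \<in> \<xi> \<Longrightarrow> aff_act (A, b) f \<in> \<xi>"
  shows "star_grp l \<xi> N X"
proof -
  interpret lin_group l X by fact
  show ?thesis
    by (intro star_grp.intro star_alg.intro star_grp_axioms.intro)
       (rule assms(2-) X_inv X_one X_mult X_minv | assumption)+
qed

lemma star_grp_polys:
  assumes L: "lin_group l X" and "subspace l" "\<And>A B. A \<in> l \<Longrightarrow> B \<in> l \<Longrightarrow> A ** B - B ** A \<in> l" "\<exists>\<alpha>. rot_mat \<alpha> \<in> l"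
    and k: "k \<ge> 1"
  shows "star_grp l (polys_upto k) k X"
proof (rule star_grpI[OF assms(1-4)])
  show "subspace (polys_upto k)" by (rule subspace_polys_upto)
  show "px \<in> polys_upto k" "py \<in> polys_upto k" using k by (auto simp: polys_upto_def)
  fix f A b assume f: "f \<in> polys_upto k"
  have fz: "pcoeff f i j = 0" if "k < i + j" for i j using f that by (simp add: polys_upto_def)
  show "php n f \<in> polys_upto k" for n using f by (auto simp: polys_upto_def)
  have "degb k (lie_act A b f)"
    unfolding degb_def lie_act_def pcoeff_nc lin_def by (auto simp: distrib_right fz)
  then show "lie_act A b f \<in> polys_upto k" by (simp add: polys_upto_def degb_def lie_act_def pcoeff_nc)
  have l: "degb 1 (lin C d r)" for C d r by (auto simp: degb_def pcoeff_lin)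
  have "degb k f" using f by (simp add: degb_def polys_upto_def)
  then have "degb k (psub (lin C d 1) (lin C d 2) f)" for C d by (rule degb_psub[OF _ l l])
  then show "aff_act (A, b) f \<in> polys_upto k"
    by (auto simp: aff_act_psub[OF fpoly_polys_upto[OF f]] polys_upto_def degb_def pcoeff_nc split: prod.split)
qed (assumption | rule subset_refl)+

lemma star_grp_tri:
  assumes L: "lin_group l X" and "subspace l" "\<exists>\<alpha>. rot_mat \<alpha> \<in> l" and l: "l \<subseteq> l_conf" and X: "X \<subseteq> X_conf"
    and S: "tri_index S" and ne: "tri_space S \<noteq> {0}"
  shows "\<exists>N. star_grp l (tri_space S) N X"
proof -
  obtain N where N: "\<And>a b. (a, b) \<in> S \<Longrightarrow> a + b \<le> N"
  proof -
    have "finite ((\<lambda>p. fst p + snd p) ` S)" using tri_indexD(1)[OF S] by simp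
    then obtain N where "\<forall>n\<in>(\<lambda>p. fst p + snd p) ` S. n \<le> N" using finite_nat_set_iff_bounded_le by blast
    then have "a + b \<le> N" if "(a, b) \<in> S" for a b using that by force
    then show ?thesis by (rule that)
  qed
  have "S \<noteq> {}"
  proof
    assume "S = {}"
    then have "tri_space S = {f. complexify f = complexify 0}" unfolding tri_space_def zset_def by (simp del: complexify_simps(4)) (simp only: complexify_simps(4))
    then have "tri_space S = {0}" unfolding complexify_inject by blast
    then show False using ne by blast
  qed
  then obtain a b where ab: "(a, b) \<in> S" by fastforce
  then have "(a, b) \<noteq> (0, 0)" using tri_indexD(2)[OF S] by metis
  \<comment> \<open>A nonempty order ideal contains one of the minimal pairs, and by symmetry both.
    Hence z and its conjugate, and with them x and y, belong to the module.\<close>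
  then have "(1, 0) \<in> S \<or> (0, 1) \<in> S" using tri_indexD(4)[OF S ab, of 1 0] tri_indexD(4)[OF S ab, of 0 1] by auto
  then have p: "(1, 0) \<in> S" "(0, 1) \<in> S" using tri_indexD(3)[OF S] by blast+
  have "star_grp l (tri_space S) N X"
  proof (rule star_grpI[OF assms(1,2) _ assms(3)])
    \<comment> \<open>Conformal matrices commute, being multiplications by complex numbers.\<close>
    show "A ** B - B ** A \<in> l" if AB: "A \<in> l" "B \<in> l" for A B
    proof -
      obtain x y u v where "A = rotm x y" "B = rotm u v" using AB l unfolding l_conf_def by blast
      then have "A ** B - B ** A = 0" by (simp add: rotm_mult mult.commute add.commute)
      then show ?thesis using lin_group.l0[OF L] by simp
    qed
    show "tri_space S \<subseteq> polys_upto N" by (rule tri_deg[OF S N])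
    fix f A b assume f: "f \<in> tri_space S"
    show "lie_act A b f \<in> tri_space S" if A: "A \<in> l"
    proof -
      obtain x y where "A = rotm x y" using A l unfolding l_conf_def by blast
      then show ?thesis using tri_lie[OF S f] by simp
    qed
    have "fpoly f" using f tri_deg[OF S N] fpoly_polys_upto by blast
    then show "aff_act (A, b) f \<in> tri_space S" if "A \<in> X" using tri_act[OF S f] that X by blast
  qed (use subspace_tri tri_p[OF p] tri_php in blast)+
  then show ?thesis by blast
qed

lemma rot_mat_mem: "rot_mat 0 \<in> l_sl2" "rot_mat \<alpha> \<in> l_conf" "rot_mat \<alpha> \<in> l_euc \<alpha>"
  by (simp add: l_sl2_def, force simp: l_conf_def rot_mat_rotm, auto simp: l_euc_def intro: exI[of _ 1])

lemma rot_mat_ex: "\<exists>\<alpha>. rot_mat \<alpha> \<in> l_sl2" "\<exists>\<alpha>. rot_mat \<alpha> \<in> UNIV" "\<exists>\<alpha>. rot_mat \<alpha> \<in> l_conf" "\<exists>\<beta>. rot_mat \<beta> \<in> l_euc \<alpha>"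
  using rot_mat_mem by blast+

lemma l_euc_conf: "l_euc \<alpha> \<subseteq> l_conf"
  by (auto simp: l_euc_def l_conf_def rot_mat_rotm rotm_scaleR)

lemma star_pair_grp:
  assumes "star_pair gt \<xi>"
  obtains l X N where "lin_group l X" "star_grp l \<xi> N X" "gt = aff_alg l"
proof -
  from assms consider (ab) "gt \<in> {aff_sl2, aff_gl2}" "\<exists>k\<ge>1. \<xi> = polys_upto k"
    | (c) "gt = conf" "triangle_sum \<xi>" "\<xi> \<noteq> {0}" | (d') "\<exists>\<alpha>\<ge>0. gt = euc \<alpha>" "triangle_sum \<xi>" "\<xi> \<noteq> {0}"
    unfolding star_pair_def by (elim disjE conjE)
  then show thesis
  proof cases
    case ab
    from ab(2) obtain k where k: "k \<ge> 1" "\<xi> = polys_upto k" by blast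
    have br: "A ** B - B ** A \<in> l_sl2" for A B :: "real^2^2" by (simp add: l_sl2_def mult_nth algebra_simps)
    have 1: "star_grp l_sl2 \<xi> k X_sl2" unfolding k(2)
      by (rule star_grp_polys[OF sl2.lin_group_axioms subspace_l_sl2 br rot_mat_ex(1) k(1)])
    have 2: "star_grp UNIV \<xi> k X_gl2" unfolding k(2)
      by (rule star_grp_polys[OF gl2.lin_group_axioms subspace_UNIV UNIV_I rot_mat_ex(2) k(1)])
    show ?thesis
    proof (cases "gt = aff_sl2")
      case True
      show ?thesis by (rule that[OF sl2.lin_group_axioms 1]) (simp add: True aff_sl2_alg)
    next
      case False
      show ?thesis by (rule that[OF gl2.lin_group_axioms 2]) (use False ab(1) in \<open>simp add: aff_gl2_alg\<close>)
    qed
  next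
    case c
    from c(2) obtain S where S: "tri_index S" "\<xi> = tri_space S" unfolding triangle_sum_iff by blast
    from star_grp_tri[OF cf.lin_group_axioms subspace_l_conf rot_mat_ex(3) subset_refl subset_refl S(1) c(3)[unfolded S(2)]]
    obtain N where "star_grp l_conf \<xi> N X_conf" unfolding S(2) by (rule exE)
    then show ?thesis using c(1) conf_alg by (intro that[OF cf.lin_group_axioms]) simp_all
  next
    case d'
    from d'(1) obtain \<alpha> where al: "gt = euc \<alpha>" by blast
    from d'(2) obtain S where S: "tri_index S" "\<xi> = tri_space S" unfolding triangle_sum_iff by blast
    from star_grp_tri[OF lin_group_euc subspace_l_euc rot_mat_ex(4) l_euc_conf X_euc_conf S(1) d'(3)[unfolded S(2)]]
    obtain N where "star_grp (l_euc \<alpha>) \<xi> N (X_euc \<alpha>)" unfolding S(2) by (rule exE)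
    then show ?thesis using al euc_alg by (intro that[OF lin_group_euc]) simp_all
  qed
qed

lemma star_pair_properties:
  assumes "star_pair gt \<xi>"
  shows "let g = star_algebra gt \<xi>; kt = stability gt;
           Gt = integral_subgroup gt; Kt = integral_subgroup kt;
           G = semidirect Gt \<xi>; K = Kt \<times> (\<xi> \<inter> order_ge2);
           M = lcosets\<^bsub>G\<^esub> K; A = coset_functions \<xi> G K
       in
         lie_subalgebra g \<and> g \<subseteq> p1_inf \<and> finite_dim g \<and>
         transitive g \<and> transversally_primitive g \<and>
         stability g = kt \<oplus>\<^sub>s emb ` (\<xi> \<inter> order_ge2) \<and>
         isotropy g = kt \<oplus>\<^sub>s emb ` (\<xi> \<inter> span {px^2, px * py, py^2}) \<and>
         connected_lie_group Gt gt \<and> connected_lie_group Kt kt \<and>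
         Gt = {(B, b). (B, 0) \<in> Kt} \<and>
         group G \<and> subgroup K G \<and> closedin (group_topology \<xi> G) K \<and>
         smooth_4_manifold (coset_topology \<xi> G K) (coset_smooth \<xi> G K) \<and>
         smooth_action \<xi> G K \<and>
         (\<exists>\<omega>. induced_form \<xi> G K \<omega>) \<and>
         (\<forall>\<omega>. induced_form \<xi> G K \<omega> \<longrightarrow> symplectic_form M A \<omega>) \<and>
         (2 < max_degree \<xi> \<longrightarrow>
            \<not> reductive g \<and>
            (\<forall>\<omega>. induced_form \<xi> G K \<omega> \<longrightarrow> \<not> homogeneous_fedosov \<xi> G K \<omega>))"
proof -
  obtain l X N where lX: "lin_group l X" "star_grp l \<xi> N X" and gt: "gt = aff_alg l"
    using star_pair_grp[OF assms] .
  interpret L: lin_group l X by fact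
  interpret S: star_grp l \<xi> N X by fact
  have Gt: "integral_subgroup gt = S.Gt" and Kt: "integral_subgroup (stability gt) = S.Kt"
    unfolding gt L.integral_aff L.integral_stab S.Gt_def S.Kt_def by auto
  have G: "semidirect S.Gt \<xi> = S.G" and K: "S.Kt \<times> (\<xi> \<inter> order_ge2) = S.K"
    by (simp_all add: S.G_def S.K_def)
  have A: "coset_functions \<xi> S.G S.K = S.A" by (simp add: S.A_def)
  have "S.Gt = {(B, b). (B, 0) \<in> S.Kt}" by (auto simp: S.Gt_def S.Kt_def)
  then show ?thesis
    unfolding Let_def Gt Kt G K A
    using S.lie_subalgebra_gg S.gg_p1_inf S.finite_dim_gg S.transitive_gg S.transversally_primitive_gg
      S.stability_gg S.isotropy_gg L.connected_lie_group_aff L.connected_lie_group_stab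
      S.group_G S.subgroup_K S.closed_K S.manifold S.smooth_action S.induced_om S.induced_symplectic
      S.not_reductive S.not_fedosov
    unfolding gt[symmetric] Gt Kt by blast
qed

section \<open>Changes of coordinates\<close>

definition ordb :: "nat \<Rightarrow> 'a::comm_ring_1 fps fps \<Rightarrow> bool" where
  "ordb k F \<longleftrightarrow> (\<forall>i j. i + j < k \<longrightarrow> pcoeff F i j = 0)"

lemma ordb_mult: "ordb m F \<Longrightarrow> ordb n G \<Longrightarrow> ordb (m + n) (F * G)"
  unfolding ordb_def pcoeff_mult
proof (intro allI impI sum.neutral ballI)
  fix i j a b
  assume F: "\<forall>i j. i + j < m \<longrightarrow> pcoeff F i j = 0" and G: "\<forall>i j. i + j < n \<longrightarrow> pcoeff G i j = 0"
    and ij: "i + j < m + n" and a: "a \<in> {..i}" and b: "b \<in> {..j}"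
  show "pcoeff F a b * pcoeff G (i - a) (j - b) = 0"
  proof (cases "a + b < m")
    case False
    then have "(i - a) + (j - b) < n" using ij a b by auto
    then show ?thesis using G by simp
  qed (use F in simp)
qed

lemma ordb_power: "ordb 1 F \<Longrightarrow> ordb n (F ^ n)"
proof (induct n)
  case (Suc n)
  then show ?case using ordb_mult[of 1 F n "F ^ n"] by simp
qed (simp add: ordb_def)

locale substitution =
  fixes u w :: plane
  assumes u0: "pcoeff u 0 0 = 0" and w0: "pcoeff w 0 0 = 0"
begin

abbreviation "sub F \<equiv> subst2 F u w"

text \<open>Since u and w have no constant term, the product of their powers has order at least i +
  j. The sum thus extends over a range that does not depend on F, which makes substitution linear on
  all series.\<close>

lemma sub_coeff: "pcoeff (sub F) m n = (\<Sum>p\<in>{..m+n}\<times>{..m+n}. pcoeff F (fst p) (snd p) * pcoeff (u ^ fst p * w ^ snd p) m n)"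
proof -
  have o: "ordb (i + j) (u ^ i * w ^ j)" for i j
    using ordb_power[of u] ordb_power[of w] u0 w0 by (intro ordb_mult) (simp_all add: ordb_def)
  have "pcoeff (sub F) m n = (\<Sum>p\<in>{(i, j). pcoeff F i j \<noteq> 0 \<and> pcoeff (u ^ i * w ^ j) m n \<noteq> 0}. pcoeff F (fst p) (snd p) * pcoeff (u ^ fst p * w ^ snd p) m n)"
    by (simp add: subst2_def pcoeff_def[of "Abs_fps _"] split_beta)
  also have "\<dots> = (\<Sum>p\<in>{..m+n}\<times>{..m+n}. pcoeff F (fst p) (snd p) * pcoeff (u ^ fst p * w ^ snd p) m n)"
  proof (rule sum.mono_neutral_left)
    show "{(i, j). pcoeff F i j \<noteq> 0 \<and> pcoeff (u ^ i * w ^ j) m n \<noteq> 0} \<subseteq> {..m+n}\<times>{..m+n}"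
    proof
      fix p assume "p \<in> {(i, j). pcoeff F i j \<noteq> 0 \<and> pcoeff (u ^ i * w ^ j) m n \<noteq> 0}"
      then have "fst p + snd p \<le> m + n" using o[of "fst p" "snd p"] unfolding ordb_def by (auto simp: not_less[symmetric])
      then show "p \<in> {..m+n}\<times>{..m+n}" by (cases p) auto
    qed
  qed auto
  finally show ?thesis .
qed

lemma sub_add: "sub (F + G) = sub F + sub G" and sub_diff: "sub (F - G) = sub F - sub G"
  and sub_scaleR: "sub (r *\<^sub>R F) = r *\<^sub>R sub F" and sub_zero [simp]: "sub 0 = 0"
  by (rule pcoeff_eqI; simp add: sub_coeff distrib_right left_diff_distrib sum.distrib sum_subtractf sum_distrib_left mult.assoc)+

lemma sub_00 [simp]: "pcoeff (sub F) 0 0 = pcoeff F 0 0"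
  by (simp add: sub_coeff)

lemma sub_one [simp]: "sub 1 = 1"
proof (rule pcoeff_eqI)
  fix m n
  have "pcoeff (sub 1) m n = (\<Sum>p\<in>{..m+n}\<times>{..m+n}. if p = (0, 0) then pcoeff 1 m n else 0)"
    unfolding sub_coeff by (rule sum.cong) auto
  then show "pcoeff (sub 1) m n = pcoeff 1 m n" by simp
qed

lemma sub_nc: "sub (nc F) = nc (sub F)"
  by (simp add: nc_def sub_diff sub_scaleR)

lemma sub_linear_part:
  assumes "pcoeff F 0 0 = 0" "m + n = 1"
  shows "pcoeff (sub F) m n = pcoeff F 1 0 * pcoeff u m n + pcoeff F 0 1 * pcoeff w m n"
proof -
  have "{..1::nat} \<times> {..1::nat} = {(0, 0), (1, 0), (0, 1), (1, 1)}" by (auto simp: le_Suc_eq)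
  moreover have "pcoeff (u * w) m n = 0" using ordb_mult[of 1 u 1 w] u0 w0 assms(2) by (simp add: ordb_def)
  ultimately show ?thesis unfolding sub_coeff assms(2) using assms(1) by simp
qed

end

text \<open>\<open>transport\<close> is defined by conjugating the action on functions, so the
  bracket has to be seen as the commutator of these actions.\<close>

lemma field_act_pb: "field_act (pb (fld a b f) (fld a' b' f')) F =
   field_act (fld a b f) (field_act (fld a' b' f') F) - field_act (fld a' b' f') (field_act (fld a b f) F)"
  unfolding pb_fld field_act_fld by (simp add: dx_mult dy_mult dxdy algebra_simps)

locale transported = substitution +
  fixes g g' :: "ham set"
  assumes g: "lie_subalgebra g" "g \<subseteq> p1_inf" "finite_dim g" "transitive g" "splitting g"
    and det: "pcoeff u 1 0 * pcoeff w 0 1 - pcoeff u 0 1 * pcoeff w 1 0 \<noteq> 0"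
    and g'_def: "g' = transport (u, w) g"
begin

definition rel :: "ham \<Rightarrow> ham \<Rightarrow> bool" where
  "rel H' H \<longleftrightarrow> qcoeff H' 0 0 = sub (qcoeff H 0 0) \<and> (\<forall>F. field_act H' (sub F) = sub (field_act H F))"

lemma g'_iff: "H' \<in> g' \<longleftrightarrow> H' \<in> p1_inf \<and> (\<exists>H\<in>g. rel H' H)"
  by (simp add: g'_def transport_def rel_def)

lemma rel_fld: "rel (fld a' b' f') (fld a b f) \<longleftrightarrow> f' = sub f \<and> (\<forall>F. a' * dx (sub F) + b' * dy (sub F) = sub (a * dx F + b * dy F))"
  by (simp add: rel_def)

lemma p1E: assumes "H \<in> p1_inf" obtains a b f where "H = fld a b f" "pcoeff f 0 0 = 0"
  using assms by (auto simp: p1_inf_fld)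

lemma gE: assumes "H \<in> g" obtains a b f where "H = fld a b f" "pcoeff f 0 0 = 0"
  using assms g(2) p1E by blast

lemma g'E: assumes "H' \<in> g'"
  obtains a' b' f' a b f where "H' = fld a' b' f'" "pcoeff f' 0 0 = 0" "fld a b f \<in> g" "rel (fld a' b' f') (fld a b f)" "pcoeff f 0 0 = 0"
proof -
  obtain H where H: "H' \<in> p1_inf" "H \<in> g" "rel H' H" using assms g'_iff by blast
  obtain a' b' f' where "H' = fld a' b' f'" "pcoeff f' 0 0 = 0" using H(1) by (rule p1E)
  moreover obtain a b f where "H = fld a b f" "pcoeff f 0 0 = 0" using H(2) by (rule gE)
  ultimately show ?thesis using that H by blast
qed

lemma g'I: "pcoeff f' 0 0 = 0 \<Longrightarrow> H \<in> g \<Longrightarrow> rel (fld a' b' f') H \<Longrightarrow> fld a' b' f' \<in> g'"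
  by (auto simp: g'_iff p1_inf_fld)

lemma subspace_g': "subspace g'"
proof (rule subspaceI)
  have sg: "subspace g" using g(1) by (simp add: lie_subalgebra_def)
  show "0 \<in> g'" unfolding fld_zero by (rule g'I[of _ 0]) (use subspace_0[OF sg] in \<open>simp_all add: rel_fld fld_zero\<close>)
  fix x y c assume "x \<in> g'" "y \<in> g'"
  then obtain a' b' f' a b f c' d' h' e d h where
    x: "x = fld a' b' f'" "pcoeff f' 0 0 = 0" "fld a b f \<in> g" "rel (fld a' b' f') (fld a b f)" and
    y: "y = fld c' d' h'" "pcoeff h' 0 0 = 0" "fld e d h \<in> g" "rel (fld c' d' h') (fld e d h)"
    by (metis g'E)
  show "x + y \<in> g'" unfolding x(1) y(1) fld_add
  proof (rule g'I)
    show "fld a b f + fld e d h \<in> g" by (rule subspace_add[OF sg x(3) y(3)])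
    have e: "a' * dx (sub F) + b' * dy (sub F) = sub (a * dx F + b * dy F)"
      "c' * dx (sub F) + d' * dy (sub F) = sub (e * dx F + d * dy F)" for F
      using x(4) y(4) unfolding rel_fld by blast+
    have "(a' + c') * dx (sub F) + (b' + d') * dy (sub F) = sub ((a + e) * dx F + (b + d) * dy F)" for F
    proof -
      have "(a' + c') * dx (sub F) + (b' + d') * dy (sub F) =
          (a' * dx (sub F) + b' * dy (sub F)) + (c' * dx (sub F) + d' * dy (sub F))" by (simp add: distrib_right)
      also have "\<dots> = sub ((a * dx F + b * dy F) + (e * dx F + d * dy F))" unfolding e sub_add ..
      also have "(a * dx F + b * dy F) + (e * dx F + d * dy F) = (a + e) * dx F + (b + d) * dy F" by (simp add: distrib_right)
      finally show ?thesis .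
    qed
    then show "rel (fld (a' + c') (b' + d') (f' + h')) (fld a b f + fld e d h)"
      using x(4) y(4) unfolding fld_add rel_fld by (simp add: sub_add)
  qed (use x y in simp)
  show "c *\<^sub>R x \<in> g'" unfolding x(1) fld_scaleR
  proof (rule g'I)
    show "c *\<^sub>R fld a b f \<in> g" by (rule subspace_scale[OF sg x(3)])
    show "rel (fld (c *\<^sub>R a') (c *\<^sub>R b') (c *\<^sub>R f')) (c *\<^sub>R fld a b f)"
      using x(4) unfolding fld_scaleR rel_fld by (simp add: sub_scaleR flip: scaleR_add_right)
  qed (use x in simp)
qed

lemma pb_g': assumes "x \<in> g'" "y \<in> g'" shows "pb x y \<in> g'"
proof -
  from assms obtain a' b' f' a b f c' d' h' e d h where
    x: "x = fld a' b' f'" "pcoeff f' 0 0 = 0" "fld a b f \<in> g" "rel (fld a' b' f') (fld a b f)" and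
    y: "y = fld c' d' h'" "pcoeff h' 0 0 = 0" "fld e d h \<in> g" "rel (fld c' d' h') (fld e d h)"
    by (metis g'E)
  have r: "f' = sub f" "h' = sub h" "\<And>F. field_act x (sub F) = sub (field_act (fld a b f) F)" "\<And>F. field_act y (sub F) = sub (field_act (fld e d h) F)"
    using x(4) y(4) unfolding x(1) y(1) rel_fld field_act_fld by blast+
  have "rel (pb x y) (pb (fld a b f) (fld e d h))"
    unfolding rel_def
  proof (intro conjI allI)
    show "qcoeff (pb x y) 0 0 = sub (qcoeff (pb (fld a b f) (fld e d h)) 0 0)"
      using r(3)[of h] r(4)[of f] unfolding x(1) y(1) pb_fld qcoeff_fld' field_act_fld r(1,2)
      by (simp add: sub_nc sub_diff)
    show "field_act (pb x y) (sub F) = sub (field_act (pb (fld a b f) (fld e d h)) F)" for F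
    proof -
      have "field_act (pb x y) (sub F) = field_act x (field_act y (sub F)) - field_act y (field_act x (sub F))"
        unfolding x(1) y(1) field_act_pb ..
      then show ?thesis unfolding r(3,4) field_act_pb sub_diff .
    qed
  qed
  moreover have "pb (fld a b f) (fld e d h) \<in> g" using g(1) x(3) y(3) by (simp add: lie_subalgebra_def)
  moreover have "pb x y \<in> p1_inf" unfolding x(1) y(1) pb_fld p1_inf_fld by (auto simp: pcoeff_nc)
  ultimately show ?thesis unfolding g'_iff by blast
qed

lemma split_g: assumes "fld a b f \<in> g" shows "fld a b 0 \<in> g" "fld 0 0 f \<in> g"
proof -
  have "fld a b f \<in> (g \<inter> Der) \<oplus>\<^sub>s (g \<inter> abelian_ideal)" using assms g(5) unfolding splitting_def by blast
  then obtain x y where xy: "x \<in> g" "x \<in> Der" "y \<in> g" "y \<in> abelian_ideal" "fld a b f = x + y" unfolding mem_set_sum by blast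
  obtain c d where x: "x = fld c d 0" using xy(2) by (auto simp: Der_fld)
  obtain h where y: "y = fld 0 0 h" using xy(4) by (auto simp: abelian_ideal_fld)
  have "c = a" "d = b" "h = f" using xy(5) by (simp_all add: x y fld_add)
  then show "fld a b 0 \<in> g" "fld 0 0 f \<in> g" using xy(1,3) x y by auto
qed

lemma split_g': assumes "fld a' b' f' \<in> g'" shows "fld a' b' 0 \<in> g'" "fld 0 0 f' \<in> g'"
proof -
  obtain a b f where r: "pcoeff f' 0 0 = 0" "fld a b f \<in> g" "rel (fld a' b' f') (fld a b f)"
    using assms by (elim g'E) simp
  show "fld a' b' 0 \<in> g'" by (rule g'I[OF _ split_g(1)[OF r(2)]]) (use r(3) in \<open>simp_all add: rel_fld\<close>)
  show "fld 0 0 f' \<in> g'" by (rule g'I[OF r(1) split_g(2)[OF r(2)]]) (use r(3) in \<open>simp add: rel_fld\<close>)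
qed

abbreviation "\<xi> \<equiv> func_part g'"

lemma xi_iff: "f \<in> \<xi> \<longleftrightarrow> fld 0 0 f \<in> g'"
  by (auto simp: func_part_fld g'_iff p1_inf_fld)

lemma xi_zero: "f \<in> \<xi> \<Longrightarrow> pcoeff f 0 0 = 0" by (simp add: func_part_fld)

lemma subspace_xi: "subspace \<xi>"
proof (rule subspaceI)
  show "0 \<in> \<xi>" using subspace_0[OF subspace_g'] by (simp add: xi_iff fld_zero)
  show "x + y \<in> \<xi>" if "x \<in> \<xi>" "y \<in> \<xi>" for x y using subspace_add[OF subspace_g', of "fld 0 0 x" "fld 0 0 y"] that by (simp add: xi_iff fld_add)
  show "c *\<^sub>R x \<in> \<xi>" if "x \<in> \<xi>" for c x using subspace_scale[OF subspace_g', of "fld 0 0 x" c] that by (simp add: xi_iff fld_scaleR)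
qed

lemma g'_star: "g' = star_algebra (g' \<inter> Der) \<xi>"
proof
  show "g' \<subseteq> star_algebra (g' \<inter> Der) \<xi>"
  proof
    fix x assume x: "x \<in> g'"
    then obtain a b f where e: "x = fld a b f" by (elim g'E)
    have "fld a b 0 \<in> g' \<inter> Der" "f \<in> \<xi>" using split_g'[of a b f] x e by (auto simp: Der_fld xi_iff)
    then show "x \<in> star_algebra (g' \<inter> Der) \<xi>" unfolding star_algebra_def e by (rule set_sum_embI)
  qed
  show "star_algebra (g' \<inter> Der) \<xi> \<subseteq> g'"
    using subspace_add[OF subspace_g'] unfolding star_algebra_def by (auto simp: mem_set_sum emb_fld xi_iff)
qed

lemma xi_finite: "\<exists>B. finite B \<and> \<xi> \<subseteq> span B"
proof -
  obtain B where B: "finite B" "g \<subseteq> span B" using g(3) unfolding finite_dim_def by blast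
  have lin: "linear (\<lambda>H. sub (qcoeff H 0 0))"
    by (rule linearI) (simp_all add: qcoeff_def sub_add[symmetric] sub_scaleR[symmetric])
  have "\<xi> \<subseteq> (\<lambda>H. sub (qcoeff H 0 0)) ` span B"
  proof
    fix f assume "f \<in> \<xi>"
    then obtain H where "H \<in> g" "rel (fld 0 0 f) H" unfolding xi_iff g'_iff by blast
    then show "f \<in> (\<lambda>H. sub (qcoeff H 0 0)) ` span B" using B(2) by (intro image_eqI[of _ _ H]) (auto simp: rel_def)
  qed
  then have "\<xi> \<subseteq> span ((\<lambda>H. sub (qcoeff H 0 0)) ` B)" using linear_span_image[OF lin] by metis
  then show ?thesis using B(1) by blast
qed

text \<open>Transitivity provides an element of g with linear part p_1 and splitting isolates its
  function; the linear part survives substitution because the Jacobian of the coordinate change is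
  invertible.\<close>

lemma xi_nonzero: "\<exists>f\<in>\<xi>. f \<noteq> 0"
proof -
  have "hp1 \<in> hom_part 1 ` g" using g(4) unfolding transitive_def by (simp add: span_base)
  then obtain H where H: "H \<in> g" "hp1 = hom_part 1 H" by blast
  obtain a b f where e: "H = fld a b f" "pcoeff f 0 0 = 0" using H(1) by (rule gE)
  have "px = pcoeff f 1 0 *\<^sub>R px + pcoeff f 0 1 *\<^sub>R py" using H(2) by (simp add: e hp1_fld hom_part_fld php1[simplified])
  from arg_cong[OF this, of "\<lambda>f. pcoeff f 1 0"] arg_cong[OF this, of "\<lambda>f. pcoeff f 0 1"]
  have f: "pcoeff f 1 0 = 1" "pcoeff f 0 1 = 0" by simp_all
  have "fld 0 0 f \<in> g" using split_g(2) H(1) e(1) by blast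
  then have "fld 0 0 (sub f) \<in> g'" by (intro g'I[of _ "fld 0 0 f"]) (use e in \<open>simp_all add: rel_fld\<close>)
  moreover have "sub f \<noteq> 0"
  proof
    assume "sub f = 0"
    then have "pcoeff u 1 0 = 0" "pcoeff u 0 1 = 0"
      using sub_linear_part[OF e(2), of 1 0] sub_linear_part[OF e(2), of 0 1] f by simp_all
    then show False using det by simp
  qed
  ultimately show ?thesis by (auto simp: xi_iff)
qed

lemma xi_act:
  assumes "fld a b 0 \<in> g'" "f \<in> \<xi>" shows "nc (a * dx f + b * dy f) \<in> \<xi>"
  using pb_g'[OF assms(1), of "fld 0 0 f"] assms(2) unfolding xi_iff pb_fld by simp

end

lemma finite_poly_space_bounded:
  assumes S: "subspace V" and B: "finite B" "V \<subseteq> span B" and p: "\<And>f. f \<in> V \<Longrightarrow> fpoly f \<and> pcoeff f 0 0 = 0"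
  shows "\<exists>N. V \<subseteq> polys_upto N"
proof -
  obtain B0 where B0: "B0 \<subseteq> V" "independent B0" "V \<subseteq> span B0" using maximal_independent_subset[of V] by blast
  have fB0: "finite B0" using independent_span_bound[OF B(1) B0(2)] B0(1) B(2) by blast
  have "\<exists>N. \<forall>f\<in>B0. f \<in> polys_upto N"
    using fB0 B0(1)
  proof (induct B0)
    case (insert x F)
    then obtain N where N: "\<forall>f\<in>F. f \<in> polys_upto N" by blast
    obtain m where m: "\<forall>i j. m < i + j \<longrightarrow> pcoeff x i j = 0" using p[of x] insert unfolding fpoly_bound by blast
    have "x \<in> polys_upto (max m N)" using m p[of x] insert by (simp add: polys_upto_def)
    moreover have "\<forall>f\<in>F. f \<in> polys_upto (max m N)" using N by (simp add: polys_upto_def)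
    ultimately show ?case by blast
  qed simp
  then obtain N where "B0 \<subseteq> polys_upto N" by blast
  then have "span B0 \<subseteq> polys_upto N" by (rule span_minimal[OF _ subspace_polys_upto])
  then show ?thesis using B0(3) by blast
qed

section \<open>Invariant spaces of polynomials\<close>

text \<open>Applying T minus one eigenvalue removes that component from the sum and multiplies every
  other one by a nonzero scalar, which reduces the claim to fewer components.\<close>

lemma (in vector_space) eigen_components:
  assumes V: "subspace V" and T: "\<And>x. x \<in> V \<Longrightarrow> T x \<in> V" and Tadd: "\<And>x y. T (x + y) = T x + T y"
    and Tscale: "\<And>c x. T (scale c x) = scale c (T x)" and "finite Q"
  shows "inj_on \<mu> Q \<Longrightarrow> (\<And>q. q \<in> Q \<Longrightarrow> T (y q) = scale (\<mu> q) (y q)) \<Longrightarrow> (\<Sum>q\<in>Q. y q) \<in> V \<Longrightarrow> q \<in> Q \<Longrightarrow> y q \<in> V"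
  using \<open>finite Q\<close>
proof (induct Q arbitrary: y q)
  case (insert q0 Q)
  have T0: "T 0 = 0" using Tadd[of 0 0] by simp
  have Ts: "T (\<Sum>q\<in>Q. z q) = (\<Sum>q\<in>Q. T (z q))" for z
    by (induct Q rule: infinite_finite_induct) (simp_all add: T0 Tadd)
  let ?s = "\<Sum>q\<in>insert q0 Q. y q"
  define z where "z q = scale (\<mu> q - \<mu> q0) (y q)" for q
  have "T ?s - scale (\<mu> q0) ?s \<in> V" using insert.prems(3) by (intro subspace_diff[OF V] T subspace_scale[OF V])
  moreover have "T ?s - scale (\<mu> q0) ?s = (\<Sum>q\<in>Q. z q)"
  proof -
    have "T ?s = scale (\<mu> q0) (y q0) + (\<Sum>q\<in>Q. scale (\<mu> q) (y q))"
      using insert by (simp add: Tadd Ts)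
    then show ?thesis using insert.hyps
      by (simp add: z_def scale_left_diff_distrib scale_right_distrib scale_sum_right sum_subtractf)
  qed
  ultimately have s: "(\<Sum>q\<in>Q. z q) \<in> V" by simp
  have inj: "inj_on \<mu> Q" and ne: "\<And>q. q \<in> Q \<Longrightarrow> \<mu> q - \<mu> q0 \<noteq> 0"
    using insert.prems(1) insert.hyps(2) by (auto simp: inj_on_def)
  have "T (z q) = scale (\<mu> q) (z q)" if "q \<in> Q" for q
    using insert.prems(2)[of q] that by (simp add: z_def Tscale scale_left_commute)
  then have zV: "z q \<in> V" if "q \<in> Q" for q using insert.hyps(3)[OF inj _ s that] by blast
  have yV: "y q \<in> V" if "q \<in> Q" for q
  proof -
    have "scale (inverse (\<mu> q - \<mu> q0)) (z q) = y q" using ne[OF that] by (simp add: z_def)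
    then show ?thesis using subspace_scale[OF V zV[OF that]] by metis
  qed
  have "y q0 = ?s - (\<Sum>q\<in>Q. y q)" using insert.hyps by simp
  moreover have "(\<Sum>q\<in>Q. y q) \<in> V" using yV by (rule subspace_sum[OF V])
  ultimately have "y q0 \<in> V" using insert.prems(3) by (metis subspace_diff[OF V])
  then show ?case using insert.prems(4) yV by blast
qed simp

lemma max_degree_element:
  assumes "V \<subseteq> polys_upto N" "\<exists>f\<in>V. f \<noteq> 0"
  obtains n f i j where "n \<ge> 1" "V \<subseteq> polys_upto n" "f \<in> V" "i + j = n" "pcoeff f i j \<noteq> 0"
proof -
  define D where "D = {i + j | f i j. f \<in> V \<and> pcoeff f i j \<noteq> 0}"
  have "i + j \<le> N" if "f \<in> V" "pcoeff f i j \<noteq> 0" for f i j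
  proof -
    have "f \<in> polys_upto N" using that(1) assms(1) by blast
    then show ?thesis using that(2) by (force simp: polys_upto_def not_less[symmetric])
  qed
  then have "D \<subseteq> {..N}" by (auto simp: D_def)
  then have fin: "finite D" by (rule finite_subset) simp
  obtain f where f: "f \<in> V" "f \<noteq> 0" using assms(2) by blast
  then obtain i j where "pcoeff f i j \<noteq> 0" using pcoeff_eqI[of f 0] by auto
  then have "D \<noteq> {}" using f by (auto simp: D_def)
  then have "Max D \<in> D" using fin by simp
  then obtain f i j where m: "f \<in> V" "pcoeff f i j \<noteq> 0" "i + j = Max D" by (auto simp: D_def)
  have "V \<subseteq> polys_upto (Max D)"
  proof
    fix h assume h: "h \<in> V"
    have "pcoeff h a b = 0" if "Max D < a + b" for a b
    proof (rule ccontr)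
      assume "pcoeff h a b \<noteq> 0"
      then have "a + b \<in> D" using h by (auto simp: D_def)
      then show False using that Max_ge[OF fin] by fastforce
    qed
    then show "h \<in> polys_upto (Max D)" using h assms(1) by (auto simp: polys_upto_def)
  qed
  moreover have "Max D \<ge> 1"
  proof (rule ccontr)
    assume "\<not> 1 \<le> Max D"
    then have "i = 0" "j = 0" using m(3) by auto
    then show False using m(1,2) assms(1) by (auto simp: polys_upto_def)
  qed
  ultimately show thesis using that m by blast
qed

text \<open>Coefficients of degree at most one do not raise the degree of f, so in degree n + 1 only
  the quadratic part of the field acts, and its result must vanish there.\<close>

lemma quadratic_top:
  assumes f: "f \<in> polys_upto n" and n: "n \<ge> 1" and l: "degb 1 a1" "degb 1 b1"
    and z: "nc ((a2 + a1) * dx f + (b2 + b1) * dy f) \<in> polys_upto n" and ij: "i + j = n + 1"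
  shows "pcoeff (a2 * dx f + b2 * dy f) i j = 0"
proof -
  have "degb (n - 1) (dx f)" "degb (n - 1) (dy f)" using f by (auto simp: degb_def polys_upto_def)
  then have "degb n (a1 * dx f)" "degb n (b1 * dy f)"
    using degb_mult[OF l(1), of "n - 1"] degb_mult[OF l(2), of "n - 1"] n by simp_all
  then have "pcoeff (a1 * dx f + b1 * dy f) i j = 0" using ij by (simp add: degb_def)
  moreover have "pcoeff ((a2 + a1) * dx f + (b2 + b1) * dy f) i j = 0"
  proof -
    have "pcoeff (nc ((a2 + a1) * dx f + (b2 + b1) * dy f)) i j = 0" using z ij unfolding polys_upto_def by simp
    then show ?thesis using ij unfolding pcoeff_nc by (auto split: if_splits)
  qed
  ultimately show ?thesis by (simp add: distrib_right)
qed

text \<open>The coefficient of \<open>px ^ (i + 1) * py ^ j\<close> is i + 2 j times the coefficient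
  of f at (i, j), minus i + 2 times the one at (i + 2, j - 2). The system is triangular in j, with
  nonzero diagonal because n is positive.\<close>

lemma no_quadratic_conformal:
  assumes V: "V \<subseteq> polys_upto n" "n \<ge> 1" and l: "degb 1 a1" "degb 1 b1"
    and act: "\<And>f. f \<in> V \<Longrightarrow> nc ((px * px - py * py + a1) * dx f + (2 *\<^sub>R (px * py) + b1) * dy f) \<in> V"
    and f: "f \<in> V"
  shows "i + j = n \<Longrightarrow> pcoeff f i j = 0"
proof (induct j arbitrary: i rule: less_induct)
  case (less j)
  have p: "f \<in> polys_upto n" "nc ((px * px - py * py + a1) * dx f + (2 *\<^sub>R (px * py) + b1) * dy f) \<in> polys_upto n"
    using f act[OF f] V(1) by blast+
  have e: "(px * px - py * py) * dx f + 2 *\<^sub>R (px * py) * dy f = px * (px * dx f) - py * (py * dx f) + 2 *\<^sub>R (px * (py * dy f))"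
    by (simp add: algebra_simps)
  have "pcoeff ((px * px - py * py) * dx f + 2 *\<^sub>R (px * py) * dy f) (i + 1) j = 0"
    by (rule quadratic_top[OF p(1) V(2) l p(2)]) (use less.prems in simp)
  then have "real i * pcoeff f i j - (if j < 2 then 0 else (real i + 2) * pcoeff f (i + 2) (j - 2)) + 2 * real j * pcoeff f i j = 0"
    unfolding e by (cases i; cases j; cases "j - 1") (auto simp: algebra_simps numeral_2_eq_2 split: if_splits)
  moreover have "pcoeff f (i + 2) (j - 2) = 0" if "\<not> j < 2" using less.hyps[of "j - 2" "i + 2"] that less.prems by simp
  ultimately have "(real i + 2 * real j) * pcoeff f i j = 0" by (simp add: distrib_right split: if_splits)
  then show ?case using less.prems V(2) by auto
qed

text \<open>The quadratic part is x times the Euler field, which multiplies the top-degree part by n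
  x.\<close>

lemma no_quadratic_projective:
  assumes V: "V \<subseteq> polys_upto n" "n \<ge> 1" and l: "degb 1 a1" "degb 1 b1"
    and act: "\<And>f. f \<in> V \<Longrightarrow> nc ((px * px + a1) * dx f + (px * py + b1) * dy f) \<in> V"
    and f: "f \<in> V" and ij: "i + j = n"
  shows "pcoeff f i j = 0"
proof -
  have p: "f \<in> polys_upto n" "nc ((px * px + a1) * dx f + (px * py + b1) * dy f) \<in> polys_upto n"
    using f act[OF f] V(1) by blast+
  have "pcoeff ((px * px) * dx f + (px * py) * dy f) (i + 1) j = 0"
    by (rule quadratic_top[OF p(1) V(2) l p(2)]) (use ij in simp)
  then have "(real i + real j) * pcoeff f i j = 0"
    unfolding mult.assoc by (cases i; cases j) (auto simp: algebra_simps)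
  then show ?thesis using ij V(2) by auto
qed

lemma recenter_fld:
  "fpoly a \<Longrightarrow> fpoly b \<Longrightarrow> recenter c (fld a b f) = fld (psub (px + fst c *\<^sub>R 1) (py + snd c *\<^sub>R 1) a) (psub (px + fst c *\<^sub>R 1) (py + snd c *\<^sub>R 1) b) 0"
  by (simp add: recenter_def Let_def field_fld subst2_psub)

text \<open>Moving the origin of an affine field changes only its constant part, and the constants
  of \<open>aff_alg l\<close> are arbitrary.\<close>

lemma recenter_aff_alg: "recenter c ` aff_alg l = aff_alg l"
proof -
  define d :: "real^2" where "d = vector [fst c, snd c]"
  have uw: "px + fst c *\<^sub>R 1 = lin (mat 1) d 1" "py + snd c *\<^sub>R 1 = lin (mat 1) d 2"
    by (simp_all add: lin_def mat_def d_def)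
  have r: "recenter c (fld (lin A b 1) (lin A b 2) 0) = fld (lin A (A *v d + b) 1) (lin A (A *v d + b) 2) 0" for A b
    by (simp add: recenter_fld uw lin_psub)
  have "fld (lin A b 1) (lin A b 2) 0 \<in> recenter c ` aff_alg l" if "A \<in> l" for A b
    by (rule image_eqI[of _ _ "fld (lin A (b - A *v d) 1) (lin A (b - A *v d) 2) 0"])
       (use that in \<open>auto simp: r aff_alg_fld\<close>)
  moreover have "recenter c x \<in> aff_alg l" if "x \<in> aff_alg l" for x
  proof -
    obtain A b where A: "x = fld (lin A b 1) (lin A b 2) 0" "A \<in> l" using \<open>x \<in> aff_alg l\<close> unfolding aff_alg_fld by blast
    show ?thesis unfolding A(1) r by (rule aff_alg_memI[OF A(2) refl refl])
  qed
  ultimately show ?thesis unfolding aff_alg_fld by blast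
qed

lemma excluded_normal_forms:
  assumes V: "V \<subseteq> polys_upto n" "n \<ge> 1"
    and f: "f \<in> V" "i + j = n" "pcoeff f i j \<noteq> 0"
    and L: "L \<in> {nf_sl2, nf_so3, nf_so31, nf_sl3}"
    and act: "\<And>a b f. fld a b 0 \<in> recenter c ` L \<Longrightarrow> f \<in> V \<Longrightarrow> nc (a * dx f + b * dy f) \<in> V"
  shows False
proof -
  let ?u = "px + fst c *\<^sub>R 1" and ?w = "py + snd c *\<^sub>R 1"
  have sq: "psub ?u ?w (px * px) = px * px + (2 * fst c) *\<^sub>R px + (fst c * fst c) *\<^sub>R 1"
    "psub ?u ?w (py * py) = py * py + (2 * snd c) *\<^sub>R py + (snd c * snd c) *\<^sub>R 1"
    "psub ?u ?w (px * py) = px * py + (snd c *\<^sub>R px + fst c *\<^sub>R py) + (fst c * snd c) *\<^sub>R 1"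
    unfolding ps.evl_mult[OF fpoly_p(1) fpoly_p(1)] ps.evl_mult[OF fpoly_p(2) fpoly_p(2)] ps.evl_mult[OF fpoly_p] psub_px
    by (rule pcoeff_eqI; simp add: distrib_left distrib_right)+
  \<comment> \<open>Each of the four forms contains one of two quadratic fields. The constant e is 1
    for \<open>nf_so3\<close> and 0 for \<open>nf_sl2\<close> and \<open>nf_so31\<close>; the
    projective field belongs to \<open>nf_sl3\<close>.\<close>
  consider (q) e where "fld (px * px - py * py + e *\<^sub>R 1) (2 *\<^sub>R (px * py)) 0 \<in> L" | (p) "fld (px * px) (px * py) 0 \<in> L"
  proof -
    have "emb 2 = 2" by (metis emb_simps(1,5) one_add_one)
    then have g: "(hp1\<^sup>2 - hp2\<^sup>2) * hq1 + 2 * hp1 * hp2 * hq2 = fld (px * px - py * py) (2 *\<^sub>R (px * py)) 0"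
      "(1 + hp1\<^sup>2 - hp2\<^sup>2) * hq1 + 2 * hp1 * hp2 * hq2 = fld (px * px - py * py + 1 *\<^sub>R 1) (2 *\<^sub>R (px * py)) 0"
      "hp1 * euler = fld (px * px) (px * py) 0"
      by (simp_all add: fld_def hp1_def hp2_def euler_def power2_eq_square emb_mult scaleR_2 algebra_simps)
    have "fld (px * px - py * py + 0 *\<^sub>R 1) (2 *\<^sub>R (px * py)) 0 \<in> nf_sl2"
      "fld (px * px - py * py + 1 *\<^sub>R 1) (2 *\<^sub>R (px * py)) 0 \<in> nf_so3"
      "fld (px * px - py * py + 0 *\<^sub>R 1) (2 *\<^sub>R (px * py)) 0 \<in> nf_so31"
      "fld (px * px) (px * py) 0 \<in> nf_sl3"
      unfolding nf_sl2_def nf_so3_def nf_so31_def nf_sl3_def g[symmetric] by (simp_all only: scaleR_zero_left add_0_right g(1)[symmetric]) (blast intro: span_base)+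
    then show thesis using q p L by blast
  qed
  then show False
  proof cases
    case q
    define a1 where "a1 = (2 * fst c) *\<^sub>R px - (2 * snd c) *\<^sub>R py + (fst c * fst c - snd c * snd c + e) *\<^sub>R (1 :: plane)"
    define b1 where "b1 = 2 *\<^sub>R (snd c *\<^sub>R px + fst c *\<^sub>R py) + (2 * fst c * snd c) *\<^sub>R (1 :: plane)"
    have "fld (psub ?u ?w (px * px - py * py + e *\<^sub>R 1)) (psub ?u ?w (2 *\<^sub>R (px * py))) 0 \<in> recenter c ` L"
      by (rule image_eqI[OF _ q]) (simp add: recenter_fld)
    moreover have "psub ?u ?w (px * px - py * py + e *\<^sub>R 1) = px * px - py * py + a1"
      by (simp add: ps.evl_add ps.evl_diff psub_scaleR sq a1_def algebra_simps)
    moreover have "psub ?u ?w (2 *\<^sub>R (px * py)) = 2 *\<^sub>R (px * py) + b1"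
      by (simp add: psub_scaleR sq b1_def algebra_simps)
    ultimately have m: "fld (px * px - py * py + a1) (2 *\<^sub>R (px * py) + b1) 0 \<in> recenter c ` L" by simp
    have "degb 1 a1" "degb 1 b1" by (auto simp: a1_def b1_def degb_def)
    from no_quadratic_conformal[OF V this act[OF m] f(1,2)] show False using f(3) by blast
  next
    case p
    define a1 where "a1 = (2 * fst c) *\<^sub>R px + (fst c * fst c) *\<^sub>R (1 :: plane)"
    define b1 where "b1 = snd c *\<^sub>R px + fst c *\<^sub>R py + (fst c * snd c) *\<^sub>R (1 :: plane)"
    have "fld (psub ?u ?w (px * px)) (psub ?u ?w (px * py)) 0 \<in> recenter c ` L"
      by (rule image_eqI[OF _ p]) (simp add: recenter_fld)
    then have m: "fld (px * px + a1) (px * py + b1) 0 \<in> recenter c ` L" unfolding sq a1_def b1_def by (simp add: add.assoc)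
    have "degb 1 a1" "degb 1 b1" by (auto simp: a1_def b1_def degb_def)
    from no_quadratic_projective[OF V this act[OF m] f(1,2)] show False using f(3) by blast
  qed
qed

lemma sl2_invariant_polys:
  assumes V: "subspace V" "V \<subseteq> polys_upto n"
    and f: "f \<in> V" "i + j = n" "pcoeff f i j \<noteq> 0"
    and act: "\<And>A b f. A \<in> l_sl2 \<Longrightarrow> f \<in> V \<Longrightarrow> lie_act A b f \<in> V"
  shows "V = polys_upto n"
proof -
  have t: "nc (px * dy h) \<in> V" "nc (py * dx h) \<in> V" "nc (px * dx h - py * dy h) \<in> V" "nc (dx h) \<in> V" if "h \<in> V" for h
    using act[of "m2 0 0 1 0" h 0] act[of "m2 0 1 0 0" h 0] act[of "m2 1 0 0 (-1)" h 0] act[of 0 h "vector [1, 0]"] that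
    by (simp_all add: l_sl2_def lie_act_def lin_def)
  have "\<exists>h\<in>V. pcoeff h n 0 \<noteq> 0"
    using f
  proof (induct j arbitrary: i f)
    case (Suc j)
    have "pcoeff (nc (px * dy f)) (Suc i) j \<noteq> 0" using Suc.prems by (simp add: pcoeff_nc)
    then show ?case using Suc.hyps[of "nc (px * dy f)" "Suc i"] t(1)[OF Suc.prems(1)] Suc.prems(2) by simp
  qed auto
  then obtain h where h: "h \<in> V" "pcoeff h n 0 \<noteq> 0" by blast
  have hN: "pcoeff h a b = 0" if "n < a + b" for a b using h(1) V(2) that by (auto simp: polys_upto_def)
  \<comment> \<open>The component of weight q under the diagonal field, which multiplies the
    monomial with exponents a, b by a - b.\<close>
  define y where "y q = Abs_fps (\<lambda>a. Abs_fps (\<lambda>b. if int a - int b = q then pcoeff h a b else 0))" for q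
  have y: "pcoeff (y q) a b = (if int a - int b = q then pcoeff h a b else 0)" for q a b by (simp add: y_def pcoeff_def)
  have "y (int n) \<in> V"
  proof (rule real_vector.eigen_components[where y = y and \<mu> = of_int and Q = "{- int n..int n}", OF V(1) t(3)])
    show "nc (px * dx (y q) - py * dy (y q)) = of_int q *\<^sub>R y q" for q
    proof (rule pcoeff_eqI)
      fix a b
      have "pcoeff (nc (px * dx (y q) - py * dy (y q))) a b = (real a - real b) * pcoeff (y q) a b"
        by (cases a; cases b) (simp_all add: pcoeff_nc algebra_simps)
      also have "\<dots> = pcoeff (of_int q *\<^sub>R y q) a b" by (auto simp: y)
      finally show "pcoeff (nc (px * dx (y q) - py * dy (y q))) a b = pcoeff (of_int q *\<^sub>R y q) a b" .
    qed
    have "(\<Sum>q\<in>{- int n..int n}. y q) = h"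
      by (rule pcoeff_eqI) (use hN in \<open>auto simp: pcoeff_sum y not_less[symmetric]\<close>)
    then show "(\<Sum>q\<in>{- int n..int n}. y q) \<in> V" using h by simp
  qed (auto simp: inj_on_def nc_lin algebra_simps)
  moreover have "y (int n) = pcoeff h n 0 *\<^sub>R mono2 1 n 0"
  proof (rule pcoeff_eqI)
    fix a b
    \<comment> \<open>Weight n with a positive exponent of y would force a degree above n.\<close>
    have "n < a + b" if "int a - int b = int n" "b \<noteq> 0" using that by linarith
    then show "pcoeff (y (int n)) a b = pcoeff (pcoeff h n 0 *\<^sub>R mono2 1 n 0) a b" using hN by (auto simp: y)
  qed
  ultimately have "inverse (pcoeff h n 0) *\<^sub>R (pcoeff h n 0 *\<^sub>R mono2 1 n 0) \<in> V" using subspace_scale[OF V(1)] by metis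
  then have m0: "mono2 1 n 0 \<in> V" using h(2) by simp
  have m1: "mono2 1 a b \<in> V" if "a + b = n" for a b
    using that
  proof (induct b arbitrary: a)
    case (Suc b)
    have "mono2 1 (Suc a) b \<in> V" using Suc by simp
    from t(2)[OF this] have "nc (py * dx (mono2 1 (Suc a) b)) \<in> V" .
    moreover have "nc (py * dx (mono2 1 (Suc a) b)) = real (Suc a) *\<^sub>R mono2 1 a (Suc b)"
      by (rule pcoeff_eqI) (auto simp: pcoeff_nc)
    ultimately have "inverse (real (Suc a)) *\<^sub>R (real (Suc a) *\<^sub>R mono2 1 a (Suc b)) \<in> V" using subspace_scale[OF V(1)] by metis
    then show ?case by simp
  qed (use m0 in simp)
  have m: "mono2 1 a b \<in> V" if "a + b + k = n" "(a, b) \<noteq> (0, 0)" for a b k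
    using that
  proof (induct k arbitrary: a)
    case (Suc k)
    have "mono2 1 (Suc a) b \<in> V" using Suc by simp
    from t(4)[OF this] have "nc (dx (mono2 1 (Suc a) b)) \<in> V" .
    moreover have "nc (dx (mono2 1 (Suc a) b)) = real (Suc a) *\<^sub>R mono2 1 a b"
      by (rule pcoeff_eqI) (use Suc.prems in \<open>auto simp: pcoeff_nc\<close>)
    ultimately have "inverse (real (Suc a)) *\<^sub>R (real (Suc a) *\<^sub>R mono2 1 a b) \<in> V" using subspace_scale[OF V(1)] by metis
    then show ?case by simp
  qed (use m1 in simp)
  have "polys_upto n \<subseteq> V"
  proof
    fix F assume F: "F \<in> polys_upto n"
    then have "finite (psupp F)" using fpoly_polys_upto by (simp add: fpoly_def)
    then have "F = (\<Sum>p\<in>psupp F. mono2 (pcoeff F (fst p) (snd p)) (fst p) (snd p))"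
      using fpoly_expand[of "psupp F" F] by simp
    also have "\<dots> \<in> V"
    proof (rule subspace_sum[OF V(1)])
      fix p assume "p \<in> psupp F"
      then have nz: "pcoeff F (fst p) (snd p) \<noteq> 0" by (auto simp: psupp_def)
      then have "fst p + snd p \<le> n" "(fst p, snd p) \<noteq> (0, 0)" using F by (auto simp: polys_upto_def not_less[symmetric])
      then have "mono2 1 (fst p) (snd p) \<in> V" using m[of "fst p" "snd p" "n - (fst p + snd p)"] by simp
      then have "pcoeff F (fst p) (snd p) *\<^sub>R mono2 1 (fst p) (snd p) \<in> V" by (rule subspace_scale[OF V(1)])
      moreover have "pcoeff F (fst p) (snd p) *\<^sub>R mono2 1 (fst p) (snd p) = mono2 (pcoeff F (fst p) (snd p)) (fst p) (snd p)"
        by (rule pcoeff_eqI) simp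
      ultimately show "mono2 (pcoeff F (fst p) (snd p)) (fst p) (snd p) \<in> V" by simp
    qed
    finally show "F \<in> V" .
  qed
  then show ?thesis using V(2) by blast
qed

section \<open>Modules invariant under translations and a rotation-like field\<close>

lemma span_zset_sum:
  assumes "finite Q" "F \<in> cv.span (zset Q)"
  obtains c where "F = (\<Sum>q\<in>Q. cscale (c q) (zz (fst q) (snd q)))"
proof -
  have "\<exists>c. F = (\<Sum>q\<in>Q. cscale (c q) (zz (fst q) (snd q)))"
    using assms(2)
  proof (induct rule: cv.span_induct_alt)
    case base
    show ?case by (rule exI[of _ "\<lambda>_. 0"]) simp
  next
    case (step k x y)
    obtain c where c: "y = (\<Sum>q\<in>Q. cscale (c q) (zz (fst q) (snd q)))" using step(2) by blast
    obtain p where p: "p \<in> Q" "x = zz (fst p) (snd p)" using step(1) by (auto simp: zset_def)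
    have "(\<Sum>q\<in>Q. cscale ((c(p := c p + k)) q) (zz (fst q) (snd q)))
        = cscale (c p + k) (zz (fst p) (snd p)) + (\<Sum>q\<in>Q - {p}. cscale (c q) (zz (fst q) (snd q)))"
      using assms(1) p(1) by (subst sum.remove[of _ p]) (auto intro!: sum.cong)
    also have "\<dots> = cscale k x + y"
      unfolding c p(2) using assms(1) p(1) by (subst (2) sum.remove[of _ p]) (simp_all add: cv.scale_left_distrib)
    finally show ?case by metis
  qed
  then show ?thesis using that by blast
qed

lemma zset_mono: "S \<subseteq> T \<Longrightarrow> cv.span (zset S) \<subseteq> cv.span (zset T)"
  unfolding zset_def by (intro cv.span_mono image_mono)

lemma linear_mult_zset:
  assumes "F \<in> cv.span (zset {(a, b). a + b = n})"
  shows "(cscale k zvar + cscale l zbar) * F \<in> cv.span (zset {(a, b). a + b = Suc n})"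
proof -
  have "fpoly F \<and> (cscale k zvar + cscale l zbar) * F \<in> cv.span (zset {(a, b). a + b = Suc n})"
    by (rule span_map[OF _ _ _ assms]) (auto simp: zset_def distrib_left distrib_right cscale_mult zvar_zz zbar_zz cv.scale_right_distrib cv.scale_scale mult.commute intro!: cv.span_add cv.span_scale zz_in[unfolded zset_def])
  then show ?thesis ..
qed

lemma mono2_zset: "mono2 1 i j \<in> cv.span (zset {(a, b). a + b = i + j})"
proof (induct i)
  case 0
  show ?case
  proof (induct j)
    case 0
    show ?case using zz_in[of 0 0 "{(a, b). a + b = 0 + 0}"] by (simp add: zz_1 one_mono2[symmetric])
  next
    case (Suc j)
    have e: "fps_const fps_X = cscale (- \<i> / 2) zvar + cscale (\<i> / 2) zbar"
      by (rule pcoeff_eqI; auto simp: zvar_def zbar_def)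
    have "fps_const fps_X * mono2 1 0 j = (mono2 1 0 (Suc j) :: complex fps fps)" unfolding Y_mono2 mono2_mult by simp
    then show ?case using linear_mult_zset[OF Suc, of "- \<i> / 2" "\<i> / 2"] unfolding e[symmetric] by simp
  qed
next
  case (Suc i)
  have e: "fps_X = cscale (1/2) zvar + cscale (1/2) zbar"
    by (rule pcoeff_eqI; auto simp: zvar_def zbar_def)
  have "fps_X * mono2 1 i j = (mono2 1 (Suc i) j :: complex fps fps)" unfolding X_mono2 mono2_mult by simp
  then show ?case using linear_mult_zset[OF Suc, of "1/2" "1/2"] unfolding e[symmetric] by simp
qed

definition tri_all :: "nat \<Rightarrow> (nat \<times> nat) set" where
  "tri_all N = {(a, b). 0 < a + b \<and> a + b \<le> N}"

lemma tri_index_all: "tri_index (tri_all N)"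
proof -
  have "finite (tri_all N)" by (rule finite_subset[of _ "{..N} \<times> {..N}"]) (auto simp: tri_all_def)
  then show ?thesis by (auto simp: tri_index_def tri_all_def)
qed

lemma polys_upto_zset: assumes F: "F \<in> polys_upto N" shows "complexify F \<in> cv.span (zset (tri_all N))"
proof -
  have "finite (psupp F)" using fpoly_polys_upto[OF F] by (simp add: fpoly_def)
  then have "complexify F = (\<Sum>p\<in>psupp F. mono2 (of_real (pcoeff F (fst p) (snd p))) (fst p) (snd p))"
    using fpoly_expand[of "psupp F" "complexify F"] by (simp add: psupp_def)
  also have "\<dots> \<in> cv.span (zset (tri_all N))"
  proof (rule cv.span_sum)
    fix p assume "p \<in> psupp F"
    then have nz: "pcoeff F (fst p) (snd p) \<noteq> 0" by (auto simp: psupp_def)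
    then have "fst p + snd p \<le> N" using F by (force simp: polys_upto_def not_less[symmetric])
    moreover have "fst p + snd p \<noteq> 0" using F nz by (intro notI) (simp add: polys_upto_def)
    ultimately have "{(a, b). a + b = fst p + snd p} \<subseteq> tri_all N" by (auto simp: tri_all_def)
    from zset_mono[OF this] mono2_zset have "mono2 1 (fst p) (snd p) \<in> cv.span (zset (tri_all N))" by blast
    then have "cscale (of_real (pcoeff F (fst p) (snd p))) (mono2 1 (fst p) (snd p)) \<in> cv.span (zset (tri_all N))" by (rule cv.span_scale)
    moreover have "cscale (of_real (pcoeff F (fst p) (snd p))) (mono2 1 (fst p) (snd p)) = mono2 (of_real (pcoeff F (fst p) (snd p))) (fst p) (snd p)"
      by (rule pcoeff_eqI) simp
    ultimately show "mono2 (of_real (pcoeff F (fst p) (snd p))) (fst p) (snd p) \<in> cv.span (zset (tri_all N))" by simp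
  qed
  finally show ?thesis .
qed

text \<open>The full order ideal of bounded degree. It supplies the enclosing module in the case
  \<alpha> = 0 and the finite set of weights in the case of nonzero \<alpha>.\<close>

lemma polys_upto_tri: "polys_upto N = tri_space (tri_all N)"
  using tri_deg[OF tri_index_all, of N N] polys_upto_zset by (auto simp: tri_space_def tri_all_def)

definition reF :: "complex fps fps \<Rightarrow> plane" where "reF = fps_map (fps_map Re)"
definition imF :: "complex fps fps \<Rightarrow> plane" where "imF = fps_map (fps_map Im)"
definition cj :: "complex fps fps \<Rightarrow> complex fps fps" where "cj = fps_map (fps_map cnj)"

lemma pcoeff_re_im [simp]: "pcoeff (reF F) i j = Re (pcoeff F i j)" "pcoeff (imF F) i j = Im (pcoeff F i j)"
  "pcoeff (cj F) i j = cnj (pcoeff F i j)"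
  by (simp_all add: reF_def imF_def cj_def pcoeff_def)

lemma re_im_simps: "reF (F + G) = reF F + reF G" "imF (F + G) = imF F + imF G"
  "reF (cscale c F) = Re c *\<^sub>R reF F - Im c *\<^sub>R imF F" "imF (cscale c F) = Re c *\<^sub>R imF F + Im c *\<^sub>R reF F"
  "reF (complexify f) = f" "imF (complexify f) = 0" "reF (cj F) = reF F" "imF (cj F) = (-1) *\<^sub>R imF F"
  "reF 0 = 0" "imF 0 = 0"
  by (rule pcoeff_eqI; simp)+

lemma re_im_decomp: "F = complexify (reF F) + cscale \<i> (complexify (imF F))"
  by (rule pcoeff_eqI) (simp add: complex_eq_iff)

lemma re_im_clie: "reF (clie A b F) = lie_act A b (reF F)" "imF (clie A b F) = lie_act A b (imF F)"
proof -
  have "clie A b F = complexify (lie_act A b (reF F)) + cscale \<i> (complexify (lie_act A b (imF F)))"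
    by (subst re_im_decomp[of F]) (simp only: clie_lin complexify_lie_act)
  then show "reF (clie A b F) = lie_act A b (reF F)" "imF (clie A b F) = lie_act A b (imF F)"
    by (simp_all add: re_im_simps)
qed

lemma cj_zz: "cj (zz a b) = zz b a"
proof -
  have m: "cj (F * G) = cj F * cj G" for F G by (rule pcoeff_eqI) (simp add: pcoeff_mult)
  have "cj 1 = 1" by (rule pcoeff_eqI) simp
  then have p: "cj (F ^ n) = cj F ^ n" for F n by (induct n) (simp_all add: m)
  have "cj zvar = zbar" "cj zbar = zvar" by (rule pcoeff_eqI; auto simp: zvar_def zbar_def)+
  then show ?thesis by (simp add: zz_def m p mult.commute)
qed

lemma zz_nonzero: "zz a b \<noteq> 0"
proof -
  have "pcoeff zvar 1 0 = 1" "pcoeff zbar 1 0 = 1" by (simp_all add: zvar_def zbar_def)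
  then have "zvar \<noteq> 0" "zbar \<noteq> 0" by auto
  then show ?thesis by (simp add: zz_def)
qed

text \<open>
  The eigenvalues \<open>m (\<alpha> - i) + n (\<alpha> + i)\<close> of \<open>\<alpha> E - J\<close> on the monomials in \<open>z\<close> and its conjugate
  are pairwise distinct precisely when \<open>\<alpha> \<noteq> 0\<close>.
\<close>

lemma rot_invariant_tri:
  assumes V: "subspace V" "V \<subseteq> polys_upto N" and \<alpha>: "\<alpha> \<noteq> 0"
    and act: "\<And>A b f. A \<in> {rot_mat \<alpha>, 0} \<Longrightarrow> f \<in> V \<Longrightarrow> lie_act A b f \<in> V"
  shows "\<exists>S. tri_index S \<and> V = tri_space S"
proof -
  \<comment> \<open>The complexification of V, described by real and imaginary parts.\<close>
  define C where "C = {F. reF F \<in> V \<and> imF F \<in> V}"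
  have C: "cv.subspace C"
    by (rule cv.subspaceI)
       (auto simp: C_def re_im_simps intro!: subspace_0[OF V(1)] subspace_add[OF V(1)] subspace_diff[OF V(1)] subspace_scale[OF V(1)])
  have Cact: "clie A b F \<in> C" if "F \<in> C" "A \<in> {rot_mat \<alpha>, 0}" for A b F
    using that act by (simp add: C_def re_im_clie)
  have Cdeg: "pcoeff F 0 0 = 0 \<and> degb N F" if "F \<in> C" for F
    using that V(2) by (auto simp: C_def polys_upto_def degb_def complex_eq_iff dest!: subsetD[OF V(2)])
  have Ccx: "complexify f \<in> C \<longleftrightarrow> f \<in> V" for f
    using subspace_0[OF V(1)] by (simp add: C_def re_im_simps)
  define S where "S = {(a, b). zz a b \<in> C}"
  have S0: "(0, 0) \<notin> S" using Cdeg[of 1] by (auto simp: S_def zz_1)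
  have SN: "a + b \<le> N" if "(a, b) \<in> S" for a b
  proof (rule ccontr)
    assume "\<not> a + b \<le> N"
    moreover have "degb N (zz a b)" using that Cdeg by (simp add: S_def)
    ultimately have "zz a b = 0" using homog_zz[of a b] unfolding homog_def degb_def
      by (intro pcoeff_eqI) (metis not_le pcoeff_simps(4))
    then show False using zz_nonzero by blast
  qed
  have fin: "finite S" by (rule finite_subset[of _ "{..N} \<times> {..N}"]) (auto dest: SN)
  have sym: "(b, a) \<in> S" if "(a, b) \<in> S" for a b
    using that subspace_scale[OF V(1), of "imF (zz a b)" "-1"] cj_zz[of a b] re_im_simps(7,8)[of "zz a b"] by (simp add: S_def C_def)
  have low: "(a, b) \<in> S" if "(Suc a, b) \<in> S" "(a, b) \<noteq> (0, 0)" for a b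
  proof -
    have z: "zz (Suc a) b \<in> C" using that(1) by (simp add: S_def)
    have "0 = rotm 0 0" by (rule mat2_eqI) simp_all
    moreover have "cnc (zz a b) = zz a b" using that(2) unfolding cnc_zz by auto
    ultimately have c: "clie 0 v (zz (Suc a) b) = cscale (of_nat (Suc a) * Complex (v $ 1) (v $ 2)) (zz a b) +
        cscale (of_nat b * Complex (v $ 1) (- v $ 2)) (cnc (zz (Suc a) (b - 1)))" for v
      using clie_rotm[of 0 0 v "Suc a" b] by (simp add: zero_complex.code[symmetric])
    \<comment> \<open>The translation d/dx - i d/dy is twice the derivative by z, so the terms that
      lower the exponent of the conjugate cancel.\<close>
    have "clie 0 (vector [1, 0]) (zz (Suc a) b) + cscale (- \<i>) (clie 0 (vector [0, 1]) (zz (Suc a) b)) = cscale (2 * of_nat (Suc a)) (zz a b)"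
      unfolding c by (rule pcoeff_eqI) (simp only: pcoeff_simps pcoeff_cscale, simp add: algebra_simps Complex_eq)
    moreover have "clie 0 (vector [1, 0]) (zz (Suc a) b) + cscale (- \<i>) (clie 0 (vector [0, 1]) (zz (Suc a) b)) \<in> C"
      by (intro cv.subspace_add[OF C] cv.subspace_scale[OF C] Cact z) simp_all
    ultimately have "cscale (inverse (2 * of_nat (Suc a))) (cscale (2 * of_nat (Suc a)) (zz a b)) \<in> C"
      by (metis cv.subspace_scale[OF C])
    moreover have "(2 * of_nat (Suc a) :: complex) \<noteq> 0" by (metis mult_eq_0_iff of_nat_eq_0_iff nat.distinct(1) zero_neq_numeral)
    ultimately have "zz a b \<in> C" by (metis cv.scale_scale left_inverse cv.scale_one)
    then show ?thesis by (simp add: S_def)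
  qed
  have low1: "(a, b) \<in> S" if "(a + k, b) \<in> S" "(a, b) \<noteq> (0, 0)" for a b k
    using that by (induct k) (auto intro: low)
  have "(a', b') \<in> S" if ab: "(a, b) \<in> S" "a' \<le> a" "b' \<le> b" "(a', b') \<noteq> (0, 0)" for a b a' b'
  proof (cases "(a', b) = (0, 0)")
    case False
    then have "(a', b) \<in> S" using low1[of a' "a - a'" b] ab by simp
    \<comment> \<open>The exponent of the conjugate variable is lowered by passing to the conjugate
      monomial, lowering its exponent of z, and conjugating back.\<close>
    then have "(b', a') \<in> S" using low1[of b' "b - b'" a'] sym ab by auto
    then show ?thesis using sym by blast
  qed (use ab in simp)
  then have tri: "tri_index S" unfolding tri_index_def using fin S0 sym by fast
  have "complexify f \<in> cv.span (zset S)" if f: "f \<in> V" for f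
  proof -
    have fQ: "finite (tri_all N)" using tri_indexD(1)[OF tri_index_all] .
    obtain c where c: "complexify f = (\<Sum>q\<in>tri_all N. cscale (c q) (zz (fst q) (snd q)))"
      using span_zset_sum[OF fQ polys_upto_zset] f V(2) by blast
    define \<mu> where "\<mu> q = of_nat (fst q) * Complex \<alpha> (- 1) + of_nat (snd q) * Complex \<alpha> 1" for q :: "nat \<times> nat"
    have yC: "cscale (c q) (zz (fst q) (snd q)) \<in> C" if "q \<in> tri_all N" for q
    proof (rule cv.eigen_components[where T = "clie (rot_mat \<alpha>) 0" and \<mu> = \<mu> and y = "\<lambda>q. cscale (c q) (zz (fst q) (snd q))", OF C _ clie_lin fQ _ _ _ that])
      show "clie (rot_mat \<alpha>) 0 F \<in> C" if "F \<in> C" for F using Cact that by simp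
      show "inj_on \<mu> (tri_all N)"
      proof (rule inj_onI)
        fix p q assume "\<mu> p = \<mu> q"
        then have "\<alpha> * (real (fst p) + real (snd p)) = \<alpha> * (real (fst q) + real (snd q))" "real (snd p) - real (fst p) = real (snd q) - real (fst q)"
          by (simp_all add: \<mu>_def complex_eq_iff algebra_simps)
        then have "fst p = fst q" "snd p = snd q" using \<alpha> by simp_all
        then show "p = q" by (rule prod_eqI)
      qed
      show "(\<Sum>q\<in>tri_all N. cscale (c q) (zz (fst q) (snd q))) \<in> C" using Ccx f c by metis
      show "clie (rot_mat \<alpha>) 0 (cscale (c q) (zz (fst q) (snd q))) = cscale (\<mu> q) (cscale (c q) (zz (fst q) (snd q)))" if "q \<in> tri_all N" for q
      proof -
        have "cnc (zz (fst q) (snd q)) = zz (fst q) (snd q)" using that by (auto simp: cnc_zz tri_all_def)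
        then show ?thesis unfolding rot_mat_rotm clie_lin clie_rotm by (simp add: \<mu>_def zero_complex.code[symmetric] mult.commute)
      qed
    qed
    have "cscale (c q) (zz (fst q) (snd q)) \<in> cv.span (zset S)" if q: "q \<in> tri_all N" for q
    proof (cases "c q = 0")
      case True
      then show ?thesis by (simp add: cv.span_zero)
    next
      case False
      have "cscale (inverse (c q)) (cscale (c q) (zz (fst q) (snd q))) \<in> C" by (rule cv.subspace_scale[OF C yC[OF q]])
      then have "zz (fst q) (snd q) \<in> C" using False by simp
      then show ?thesis by (intro cv.span_scale zz_in) (simp add: S_def split_beta)
    qed
    then show ?thesis unfolding c by (rule cv.span_sum)
  qed
  moreover have "f \<in> V" if "complexify f \<in> cv.span (zset S)" for f
  proof -
    have "zset S \<subseteq> C" by (auto simp: zset_def S_def)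
    then have "cv.span (zset S) \<subseteq> C" using C by (rule cv.span_minimal)
    then show ?thesis using that Ccx by blast
  qed
  ultimately have "V = tri_space S" by (auto simp: tri_space_def)
  then show ?thesis using tri by blast
qed

lemma star_pair_euc_zero: assumes "1 \<le> n" shows "star_pair (euc 0) (polys_upto n)"
proof -
  have "px \<in> polys_upto n" using assms by (auto simp: polys_upto_def)
  moreover have "px \<noteq> 0" by (metis pcoeff_px pcoeff_simps(4) zero_neq_one)
  ultimately have "polys_upto n \<noteq> {0}" by blast
  moreover have "triangle_sum (polys_upto n)" unfolding triangle_sum_iff using polys_upto_tri tri_index_all by blast
  ultimately show ?thesis unfolding star_pair_def by blast
qed

lemma splitting_polynomial_classification:
  assumes g: "lie_subalgebra g" "g \<subseteq> p1_inf" "finite_dim g" "transitive g" "splitting g"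
    and \<phi>: "coord_change \<phi>" and nf: "polynomial_normal_form (transport \<phi> g)"
  defines "g' \<equiv> transport \<phi> g"
  shows "\<exists>\<xi>. star_pair (g' \<inter> Der) \<xi> \<and> g' \<subseteq> star_algebra (g' \<inter> Der) \<xi> \<and>
            (g' \<inter> Der \<noteq> euc 0 \<longrightarrow> g' = star_algebra (g' \<inter> Der) \<xi>)"
proof -
  have nf': "polynomial_normal_form g'" using nf unfolding g'_def .
  obtain u w where uw: "\<phi> = (u, w)" by fastforce
  interpret transported u w g g'
    by unfold_locales (use g \<phi> in \<open>simp_all add: g'_def uw coord_change_def\<close>)
  let ?V = "func_part g'"
  obtain L c where L: "L \<in> primitive_normal_forms" "g' \<inter> Der = recenter c ` L" and P: "\<And>f. f \<in> ?V \<Longrightarrow> fpoly f"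
    using nf' unfolding polynomial_normal_form_def is_polynomial_fpoly by (elim conjE bexE exE) simp
  obtain B where B: "finite B" "?V \<subseteq> span B" using xi_finite by blast
  obtain N where N: "?V \<subseteq> polys_upto N" using finite_poly_space_bounded[OF subspace_xi B] P xi_zero by blast
  obtain n f i j where n: "n \<ge> 1" "?V \<subseteq> polys_upto n" and f: "f \<in> ?V" "i + j = n" "pcoeff f i j \<noteq> 0"
    by (rule max_degree_element[OF N xi_nonzero])
  have act: "nc (a * dx h + b * dy h) \<in> ?V" if "fld a b 0 \<in> recenter c ` L" "h \<in> ?V" for a b h
    using xi_act that L(2) by blast
  have aff: "g' \<inter> Der = L \<and> (\<forall>A b h. A \<in> l \<longrightarrow> h \<in> ?V \<longrightarrow> lie_act A b h \<in> ?V)" if l: "L = aff_alg l" for l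
  proof -
    have e: "g' \<inter> Der = aff_alg l" unfolding L(2) l recenter_aff_alg ..
    have "lie_act A b h \<in> ?V" if "A \<in> l" "h \<in> ?V" for A b h
      unfolding lie_act_def using xi_act that aff_alg_memI[OF that(1) refl refl] e by blast
    then show ?thesis using e l by blast
  qed
  have eq: "?V \<noteq> {0}" using xi_nonzero by blast
  consider (ex) "L \<in> {nf_sl2, nf_so3, nf_so31, nf_sl3}" | (ab) "L = aff_sl2 \<or> L = aff_gl2" | (c) "L = conf"
    | (d) \<alpha> where "L = euc \<alpha>" "\<alpha> > 0" | (e) "L = euc 0"
  proof -
    have "L \<in> {nf_sl2, nf_so3, nf_so31, nf_sl3} \<or> (L = aff_sl2 \<or> L = aff_gl2) \<or> L = conf \<or> (\<exists>\<alpha>\<ge>0. L = euc \<alpha>)"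
      using L(1) unfolding primitive_normal_forms_def by blast
    then show thesis using ex ab c d e by (elim disjE exE conjE) (simp_all add: le_less, blast)
  qed
  then show ?thesis
  proof cases
    case ex
    then show ?thesis using excluded_normal_forms[OF n(2,1) f ex act] by blast
  next
    case ab
    then obtain l where l: "L = aff_alg l" "l_sl2 \<subseteq> l" using aff_sl2_alg aff_gl2_alg by blast
    have "?V = polys_upto n"
      by (rule sl2_invariant_polys[OF subspace_xi n(2) f]) (use aff[OF l(1)] l(2) in blast)
    then have "star_pair (g' \<inter> Der) ?V" using aff[OF l(1)] ab n(1) unfolding star_pair_def by auto
    then show ?thesis using g'_star by blast
  next
    case c
    \<comment> \<open>The conformal algebra contains E - J, so the case \<alpha> = 1 of the
      eigenvalue argument applies.\<close>
    have "{rot_mat 1, 0} \<subseteq> l_conf" using rot_mat_mem(2) cf.l0 by blast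
    with aff[OF c[unfolded conf_alg]] have "\<exists>S. tri_index S \<and> ?V = tri_space S"
      by (intro rot_invariant_tri[OF subspace_xi n(2), of 1]) auto
    then have "star_pair (g' \<inter> Der) ?V" using aff[OF c[unfolded conf_alg]] c eq unfolding star_pair_def triangle_sum_iff by auto
    then show ?thesis using g'_star by blast
  next
    case d
    have "{rot_mat \<alpha>, 0} \<subseteq> l_euc \<alpha>" using rot_mat_mem(3) subspace_0[OF subspace_l_euc] by blast
    with aff[OF d(1)[unfolded euc_alg]] have "\<exists>S. tri_index S \<and> ?V = tri_space S"
      by (intro rot_invariant_tri[OF subspace_xi n(2), of \<alpha>]) (use d(2) in auto)
    moreover have "\<exists>\<alpha>\<ge>0. g' \<inter> Der = euc \<alpha>" using aff[OF d(1)[unfolded euc_alg]] d by (intro exI[of _ \<alpha>]) simp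
    ultimately have "star_pair (g' \<inter> Der) ?V" using eq unfolding star_pair_def triangle_sum_iff by blast
    then show ?thesis using g'_star by blast
  next
    case e
    have gt: "g' \<inter> Der = euc 0" using aff[OF e[unfolded euc_alg]] e by simp
    have "star_algebra (g' \<inter> Der) ?V \<subseteq> star_algebra (g' \<inter> Der) (polys_upto n)"
      using n(2) unfolding star_algebra_def set_sum_def by blast
    then have "g' \<subseteq> star_algebra (g' \<inter> Der) (polys_upto n)" using g'_star by blast
    then show ?thesis using gt star_pair_euc_zero[OF n(1)] by (intro exI[of _ "polys_upto n"]) simp
  qed
qed

theorem theorem11:
  shows
   "(\<forall>gt \<xi>. star_pair gt \<xi> \<longrightarrow>
      (let g = star_algebra gt \<xi>; kt = stability gt;
           Gt = integral_subgroup gt; Kt = integral_subgroup kt;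
           G = semidirect Gt \<xi>; K = Kt \<times> (\<xi> \<inter> order_ge2);
           M = lcosets\<^bsub>G\<^esub> K; A = coset_functions \<xi> G K
       in
         lie_subalgebra g \<and> g \<subseteq> p1_inf \<and> finite_dim g \<and>
         transitive g \<and> transversally_primitive g \<and>
         stability g = kt \<oplus>\<^sub>s emb ` (\<xi> \<inter> order_ge2) \<and>
         isotropy g = kt \<oplus>\<^sub>s emb ` (\<xi> \<inter> span {px^2, px * py, py^2}) \<and>
         connected_lie_group Gt gt \<and> connected_lie_group Kt kt \<and>
         Gt = {(B, b). (B, 0) \<in> Kt} \<and>
         group G \<and> subgroup K G \<and> closedin (group_topology \<xi> G) K \<and>
         smooth_4_manifold (coset_topology \<xi> G K) (coset_smooth \<xi> G K) \<and>
         smooth_action \<xi> G K \<and>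
         (\<exists>\<omega>. induced_form \<xi> G K \<omega>) \<and>
         (\<forall>\<omega>. induced_form \<xi> G K \<omega> \<longrightarrow> symplectic_form M A \<omega>) \<and>
         (2 < max_degree \<xi> \<longrightarrow>
            \<not> reductive g \<and>
            (\<forall>\<omega>. induced_form \<xi> G K \<omega> \<longrightarrow> \<not> homogeneous_fedosov \<xi> G K \<omega>))))
    \<and>
    (\<forall>g \<phi>. lie_subalgebra g \<and> g \<subseteq> p1_inf \<and> finite_dim g \<and>
       transitive g \<and> transversally_primitive g \<and> splitting g \<and>
       coord_change \<phi> \<and> polynomial_normal_form (transport \<phi> g) \<longrightarrow>
       (let g' = transport \<phi> g; gt = g' \<inter> Der in
          \<exists>\<xi>. star_pair gt \<xi> \<and> g' \<subseteq> star_algebra gt \<xi> \<and>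
            (gt \<noteq> euc 0 \<longrightarrow> g' = star_algebra gt \<xi>)))"
proof (intro conjI allI impI, goal_cases)
  case (1 gt \<xi>)
  then show ?case by (rule star_pair_properties)
next
  case (2 g \<phi>)
  then show ?case unfolding Let_def by (elim conjE) (rule splitting_polynomial_classification)
qed

end
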